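(* If $m\in\mathcal{M}^+(\Gamma\times[0,T])$ is a measure-valued solution of the nonlinear transport problem $$\begin{cases}\partial_t m+\partial_x(v[m_t]m)=0 & \text{in }\Gamma\times[0,T]\\ m_{t=0}=m_0\\ m_{x=x_i}=\sigma_0^i & \forall x_i\in\mathcal{S}\\ m^j_{x=x_i}=\sum_{k\in \mathrm{Inc}(x_i)}p_{kj}\cdot m^k_{x=x_i} & \forall x_i\in\mathcal{V}\setminus\mathcal{S},\ \forall e_j\in \mathrm{Out}(x_i),\end{cases}$$ then for every $t\in[0,T]$ the measure $m_t$ is given by $$m_t=\int_\Gamma\sum_{\gamma\in\mathcal{A}(x)}\delta_{(\Phi^\gamma_t(x,0),t)}\,p_\gamma(x,0)\,dm_0(x)+\sum_{x_i\in\mathcal{S}}\int_{[0,t]}\sum_{\gamma\in\mathcal{A}(x_i)}\delta_{(\Phi^\gamma_t(x_i,s),t)}\,p_\gamma(x_i,s)\,d\sigma_0^i(s),$$ where $\mathcal{A}(x)$ is the set of paths starting from $x$, $\Phi^\gamma$ is the flow map along $\gamma$ of the velocity field $v[m_t]$, and $p_\gamma$ are the path coefficients (all defined in the context); $m_t$ is regarded as a measure on $\Gamma\times\{t\}\equiv\Gamma$.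
   Context: **Network.** $\Gamma=(\mathcal{V},\mathcal{E})$ is a connected oriented network: a finite set of vertices $\mathcal{V}=\{x_i\}_{i\in I}$ and a finite set of continuous non-self-intersecting arcs $\mathcal{E}=\{e_j\}_{j\in J}$ whose endpoints belong to $\mathcal{V}$. A bounded arc $e_j$ is parametrized by a smooth injective $\pi_j:[0,L_j]\to\mathbb{R}^d$ ($L_j>0$); an unbounded arc terminating in a vertex $V$ by $\pi_j:(-\infty,0]\to\mathbb{R}^d$ with $\pi_j(0)=V$; an unbounded arc originating from $V$ by $\pi_j:[0,+\infty)\to\mathbb{R}^d$ with $\pi_j(0)=V$. Parametrizations comply with the orientation; points of an arc are identified with their parameters, and $\partial_x$ is the derivative in the parameter. $d_\Gamma$ is the minimum path distance on $\Gamma$. $\mathrm{Out}(x_i)$ and $\mathrm{Inc}(x_i)$ denote the sets of arcs originating from, respectively terminating in, $x_i$. A source is a vertex with no incoming arc; $\mathcal{S}$ is the set of sources, and each source has exactly one outgoing arc. There are no sinks (vertices without outgoing arcs): terminal arcs have infinite length. **Measures.** For a metric space $(\mathcal{T},d)$, $BL(\mathcal{T})$ is the space of bounded Lipschitz functions with norm $\|\phi\|_{BL}=\|\phi\|_\infty+|\phi|_L$, $|\phi|_L$ being the Lipschitz constant. $\mathcal{M}(\mathcal{T})$ is the space of finite Radon measures, $\mathcal{M}^+(\mathcal{T})$ the cone of nonnegative ones, and $\|\mu\|_{BL}^\ast=\sup\{|\langle\mu,\phi\rangle|:\phi\in BL(\mathcal{T}),\ \|\phi\|_{BL}\le1\}$.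 $\Gamma$ carries the distance $d_\Gamma$ and $\Gamma\times[0,T]$ the distance $d_\Gamma(x,y)+|t-s|$. Throughout, all measures considered are without Cantorian part. Integrals of Dirac masses against a measure are Bochner integrals, i.e. tested against functions. **Data.** $T>0$. The initial datum is $m_0=\sum_{j\in J}m_0^j$ with $m_0^j\in\mathcal{M}^+(\Gamma)$, $\mathrm{supp}\,m_0^j\subseteq e_j$. The boundary datum is $\sigma_0=\sum_{x_i\in\mathcal{S}}\sigma_0^i$, $\sigma_0^i$ a finite nonnegative measure on $\{x_i\}\times[0,T]$ (identified with a measure in time). The distribution coefficients $p_{kj}\in BV([0,T])$, $0\le p_{kj}(t)\le1$, satisfy, for every $t$: $p_{kj}(t)=0$ unless $e_k$ terminates in a vertex from which $e_j$ originates; and $\sum_j p_{kj}(t)=1$ for every arc $e_k$ terminating in a vertex. **Velocity.** $v:\mathcal{M}^+(\Gamma)\times\Gamma\to\mathbb{R}$, $(m,x)\mapsto v[m](x)$, satisfies for constants $V_{max}>0$, $L$: (i) $v$ is nonnegative with maximum value $V_{max}$; (ii) on each arc $e_j$, $|v[m](x)-v[m](y)|\le L|x-y|$ for all $m\in\mathcal{M}^+(\Gamma)$, $x,y\in e_j$; (iii) $|v[m_1](x)-v[m_2](x)|\le L\|m_1-m_2\|_{BL}^\ast$ for all $x\in\Gamma$, $m_1,m_2\in\mathcal{M}^+(\Gamma)$. Continuity of $v[m]$ across vertices is not required (on each arc, $v[m]$ has its own values up to the endpoints). **Solutions.** $C^1_0(\Gamma\times[0,T])$ is the set of continuous functions on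 $\Gamma\times[0,T]$ that are $C^1$ on $e_j\times[0,T]$ for each $j$ and vanish at infinity along unbounded arcs. A measure on $\Gamma\times[0,T]$ is disintegrated as $m(dx\,dt)=m_t(dx)\otimes dt$, with $m_t=\sum_j m_t^j$, $m^j_t$ the part on $e_j$. A measure-valued solution is a finite measure $m\in\mathcal{M}^+(\Gamma\times[0,T])$ such that for every $f\in C^1_0(\Gamma\times[0,T])$ $$\langle m_{t=T}-m_0,f\rangle-\langle\sigma_0,f\rangle=\int_0^T\langle m_t,\partial_tf+v[m_t]\partial_xf\rangle\,dt$$ and, for all $x_i\in\mathcal{V}\setminus\mathcal{S}$, $e_j\in\mathrm{Out}(x_i)$, $$\langle m^j_{x=x_i},f\rangle=\sum_{e_k\in\mathrm{Inc}(x_i)}\langle m^k_{x=x_i},p_{kj}f\rangle .$$ Here $\langle m_{t=T},f\rangle=\int f(x,T)\,dm_T(x)$, $\langle m_0,f\rangle=\int f(x,0)\,dm_0(x)$, $\langle\sigma_0,f\rangle=\sum_{x_i\in\mathcal{S}}\int f(x_i,t)\,d\sigma_0^i(t)$, and the traces $m^j_{x=x_i}$ are measures on $\{x_i\}\times[0,T]$ characterized by $$\pm\langle m^j_{x=x_i},f\rangle=\int_0^T\langle m_t^j,\partial_tf+v[m_t]\partial_xf\rangle\,dt-\langle m_T^j-m_0^j,f\rangle$$ for test functions $f$ whose support contains no vertex other than $x_i$, with sign $+$ if $e_j\in\mathrm{Inc}(x_i)$ and $-$ if $e_j\in\mathrm{Out}(x_i)$. **Paths, flow, coefficients.** A path $\gamma$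 starting from $x\in\Gamma$ is a sequence of arcs $(e_{j_0},e_{j_1},\dots)$ in which each arc $e_{j_{i+1}}$ originates from the vertex in which $e_{j_i}$ terminates, $e_{j_0}$ being the sub-arc from $x$ to the terminal vertex of the arc containing $x$ (or the half-line from $x$ if that arc is unbounded and originates from a vertex), and with $\gamma$ of infinite total length; $\mathcal{A}(x)$ is the set of such paths. If $x$ is a vertex belonging to several arcs, the mass $m_0^j$ at $x$ is propagated along paths whose first arc lies in $e_j$. The flow map $t\mapsto\Phi^\gamma_t(x,s)$ is the trajectory running along $\gamma$ with $\Phi^\gamma_s(x,s)=x$ and $\frac{d}{dt}\Phi^\gamma_t(x,s)=v[m_t](\Phi^\gamma_t(x,s))$ on each arc of $\gamma$ (in the arc parameter), continuing on the next arc of $\gamma$ when it reaches the end of an arc. The exit times are $\theta_0^\gamma(x,s)=\inf\{t\ge s:\Phi^\gamma_t(x,s)=\text{terminal vertex of }e_{j_0}\}$ and $\theta_k^\gamma(x,s)=\inf\{t\ge\theta_{k-1}^\gamma(x,s):\Phi^\gamma_t(x,s)=\text{terminal vertex of }e_{j_k}\}$ for $k\ge1$. The coefficients are $$p_\gamma(x,s)=\prod_k p_{j_kj_{k+1}}(\theta_k^\gamma(x,s)),$$ the product being over the $k$ with $\theta_k^\gamma(x,s)\le T$ (empty product $=1$); in the sums over $\gamma$, paths having the same initial list of arcs visited up to time $T$ (that is, the same $e_{j_0},\dots,e_{j_n}$ with $n$ the number of exit times $\le T$) are identified and counted once, so that the sums are finite.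
   Formalization: For t<T, m_t is the right-continuous (dual BL norm) version, as the disintegration fixes it only for a.e. t; and the part of m_t on an arc is assumed not to charge the arc's terminal vertex, since otherwise mass may stay at the end of an arc where v vanishes and the formula fails. *)

theory Defs
  imports "HOL-Analysis.Analysis"
begin

section \<open>Networks\<close>

text \<open>
  The arc \<open>j\<close> is parametrized by \<open>par G j\<close> on the interval \<open>pdom G j\<close>, oriented by increasing
  parameter. Points of an arc are identified with their parameters, so lengths, \<open>\<partial>\<^sub>x\<close> and
  velocities are always taken in the parameter. The initial (terminal) endpoint of an arc is the
  point with parameter \<open>Inf (pdom G j)\<close> (\<open>Sup (pdom G j)\<close>), and exists iff \<open>pdom G j\<close> is bounded
  below (above).
\<close>

record ('j, 'a) network =
  verts :: "'a set"
  arcs :: "'j set"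
  pdom :: "'j \<Rightarrow> real set"
  par :: "'j \<Rightarrow> real \<Rightarrow> 'a"

definition points :: "('j, 'a) network \<Rightarrow> 'a set" where
  "points G = (\<Union>j\<in>arcs G. par G j ` pdom G j)"

definition Out :: "('j, 'a) network \<Rightarrow> 'a \<Rightarrow> 'j set" where
  "Out G x = {j \<in> arcs G. bdd_below (pdom G j) \<and> par G j (Inf (pdom G j)) = x}"

definition Inc :: "('j, 'a) network \<Rightarrow> 'a \<Rightarrow> 'j set" where
  "Inc G x = {j \<in> arcs G. bdd_above (pdom G j) \<and> par G j (Sup (pdom G j)) = x}"

definition sources :: "('j, 'a) network \<Rightarrow> 'a set" where
  "sources G = {x \<in> verts G. Inc G x = {}}"

text \<open>\<open>walk G x l y\<close>: one can go from \<open>x\<close> to \<open>y\<close> along arcs (in either direction) over a total length \<open>l\<close>.\<close>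

inductive walk :: "('j, 'a) network \<Rightarrow> 'a \<Rightarrow> real \<Rightarrow> 'a \<Rightarrow> bool" for G where
  walk_refl: "x \<in> points G \<Longrightarrow> walk G x 0 x"
| walk_step: "\<lbrakk>j \<in> arcs G; a \<in> pdom G j; b \<in> pdom G j; walk G (par G j b) l z\<rbrakk>
    \<Longrightarrow> walk G (par G j a) (\<bar>a - b\<bar> + l) z"

definition path_dist :: "('j, 'a) network \<Rightarrow> 'a \<Rightarrow> 'a \<Rightarrow> real" where
  "path_dist G x y = Inf {l. walk G x l y}"

definition smooth_on_interval :: "real set \<Rightarrow> (real \<Rightarrow> 'a::real_normed_vector) \<Rightarrow> bool" where
  "smooth_on_interval I f \<longleftrightarrow> (\<exists>g :: nat \<Rightarrow> real \<Rightarrow> 'a. (\<forall>y\<in>I. g 0 y = f y) \<and>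
     (\<forall>n. \<forall>y\<in>I. (g n has_vector_derivative g (Suc n) y) (at y within I)))"

text \<open>Part of the notion of network: distinct arcs meet only at vertices, and the vertices lying on an
  arc are endpoints of it. Connectedness is that of the path distance. The last two conditions
  exclude sinks and give each source exactly one outgoing arc.\<close>

definition oriented_network :: "('j, 'a::euclidean_space) network \<Rightarrow> bool" where
  "oriented_network G \<longleftrightarrow>
     finite (verts G) \<and> finite (arcs G) \<and>
     (\<forall>j\<in>arcs G. (\<exists>l>0. pdom G j = {0..l}) \<or> pdom G j = {..0} \<or> pdom G j = {0..}) \<and>
     (\<forall>j\<in>arcs G. smooth_on_interval (pdom G j) (par G j) \<and> inj_on (par G j) (pdom G j)) \<and>
     (\<forall>j\<in>arcs G. (bdd_below (pdom G j) \<longrightarrow> par G j (Inf (pdom G j)) \<in> verts G) \<and>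
                 (bdd_above (pdom G j) \<longrightarrow> par G j (Sup (pdom G j)) \<in> verts G)) \<and>
     (\<forall>i\<in>arcs G. \<forall>j\<in>arcs G. i \<noteq> j \<longrightarrow> par G i ` pdom G i \<inter> par G j ` pdom G j \<subseteq> verts G) \<and>
     (\<forall>j\<in>arcs G. \<forall>y\<in>pdom G j. par G j y \<in> verts G \<longrightarrow>
         bdd_below (pdom G j) \<and> y = Inf (pdom G j) \<or> bdd_above (pdom G j) \<and> y = Sup (pdom G j)) \<and>
     (\<forall>x\<in>points G. \<forall>y\<in>points G. \<exists>l. walk G x l y) \<and>
     (\<forall>x\<in>verts G. Out G x \<noteq> {}) \<and>
     (\<forall>x\<in>sources G. card (Out G x) = 1)"


section \<open>Measures\<close>

text \<open>
  The Borel sets of the space \<open>points G\<close> with the distance \<open>path_dist G\<close> are its Borel sets as a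
  subspace of the ambient Euclidean space: both are generated by the images of compact parameter
  intervals. Finite Borel measures on this space are automatically Radon.

  A measure on the line is without Cantorian part iff, off a countable set, it is absolutely
  continuous with respect to Lebesgue measure; on a network, Lebesgue measure is the one carried by
  the arcs in their parameters.
\<close>

definition line_measures :: "real set \<Rightarrow> real measure set" where
  "line_measures I = {\<mu>. sets \<mu> = sets (restrict_space borel I) \<and> finite_measure \<mu> \<and>
     (\<exists>A. countable A \<and> (\<forall>N\<in>sets \<mu>. N \<in> null_sets lborel \<longrightarrow> emeasure \<mu> (N - A) = 0))}"

definition net_measures :: "('j, 'a::euclidean_space) network \<Rightarrow> 'a measure set" where
  "net_measures G = {\<mu>. sets \<mu> = sets (restrict_space borel (points G)) \<and> finite_measure \<mu> \<and>
     (\<exists>A. countable A \<and> (\<forall>B\<in>sets \<mu>.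
        (\<forall>j\<in>arcs G. {y \<in> pdom G j. par G j y \<in> B} \<in> null_sets lborel) \<longrightarrow>
        emeasure \<mu> (B - A) = 0))}"

text \<open>A measure carried by the arc \<open>j\<close> is represented as a measure on \<open>pdom G j\<close>. \<open>glue G \<nu>\<close> is the
  sum over \<open>j\<close> of the measures \<open>\<nu> j\<close>, as a measure on the network.\<close>

definition glue :: "('j, 'a::euclidean_space) network \<Rightarrow> ('j \<Rightarrow> real measure) \<Rightarrow> 'a measure" where
  "glue G \<nu> = measure_of (points G) (sets (restrict_space borel (points G)))
     (\<lambda>B. \<Sum>j\<in>arcs G. emeasure (\<nu> j) {y \<in> pdom G j. par G j y \<in> B})"

definition BL_space :: "('j, 'a) network \<Rightarrow> ('a \<Rightarrow> real) set" where
  "BL_space G = {\<phi>. bounded (\<phi> ` points G) \<and>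
     (\<exists>K. \<forall>x\<in>points G. \<forall>y\<in>points G. \<bar>\<phi> x - \<phi> y\<bar> \<le> K * path_dist G x y)}"

definition lip_const :: "('j, 'a) network \<Rightarrow> ('a \<Rightarrow> real) \<Rightarrow> real" where
  "lip_const G \<phi> = Inf {K. 0 \<le> K \<and> (\<forall>x\<in>points G. \<forall>y\<in>points G. \<bar>\<phi> x - \<phi> y\<bar> \<le> K * path_dist G x y)}"

definition BL_norm :: "('j, 'a) network \<Rightarrow> ('a \<Rightarrow> real) \<Rightarrow> real" where
  "BL_norm G \<phi> = (SUP x\<in>points G. \<bar>\<phi> x\<bar>) + lip_const G \<phi>"

text \<open>The dual norm of \<open>\<mu> - \<nu>\<close>, a signed measure in general.\<close>

definition BL_dist :: "('j, 'a) network \<Rightarrow> 'a measure \<Rightarrow> 'a measure \<Rightarrow> real" where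
  "BL_dist G \<mu> \<nu> = Sup {\<bar>(\<integral>x. \<phi> x \<partial>\<mu>) - (\<integral>x. \<phi> x \<partial>\<nu>)\<bar> | \<phi>. \<phi> \<in> BL_space G \<and> BL_norm G \<phi> \<le> 1}"


section \<open>Data of the problem\<close>

text \<open>\<open>v \<mu> j y\<close> is the value of \<open>v[\<mu>]\<close> at the point with parameter \<open>y\<close> of the arc \<open>j\<close>; at a vertex it
  may depend on the arc.\<close>

definition velocity_field ::
  "('j, 'a::euclidean_space) network \<Rightarrow> real \<Rightarrow> real \<Rightarrow> ('a measure \<Rightarrow> 'j \<Rightarrow> real \<Rightarrow> real) \<Rightarrow> bool" where
  "velocity_field G Vmax L v \<longleftrightarrow>
     (\<forall>\<mu>\<in>net_measures G. \<forall>j\<in>arcs G. \<forall>y\<in>pdom G j. 0 \<le> v \<mu> j y \<and> v \<mu> j y \<le> Vmax) \<and>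
     (\<forall>\<mu>\<in>net_measures G. \<forall>j\<in>arcs G. \<forall>y\<in>pdom G j. \<forall>z\<in>pdom G j.
        \<bar>v \<mu> j y - v \<mu> j z\<bar> \<le> L * \<bar>y - z\<bar>) \<and>
     (\<forall>\<mu>\<^sub>1\<in>net_measures G. \<forall>\<mu>\<^sub>2\<in>net_measures G. \<forall>j\<in>arcs G. \<forall>y\<in>pdom G j.
        \<bar>v \<mu>\<^sub>1 j y - v \<mu>\<^sub>2 j y\<bar> \<le> L * BL_dist G \<mu>\<^sub>1 \<mu>\<^sub>2)"

definition BV_on :: "real \<Rightarrow> real \<Rightarrow> (real \<Rightarrow> real) \<Rightarrow> bool" where
  "BV_on a b q \<longleftrightarrow> (\<exists>B. \<forall>n :: nat. \<forall>u :: nat \<Rightarrow> real.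
     (\<forall>i\<le>n. u i \<in> {a..b}) \<and> (\<forall>i<n. u i \<le> u (Suc i)) \<longrightarrow>
     (\<Sum>i<n. \<bar>q (u (Suc i)) - q (u i)\<bar>) \<le> B)"

definition distribution_coefficients ::
  "('j, 'a) network \<Rightarrow> real \<Rightarrow> ('j \<Rightarrow> 'j \<Rightarrow> real \<Rightarrow> real) \<Rightarrow> bool" where
  "distribution_coefficients G T p \<longleftrightarrow>
     (\<forall>k\<in>arcs G. \<forall>j\<in>arcs G. BV_on 0 T (p k j)) \<and>
     (\<forall>k\<in>arcs G. \<forall>j\<in>arcs G. \<forall>t\<in>{0..T}. 0 \<le> p k j t \<and> p k j t \<le> 1 \<and>
        ((\<nexists>x. x \<in> verts G \<and> k \<in> Inc G x \<and> j \<in> Out G x) \<longrightarrow> p k j t = 0)) \<and>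
     (\<forall>k\<in>arcs G. bdd_above (pdom G k) \<longrightarrow> (\<forall>t\<in>{0..T}. (\<Sum>j\<in>arcs G. p k j t) = 1))"


section \<open>Measure-valued solutions\<close>

definition dx :: "('j, 'a) network \<Rightarrow> ('a \<Rightarrow> real \<Rightarrow> real) \<Rightarrow> 'j \<Rightarrow> real \<Rightarrow> real \<Rightarrow> real" where
  "dx G f j y t = vector_derivative (\<lambda>z. f (par G j z) t) (at y within pdom G j)"

definition dt :: "('j, 'a) network \<Rightarrow> real \<Rightarrow> ('a \<Rightarrow> real \<Rightarrow> real) \<Rightarrow> 'j \<Rightarrow> real \<Rightarrow> real \<Rightarrow> real" where
  "dt G T f j y t = vector_derivative (\<lambda>r. f (par G j y) r) (at t within {0..T})"

text \<open>The arcs are finitely many closed sets covering the network in its distance \<open>path_dist G\<close>, so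
  continuity of \<open>f\<close> on the network times \<open>{0..T}\<close> is continuity on each closed arc times \<open>{0..T}\<close>
  (\<open>f\<close> being single-valued at the vertices). The last condition is void on bounded arcs.\<close>

definition C1_0 :: "('j, 'a) network \<Rightarrow> real \<Rightarrow> ('a \<Rightarrow> real \<Rightarrow> real) set" where
  "C1_0 G T = {f. \<forall>j\<in>arcs G.
     continuous_on (pdom G j \<times> {0..T}) (\<lambda>(y, t). f (par G j y) t) \<and>
     (\<forall>y\<in>pdom G j. \<forall>t\<in>{0..T}. (\<lambda>z. f (par G j z) t) differentiable (at y within pdom G j)) \<and>
     (\<forall>y\<in>pdom G j. \<forall>t\<in>{0..T}. (\<lambda>r. f (par G j y) r) differentiable (at t within {0..T})) \<and>
     continuous_on (pdom G j \<times> {0..T}) (\<lambda>(y, t). dx G f j y t) \<and>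
     continuous_on (pdom G j \<times> {0..T}) (\<lambda>(y, t). dt G T f j y t) \<and>
     (\<forall>\<epsilon>>0. \<exists>R. \<forall>y\<in>pdom G j. \<forall>t\<in>{0..T}. R < \<bar>y\<bar> \<longrightarrow> \<bar>f (par G j y) t\<bar> < \<epsilon>)}"

text \<open>The support of \<open>f\<close> contains no point \<open>(x', t)\<close> with \<open>x'\<close> a vertex other than \<open>x\<close>.\<close>

definition supp_off_other_verts ::
  "('j, 'a) network \<Rightarrow> real \<Rightarrow> 'a \<Rightarrow> ('a \<Rightarrow> real \<Rightarrow> real) \<Rightarrow> bool" where
  "supp_off_other_verts G T x f \<longleftrightarrow> (\<forall>j\<in>arcs G. \<forall>y\<in>pdom G j. \<forall>t\<in>{0..T}.
     par G j y \<in> verts G - {x} \<longrightarrow>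
     (y, t) \<notin> closure {(z, s). z \<in> pdom G j \<and> s \<in> {0..T} \<and> f (par G j z) s \<noteq> 0})"

text \<open>Below, \<open>\<nu> t j\<close> is the part \<open>m\<^sub>t\<^sup>j\<close> on the arc \<open>j\<close> of the measure \<open>m\<^sub>t = glue G (\<nu> t)\<close>.\<close>

definition disintegration ::
  "('j, 'a::euclidean_space) network \<Rightarrow> real \<Rightarrow> ('a \<times> real) measure \<Rightarrow> (real \<Rightarrow> 'j \<Rightarrow> real measure) \<Rightarrow> bool"
  where
  "disintegration G T m \<nu> \<longleftrightarrow>
     (\<forall>j\<in>arcs G. \<forall>A\<in>sets (restrict_space borel (pdom G j)).
        (\<lambda>t. emeasure (\<nu> t j) A) \<in> borel_measurable (restrict_space borel {0..T})) \<and>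
     (\<forall>B\<in>sets m. emeasure m B =
        (\<integral>\<^sup>+t\<in>{0..T}. (\<Sum>j\<in>arcs G. emeasure (\<nu> t j) {y \<in> pdom G j. (par G j y, t) \<in> B}) \<partial>lborel))"

definition transport_integrand ::
  "('j, 'a::euclidean_space) network \<Rightarrow> real \<Rightarrow> ('a measure \<Rightarrow> 'j \<Rightarrow> real \<Rightarrow> real) \<Rightarrow>
    (real \<Rightarrow> 'j \<Rightarrow> real measure) \<Rightarrow> ('a \<Rightarrow> real \<Rightarrow> real) \<Rightarrow> 'j \<Rightarrow> real \<Rightarrow> real \<Rightarrow> real" where
  "transport_integrand G T v \<nu> f j t y = dt G T f j y t + v (glue G (\<nu> t)) j y * dx G f j y t"

text \<open>Functions in \<open>C1_0\<close> may have unbounded derivatives along unbounded arcs; the equations are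
  required for those test functions for which the right-hand side converges absolutely.\<close>

definition transport_converges ::
  "('j, 'a::euclidean_space) network \<Rightarrow> real \<Rightarrow> ('a measure \<Rightarrow> 'j \<Rightarrow> real \<Rightarrow> real) \<Rightarrow>
    (real \<Rightarrow> 'j \<Rightarrow> real measure) \<Rightarrow> ('a \<Rightarrow> real \<Rightarrow> real) \<Rightarrow> 'j \<Rightarrow> bool" where
  "transport_converges G T v \<nu> f j \<longleftrightarrow>
     (\<integral>\<^sup>+t\<in>{0..T}. (\<integral>\<^sup>+y. ennreal \<bar>transport_integrand G T v \<nu> f j t y\<bar> \<partial>\<nu> t j) \<partial>lborel) < \<infinity>"

definition transport_pairing ::
  "('j, 'a::euclidean_space) network \<Rightarrow> real \<Rightarrow> ('a measure \<Rightarrow> 'j \<Rightarrow> real \<Rightarrow> real) \<Rightarrow>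
    (real \<Rightarrow> 'j \<Rightarrow> real measure) \<Rightarrow> ('a \<Rightarrow> real \<Rightarrow> real) \<Rightarrow> 'j \<Rightarrow> real" where
  "transport_pairing G T v \<nu> f j =
     (LINT t:{0..T}|lborel. (\<integral>y. transport_integrand G T v \<nu> f j t y \<partial>\<nu> t j))"

text \<open>\<open>\<tau>\<close> is the trace at the vertex \<open>x\<close> of the part of the solution on the arc \<open>j\<close>.\<close>

definition is_trace ::
  "('j, 'a::euclidean_space) network \<Rightarrow> real \<Rightarrow> ('a measure \<Rightarrow> 'j \<Rightarrow> real \<Rightarrow> real) \<Rightarrow> ('j \<Rightarrow> real measure) \<Rightarrow>
    (real \<Rightarrow> 'j \<Rightarrow> real measure) \<Rightarrow> 'j \<Rightarrow> 'a \<Rightarrow> real measure \<Rightarrow> bool" where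
  "is_trace G T v m0 \<nu> j x \<tau> \<longleftrightarrow>
     sets \<tau> = sets (restrict_space borel {0..T}) \<and> finite_measure \<tau> \<and>
     (\<forall>f\<in>C1_0 G T. supp_off_other_verts G T x f \<and> transport_converges G T v \<nu> f j \<longrightarrow>
        (if j \<in> Inc G x then 1 else - 1) * (\<integral>t. f x t \<partial>\<tau>) =
        transport_pairing G T v \<nu> f j
          - ((\<integral>y. f (par G j y) T \<partial>\<nu> T j) - (\<integral>y. f (par G j y) 0 \<partial>m0 j)))"

text \<open>
  Two conventions fix what the measure \<open>m\<close> alone leaves open in the family \<open>m\<^sub>t\<^sup>j\<close>.

  \<^item> A mass sitting at a vertex at time \<open>t\<close> belongs to several arcs. It is attributed to the arcs
    originating from that vertex: \<open>m\<^sub>t\<^sup>j\<close> does not charge the terminal vertex of \<open>j\<close>. Where the velocity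
    at the end of an arc is positive this is automatic for almost every \<open>t\<close>; where it
    vanishes, mass having reached the end of its arc could otherwise remain there, in contrast with
    the flow map, which continues on the next arc.
  \<^item> As \<open>\<sigma>0\<close> may have atoms, \<open>t \<mapsto> m\<^sub>t\<close> may jump; for \<open>t < T\<close>, \<open>m\<^sub>t\<close> denotes the right-continuous
    representative (\<open>m\<^sub>T\<close> is fixed by the weak equation). In particular \<open>m\<^sub>t\<close> at \<open>t = 0\<close> includes the
    atoms of \<open>\<sigma>0\<close> at time 0, and the initial condition is the one expressed by the weak equation.
\<close>

definition measure_valued_solution ::
  "('j, 'a::euclidean_space) network \<Rightarrow> real \<Rightarrow> ('a measure \<Rightarrow> 'j \<Rightarrow> real \<Rightarrow> real) \<Rightarrow>
    ('j \<Rightarrow> 'j \<Rightarrow> real \<Rightarrow> real) \<Rightarrow> ('j \<Rightarrow> real measure) \<Rightarrow> ('a \<Rightarrow> real measure) \<Rightarrow>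
    ('a \<times> real) measure \<Rightarrow> (real \<Rightarrow> 'j \<Rightarrow> real measure) \<Rightarrow> bool" where
  "measure_valued_solution G T v p m0 \<sigma>0 m \<nu> \<longleftrightarrow>
     sets m = sets (restrict_space borel (points G \<times> {0..T})) \<and> finite_measure m \<and>
     (\<forall>t\<in>{0..T}. \<forall>j\<in>arcs G. \<nu> t j \<in> line_measures (pdom G j)) \<and>
     disintegration G T m \<nu> \<and>
     (\<forall>t\<in>{0..T}. \<forall>j\<in>arcs G. bdd_above (pdom G j) \<longrightarrow> emeasure (\<nu> t j) {Sup (pdom G j)} = 0) \<and>
     (\<forall>t\<in>{0..<T}. ((\<lambda>s. BL_dist G (glue G (\<nu> s)) (glue G (\<nu> t))) \<longlongrightarrow> 0) (at_right t)) \<and>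
     (\<forall>f\<in>C1_0 G T. (\<forall>j\<in>arcs G. transport_converges G T v \<nu> f j) \<longrightarrow>
        ((\<integral>x. f x T \<partial>glue G (\<nu> T)) - (\<integral>x. f x 0 \<partial>glue G m0)) - (\<Sum>x\<in>sources G. \<integral>t. f x t \<partial>\<sigma>0 x)
          = (\<Sum>j\<in>arcs G. transport_pairing G T v \<nu> f j)) \<and>
     (\<exists>\<tau> :: 'j \<Rightarrow> 'a \<Rightarrow> real measure.
        (\<forall>x\<in>verts G - sources G. \<forall>j\<in>Inc G x \<union> Out G x. is_trace G T v m0 \<nu> j x (\<tau> j x)) \<and>
        (\<forall>x\<in>verts G - sources G. \<forall>j\<in>Out G x. \<forall>f\<in>C1_0 G T.
           (\<integral>t. f x t \<partial>\<tau> j x) = (\<Sum>k\<in>Inc G x. \<integral>t. p k j t * f x t \<partial>\<tau> k x)))"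


section \<open>Paths, flow and coefficients\<close>

text \<open>The paths whose first arc lies in \<open>j\<close>. A path ending with an unbounded arc is represented by the
  sequence which repeats this arc forever; it is never left.\<close>

definition paths :: "('j, 'a) network \<Rightarrow> 'j \<Rightarrow> (nat \<Rightarrow> 'j) set" where
  "paths G j = {\<gamma>. \<gamma> 0 = j \<and> (\<forall>i. \<gamma> i \<in> arcs G \<and>
     (if bdd_above (pdom G (\<gamma> i)) then \<exists>x\<in>verts G. \<gamma> i \<in> Inc G x \<and> \<gamma> (Suc i) \<in> Out G x
      else \<gamma> (Suc i) = \<gamma> i))}"

text \<open>
  The path \<open>\<gamma>\<close> starting from the point with parameter \<open>y\<close> of its first arc is a half-line
  \<open>{0..}\<close> in the travelled distance \<open>r\<close>. \<open>arc_end G \<gamma> y k\<close> is the distance at which its arc number \<open>k\<close>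
  ends; the point at distance \<open>r\<close> lies on the arc number \<open>arc_index G \<gamma> y r\<close> (on the later one at
  junctions) and has parameter \<open>arc_param G \<gamma> y r\<close> there.
\<close>

definition arc_end :: "('j, 'a) network \<Rightarrow> (nat \<Rightarrow> 'j) \<Rightarrow> real \<Rightarrow> nat \<Rightarrow> ereal" where
  "arc_end G \<gamma> y k =
     (if \<forall>i\<le>k. bdd_above (pdom G (\<gamma> i))
      then ereal (Sup (pdom G (\<gamma> 0)) - y + (\<Sum>i=1..k. Sup (pdom G (\<gamma> i)) - Inf (pdom G (\<gamma> i))))
      else \<infinity>)"

definition arc_index :: "('j, 'a) network \<Rightarrow> (nat \<Rightarrow> 'j) \<Rightarrow> real \<Rightarrow> real \<Rightarrow> nat" where
  "arc_index G \<gamma> y r = (LEAST k. ereal r < arc_end G \<gamma> y k)"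

definition arc_param :: "('j, 'a) network \<Rightarrow> (nat \<Rightarrow> 'j) \<Rightarrow> real \<Rightarrow> real \<Rightarrow> real" where
  "arc_param G \<gamma> y r = (case arc_index G \<gamma> y r of
       0 \<Rightarrow> y + r
     | Suc k \<Rightarrow> Inf (pdom G (\<gamma> (Suc k))) + (r - real_of_ereal (arc_end G \<gamma> y k)))"

definition path_point :: "('j, 'a) network \<Rightarrow> (nat \<Rightarrow> 'j) \<Rightarrow> real \<Rightarrow> real \<Rightarrow> 'a" where
  "path_point G \<gamma> y r = par G (\<gamma> (arc_index G \<gamma> y r)) (arc_param G \<gamma> y r)"

text \<open>
  Distance travelled at time \<open>t\<close> by the trajectory along \<open>\<gamma>\<close> which is at distance \<open>0\<close> at time \<open>s\<close>.
  The differential equation is stated in integral form, as \<open>v[m\<^sub>t]\<close> may jump in \<open>t\<close>, and when passing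
  from an arc to the next one.
\<close>

definition trajectory ::
  "('j, 'a::euclidean_space) network \<Rightarrow> real \<Rightarrow> ('a measure \<Rightarrow> 'j \<Rightarrow> real \<Rightarrow> real) \<Rightarrow>
    (real \<Rightarrow> 'j \<Rightarrow> real measure) \<Rightarrow> (nat \<Rightarrow> 'j) \<Rightarrow> real \<Rightarrow> real \<Rightarrow> (real \<Rightarrow> real) \<Rightarrow> bool" where
  "trajectory G T v \<nu> \<gamma> y s R \<longleftrightarrow> (\<forall>t\<in>{s..T}. 0 \<le> R t \<and>
     ((\<lambda>r. v (glue G (\<nu> r)) (\<gamma> (arc_index G \<gamma> y (R r))) (arc_param G \<gamma> y (R r))) has_integral R t) {s..t})"

definition travelled ::
  "('j, 'a::euclidean_space) network \<Rightarrow> real \<Rightarrow> ('a measure \<Rightarrow> 'j \<Rightarrow> real \<Rightarrow> real) \<Rightarrow>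
    (real \<Rightarrow> 'j \<Rightarrow> real measure) \<Rightarrow> (nat \<Rightarrow> 'j) \<Rightarrow> real \<Rightarrow> real \<Rightarrow> real \<Rightarrow> real" where
  "travelled G T v \<nu> \<gamma> y s t = (THE d. \<exists>R. trajectory G T v \<nu> \<gamma> y s R \<and> R t = d)"

definition flow ::
  "('j, 'a::euclidean_space) network \<Rightarrow> real \<Rightarrow> ('a measure \<Rightarrow> 'j \<Rightarrow> real \<Rightarrow> real) \<Rightarrow>
    (real \<Rightarrow> 'j \<Rightarrow> real measure) \<Rightarrow> (nat \<Rightarrow> 'j) \<Rightarrow> real \<Rightarrow> real \<Rightarrow> real \<Rightarrow> 'a" where
  "flow G T v \<nu> \<gamma> y s t = path_point G \<gamma> y (travelled G T v \<nu> \<gamma> y s t)"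

text \<open>The exit times; the value is \<open>\<infinity>\<close> if the exit does not occur up to time \<open>T\<close>.\<close>

primrec exit_time ::
  "('j, 'a::euclidean_space) network \<Rightarrow> real \<Rightarrow> ('a measure \<Rightarrow> 'j \<Rightarrow> real \<Rightarrow> real) \<Rightarrow>
    (real \<Rightarrow> 'j \<Rightarrow> real measure) \<Rightarrow> (nat \<Rightarrow> 'j) \<Rightarrow> real \<Rightarrow> real \<Rightarrow> nat \<Rightarrow> ereal" where
  "exit_time G T v \<nu> \<gamma> y s 0 =
     Inf {ereal t | t. s \<le> t \<and> t \<le> T \<and> bdd_above (pdom G (\<gamma> 0)) \<and>
       flow G T v \<nu> \<gamma> y s t = par G (\<gamma> 0) (Sup (pdom G (\<gamma> 0)))}"
| "exit_time G T v \<nu> \<gamma> y s (Suc k) =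
     Inf {ereal t | t. exit_time G T v \<nu> \<gamma> y s k \<le> ereal t \<and> t \<le> T \<and> bdd_above (pdom G (\<gamma> (Suc k))) \<and>
       flow G T v \<nu> \<gamma> y s t = par G (\<gamma> (Suc k)) (Sup (pdom G (\<gamma> (Suc k))))}"

definition path_coeff ::
  "('j, 'a::euclidean_space) network \<Rightarrow> real \<Rightarrow> ('a measure \<Rightarrow> 'j \<Rightarrow> real \<Rightarrow> real) \<Rightarrow>
    (real \<Rightarrow> 'j \<Rightarrow> real measure) \<Rightarrow> ('j \<Rightarrow> 'j \<Rightarrow> real \<Rightarrow> real) \<Rightarrow> (nat \<Rightarrow> 'j) \<Rightarrow> real \<Rightarrow> real \<Rightarrow> real" where
  "path_coeff G T v \<nu> p \<gamma> y s =
     (\<Prod>k\<in>{k. exit_time G T v \<nu> \<gamma> y s k \<le> ereal T}.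
        p (\<gamma> k) (\<gamma> (Suc k)) (real_of_ereal (exit_time G T v \<nu> \<gamma> y s k)))"

definition visited_arcs ::
  "('j, 'a::euclidean_space) network \<Rightarrow> real \<Rightarrow> ('a measure \<Rightarrow> 'j \<Rightarrow> real \<Rightarrow> real) \<Rightarrow>
    (real \<Rightarrow> 'j \<Rightarrow> real measure) \<Rightarrow> real \<Rightarrow> real \<Rightarrow> (nat \<Rightarrow> 'j) \<Rightarrow> 'j list" where
  "visited_arcs G T v \<nu> y s \<gamma> = map \<gamma> [0..<Suc (card {k. exit_time G T v \<nu> \<gamma> y s k \<le> ereal T})]"

text \<open>\<open>path_sum G T v \<nu> p \<phi> j y s t\<close> is the pairing with \<open>\<phi>\<close> of the sum, over the paths \<open>\<gamma>\<close> starting from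
  the point with parameter \<open>y\<close> of the arc \<open>j\<close>, of the Dirac masses at \<open>\<Phi>\<^sup>\<gamma>\<^sub>t(y, s)\<close> with weight
  \<open>p\<^sub>\<gamma>(y, s)\<close>. Each list of visited arcs is counted once, through a path realizing it; flow and
  coefficient do not depend on which one.\<close>

definition path_sum ::
  "('j, 'a::euclidean_space) network \<Rightarrow> real \<Rightarrow> ('a measure \<Rightarrow> 'j \<Rightarrow> real \<Rightarrow> real) \<Rightarrow>
    (real \<Rightarrow> 'j \<Rightarrow> real measure) \<Rightarrow> ('j \<Rightarrow> 'j \<Rightarrow> real \<Rightarrow> real) \<Rightarrow> ('a \<Rightarrow> real) \<Rightarrow>
    'j \<Rightarrow> real \<Rightarrow> real \<Rightarrow> real \<Rightarrow> real" where
  "path_sum G T v \<nu> p \<phi> j y s t =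
     (\<Sum>\<xi>\<in>visited_arcs G T v \<nu> y s ` paths G j.
        let \<gamma> = inv_into (paths G j) (visited_arcs G T v \<nu> y s) \<xi>
        in \<phi> (flow G T v \<nu> \<gamma> y s t) * path_coeff G T v \<nu> p \<gamma> y s)"

end

theory Submission
  imports Defs
begin

text \<open>
  On a single arc the equation is a transport problem on an interval. Testing it with smooth
  approximations of the indicator of the points to the right of a characteristic shows that the mass
  there changes only through the ends of the arc. Labelling mass by the position at time \<open>0\<close> of the
  characteristic carrying it, one finds for almost every \<open>t\<close>, and for \<open>t = T\<close>, that the mass present
  at time \<open>t\<close> and the mass that has left have together the same labels as the initial mass and the
  mass that has entered. As \<open>m\<^sub>t\<close> does not charge terminal vertices, mass leaves an arc at the time
  at which its characteristic first hits the end, so the label determines what becomes of it.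

  Hence, on each arc, the integral of \<open>\<phi>\<close> against the mass present plus that of the sum over the
  successors of the weighted path sums against the outflow equals the integral of the path sum of \<open>\<phi>\<close>
  against the initial mass and the inflow. When these identities are summed over the arcs, the junction
  conditions cancel the outflows against the inflows at all vertices other than sources, which leaves
  the formula at these times. Both sides are right-continuous in \<open>t\<close> for Lipschitz \<open>\<phi>\<close>, which gives
  it at every time, and a monotone class argument extends it to bounded Borel functions.
\<close>

section \<open>The flow of a field on the line\<close>

text \<open>As the solution is given, its velocity can be frozen into a field \<open>u\<close> of
  time and parameter, and each arc carries a linear problem. The obstacle is the regularity of
  \<open>u\<close>: Lipschitz in the parameter, but merely right-continuous in time, since the
  solution may jump with the atoms of \<open>\<sigma>0\<close>. Characteristics are then not C^1 and
  cannot enter a test function; they are replaced by forward averages in time, whose derivatives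
  converge to the velocity everywhere by right continuity. When the profile sharpens to an
  indicator, its derivative, of order n, is multiplied by the difference of \<open>u\<close> at
  \<open>y\<close> and at the characteristic, at most a multiple of their distance; the product
  stays bounded and tends to 0. For path sums the difficulty is that the coefficients involve all
  exits up to \<open>T\<close>, whereas the position is taken at \<open>t\<close>. The factors of
  exits after \<open>t\<close> sum to 1 over the continuations, which yields a recursion over the
  first arc. It terminates because bounded arcs have a minimal length and speeds a maximal value;
  the same delay gives measurability in the starting time.\<close>

lemma right_continuous_approx:
  fixes t :: real
  defines "q \<equiv> \<lambda>n::nat. (of_int (\<lfloor>t * real (Suc n)\<rfloor>) + 1) / real (Suc n)"
  shows "filterlim q (at_right t) sequentially"
proof -
  \<comment> \<open>\<open>q n\<close> is the least multiple of \<open>1 / (n + 1)\<close> strictly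
    above \<open>t\<close>. Strictness makes the approach one from the right even when
    \<open>t\<close> is itself a grid point.\<close>
  have gt: "t < q n" and le: "q n \<le> t + 1 / real (Suc n)" for n
  proof -
    have "t * real (Suc n) < of_int \<lfloor>t * real (Suc n)\<rfloor> + 1" by linarith
    then show "t < q n" unfolding q_def by (simp add: pos_less_divide_eq del: of_nat_Suc)
    have "of_int \<lfloor>t * real (Suc n)\<rfloor> + 1 \<le> t * real (Suc n) + 1" by linarith
    then have "q n \<le> (t * real (Suc n) + 1) / real (Suc n)"
      unfolding q_def by (intro divide_right_mono) auto
    also have "\<dots> = t + 1 / real (Suc n)" by (simp add: field_simps del: of_nat_Suc)
    finally show "q n \<le> t + 1 / real (Suc n)" .
  qed
  have "(\<lambda>n. t + 1 / real (Suc n)) \<longlonglongrightarrow> t + 0"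
    by (intro tendsto_intros LIMSEQ_Suc lim_1_over_n)
  then have "q \<longlonglongrightarrow> t"
    by (intro real_tendsto_sandwich[of "\<lambda>_. t" q _ "\<lambda>n. t + 1 / real (Suc n)"])
       (use gt le in \<open>auto intro!: always_eventually less_imp_le\<close>)
  then show ?thesis
    using gt by (auto simp: filterlim_at less_imp_neq[symmetric] intro!: always_eventually)
qed

lemma tendsto_null_abs_le:
  fixes f g :: "'a \<Rightarrow> real"
  assumes "(g \<longlongrightarrow> 0) F" "\<And>x. \<bar>f x\<bar> \<le> g x"
  shows "(f \<longlongrightarrow> 0) F"
  by (rule Lim_null_comparison[OF _ assms(1)]) (simp add: assms(2))

text \<open>Moving the time to the next point of a grid gives a function that depends on time
  through countably many values, hence is jointly measurable; right continuity makes these functions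
  converge pointwise as the grid is refined.\<close>

lemma right_continuous_pair_measurable:
  fixes f :: "real \<Rightarrow> 'b \<Rightarrow> real"
  assumes rc: "\<And>t y. y \<in> space M \<Longrightarrow> ((\<lambda>s. f s y) \<longlongrightarrow> f t y) (at_right t)"
    and meas: "\<And>t. f t \<in> borel_measurable M"
  shows "(\<lambda>(t, y). f t y) \<in> borel_measurable (borel \<Otimes>\<^sub>M M)"
proof -
  define q where "q = (\<lambda>n::nat. \<lambda>t::real. (of_int (\<lfloor>t * real (Suc n)\<rfloor>) + 1) / real (Suc n))"
  have m: "(\<lambda>z. f (q n (fst z)) (snd z)) \<in> borel_measurable (borel \<Otimes>\<^sub>M M)" for n
  proof -
    have "(\<lambda>z. (\<lambda>i z. f ((of_int (i::int) + 1) / real (Suc n)) (snd z)) (\<lfloor>fst z * real (Suc n)\<rfloor>) z)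
        \<in> borel_measurable (borel \<Otimes>\<^sub>M M)"
    proof (rule measurable_compose_countable[where g = "\<lambda>z. \<lfloor>fst z * real (Suc n)\<rfloor>"
          and f = "\<lambda>(i::int) z. f ((of_int i + 1) / real (Suc n)) (snd z)"])
      fix i :: int
      show "(\<lambda>z. f ((of_int i + 1) / real (Suc n)) (snd z)) \<in> borel_measurable (borel \<Otimes>\<^sub>M M)"
        by (rule measurable_compose[OF measurable_snd meas])
    next
      show "(\<lambda>z. \<lfloor>fst z * real (Suc n)\<rfloor>) \<in> (borel \<Otimes>\<^sub>M M) \<rightarrow>\<^sub>M count_space UNIV"
        by measurable
    qed
    then show ?thesis by (simp add: q_def)
  qed
  have lim: "(\<lambda>n. f (q n (fst z)) (snd z)) \<longlonglongrightarrow> (\<lambda>(t, y). f t y) z" if "z \<in> space (borel \<Otimes>\<^sub>M M)" for z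
    using filterlim_compose[OF rc right_continuous_approx, of "snd z" "fst z"] that
    by (auto simp: q_def case_prod_beta space_pair_measure)
  show ?thesis
    by (rule borel_measurable_LIMSEQ_metric[OF m lim])
qed

lemma continuous_comparison_ivt:
  fixes f g :: "real \<Rightarrow> real"
  assumes "continuous_on UNIV f" "continuous_on UNIV g" "f s < g s" "\<And>t. f t \<noteq> g t"
  shows "f t < g t"
proof (rule ccontr)
  assume "\<not> f t < g t"
  then have ft: "g t \<le> f t" by simp
  have c: "continuous_on {min s t..max s t} (\<lambda>x. f x - g x)"
    by (intro continuous_intros continuous_on_subset[OF assms(1)] continuous_on_subset[OF assms(2)]) auto
  have "\<exists>x. f x - g x = 0"
  proof (cases "s \<le> t")
    case True
    then show ?thesis
      using IVT'[of "\<lambda>x. f x - g x" s 0 t] assms(3) ft c by auto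
  next
    case False
    then show ?thesis
      using IVT2'[of "\<lambda>x. f x - g x" s 0 t] assms(3) ft c by auto
  qed
  then show False using assms(4) by auto
qed

text \<open>\<open>exp (2 * c * \<bar>t - s\<bar>)\<close> is the weight of a Bielecki norm:
  integrating it against the Lipschitz constant \<open>c\<close> returns less than half of it. This
  half is the contraction factor of the Picard map, uniformly in time.\<close>

lemma has_integral_exp_forward:
  fixes c s t :: real
  assumes "c > 0" "s \<le> t"
  shows "((\<lambda>r. c * exp (2 * c * \<bar>r - s\<bar>)) has_integral (exp (2 * c * \<bar>t - s\<bar>) - 1) / 2) {s..t}"
proof -
  have "((\<lambda>r. c * exp (2 * c * (r - s))) has_integral exp (2 * c * (t - s)) / 2 - exp (2 * c * (s - s)) / 2) {s..t}"
    by (rule fundamental_theorem_of_calculus[OF assms(2)])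
       (use assms in \<open>auto intro!: derivative_eq_intros simp flip: has_real_derivative_iff_has_vector_derivative\<close>)
  then have "((\<lambda>r. c * exp (2 * c * \<bar>r - s\<bar>)) has_integral exp (2 * c * (t - s)) / 2 - exp (2 * c * (s - s)) / 2) {s..t}"
    by (rule has_integral_eq[rotated]) auto
  then show ?thesis using assms by (simp add: diff_divide_distrib)
qed

lemma has_integral_exp_backward:
  fixes c s t :: real
  assumes "c > 0" "t \<le> s"
  shows "((\<lambda>r. c * exp (2 * c * \<bar>r - s\<bar>)) has_integral (exp (2 * c * \<bar>t - s\<bar>) - 1) / 2) {t..s}"
proof -
  have "((\<lambda>r. c * exp (2 * c * (s - r))) has_integral - exp (2 * c * (s - s)) / 2 - - exp (2 * c * (s - t)) / 2) {t..s}"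
    by (rule fundamental_theorem_of_calculus[OF assms(2)])
       (use assms in \<open>auto intro!: derivative_eq_intros simp flip: has_real_derivative_iff_has_vector_derivative\<close>)
  then have "((\<lambda>r. c * exp (2 * c * \<bar>r - s\<bar>)) has_integral - exp (2 * c * (s - s)) / 2 - - exp (2 * c * (s - t)) / 2) {t..s}"
    by (rule has_integral_eq[rotated]) auto
  then show ?thesis using assms by (simp add: diff_divide_distrib)
qed

text \<open>The field is defined on the whole plane, so that trajectories exist for all times and
  never leave the domain. The network provides such a field by clamping time and parameter.\<close>

locale transport_field =
  fixes u :: "real \<Rightarrow> real \<Rightarrow> real" and V L :: real
  assumes L_pos: "0 < L" and u_nonneg: "0 \<le> u t y" and u_le: "u t y \<le> V"
    and u_lip: "\<bar>u t y - u t z\<bar> \<le> L * \<bar>y - z\<bar>"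
    and u_rc: "((\<lambda>s. u s y) \<longlongrightarrow> u t y) (at_right t)"
begin

lemma V_nonneg: "0 \<le> V"
  using u_nonneg u_le order_trans by blast

lemma u_pair_measurable: "(\<lambda>(t, y). u t y) \<in> borel_measurable (borel \<Otimes>\<^sub>M borel)"
proof (rule right_continuous_pair_measurable)
  fix t
  have "continuous_on UNIV (u t)"
    by (rule continuous_on_subset[OF lipschitz_on_continuous_on[of L]])
       (use L_pos u_lip in \<open>auto simp: lipschitz_on_def dist_real_def\<close>)
  then show "u t \<in> borel_measurable borel" by (rule borel_measurable_continuous_onI)
qed (use u_rc in auto)

lemma u_along_measurable:
  assumes "X \<in> borel_measurable borel"
  shows "(\<lambda>r. u r (X r)) \<in> borel_measurable borel"
  using measurable_compose[OF _ u_pair_measurable, of "\<lambda>r. (r, X r)" borel] assms by simp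

lemma u_along_right_continuous:
  assumes "isCont X t"
  shows "((\<lambda>r. u r (X r)) \<longlongrightarrow> u t (X t)) (at_right t)"
proof -
  have "(X \<longlongrightarrow> X t) (at_right t)"
    using assms by (simp add: isCont_def filterlim_at_split)
  then have "((\<lambda>r. L * \<bar>X r - X t\<bar>) \<longlongrightarrow> L * \<bar>X t - X t\<bar>) (at_right t)"
    by (intro tendsto_intros)
  then have "((\<lambda>r. u r (X r) - u r (X t)) \<longlongrightarrow> 0) (at_right t)"
    by - (rule tendsto_null_abs_le[where g = "\<lambda>r. L * \<bar>X r - X t\<bar>"], simp_all add: u_lip)
  from tendsto_add[OF this u_rc[of "X t" t]] show ?thesis by simp
qed

lemma u_along_integrable:
  assumes "X \<in> borel_measurable borel"
  shows "(\<lambda>r. u r (X r)) integrable_on {s..t}"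
proof -
  have "(\<lambda>r. u r (X r)) absolutely_integrable_on {s..t}"
  proof (rule measurable_bounded_by_integrable_imp_absolutely_integrable)
    show "(\<lambda>r. u r (X r)) \<in> borel_measurable (lebesgue_on {s..t})"
      by (intro measurable_restrict_space1 measurable_completion)
         (use u_along_measurable[OF assms] in simp)
    show "(\<lambda>_. V) integrable_on {s..t}" by (rule integrable_const_ivl)
  qed (use u_nonneg u_le in auto)
  then show ?thesis by (rule set_lebesgue_integral_eq_integral(1))
qed

text \<open>The field need not be continuous in time, so solutions are taken in integral form.\<close>

definition sol_on :: "real \<Rightarrow> real \<Rightarrow> (real \<Rightarrow> real) \<Rightarrow> bool" where
  "sol_on c d X \<longleftrightarrow> (\<forall>s t. c \<le> s \<and> s \<le> t \<and> t \<le> d \<longrightarrow> ((\<lambda>r. u r (X r)) has_integral (X t - X s)) {s..t})"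

lemma sol_onD: "sol_on c d X \<Longrightarrow> c \<le> s \<Longrightarrow> s \<le> t \<Longrightarrow> t \<le> d \<Longrightarrow> ((\<lambda>r. u r (X r)) has_integral (X t - X s)) {s..t}"
  by (simp add: sol_on_def)

lemma sol_on_bounds:
  assumes "sol_on c d X" "c \<le> s" "s \<le> t" "t \<le> d"
  shows "X s \<le> X t" "X t - X s \<le> V * (t - s)"
proof -
  have i: "((\<lambda>r. u r (X r)) has_integral (X t - X s)) {s..t}" using sol_onD[OF assms] .
  show "X s \<le> X t" using has_integral_nonneg[OF i] u_nonneg by auto
  have "((\<lambda>r. V) has_integral (t - s) * V) {s..t}"
    using has_integral_const_real[of V s t] assms by simp
  from has_integral_le[OF i this] show "X t - X s \<le> V * (t - s)"
    using u_le by (simp add: mult.commute)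
qed

lemma sol_on_lip:
  assumes "sol_on c d X" "s \<in> {c..d}" "t \<in> {c..d}"
  shows "\<bar>X t - X s\<bar> \<le> V * \<bar>t - s\<bar>"
  using sol_on_bounds[OF assms(1), of s t] sol_on_bounds[OF assms(1), of t s] assms
  by (cases "s \<le> t") auto

text \<open>One application of the integral equation halves a bound in the weighted norm. Forward
  and backward intervals are treated together, and the lemma serves for uniqueness as well as for
  existence.\<close>

lemma contraction_step:
  assumes X: "((\<lambda>r. u r (X r)) has_integral I) S" and Y: "((\<lambda>r. u r (Y r)) has_integral J) S"
    and S: "S = {s..t} \<and> s \<le> t \<or> S = {t..s} \<and> t \<le> s"
    and le: "\<And>r. r \<in> S \<Longrightarrow> \<bar>X r - Y r\<bar> \<le> C * exp (2 * L * \<bar>r - s\<bar>)"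
  shows "\<bar>I - J\<bar> \<le> C / 2 * (exp (2 * L * \<bar>t - s\<bar>) - 1)"
proof -
  have "((\<lambda>r. L * exp (2 * L * \<bar>r - s\<bar>)) has_integral (exp (2 * L * \<bar>t - s\<bar>) - 1) / 2) S"
    using S has_integral_exp_forward[OF L_pos] has_integral_exp_backward[OF L_pos] by auto
  from has_integral_mult_right[OF this, of C]
  have E: "((\<lambda>r. C * (L * exp (2 * L * \<bar>r - s\<bar>))) has_integral C / 2 * (exp (2 * L * \<bar>t - s\<bar>) - 1)) S"
    by simp
  have b: "\<bar>u r (X r) - u r (Y r)\<bar> \<le> C * (L * exp (2 * L * \<bar>r - s\<bar>))" if "r \<in> S" for r
  proof -
    have "\<bar>u r (X r) - u r (Y r)\<bar> \<le> L * \<bar>X r - Y r\<bar>" by (rule u_lip)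
    also have "\<dots> \<le> L * (C * exp (2 * L * \<bar>r - s\<bar>))"
      using le[OF that] L_pos by simp
    finally show ?thesis by (simp add: ac_simps)
  qed
  have D: "((\<lambda>r. u r (X r) - u r (Y r)) has_integral (I - J)) S" by (rule has_integral_diff[OF X Y])
  have "I - J \<le> C / 2 * (exp (2 * L * \<bar>t - s\<bar>) - 1)"
    by (rule has_integral_le[OF D E]) (use b in fastforce)
  moreover have "- (I - J) \<le> C / 2 * (exp (2 * L * \<bar>t - s\<bar>) - 1)"
    by (rule has_integral_le[OF has_integral_neg[OF D] E]) (use b in fastforce)
  ultimately show ?thesis by linarith
qed

text \<open>A Gronwall inequality, with 2 as additional factor, obtained by iterating the integral
  equation. It holds on both sides of \<open>s\<close>, as trajectories will be followed back to
  time 0.\<close>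

lemma sol_on_compare:
  assumes X: "sol_on c d X" and Y: "sol_on c d Y" and s: "s \<in> {c..d}" and t: "t \<in> {c..d}"
  shows "\<bar>X t - Y t\<bar> \<le> 2 * \<bar>X s - Y s\<bar> * exp (2 * L * \<bar>t - s\<bar>)"
proof -
  define C where "C = 2 * V * (d - c)"
  have C0: "0 \<le> C" using V_nonneg s by (auto simp: C_def)
  define D where "D = \<bar>X s - Y s\<bar>"
  \<comment> \<open>\<open>C\<close> bounds the two displacements together, each at speed at most
    \<open>V\<close>. Every pass halves this part, while the gap at \<open>s\<close> enters afresh
    each time and accumulates to at most \<open>2 * D\<close>.\<close>
  have *: "\<forall>t\<in>{c..d}. \<bar>X t - Y t\<bar> \<le> (2 * D + C / 2 ^ n) * exp (2 * L * \<bar>t - s\<bar>)" for n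
  proof (induction n)
    case 0
    show ?case
    proof
      fix t assume t: "t \<in> {c..d}"
      have "V * \<bar>t - s\<bar> \<le> V * (d - c)" using s t V_nonneg by (intro mult_left_mono) auto
      moreover have "\<bar>X t - Y t\<bar> \<le> \<bar>X t - X s\<bar> + \<bar>Y t - Y s\<bar> + \<bar>X s - Y s\<bar>" by linarith
      ultimately have "\<bar>X t - Y t\<bar> \<le> 2 * D + C"
        using sol_on_lip[OF X s t] sol_on_lip[OF Y s t] unfolding C_def D_def
        by (smt (verit) mult_2 distrib_right)
      also have "\<dots> \<le> (2 * D + C) * exp (2 * L * \<bar>t - s\<bar>)"
        using C0 mult_left_mono[of 1 "exp (2 * L * \<bar>t - s\<bar>)" "2 * D + C"] L_pos by (simp add: D_def)
      finally show "\<bar>X t - Y t\<bar> \<le> (2 * D + C / 2 ^ 0) * exp (2 * L * \<bar>t - s\<bar>)" by simp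
    qed
  next
    case (Suc n)
    let ?K = "2 * D + C / 2 ^ n"
    show ?case
    proof
      fix t assume t: "t \<in> {c..d}"
      let ?E = "exp (2 * L * \<bar>t - s\<bar>)"
      have "\<bar>(X t - X s) - (Y t - Y s)\<bar> \<le> ?K / 2 * (?E - 1)"
      proof (cases "s \<le> t")
        case True
        show ?thesis
          by (rule contraction_step[OF sol_onD[OF X] sol_onD[OF Y], of s t])
            (use s t True Suc in \<open>simp_all del: abs_of_nonneg abs_of_nonpos\<close>)
      next
        case False
        have "\<bar>(X s - X t) - (Y s - Y t)\<bar> \<le> ?K / 2 * (?E - 1)"
          by (rule contraction_step[OF sol_onD[OF X] sol_onD[OF Y], of t s])
            (use s t False Suc in \<open>simp_all del: abs_of_nonneg abs_of_nonpos\<close>)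
        then show ?thesis by linarith
      qed
      then have "\<bar>X t - Y t\<bar> \<le> D + ?K / 2 * (?E - 1)" unfolding D_def by linarith
      also have "\<dots> = (D + C / 2 ^ Suc n) * ?E - C / 2 ^ Suc n" by (simp add: field_simps)
      also have "\<dots> \<le> (2 * D + C / 2 ^ Suc n) * ?E"
        using C0 by (simp add: algebra_simps D_def)
      finally show "\<bar>X t - Y t\<bar> \<le> (2 * D + C / 2 ^ Suc n) * ?E" .
    qed
  qed
  have "(\<lambda>n. (2 * D + C * (1 / 2) ^ n) * exp (2 * L * \<bar>t - s\<bar>)) \<longlonglongrightarrow> (2 * D + C * 0) * exp (2 * L * \<bar>t - s\<bar>)"
    by (intro tendsto_intros) auto
  from LIMSEQ_le_const[OF this, of "\<bar>X t - Y t\<bar>"] show ?thesis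
    using * t by (auto simp: D_def power_divide)
qed

lemma sol_on_unique:
  "sol_on c d X \<Longrightarrow> sol_on c d Y \<Longrightarrow> s \<in> {c..d} \<Longrightarrow> X s = Y s \<Longrightarrow> t \<in> {c..d} \<Longrightarrow> X t = Y t"
  using sol_on_compare[of c d X Y s t] by simp

text \<open>An oriented integral from \<open>s\<close> to \<open>t\<close>: of the two intervals one
  is empty or a point, and its integral is 0.\<close>

definition picard :: "real \<Rightarrow> real \<Rightarrow> (real \<Rightarrow> real) \<Rightarrow> real \<Rightarrow> real" where
  "picard s y X t = y + integral {s..t} (\<lambda>r. u r (X r)) - integral {t..s} (\<lambda>r. u r (X r))"

lemma picard_has_integral:
  assumes "X \<in> borel_measurable borel" "c \<le> d"
  shows "((\<lambda>r. u r (X r)) has_integral (picard s y X d - picard s y X c)) {c..d}"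
proof -
  let ?I = "\<lambda>a b. integral {a..b} (\<lambda>r. u r (X r))"
  have comb: "?I p q + ?I q r = ?I p r" if "p \<le> q" "q \<le> r" for p q r
    by (rule Henstock_Kurzweil_Integration.integral_combine[OF that u_along_integrable[OF assms(1)]])
  have z: "?I p q = 0" if "q \<le> p" for p q
    using that by (cases "p = q") auto
  have "picard s y X d - picard s y X c = ?I c d"
  proof -
    consider "s \<le> c" | "c \<le> s" "s \<le> d" | "d \<le> s" by linarith
    then show ?thesis
    proof cases
      case 1
      then show ?thesis using comb[of s c d] z[of s c] z[of s d] assms(2) by (simp add: picard_def)
    next
      case 2
      then show ?thesis using comb[of c s d] z[of s d] z[of c s] assms(2) by (simp add: picard_def)
    next
      case 3
      then show ?thesis using comb[of c d s] z[of c s] z[of d s] assms(2) by (simp add: picard_def)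
    qed
  qed
  then show ?thesis
    using integrable_integral[OF u_along_integrable[OF assms(1)], of c d] by simp
qed

lemma picard_lip:
  assumes "X \<in> borel_measurable borel" "c \<le> d"
  shows "picard s y X c \<le> picard s y X d" "picard s y X d - picard s y X c \<le> V * (d - c)"
proof -
  note i = picard_has_integral[OF assms, of s y]
  show "picard s y X c \<le> picard s y X d" using has_integral_nonneg[OF i] u_nonneg by auto
  have "((\<lambda>r. V) has_integral (d - c) * V) {c..d}"
    using has_integral_const_real[of V c d] assms by simp
  from has_integral_le[OF i this] show "picard s y X d - picard s y X c \<le> V * (d - c)"
    using u_le by (simp add: mult.commute)
qed

lemma picard_measurable:
  assumes "X \<in> borel_measurable borel" shows "picard s y X \<in> borel_measurable borel"
  by (rule borel_measurable_mono) (use picard_lip[OF assms] in \<open>auto simp: mono_def\<close>)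

lemma picard_at_start [simp]: "picard s y X s = y"
  by (simp add: picard_def)

lemma picard_contract:
  assumes "X \<in> borel_measurable borel" "Y \<in> borel_measurable borel"
    and "\<And>r. \<bar>X r - Y r\<bar> \<le> C * exp (2 * L * \<bar>r - s\<bar>)"
  shows "\<bar>picard s y X t - picard s y Y t\<bar> \<le> C / 2 * exp (2 * L * \<bar>t - s\<bar>)"
proof -
  have C: "0 \<le> C" using assms(3)[of s] by simp
  have "\<bar>picard s y X t - picard s y Y t\<bar> \<le> C / 2 * (exp (2 * L * \<bar>t - s\<bar>) - 1)"
  proof (cases "s \<le> t")
    case True
    have "\<bar>(picard s y X t - picard s y X s) - (picard s y Y t - picard s y Y s)\<bar> \<le> C / 2 * (exp (2 * L * \<bar>t - s\<bar>) - 1)"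
      by (rule contraction_step[OF picard_has_integral[OF assms(1) True]
          picard_has_integral[OF assms(2) True]]) (simp add: True, rule assms(3))
    then show ?thesis by simp
  next
    case False
    then have ts: "t \<le> s" by simp
    have "\<bar>(picard s y X s - picard s y X t) - (picard s y Y s - picard s y Y t)\<bar> \<le> C / 2 * (exp (2 * L * \<bar>t - s\<bar>) - 1)"
      by (rule contraction_step[OF picard_has_integral[OF assms(1) ts]
          picard_has_integral[OF assms(2) ts]]) (simp add: ts, rule assms(3))
    then show ?thesis by (simp add: abs_minus_commute)
  qed
  also have "\<dots> \<le> C / 2 * exp (2 * L * \<bar>t - s\<bar>)" using C by (intro mult_left_mono) auto
  finally show ?thesis .
qed

text \<open>In the weighted norm the Picard map contracts by 1/2 on the whole line at once, so the
  iterates converge without patching of short intervals. Measurability is carried along because the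
  field is composed with each iterate.\<close>

theorem global_solution: "\<exists>X. X s = y \<and> (\<forall>c d. sol_on c d X)"
proof -
  define Z where "Z = rec_nat (\<lambda>_::real. y) (\<lambda>_. picard s y)"
  have Z0: "Z 0 = (\<lambda>_. y)" and ZS: "Z (Suc n) = picard s y (Z n)" for n by (simp_all add: Z_def)
  have Zm: "Z n \<in> borel_measurable borel" for n
    by (induction n) (auto simp: Z0 ZS intro: picard_measurable)
  \<comment> \<open>Chosen for the first increment: it is at most
    \<open>V * \<bar>t - s\<bar> = C * (L * \<bar>t - s\<bar>)\<close>, and the last factor is below
    the weight.\<close>
  define C where "C = V / L"
  have C0: "0 \<le> C" using V_nonneg L_pos by (simp add: C_def)
  have step: "\<bar>Z (Suc n) t - Z n t\<bar> \<le> C / 2 ^ n * exp (2 * L * \<bar>t - s\<bar>)" for n t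
  proof (induction n arbitrary: t)
    case 0
    have "\<bar>Z (Suc 0) t - Z 0 t\<bar> = \<bar>picard s y (\<lambda>_. y) t - picard s y (\<lambda>_. y) s\<bar>"
      by (simp add: Z0 ZS)
    also have "\<dots> \<le> V * \<bar>t - s\<bar>"
      using picard_lip[of "\<lambda>_. y" s t s y] picard_lip[of "\<lambda>_. y" t s s y] by (cases "s \<le> t") auto
    also have "\<dots> = C * (L * \<bar>t - s\<bar>)" using L_pos by (simp add: C_def)
    also have "\<dots> \<le> C * exp (2 * L * \<bar>t - s\<bar>)"
    proof (rule mult_left_mono[OF _ C0])
      have "1 + 2 * L * \<bar>t - s\<bar> \<le> exp (2 * L * \<bar>t - s\<bar>)" by (rule exp_ge_add_one_self)
      moreover have "0 \<le> L * \<bar>t - s\<bar>" using L_pos by simp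
      ultimately show "L * \<bar>t - s\<bar> \<le> exp (2 * L * \<bar>t - s\<bar>)" by linarith
    qed
    finally show ?case by simp
  next
    case (Suc n)
    have "\<bar>picard s y (Z (Suc n)) t - picard s y (Z n) t\<bar> \<le> C / 2 ^ n / 2 * exp (2 * L * \<bar>t - s\<bar>)"
      by (rule picard_contract[OF Zm Zm Suc])
    then show ?case by (simp add: ZS)
  qed
  have summ: "summable (\<lambda>n. Z (Suc n) t - Z n t)" for t
  proof (rule summable_comparison_test'[of "\<lambda>n. (C * exp (2 * L * \<bar>t - s\<bar>)) * (1/2)^n" 0])
    show "summable (\<lambda>n. (C * exp (2 * L * \<bar>t - s\<bar>)) * (1/2::real)^n)"
      by (intro summable_mult summable_geometric) auto
  qed (use step in \<open>auto simp: power_divide field_simps\<close>)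
  define X where "X t = lim (\<lambda>n. Z n t)" for t
  have lim: "(\<lambda>n. Z n t) \<longlonglongrightarrow> X t" for t
  proof -
    have "convergent (\<lambda>n. Z n t)"
    proof -
      have "(\<lambda>n. \<Sum>i<n. Z (Suc i) t - Z i t) = (\<lambda>n. Z n t - Z 0 t)"
        by (intro ext sum_lessThan_telescope)
      with summ[of t] have "convergent (\<lambda>n. Z n t - Z 0 t)"
        by (simp add: summable_iff_convergent)
      then show ?thesis using convergent_add[OF _ convergent_const[of "Z 0 t"]] by fastforce
    qed
    then show ?thesis unfolding X_def by (simp add: convergent_LIMSEQ_iff)
  qed
  have Xm: "X \<in> borel_measurable borel"
    by (rule borel_measurable_LIMSEQ_real[OF lim Zm])
  \<comment> \<open>The factor \<open>2 - 2 / 2 ^ k\<close> is the partial sum of the geometric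
    series of the increments.\<close>
  have tele: "\<bar>Z (n + k) t - Z n t\<bar> \<le> (2 - 2 / 2 ^ k) * C / 2 ^ n * exp (2 * L * \<bar>t - s\<bar>)" for n k t
  proof (induction k)
    case (Suc k)
    have "\<bar>Z (n + Suc k) t - Z n t\<bar> \<le> C / 2 ^ (n + k) * exp (2 * L * \<bar>t - s\<bar>)
        + (2 - 2 / 2 ^ k) * C / 2 ^ n * exp (2 * L * \<bar>t - s\<bar>)"
      using step[of "n + k" t] Suc by simp
    also have "\<dots> = (2 - 2 / 2 ^ Suc k) * C / 2 ^ n * exp (2 * L * \<bar>t - s\<bar>)"
      by (simp add: field_simps power_add)
    finally show ?case .
  qed simp
  have close: "\<bar>Z n t - X t\<bar> \<le> 2 * C / 2 ^ n * exp (2 * L * \<bar>t - s\<bar>)" for n t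
  proof -
    have "(\<lambda>k. \<bar>Z (k + n) t - Z n t\<bar>) \<longlonglongrightarrow> \<bar>X t - Z n t\<bar>"
      by (intro tendsto_intros LIMSEQ_ignore_initial_segment lim)
    moreover have "\<bar>Z (k + n) t - Z n t\<bar> \<le> 2 * C / 2 ^ n * exp (2 * L * \<bar>t - s\<bar>)" for k
    proof -
      have "\<bar>Z (k + n) t - Z n t\<bar> \<le> (2 - 2 / 2 ^ k) * (C / 2 ^ n * exp (2 * L * \<bar>t - s\<bar>))"
        using tele[of n k t] by (simp add: add.commute)
      also have "\<dots> \<le> 2 * (C / 2 ^ n * exp (2 * L * \<bar>t - s\<bar>))"
        using C0 by (intro mult_right_mono) auto
      finally show ?thesis by simp
    qed
    ultimately have "\<bar>X t - Z n t\<bar> \<le> 2 * C / 2 ^ n * exp (2 * L * \<bar>t - s\<bar>)"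
      by (intro LIMSEQ_le_const2) auto
    then show ?thesis by linarith
  qed
  have fix_eq: "picard s y X t = X t" for t
  proof -
    have b: "\<bar>picard s y X t - Z (Suc n) t\<bar> \<le> C * exp (2 * L * \<bar>t - s\<bar>) * (1/2) ^ n" for n
      using picard_contract[OF Xm Zm, where C = "2 * C / 2 ^ n" and s = s and y = y and t = t and n1 = n] close[of n]
      by (simp add: ZS abs_minus_commute power_divide)
    have "(\<lambda>n. C * exp (2 * L * \<bar>t - s\<bar>) * (1/2) ^ n) \<longlonglongrightarrow> C * exp (2 * L * \<bar>t - s\<bar>) * 0"
      by (intro tendsto_intros) auto
    then have "(\<lambda>n. picard s y X t - Z (Suc n) t) \<longlonglongrightarrow> 0"
      by - (rule tendsto_null_abs_le[where g = "\<lambda>n. C * exp (2 * L * \<bar>t - s\<bar>) * (1/2) ^ n"], simp, rule b)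
    moreover have "(\<lambda>n. picard s y X t - Z (Suc n) t) \<longlonglongrightarrow> picard s y X t - X t"
      by (intro tendsto_intros LIMSEQ_Suc lim)
    ultimately show ?thesis using LIMSEQ_unique by fastforce
  qed
  have "X s = y" using fix_eq[of s] by simp
  moreover have "sol_on c d X" for c d
    unfolding sol_on_def using picard_has_integral[OF Xm, of _ _ s y] by (simp add: fix_eq)
  ultimately show ?thesis by blast
qed

text \<open>Starting time, starting point, then the time of evaluation, which may precede the
  start.\<close>

definition Fl :: "real \<Rightarrow> real \<Rightarrow> real \<Rightarrow> real" where
  "Fl s y = (SOME X. X s = y \<and> (\<forall>c d. sol_on c d X))"

lemma Fl_start [simp]: "Fl s y s = y" and Fl_sol: "sol_on c d (Fl s y)"
  using someI_ex[OF global_solution[of s y]] unfolding Fl_def by auto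

lemma Fl_unique:
  assumes "sol_on c d X" "s \<in> {c..d}" "t \<in> {c..d}"
  shows "X t = Fl s (X s) t"
  by (rule sol_on_unique[OF assms(1) Fl_sol assms(2) _ assms(3)]) simp

lemma Fl_comp [simp]: "Fl s (Fl r y s) t = Fl r y t"
  using Fl_unique[OF Fl_sol, of s "min s t" "max s t" t r y] by simp

lemma Fl_mono_time: "r \<le> t \<Longrightarrow> Fl s y r \<le> Fl s y t"
  using sol_on_bounds(1)[OF Fl_sol, of r r t t s y] by simp

lemma Fl_speed: "r \<le> t \<Longrightarrow> Fl s y t - Fl s y r \<le> V * (t - r)"
  using sol_on_bounds(2)[OF Fl_sol, of r r t t s y] by simp

lemma Fl_lip_time: "\<bar>Fl s y t - Fl s y r\<bar> \<le> V * \<bar>t - r\<bar>"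
  using sol_on_lip[OF Fl_sol, of r "min r t" "max r t" t s y] by simp

lemma Fl_continuous: "continuous_on A (Fl s y)"
  by (rule continuous_on_subset[OF lipschitz_on_continuous_on[of V UNIV]])
     (use V_nonneg Fl_lip_time in \<open>auto simp: lipschitz_on_def dist_real_def abs_minus_commute\<close>)

lemma Fl_isCont: "isCont (Fl s y) t"
  using Fl_continuous[of UNIV s y] by (simp add: continuous_on_eq_continuous_at)

lemma Fl_compare: "\<bar>Fl s y t - Fl s z t\<bar> \<le> 2 * \<bar>y - z\<bar> * exp (2 * L * \<bar>t - s\<bar>)"
  using sol_on_compare[OF Fl_sol Fl_sol, of s "min s t" "max s t" t s y s z] by simp

lemma Fl_cont_start: "continuous_on A (\<lambda>y. Fl s y t)"
  by (rule continuous_on_subset[OF lipschitz_on_continuous_on[of "2 * exp (2 * L * \<bar>t - s\<bar>)" UNIV]])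
     (use Fl_compare[of s _ t] in \<open>auto simp: lipschitz_on_def dist_real_def ac_simps\<close>)

text \<open>Trajectories cannot cross: if two of them met at some time, restarting both from there
  would make them equal at \<open>s\<close>. The order on the line is therefore preserved, which is
  what makes labels comparable.\<close>

lemma Fl_less_iff: "Fl s y t < Fl s z t \<longleftrightarrow> y < z"
proof -
  have imp: "Fl s y t < Fl s z t" if "y < z" for y z
  proof (rule continuous_comparison_ivt[OF Fl_continuous Fl_continuous])
    show "Fl s y s < Fl s z s" using that by simp
    show "Fl s y r \<noteq> Fl s z r" for r
      using Fl_comp[of r s y s] Fl_comp[of r s z s] that by force
  qed
  show ?thesis using imp[of y z] imp[of z y] by (cases y z rule: linorder_cases) auto
qed

lemma Fl_le_iff: "Fl s y t \<le> Fl s z t \<longleftrightarrow> y \<le> z"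
  using Fl_less_iff[of s z t y] by linarith

lemma Fl_shift_less_iff: "Fl s y r < Fl t z r \<longleftrightarrow> Fl s y t < z"
  using Fl_less_iff[of t "Fl s y t" r z] by simp

text \<open>The trajectory started at a nearby time and point is compared with the point that the
  given trajectory occupies at that nearby time; this point is close because the speed is at most
  \<open>V\<close>.\<close>

lemma Fl_pair_continuous: "continuous_on UNIV (\<lambda>(s, y). Fl s y t)"
proof -
  have "isCont (\<lambda>(s, y). Fl s y t) (s, y)" for s y
  proof -
    have "((\<lambda>z. 2 * (\<bar>snd z - y\<bar> + V * \<bar>fst z - s\<bar>) * exp (2 * L * \<bar>t - fst z\<bar>))
        \<longlongrightarrow> 2 * (\<bar>y - y\<bar> + V * \<bar>s - s\<bar>) * exp (2 * L * \<bar>t - s\<bar>)) (at (s, y))"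
      by (intro tendsto_intros tendsto_fst[of "\<lambda>z. z" "(s,y)", simplified] tendsto_snd[of "\<lambda>z. z" "(s,y)", simplified])
    note lim = this
    have le: "\<bar>Fl (fst z) (snd z) t - Fl s y t\<bar> \<le> 2 * (\<bar>snd z - y\<bar> + V * \<bar>fst z - s\<bar>) * exp (2 * L * \<bar>t - fst z\<bar>)" for z
    proof -
      have "\<bar>Fl (fst z) (snd z) t - Fl (fst z) (Fl s y (fst z)) t\<bar>
          \<le> 2 * \<bar>snd z - Fl s y (fst z)\<bar> * exp (2 * L * \<bar>t - fst z\<bar>)" by (rule Fl_compare)
      also have "\<dots> \<le> 2 * (\<bar>snd z - y\<bar> + V * \<bar>fst z - s\<bar>) * exp (2 * L * \<bar>t - fst z\<bar>)"
        using Fl_lip_time[of s y "fst z" s] by (intro mult_right_mono mult_left_mono) auto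
      finally show ?thesis by simp
    qed
    have "((\<lambda>z. Fl (fst z) (snd z) t - Fl s y t) \<longlongrightarrow> 0) (at (s, y))"
    proof (rule Lim_null_comparison)
      show "\<forall>\<^sub>F z in at (s, y). norm (Fl (fst z) (snd z) t - Fl s y t)
          \<le> 2 * (\<bar>snd z - y\<bar> + V * \<bar>fst z - s\<bar>) * exp (2 * L * \<bar>t - fst z\<bar>)"
        using le by (simp add: always_eventually)
      show "((\<lambda>z. 2 * (\<bar>snd z - y\<bar> + V * \<bar>fst z - s\<bar>) * exp (2 * L * \<bar>t - fst z\<bar>)) \<longlongrightarrow> 0) (at (s, y))"
        using lim by simp
    qed
    then show ?thesis by (simp add: isCont_def LIM_zero_iff case_prod_beta')
  qed
  then show ?thesis by (simp add: continuous_on_eq_continuous_at)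
qed

lemma Fl_measurable_start: "(\<lambda>s. Fl s y t) \<in> borel_measurable borel"
  and Fl_measurable_point: "(\<lambda>y. Fl s y t) \<in> borel_measurable borel"
proof -
  show "(\<lambda>y. Fl s y t) \<in> borel_measurable borel"
    by (rule borel_measurable_continuous_onI[OF Fl_cont_start])
  have "continuous_on UNIV (\<lambda>s. Fl s y t)"
    using continuous_on_compose2[OF Fl_pair_continuous[of t], of UNIV "\<lambda>s. (s, y)"]
    by (simp add: continuous_intros)
  then show "(\<lambda>s. Fl s y t) \<in> borel_measurable borel"
    by (rule borel_measurable_continuous_onI)
qed

end

section \<open>Measures\<close>

text \<open>The sum of the images of the measures \<open>M j\<close> under the maps
  \<open>f j\<close>. Measures glued from the arcs and the label measures on one arc are both of
  this kind.\<close>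

definition sum_distr :: "'i set \<Rightarrow> 'b measure \<Rightarrow> ('i \<Rightarrow> 'c measure) \<Rightarrow> ('i \<Rightarrow> 'c \<Rightarrow> 'b) \<Rightarrow> 'b measure" where
  "sum_distr J K M f = measure_of (space K) (sets K) (\<lambda>B. \<Sum>j\<in>J. emeasure (M j) (f j -` B \<inter> space (M j)))"

lemma sets_sum_distr [simp]: "sets (sum_distr J K M f) = sets K"
  unfolding sum_distr_def by (simp add: sets.sets_measure_of_eq)

lemma space_sum_distr [simp]: "space (sum_distr J K M f) = space K"
  unfolding sum_distr_def by simp

lemma borel_measurable_sum_distr [simp]: "borel_measurable (sum_distr J K M f) = borel_measurable K"
  by (rule measurable_cong_sets) simp_all

lemma emeasure_sum_distr:
  assumes f: "\<And>j. j \<in> J \<Longrightarrow> f j \<in> measurable (M j) K" and B: "B \<in> sets K"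
  shows "emeasure (sum_distr J K M f) B = (\<Sum>j\<in>J. emeasure (M j) (f j -` B \<inter> space (M j)))"
proof (rule emeasure_measure_of[OF sum_distr_def])
  show "sets K \<subseteq> Pow (space K)" by (rule sets.space_closed)
  show "B \<in> sets (sum_distr J K M f)" using B by simp
  show "positive (sets (sum_distr J K M f)) (\<lambda>B. \<Sum>j\<in>J. emeasure (M j) (f j -` B \<inter> space (M j)))"
    by (simp add: positive_def)
  show "countably_additive (sets (sum_distr J K M f)) (\<lambda>B. \<Sum>j\<in>J. emeasure (M j) (f j -` B \<inter> space (M j)))"
  proof (rule countably_additiveI)
    fix A :: "nat \<Rightarrow> _"
    assume A: "range A \<subseteq> sets (sum_distr J K M f)" "disjoint_family A"
    have "(\<Sum>i. \<Sum>j\<in>J. emeasure (M j) (f j -` A i \<inter> space (M j)))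
        = (\<Sum>j\<in>J. \<Sum>i. emeasure (M j) (f j -` A i \<inter> space (M j)))"
      by (rule suminf_sum) simp
    also have "\<dots> = (\<Sum>j\<in>J. emeasure (M j) (f j -` (\<Union>i. A i) \<inter> space (M j)))"
    proof (rule sum.cong[OF refl])
      fix j assume j: "j \<in> J"
      have "(\<Sum>i. emeasure (M j) (f j -` A i \<inter> space (M j))) = emeasure (M j) (\<Union>i. f j -` A i \<inter> space (M j))"
      proof (rule suminf_emeasure)
        show "range (\<lambda>i. f j -` A i \<inter> space (M j)) \<subseteq> sets (M j)"
          using A f[OF j] by (auto intro!: measurable_sets)
        show "disjoint_family (\<lambda>i. f j -` A i \<inter> space (M j))"
          using A(2) unfolding disjoint_family_on_def by blast
      qed
      also have "(\<Union>i. f j -` A i \<inter> space (M j)) = f j -` (\<Union>i. A i) \<inter> space (M j)" by blast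
      finally show "(\<Sum>i. emeasure (M j) (f j -` A i \<inter> space (M j))) = emeasure (M j) (f j -` (\<Union>i. A i) \<inter> space (M j))" .
    qed
    finally show "(\<Sum>i. \<Sum>j\<in>J. emeasure (M j) (f j -` A i \<inter> space (M j)))
        = (\<Sum>j\<in>J. emeasure (M j) (f j -` (\<Union>i. A i) \<inter> space (M j)))" .
  qed
qed

lemma sum_ennreal_neq_top:
  fixes h :: "'i \<Rightarrow> ennreal"
  assumes "\<And>j. j \<in> J \<Longrightarrow> h j \<noteq> top"
  shows "sum h J \<noteq> top"
  using assms by (induction J rule: infinite_finite_induct) auto

lemma finite_measure_sum_distr:
  assumes f: "\<And>j. j \<in> J \<Longrightarrow> f j \<in> measurable (M j) K"
    and fin: "\<And>j. j \<in> J \<Longrightarrow> finite_measure (M j)"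
  shows "finite_measure (sum_distr J K M f)"
proof
  have "emeasure (sum_distr J K M f) (space K) \<noteq> \<infinity>"
    using sum_ennreal_neq_top[of J "\<lambda>j. emeasure (M j) (f j -` space K \<inter> space (M j))"]
      finite_measure.emeasure_finite[OF fin] emeasure_sum_distr[of J f M K "space K"] f
    by simp
  then show "emeasure (sum_distr J K M f) (space (sum_distr J K M f)) \<noteq> \<infinity>" by simp
qed

lemma nn_integral_sum_distr:
  assumes f: "\<And>j. j \<in> J \<Longrightarrow> f j \<in> measurable (M j) K" and g: "g \<in> borel_measurable K"
  shows "(\<integral>\<^sup>+x. g x \<partial>sum_distr J K M f) = (\<Sum>j\<in>J. \<integral>\<^sup>+y. g (f j y) \<partial>M j)"
  using g
proof (induction rule: borel_measurable_induct)
  case (cong g h)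
  then have "(\<integral>\<^sup>+x. g x \<partial>sum_distr J K M f) = (\<integral>\<^sup>+x. h x \<partial>sum_distr J K M f)"
    by (intro nn_integral_cong) simp
  moreover have "(\<integral>\<^sup>+y. g (f j y) \<partial>M j) = (\<integral>\<^sup>+y. h (f j y) \<partial>M j)" if "j \<in> J" for j
    using cong(3) measurable_space[OF f[OF that]] by (intro nn_integral_cong) simp
  ultimately show ?case using cong(4) by simp
next
  case (set A)
  have "(\<integral>\<^sup>+y. indicator A (f j y) \<partial>M j) = emeasure (M j) (f j -` A \<inter> space (M j))" if "j \<in> J" for j
  proof -
    have "(\<integral>\<^sup>+y. indicator A (f j y) \<partial>M j) = (\<integral>\<^sup>+y. indicator (f j -` A \<inter> space (M j)) y \<partial>M j)"
      by (intro nn_integral_cong) (auto split: split_indicator)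
    then show ?thesis using measurable_sets[OF f[OF that] set] by simp
  qed
  then show ?case using set emeasure_sum_distr[OF f set] by simp
next
  case (mult h c)
  then show ?case
    using measurable_compose[OF f mult(2)]
    by (simp add: nn_integral_cmult sum_distrib_left)
next
  case (add h g)
  then show ?case
    using measurable_compose[OF f add(1)] measurable_compose[OF f add(3)]
    by (simp add: nn_integral_add sum.distrib)
next
  case (seq U)
  have "(\<integral>\<^sup>+x. (SUP i. U i) x \<partial>sum_distr J K M f) = (SUP i. \<integral>\<^sup>+x. U i x \<partial>sum_distr J K M f)"
    unfolding SUP_apply using seq by (intro nn_integral_monotone_convergence_SUP) auto
  also have "\<dots> = (SUP i. \<Sum>j\<in>J. \<integral>\<^sup>+y. U i (f j y) \<partial>M j)" using seq by simp
  also have "\<dots> = (\<Sum>j\<in>J. SUP i. \<integral>\<^sup>+y. U i (f j y) \<partial>M j)"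
    by (rule ennreal_SUP_sum)
       (use seq(3) in \<open>auto simp: incseq_def le_fun_def intro!: nn_integral_mono\<close>)
  also have "\<dots> = (\<Sum>j\<in>J. \<integral>\<^sup>+y. (SUP i. U i) (f j y) \<partial>M j)"
  proof (intro sum.cong refl)
    fix j assume j: "j \<in> J"
    show "(SUP i. \<integral>\<^sup>+y. U i (f j y) \<partial>M j) = (\<integral>\<^sup>+y. (SUP i. U i) (f j y) \<partial>M j)"
      unfolding SUP_apply using seq f[OF j]
      by (intro nn_integral_monotone_convergence_SUP[symmetric]) (auto simp: incseq_def le_fun_def)
  qed
  finally show ?case .
qed

lemma integrable_bounded_finite:
  fixes g :: "'b \<Rightarrow> real"
  assumes "finite_measure M" "g \<in> borel_measurable M" "\<And>x. x \<in> space M \<Longrightarrow> \<bar>g x\<bar> \<le> B"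
  shows "integrable M g"
  using assms by (intro finite_measure.integrable_const_bound[of M g B]) auto

lemma integral_sum_distr:
  fixes g :: "'b \<Rightarrow> real"
  assumes f: "\<And>j. j \<in> J \<Longrightarrow> f j \<in> measurable (M j) K" and fin: "\<And>j. j \<in> J \<Longrightarrow> finite_measure (M j)"
    and g: "g \<in> borel_measurable K" and B: "\<And>x. x \<in> space K \<Longrightarrow> \<bar>g x\<bar> \<le> B"
  shows "(\<integral>x. g x \<partial>sum_distr J K M f) = (\<Sum>j\<in>J. \<integral>y. g (f j y) \<partial>M j)"
proof -
  have gi: "integrable (sum_distr J K M f) g"
    by (rule integrable_bounded_finite[OF finite_measure_sum_distr[OF f fin]]) (use g B in auto)
  have gj: "integrable (M j) (\<lambda>y. g (f j y))" if "j \<in> J" for j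
    by (rule integrable_bounded_finite[OF fin[OF that]])
       (use measurable_compose[OF f[OF that] g] B measurable_space[OF f[OF that]] in auto)
  \<comment> \<open>Both signs of \<open>g\<close> are treated at once, for the positive and the
    negative part of the integral.\<close>
  have *: "enn2real (\<integral>\<^sup>+x. ennreal (h x) \<partial>sum_distr J K M f) = (\<Sum>j\<in>J. enn2real (\<integral>\<^sup>+y. ennreal (h (f j y)) \<partial>M j))"
    if "h = g \<or> h = (\<lambda>x. - g x)" for h
  proof -
    have hm: "h \<in> borel_measurable K" using that g by auto
    have "enn2real (\<integral>\<^sup>+x. ennreal (h x) \<partial>sum_distr J K M f) = enn2real (\<Sum>j\<in>J. \<integral>\<^sup>+y. ennreal (h (f j y)) \<partial>M j)"
      by (intro arg_cong[where f = enn2real] nn_integral_sum_distr[OF f]) (use hm in simp_all)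
    also have "\<dots> = (\<Sum>j\<in>J. enn2real (\<integral>\<^sup>+y. ennreal (h (f j y)) \<partial>M j))"
    proof (rule enn2real_sum[unfolded o_def])
      fix j assume "j \<in> J"
      then have "integrable (M j) (\<lambda>y. h (f j y))" using gj that by auto
      then show "(\<integral>\<^sup>+y. ennreal (h (f j y)) \<partial>M j) < top"
        by (auto simp: real_integrable_def top.not_eq_extremum)
    qed
    finally show ?thesis .
  qed
  show ?thesis
    using *[of g] *[of "\<lambda>x. - g x"] gj
    by (simp add: real_lebesgue_integral_def[OF gi] real_lebesgue_integral_def sum_subtractf)
qed

text \<open>Right continuity in the endpoint reduces all half-lines to rational ones. Countability
  matters: the balance to the right of a characteristic holds off a null set of times that depends
  on the characteristic.\<close>

lemma measure_eqI_rat_greaterThan: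
  fixes M N :: "real measure"
  assumes sets: "sets M = sets borel" "sets N = sets borel" and fin: "finite_measure M" "finite_measure N"
    and eq: "\<And>x. x \<in> \<rat> \<Longrightarrow> emeasure M {x <..} = emeasure N {x <..}"
  shows "M = N"
proof (rule measure_eqI_lessThan[OF sets])
  show "emeasure M {x<..} < \<infinity>" for x
    using finite_measure.emeasure_finite[OF fin(1)] by (simp add: top.not_eq_extremum)
  fix x :: real
  have "\<exists>r. \<forall>n::nat. r n \<in> \<rat> \<and> x < r n \<and> r n < x + 1 / real (Suc n)"
    using Rats_dense_in_real[of x "x + 1 / real (Suc _)"] by (intro choice) auto
  then obtain r :: "nat \<Rightarrow> real" where r: "\<And>n. r n \<in> \<rat>" "\<And>n. x < r n" "\<And>n. r n < x + 1 / real (Suc n)"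
    by blast
  \<comment> \<open>The running minimum turns the approximating endpoints into a decreasing
    sequence, so that the half-lines increase.\<close>
  define s where "s n = Min (r ` {..n})" for n
  have s: "s n \<in> r ` {..n}" for n unfolding s_def by (rule Min_in) auto
  have dec: "s n \<le> s m" if "m \<le> n" for m n
    unfolding s_def using that by (intro Min_antimono) auto
  have sr: "s n \<le> r n" for n unfolding s_def by (rule Min_le) auto
  have U: "{x<..} = (\<Union>n. {s n<..})"
  proof (intro equalityI subsetI)
    fix y assume "y \<in> {x<..}"
    then obtain n where "1 / real (Suc n) < y - x" using nat_approx_posE[of "y - x"] by auto
    then have "s n < y" using sr[of n] r(3)[of n] by linarith
    then show "y \<in> (\<Union>n. {s n<..})" by auto
  next
    fix y assume "y \<in> (\<Union>n. {s n<..})"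
    then obtain n where n: "s n < y" by auto
    obtain i where "s n = r i" using s[of n] by auto
    then show "y \<in> {x<..}" using n r(2)[of i] by auto
  qed
  have inc: "incseq (\<lambda>n. {s n<..})" using dec by (auto simp: incseq_def intro: order.strict_trans1)
  have eq_s: "emeasure M {s n<..} = emeasure N {s n<..}" for n
  proof (rule eq)
    obtain i where "s n = r i" using s[of n] by auto
    then show "s n \<in> \<rat>" using r(1) by simp
  qed
  have "emeasure K {x<..} = (SUP n. emeasure K {s n<..})" if "sets K = sets borel" for K
  proof -
    have "range (\<lambda>n. {s n<..}) \<subseteq> sets K" by (simp add: that image_subset_iff)
    from SUP_emeasure_incseq[OF this inc] show ?thesis by (simp only: U)
  qed
  from this[OF sets(1)] this[OF sets(2)] show "emeasure M {x<..} = emeasure N {x<..}"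
    by (simp only: eq_s)
qed

text \<open>The sets over which the integral vanishes form a Dynkin system containing the
  half-lines, which are stable under intersection and generate the Borel sets.\<close>

lemma AE_zero_if_integral_atMost_zero:
  fixes q :: "real \<Rightarrow> real"
  assumes q: "integrable lborel q" and U: "(\<integral>t. q t \<partial>lborel) = 0"
    and zero: "\<And>c. (LINT t:{..c}|lborel. q t) = 0"
  shows "AE t in lborel. q t = 0"
proof (rule sigma_finite_measure.density_zero[OF lborel.sigma_finite_measure_axioms q])
  fix A :: "real set" assume "A \<in> sets lborel"
  then have "A \<in> sigma_sets UNIV (range atMost)" by (simp add: borel_eq_atMost)
  moreover have "Int_stable (range (atMost :: real \<Rightarrow> _))" by (auto simp: Int_stable_def)
  moreover have "range (atMost :: real \<Rightarrow> _) \<subseteq> Pow UNIV" by simp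
  ultimately show "(LINT t:A|lborel. q t) = 0"
  proof -
    assume "A \<in> sigma_sets UNIV (range atMost)" "Int_stable (range (atMost :: real \<Rightarrow> _))"
      "range (atMost :: real \<Rightarrow> _) \<subseteq> Pow UNIV"
    from this(2,3,1) show ?thesis
  proof (induction A rule: sigma_sets_induct_disjoint)
    case (basic A)
    then show ?case using zero by auto
  next
    case empty
    then show ?case by (simp add: set_lebesgue_integral_def)
  next
    case (compl A)
    then have A: "A \<in> sets borel" by (simp add: borel_eq_atMost)
    have "(LINT t:UNIV - A|lborel. q t) = (\<integral>t. q t - indicator A t *\<^sub>R q t \<partial>lborel)"
      unfolding set_lebesgue_integral_def
      by (intro Bochner_Integration.integral_cong) (auto split: split_indicator)
    also have "\<dots> = (\<integral>t. q t \<partial>lborel) - (LINT t:A|lborel. q t)"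
      unfolding set_lebesgue_integral_def
      by (rule Bochner_Integration.integral_diff[OF q integrable_mult_indicator]) (use A q in auto)
    finally show ?case using compl U by simp
  next
    case (union A)
    then have A: "\<And>i. A i \<in> sets borel" by (auto simp: borel_eq_atMost)
    have "(LINT t:(\<Union>i. A i)|lborel. q t) = (\<Sum>i. LINT t:A i|lborel. q t)"
    proof (rule lebesgue_integral_countable_add)
      show "set_integrable lborel (\<Union>i. A i) q"
        unfolding set_integrable_def using A q by (intro integrable_mult_indicator) auto
    qed (use A union in \<open>auto simp: disjoint_family_on_def\<close>)
    then show ?case using union by simp
  qed
  qed
qed

section \<open>Integration against a family of measures depending on time\<close>

locale real_kernel =
  fixes N :: "real \<Rightarrow> real measure" and T :: real
  assumes N_sets [simp]: "sets (N t) = sets borel"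
    and N_fin: "finite_measure (N t)"
    and N_kernel: "A \<in> sets borel \<Longrightarrow> (\<lambda>t. emeasure (N t) A) \<in> borel_measurable borel"
    and N_int: "(\<integral>\<^sup>+t\<in>{0..T}. emeasure (N t) UNIV \<partial>lborel) < \<infinity>"
begin

lemma N_space [simp]: "space (N t) = UNIV"
  using sets_eq_imp_space_eq[OF N_sets] by simp

lemma kernel_emeasure:
  assumes "A \<in> sets (borel \<Otimes>\<^sub>M borel)"
  shows "(\<lambda>t. emeasure (N t) (Pair t -` A)) \<in> borel_measurable borel"
proof -
  let ?G = "{a \<times> b | a b. a \<in> sets (borel :: real measure) \<and> b \<in> sets (borel :: real measure)}"
  have "Int_stable ?G" "?G \<subseteq> Pow (UNIV \<times> UNIV)" "A \<in> sigma_sets (UNIV \<times> UNIV) ?G"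
    using assms Int_stable_pair_measure_generator[of borel borel] unfolding sets_pair_measure by auto
  then show ?thesis
  proof (induction A rule: sigma_sets_induct_disjoint)
    case (basic A)
    then obtain a b where A: "A = a \<times> b" "a \<in> sets borel" "b \<in> sets borel" by auto
    have "(\<lambda>t. emeasure (N t) (Pair t -` A)) = (\<lambda>t. emeasure (N t) b * indicator a t)"
      unfolding A by (auto split: split_indicator)
    then show ?case using N_kernel[OF A(3)] A(2) by simp
  next
    case empty
    then show ?case by simp
  next
    case (compl A)
    then have A: "A \<in> sets (borel \<Otimes>\<^sub>M borel)"
      unfolding sets_pair_measure by simp
    have "emeasure (N t) (Pair t -` (UNIV \<times> UNIV - A)) = emeasure (N t) UNIV - emeasure (N t) (Pair t -` A)" for t
    proof -
      have m: "Pair t -` A \<in> sets (N t)"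
        using measurable_sets[OF measurable_Pair1'[of t borel borel] A] by (simp add: space_pair_measure)
      have "Pair t -` (UNIV \<times> UNIV - A) = space (N t) - Pair t -` A" by auto
      then show ?thesis
        using emeasure_compl[OF m] finite_measure.emeasure_finite[OF N_fin] by simp
    qed
    then show ?case using compl N_kernel[of UNIV] by simp
  next
    case (union A)
    then have A: "\<And>i. A i \<in> sets (borel \<Otimes>\<^sub>M borel)"
      unfolding sets_pair_measure by auto
    have "emeasure (N t) (Pair t -` (\<Union>i. A i)) = (\<Sum>i. emeasure (N t) (Pair t -` A i))" for t
    proof -
      have m: "Pair t -` A i \<in> sets (N t)" for i
        using measurable_sets[OF measurable_Pair1'[of t borel borel] A[of i]] by (simp add: space_pair_measure)
      have "disjoint_family (\<lambda>i. Pair t -` A i)"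
        using union unfolding disjoint_family_on_def by blast
      with suminf_emeasure[of "\<lambda>i. Pair t -` A i" "N t"] m show ?thesis
        by (simp add: vimage_UN image_subset_iff)
    qed
    then show ?case using union by simp
  qed
qed

lemma kernel_nn_integral:
  assumes "F \<in> borel_measurable (borel \<Otimes>\<^sub>M borel)"
  shows "(\<lambda>t. \<integral>\<^sup>+y. F (t, y) \<partial>N t) \<in> borel_measurable borel"
  using assms
proof (induction rule: borel_measurable_induct)
  case (cong f g)
  then have "f = g" by (auto simp: space_pair_measure)
  then show ?case using cong by simp
next
  case (set A)
  have "(\<integral>\<^sup>+y. indicator A (t, y) \<partial>N t) = emeasure (N t) (Pair t -` A)" for t
  proof -
    have m: "Pair t -` A \<in> sets (N t)"
      using measurable_sets[OF measurable_Pair1'[of t borel borel] set] by (simp add: space_pair_measure)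
    have "(\<integral>\<^sup>+y. indicator A (t, y) \<partial>N t) = (\<integral>\<^sup>+y. indicator (Pair t -` A) y \<partial>N t)"
      by (intro nn_integral_cong) (auto split: split_indicator)
    then show ?thesis using m by simp
  qed
  then show ?case using kernel_emeasure[OF set] by simp
next
  case (mult f c)
  have "(\<lambda>y. f (t, y)) \<in> borel_measurable (N t)" for t
    using measurable_compose[OF measurable_Pair1'[of t borel borel] mult(2)]
    by (simp cong: measurable_cong_sets)
  then show ?case using mult by (simp add: nn_integral_cmult)
next
  case (add f g)
  have "(\<lambda>y. f (t, y)) \<in> borel_measurable (N t)" "(\<lambda>y. g (t, y)) \<in> borel_measurable (N t)" for t
    using measurable_compose[OF measurable_Pair1'[of t borel borel]] add
    by (simp_all cong: measurable_cong_sets)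
  then show ?case using add by (simp add: nn_integral_add)
next
  case (seq U)
  have m: "(\<lambda>y. U i (t, y)) \<in> borel_measurable (N t)" for t i
    using measurable_compose[OF measurable_Pair1'[of t borel borel]] seq(1)
    by (simp cong: measurable_cong_sets)
  have "(\<integral>\<^sup>+y. (SUP i. U i) (t, y) \<partial>N t) = (SUP i. \<integral>\<^sup>+y. U i (t, y) \<partial>N t)" for t
    unfolding SUP_apply using seq m
    by (intro nn_integral_monotone_convergence_SUP) (auto simp: incseq_def le_fun_def)
  then show ?case using seq by simp
qed

lemma kernel_section_measurable:
  assumes "(\<lambda>(t, y). F t y) \<in> borel_measurable (borel \<Otimes>\<^sub>M borel)"
  shows "F t \<in> borel_measurable (N t)"
  using measurable_compose[OF measurable_Pair1'[of t borel borel] assms]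
  by (simp cong: measurable_cong_sets)

lemma mass_measurable: "(\<lambda>t. measure (N t) UNIV) \<in> borel_measurable borel"
  unfolding measure_def using N_kernel[of UNIV] by auto

lemma kernel_section_integrable:
  fixes F :: "real \<Rightarrow> real \<Rightarrow> real"
  assumes "(\<lambda>(t, y). F t y) \<in> borel_measurable (borel \<Otimes>\<^sub>M borel)" "AE y in N t. \<bar>F t y\<bar> \<le> B"
  shows "integrable (N t) (F t)"
proof -
  interpret finite_measure "N t" by (rule N_fin)
  show ?thesis
    by (rule integrable_const_bound[of _ B])
       (use kernel_section_measurable[OF assms(1)] assms(2) in auto)
qed

lemma kernel_integral_measurable:
  fixes F :: "real \<Rightarrow> real \<Rightarrow> real"
  assumes m: "(\<lambda>(t, y). F t y) \<in> borel_measurable (borel \<Otimes>\<^sub>M borel)" and B: "\<And>t. t \<in> {0..T} \<Longrightarrow> AE y in N t. \<bar>F t y\<bar> \<le> B"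
  shows "(\<lambda>t. indicator {0..T} t * (\<integral>y. F t y \<partial>N t)) \<in> borel_measurable borel"
proof -
  have eq: "indicator {0..T} t * (\<integral>y. F t y \<partial>N t)
     = indicator {0..T} t * (enn2real (\<integral>\<^sup>+y. ennreal (F t y) \<partial>N t) - enn2real (\<integral>\<^sup>+y. ennreal (- F t y) \<partial>N t))" for t
    using real_lebesgue_integral_def[OF kernel_section_integrable[OF m B, of t]]
    by (auto split: split_indicator)
  have "(\<lambda>t. \<integral>\<^sup>+y. ennreal (F t y) \<partial>N t) \<in> borel_measurable borel"
    using kernel_nn_integral[of "\<lambda>(t, y). ennreal (F t y)"] m by (simp add: case_prod_beta)
  moreover have "(\<lambda>t. \<integral>\<^sup>+y. ennreal (- F t y) \<partial>N t) \<in> borel_measurable borel"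
    using kernel_nn_integral[of "\<lambda>(t, y). ennreal (- F t y)"] m by (simp add: case_prod_beta)
  ultimately show ?thesis unfolding eq by measurable
qed

lemma mass_integrable: "integrable lborel (\<lambda>t. indicator {0..T} t * measure (N t) UNIV)"
proof (rule integrableI_bounded)
  show "(\<lambda>t. indicator {0..T} t * measure (N t) UNIV) \<in> borel_measurable lborel"
    using mass_measurable by simp
  have "(\<integral>\<^sup>+t. ennreal (norm (indicator {0..T} t * measure (N t) UNIV)) \<partial>lborel)
      = (\<integral>\<^sup>+t\<in>{0..T}. emeasure (N t) UNIV \<partial>lborel)"
    by (intro nn_integral_cong)
       (auto simp: finite_measure.emeasure_eq_measure[OF N_fin] split: split_indicator)
  then show "(\<integral>\<^sup>+t. ennreal (norm (indicator {0..T} t * measure (N t) UNIV)) \<partial>lborel) < \<infinity>"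
    using N_int by simp
qed

lemma kernel_integral_bound:
  fixes F :: "real \<Rightarrow> real \<Rightarrow> real"
  assumes "(\<lambda>(t, y). F t y) \<in> borel_measurable (borel \<Otimes>\<^sub>M borel)" "AE y in N t. \<bar>F t y\<bar> \<le> B"
  shows "\<bar>\<integral>y. F t y \<partial>N t\<bar> \<le> B * measure (N t) UNIV"
proof -
  have "\<bar>\<integral>y. F t y \<partial>N t\<bar> \<le> (\<integral>y. \<bar>F t y\<bar> \<partial>N t)" by (rule integral_abs_bound)
  also have "\<dots> \<le> (\<integral>y. B \<partial>N t)"
    by (rule integral_mono_AE)
       (use kernel_section_integrable[OF assms] assms(2) finite_measure.integrable_const[OF N_fin] in auto)
  finally show ?thesis by (simp add: mult.commute)
qed

lemma kernel_integral_integrable: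
  fixes F :: "real \<Rightarrow> real \<Rightarrow> real"
  assumes m: "(\<lambda>(t, y). F t y) \<in> borel_measurable (borel \<Otimes>\<^sub>M borel)" and B: "\<And>t. t \<in> {0..T} \<Longrightarrow> AE y in N t. \<bar>F t y\<bar> \<le> B"
  shows "integrable lborel (\<lambda>t. indicator {0..T} t * (\<integral>y. F t y \<partial>N t))"
proof (rule Bochner_Integration.integrable_bound)
  show "integrable lborel (\<lambda>t. B * (indicator {0..T} t * measure (N t) UNIV))"
    using mass_integrable by simp
  show "(\<lambda>t. indicator {0..T} t * (\<integral>y. F t y \<partial>N t)) \<in> borel_measurable lborel"
    using kernel_integral_measurable[OF m B] by simp
  show "AE t in lborel. norm (indicator {0..T} t * (\<integral>y. F t y \<partial>N t)) \<le> norm (B * (indicator {0..T} t * measure (N t) UNIV))"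
    using kernel_integral_bound[OF m B]
    by (intro always_eventually) (auto split: split_indicator intro: order_trans[OF _ abs_ge_self])
qed

text \<open>Two dominated convergences, first in the parameter and then in time. The masses of
  \<open>N t\<close> are integrable in \<open>t\<close> but not assumed bounded, so the majorant in
  time is a multiple of the mass.\<close>

lemma kernel_dominated_convergence:
  fixes F :: "nat \<Rightarrow> real \<Rightarrow> real \<Rightarrow> real"
  assumes m: "\<And>n. (\<lambda>(t, y). F n t y) \<in> borel_measurable (borel \<Otimes>\<^sub>M borel)"
    and B: "\<And>n t. t \<in> {0..T} \<Longrightarrow> AE y in N t. \<bar>F n t y\<bar> \<le> B"
    and m': "(\<lambda>(t, y). f t y) \<in> borel_measurable (borel \<Otimes>\<^sub>M borel)"
    and lim: "\<And>t. t \<in> {0..T} \<Longrightarrow> AE y in N t. (\<lambda>n. F n t y) \<longlonglongrightarrow> f t y"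
  shows "(\<lambda>n. LINT t:{0..T}|lborel. (\<integral>y. F n t y \<partial>N t)) \<longlonglongrightarrow> (LINT t:{0..T}|lborel. (\<integral>y. f t y \<partial>N t))"
proof -
  have B': "AE y in N t. \<bar>f t y\<bar> \<le> B" if "t \<in> {0..T}" for t
  proof -
    have "AE y in N t. \<forall>n. \<bar>F n t y\<bar> \<le> B" using B[OF that] by (simp add: AE_all_countable)
    with lim[OF that] show ?thesis
    proof eventually_elim
      case (elim y)
      then have "(\<lambda>n. \<bar>F n t y\<bar>) \<longlonglongrightarrow> \<bar>f t y\<bar>" by (intro tendsto_intros)
      then show ?case using elim by (intro LIMSEQ_le_const2) auto
    qed
  qed
  have inner: "(\<lambda>n. \<integral>y. F n t y \<partial>N t) \<longlonglongrightarrow> (\<integral>y. f t y \<partial>N t)" if "t \<in> {0..T}" for t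
    by (rule integral_dominated_convergence[where w = "\<lambda>_. B"])
       (use kernel_section_measurable[OF m] kernel_section_measurable[OF m'] B[OF that] lim[OF that]
          finite_measure.integrable_const[OF N_fin] in auto)
  show ?thesis
    unfolding set_lebesgue_integral_def real_scaleR_def
  proof (rule integral_dominated_convergence[where w = "\<lambda>t. B * (indicator {0..T} t * measure (N t) UNIV)"])
    show "(\<lambda>t. indicator {0..T} t * (\<integral>y. f t y \<partial>N t)) \<in> borel_measurable lborel"
      using kernel_integral_measurable[OF m' B'] by simp
    show "(\<lambda>t. indicator {0..T} t * (\<integral>y. F n t y \<partial>N t)) \<in> borel_measurable lborel" for n
      using kernel_integral_measurable[OF m B] by simp
    show "integrable lborel (\<lambda>t. B * (indicator {0..T} t * measure (N t) UNIV))"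
      using mass_integrable by simp
    show "AE t in lborel. (\<lambda>n. indicator {0..T} t * (\<integral>y. F n t y \<partial>N t)) \<longlonglongrightarrow> indicator {0..T} t * (\<integral>y. f t y \<partial>N t)"
      using inner by (intro always_eventually) (auto split: split_indicator)
    show "AE t in lborel. norm (indicator {0..T} t * (\<integral>y. F n t y \<partial>N t)) \<le> B * (indicator {0..T} t * measure (N t) UNIV)" for n
      using kernel_integral_bound[OF m B] by (intro always_eventually) (auto split: split_indicator)
  qed
qed

end

text \<open>The squared positive part is the C^1 building block of all the cutoffs below, both on
  the line and near the vertices.\<close>

lemma has_derivative_pos_part_square:
  "((\<lambda>x::real. (max 0 x)\<^sup>2) has_real_derivative 2 * max 0 x) (at x)"
proof -
  consider "x > 0" | "x < 0" | "x = 0" by linarith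
  then show ?thesis
  proof cases
    case 1
    have "((\<lambda>x::real. x\<^sup>2) has_real_derivative 2 * max 0 x) (at x)"
      using 1 by (auto intro!: derivative_eq_intros)
    then show ?thesis
      by (rule has_field_derivative_transform_within_open[of _ _ _ "{0<..}"]) (use 1 in auto)
  next
    case 2
    have "((\<lambda>x::real. 0) has_real_derivative 2 * max 0 x) (at x)" using 2 by simp
    then show ?thesis
      by (rule has_field_derivative_transform_within_open[of _ _ _ "{..<0}"]) (use 2 in auto)
  next
    case 3
    have "((\<lambda>h::real. (max 0 h)\<^sup>2 / h) \<longlongrightarrow> 0) (at 0)"
    proof (rule tendsto_null_abs_le)
      show "((\<lambda>h::real. \<bar>h\<bar>) \<longlongrightarrow> 0) (at 0)" by (rule tendsto_eq_intros) auto
      show "\<bar>(max 0 h)\<^sup>2 / h\<bar> \<le> \<bar>h\<bar>" for h :: real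
        by (cases "h > 0") (auto simp: power2_eq_square max_def)
    qed
    then show ?thesis using 3 by (simp add: DERIV_def)
  qed
qed

section \<open>Transport along one arc\<close>

text \<open>A C^1 profile that vanishes on the negative half-line and tends to 1 at infinity, so
  that its dilations tend to the indicator of the open half-line. Its derivative decays fast enough
  for \<open>cutoff_deriv x * x\<close> to tend to 0 under dilation.\<close>

definition cutoff :: "real \<Rightarrow> real" where
  "cutoff x = (max 0 x)\<^sup>2 / (1 + (max 0 x)\<^sup>2)"

definition cutoff_deriv :: "real \<Rightarrow> real" where
  "cutoff_deriv x = 2 * max 0 x / (1 + (max 0 x)\<^sup>2)\<^sup>2"

lemma one_plus_square_pos: "0 < 1 + (x::real)\<^sup>2"
  by (simp add: add_pos_nonneg)

lemma one_plus_square_neq_0: "1 + (x::real)\<^sup>2 \<noteq> 0"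
  using one_plus_square_pos[of x] by linarith

lemma cutoff_has_derivative: "(cutoff has_real_derivative cutoff_deriv x) (at x)"
proof -
  have "((\<lambda>x. (max 0 x)\<^sup>2 / (1 + (max 0 x)\<^sup>2)) has_real_derivative
      ((2 * max 0 x) * (1 + (max 0 x)\<^sup>2) - (max 0 x)\<^sup>2 * (0 + 2 * max 0 x)) / ((1 + (max 0 x)\<^sup>2) * (1 + (max 0 x)\<^sup>2))) (at x)"
    by (intro DERIV_divide DERIV_add DERIV_const has_derivative_pos_part_square one_plus_square_neq_0)
  moreover have "((2 * max 0 x) * (1 + (max 0 x)\<^sup>2) - (max 0 x)\<^sup>2 * (0 + 2 * max 0 x)) / ((1 + (max 0 x)\<^sup>2) * (1 + (max 0 x)\<^sup>2))
      = cutoff_deriv x"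
    unfolding cutoff_deriv_def by (simp add: algebra_simps power2_eq_square)
  ultimately show ?thesis unfolding cutoff_def by simp
qed

lemma cutoff_deriv_continuous: "continuous_on UNIV cutoff_deriv"
  unfolding cutoff_deriv_def by (intro continuous_intros) (use one_plus_square_neq_0 in auto)

lemma cutoff_bounds: "0 \<le> cutoff x" "cutoff x \<le> 1"
  unfolding cutoff_def by (auto simp: divide_simps one_plus_square_pos)

lemma two_mult_le_one_plus_square: "2 * \<bar>x\<bar> \<le> 1 + (x::real)\<^sup>2"
proof -
  have "0 \<le> (\<bar>x\<bar> - 1)\<^sup>2" by simp
  then show ?thesis by (simp add: power2_diff)
qed

text \<open>This product governs the singular term of the approximation: the derivative of the
  dilated profile is multiplied by a difference of velocities, which is Lipschitz in the distance to
  the characteristic.\<close>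

lemma cutoff_deriv_mult_le: "\<bar>cutoff_deriv x * x\<bar> \<le> 1"
proof (cases "x \<le> 0")
  case False
  have "2 * x\<^sup>2 \<le> (1 + x\<^sup>2)\<^sup>2" by (simp add: power2_sum)
  moreover have "cutoff_deriv x * x = 2 * x\<^sup>2 / (1 + x\<^sup>2)\<^sup>2"
    using False by (simp add: cutoff_deriv_def power2_eq_square)
  ultimately show ?thesis by (simp add: divide_le_eq one_plus_square_pos)
qed (simp add: cutoff_deriv_def)

lemma cutoff_deriv_le: "\<bar>cutoff_deriv x\<bar> \<le> 1"
proof (cases "x \<le> 0")
  case False
  have "2 * x \<le> 1 + x\<^sup>2" using two_mult_le_one_plus_square[of x] by linarith
  also have "\<dots> \<le> (1 + x\<^sup>2)\<^sup>2" by (simp add: power2_sum)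
  finally show ?thesis using False by (simp add: cutoff_deriv_def divide_le_eq one_plus_square_pos)
qed (simp add: cutoff_deriv_def)

lemma scaled_to_infinity: "0 < (x::real) \<Longrightarrow> filterlim (\<lambda>n. real (Suc n) * x) at_top sequentially"
  by (intro filterlim_at_top_mult_tendsto_pos[OF tendsto_const]
      filterlim_compose[OF filterlim_real_sequentially filterlim_Suc])

lemma cutoff_scaled_tendsto: "(\<lambda>n. cutoff (real (Suc n) * x)) \<longlonglongrightarrow> indicator {0<..} x"
proof (cases "0 < x")
  case True
  have eq: "cutoff y = 1 - inverse (1 + (max 0 y)\<^sup>2)" for y
    unfolding cutoff_def by (simp add: field_simps one_plus_square_neq_0)
  have "filterlim (\<lambda>n. 1 + (real (Suc n) * x) ^ 2) at_top sequentially"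
    by (intro filterlim_tendsto_add_at_top[OF tendsto_const] filterlim_pow_at_top scaled_to_infinity True) auto
  then have "(\<lambda>n. 1 - inverse (1 + (real (Suc n) * x)\<^sup>2)) \<longlonglongrightarrow> 1 - 0"
    by (intro tendsto_diff tendsto_const tendsto_inverse_0_at_top)
  then show ?thesis using True by (simp add: eq max_def)
next
  case False
  then have "max 0 (real (Suc n) * x) = 0" for n by (intro max_absorb1 mult_nonneg_nonpos) auto
  then show ?thesis using False by (simp add: cutoff_def del: of_nat_Suc)
qed

lemma cutoff_deriv_scaled_tendsto: "(\<lambda>n. cutoff_deriv (real (Suc n) * x) * (real (Suc n) * x)) \<longlonglongrightarrow> 0"
proof (cases "0 < x")
  case True
  have "filterlim (\<lambda>n. (real (Suc n) * x) ^ 2) at_top sequentially"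
    by (intro filterlim_pow_at_top scaled_to_infinity True) auto
  then have lim: "(\<lambda>n. 2 * inverse ((real (Suc n) * x)\<^sup>2)) \<longlonglongrightarrow> 2 * 0"
    by (intro tendsto_mult tendsto_const tendsto_inverse_0_at_top)
  have b: "\<bar>cutoff_deriv y * y\<bar> \<le> 2 * inverse (y\<^sup>2)" if "0 < y" for y
  proof -
    have "y\<^sup>2 * y\<^sup>2 \<le> (1 + y\<^sup>2)\<^sup>2" by (simp add: power2_eq_square algebra_simps)
    then have "2 * y\<^sup>2 / (1 + y\<^sup>2)\<^sup>2 \<le> 2 * y\<^sup>2 / (y\<^sup>2 * y\<^sup>2)"
      using that by (intro divide_left_mono mult_pos_pos) (auto simp: one_plus_square_pos)
    also have "\<dots> = 2 * inverse (y\<^sup>2)" using that by (simp add: field_simps)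
    finally show ?thesis using that by (simp add: cutoff_deriv_def power2_eq_square)
  qed
  show ?thesis
    by (rule tendsto_null_abs_le[where g = "\<lambda>n. 2 * inverse ((real (Suc n) * x)\<^sup>2)"])
       (use lim in simp, rule b, use True in simp)
next
  case False
  then have "max 0 (real (Suc n) * x) = 0" for n by (intro max_absorb1 mult_nonneg_nonpos) auto
  then show ?thesis by (simp add: cutoff_deriv_def del: of_nat_Suc)
qed

text \<open>Cutoffs at infinity for unbounded arcs: they tend to 1, and their derivatives are at
  most \<open>1 / (n + 1)\<close>, so they leave no trace in the limit of the weak equation.\<close>

definition bump :: "nat \<Rightarrow> real \<Rightarrow> real" where
  "bump n y = 1 / (1 + (y / real (Suc n))\<^sup>2)"

definition bump_deriv :: "nat \<Rightarrow> real \<Rightarrow> real" where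
  "bump_deriv n y = - (2 * (y / real (Suc n)) / real (Suc n)) / (1 + (y / real (Suc n))\<^sup>2)\<^sup>2"

lemma bump_has_derivative: "(bump n has_real_derivative bump_deriv n y) (at y)"
proof -
  have "((\<lambda>y. 1 + (y / real (Suc n))\<^sup>2) has_real_derivative 2 * (y / real (Suc n)) / real (Suc n)) (at y)"
    by (auto intro!: derivative_eq_intros simp del: of_nat_Suc)
  from DERIV_divide[OF DERIV_const[of 1] this one_plus_square_neq_0] show ?thesis
    unfolding bump_def bump_deriv_def by (simp add: power2_eq_square)
qed

lemma bump_deriv_continuous: "continuous_on UNIV (bump_deriv n)"
  unfolding bump_deriv_def by (intro continuous_intros) (use one_plus_square_neq_0 in auto)

lemma bump_bounds: "\<bar>bump n y\<bar> \<le> 1"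
  unfolding bump_def by (simp add: divide_le_eq one_plus_square_pos)

lemma bump_deriv_bound: "\<bar>bump_deriv n y\<bar> \<le> 1 / real (Suc n)"
proof -
  let ?x = "y / real (Suc n)"
  have "2 * \<bar>?x\<bar> \<le> 1 + ?x\<^sup>2" by (rule two_mult_le_one_plus_square)
  also have "\<dots> \<le> (1 + ?x\<^sup>2)\<^sup>2" by (simp add: power2_sum)
  finally have "2 * \<bar>?x\<bar> / (1 + ?x\<^sup>2)\<^sup>2 \<le> 1" by (simp only: divide_le_eq_1) (simp add: one_plus_square_pos)
  then have "2 * \<bar>?x\<bar> / (1 + ?x\<^sup>2)\<^sup>2 / real (Suc n) \<le> 1 / real (Suc n)" by (rule divide_right_mono) simp
  moreover have "\<bar>bump_deriv n y\<bar> = 2 * \<bar>?x\<bar> / (1 + ?x\<^sup>2)\<^sup>2 / real (Suc n)"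
    unfolding bump_deriv_def by (simp add: abs_mult abs_divide ac_simps)
  ultimately show ?thesis by simp
qed

lemma bump_tendsto: "(\<lambda>n. bump n y) \<longlonglongrightarrow> 1"
proof -
  have "(\<lambda>n. y / real (Suc n)) \<longlonglongrightarrow> 0"
    using tendsto_mult[OF tendsto_const[of y] LIMSEQ_inverse_real_of_nat] by (simp add: divide_inverse)
  then have "(\<lambda>n. 1 / (1 + (y / real (Suc n))\<^sup>2)) \<longlonglongrightarrow> 1 / (1 + 0\<^sup>2)"
    by (intro tendsto_intros) auto
  then show ?thesis by (simp add: bump_def)
qed

lemma bump_deriv_tendsto: "(\<lambda>n. bump_deriv n y) \<longlonglongrightarrow> 0"
  by (rule tendsto_null_abs_le[OF _ bump_deriv_bound])
     (use LIMSEQ_inverse_real_of_nat in \<open>simp add: inverse_eq_divide\<close>)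

lemma bump_vanishes: "\<epsilon> > 0 \<Longrightarrow> \<exists>R. \<forall>y. R < \<bar>y\<bar> \<longrightarrow> \<bar>bump n y\<bar> < \<epsilon>"
proof -
  assume e: "\<epsilon> > 0"
  have inv: "\<bar>1 / D\<bar> < \<epsilon>" if "1 / \<epsilon> < D" "0 < D" for D using that e by (simp add: field_simps)
  have "\<bar>bump n y\<bar> < \<epsilon>" if y: "real (Suc n) * (1 + 1 / \<epsilon>) < \<bar>y\<bar>" for y
  proof -
    have q: "1 + 1 / \<epsilon> < \<bar>y / real (Suc n)\<bar>"
      using y by (simp add: abs_divide pos_less_divide_eq mult.commute del: of_nat_Suc)
    have "1 / \<epsilon> < 1 + 1 / \<epsilon>" by simp
    also have "\<dots> \<le> (1 + 1 / \<epsilon>)\<^sup>2" using e by (simp add: power2_eq_square field_simps)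
    also have "\<dots> \<le> \<bar>y / real (Suc n)\<bar>\<^sup>2" using q e by (intro power_mono) (auto simp: add_nonneg_nonneg)
    finally have "1 / \<epsilon> < 1 + (y / real (Suc n))\<^sup>2" by (simp add: power_divide)
    then show ?thesis
      unfolding bump_def using inv[OF _ one_plus_square_pos] by simp
  qed
  then show ?thesis by blast
qed

lemma continuous_antiderivative:
  fixes f :: "real \<Rightarrow> real"
  assumes "continuous_on UNIV f"
  shows "\<exists>F. \<forall>x. (F has_real_derivative f x) (at x)"
proof (intro exI allI)
  fix x
  have "((\<lambda>u. LBINT y=ereal 0..ereal u. f y) has_vector_derivative f x) (at x within {- \<bar>x\<bar> - 1..\<bar>x\<bar> + 1})"
    by (rule interval_integral_FTC2) (use assms in \<open>auto intro: continuous_on_subset\<close>)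
  moreover have "at x within {- \<bar>x\<bar> - 1..\<bar>x\<bar> + 1} = at x" by (rule at_within_Icc_at) auto
  ultimately show "((\<lambda>u. LBINT y=ereal 0..ereal u. f y) has_real_derivative f x) (at x)"
    by (simp add: has_real_derivative_iff_has_vector_derivative)
qed

text \<open>The function comes with its two partial derivatives on the whole plane, so that
  endpoints of an arc need no one-sided derivatives; bounds and decay are asked for on
  \<open>I\<close> and \<open>{0..T}\<close> alone. Bounded derivatives ensure that the transport
  term converges absolutely.\<close>

definition test_fun ::
  "real set \<Rightarrow> real \<Rightarrow> (real \<Rightarrow> real \<Rightarrow> real) \<Rightarrow> (real \<Rightarrow> real \<Rightarrow> real) \<Rightarrow> (real \<Rightarrow> real \<Rightarrow> real) \<Rightarrow> bool" where
  "test_fun I T f fy ft \<longleftrightarrow>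
     continuous_on UNIV (\<lambda>(y, t). f y t) \<and> continuous_on UNIV (\<lambda>(y, t). fy y t) \<and>
     continuous_on UNIV (\<lambda>(y, t). ft y t) \<and>
     (\<forall>y t. ((\<lambda>z. f z t) has_real_derivative fy y t) (at y)) \<and>
     (\<forall>y t. ((\<lambda>r. f y r) has_real_derivative ft y t) (at t)) \<and>
     (\<exists>B. \<forall>y\<in>I. \<forall>t\<in>{0..T}. \<bar>fy y t\<bar> \<le> B \<and> \<bar>ft y t\<bar> \<le> B) \<and>
     (\<forall>\<epsilon>>0. \<exists>R. \<forall>y\<in>I. \<forall>t\<in>{0..T}. R < \<bar>y\<bar> \<longrightarrow> \<bar>f y t\<bar> < \<epsilon>)"

text \<open>Averages over intervals starting at \<open>t\<close> see just the values of
  \<open>g\<close> at and after \<open>t\<close>. The primitive appears only through its increments,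
  which lets the lemma apply to an antiderivative of a trajectory and to the trajectory
  itself.\<close>

lemma has_integral_average_right_continuous:
  fixes g :: "real \<Rightarrow> real"
  assumes g: "\<And>a b. a \<le> b \<Longrightarrow> (g has_integral (G b - G a)) {a..b}" and rc: "(g \<longlongrightarrow> g t) (at_right t)"
  shows "(\<lambda>n. real (Suc n) * (G (t + 1 / real (Suc n)) - G t)) \<longlonglongrightarrow> g t"
proof (rule LIMSEQ_I)
  fix e :: real assume e: "0 < e"
  have "\<forall>\<^sub>F r in at_right t. dist (g r) (g t) < e / 2" using tendstoD[OF rc, of "e/2"] e by simp
  then obtain b where b: "b > t" "\<And>r. t < r \<Longrightarrow> r < b \<Longrightarrow> \<bar>g r - g t\<bar> < e / 2"
    by (auto simp: eventually_at_right_field dist_real_def)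
  obtain n0 where n0: "1 / real (Suc n0) < b - t" using nat_approx_posE[of "b - t"] b(1) by auto
  show "\<exists>no. \<forall>n\<ge>no. norm (real (Suc n) * (G (t + 1 / real (Suc n)) - G t) - g t) < e"
  proof (intro exI allI impI)
    fix n assume n: "n0 \<le> n"
    let ?h = "1 / real (Suc n)"
    have h: "0 < ?h" "?h \<le> 1 / real (Suc n0)" using n by (auto simp: frac_le)
    have i1: "(g has_integral (G (t + ?h) - G t)) {t..t + ?h}" by (rule g) (use h in auto)
    have i2: "((\<lambda>_. g t) has_integral ?h * g t) {t..t + ?h}"
      using has_integral_const_real[of "g t" t "t + ?h"] h by simp
    have i3: "((\<lambda>r. g r - g t) has_integral (G (t + ?h) - G t - ?h * g t)) {t..t + ?h}"
      by (rule has_integral_diff[OF i1 i2])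
    have "norm (G (t + ?h) - G t - ?h * g t) \<le> e / 2 * measure lborel {t..t + ?h}"
    proof (rule has_integral_bound_real)
      show "((\<lambda>r. g r - g t) has_integral (G (t + ?h) - G t - ?h * g t)) {t..t + ?h}" by (rule i3)
      show "norm (g r - g t) \<le> e / 2" if "r \<in> {t..t + ?h} - {}" for r
        using b(2)[of r] that h n0 e by (cases "r = t") auto
    qed (use e in auto)
    then have "\<bar>G (t + ?h) - G t - ?h * g t\<bar> \<le> e / 2 * ?h" using h by simp
    then have "real (Suc n) * \<bar>G (t + ?h) - G t - ?h * g t\<bar> \<le> real (Suc n) * (e / 2 * ?h)"
      by (rule mult_left_mono) simp
    moreover have "real (Suc n) * (G (t + ?h) - G t) - g t = real (Suc n) * (G (t + ?h) - G t - ?h * g t)"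
      by (simp add: right_diff_distrib del: of_nat_Suc)
    ultimately have "\<bar>real (Suc n) * (G (t + ?h) - G t) - g t\<bar> \<le> e / 2"
      by (simp add: abs_mult del: of_nat_Suc)
    then show "norm (real (Suc n) * (G (t + ?h) - G t) - g t) < e" using e by simp
  qed
qed

text \<open>\<open>lam\<close> is the inflow and \<open>tau\<close> the outflow, as measures in
  time. On an unbounded side \<open>Inf I\<close> or \<open>Sup I\<close> is a default value, kept
  from contributing by \<open>lam_null\<close> and \<open>tau_null\<close>. \<open>N_end\<close>
  expresses that mass at a terminal vertex belongs to the outgoing arcs.\<close>

locale arc_problem = transport_field u V L + real_kernel N T
  for u :: "real \<Rightarrow> real \<Rightarrow> real" and V L :: real and N :: "real \<Rightarrow> real measure" and T :: real +
  fixes I :: "real set" and m0 lam tau :: "real measure"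
  assumes T_pos: "0 < T"
    and N_I: "AE y in N t. y \<in> I"
    and N_end: "bdd_above I \<Longrightarrow> AE y in N t. y \<noteq> Sup I"
    and Sup_in: "bdd_above I \<Longrightarrow> y \<in> I \<Longrightarrow> y \<le> Sup I"
    and Inf_less: "bdd_below I \<Longrightarrow> bdd_above I \<Longrightarrow> Inf I < Sup I"
    and m0_sets [simp]: "sets m0 = sets borel" and m0_fin: "finite_measure m0" and m0_I: "AE y in m0. y \<in> I"
    and lam_sets [simp]: "sets lam = sets borel" and lam_fin: "finite_measure lam" and lam_T: "AE s in lam. s \<in> {0..T}"
    and lam_null: "\<not> bdd_below I \<Longrightarrow> AE s in lam. False"
    and tau_sets [simp]: "sets tau = sets borel" and tau_fin: "finite_measure tau" and tau_T: "AE s in tau. s \<in> {0..T}"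
    and tau_null: "\<not> bdd_above I \<Longrightarrow> AE s in tau. False"
    and weak: "test_fun I T f fy ft \<Longrightarrow>
      (LINT t:{0..T}|lborel. (\<integral>y. ft y t + u t y * fy y t \<partial>N t))
      = (\<integral>y. f y T \<partial>N T) - (\<integral>y. f y 0 \<partial>m0) + (\<integral>t. f (Sup I) t \<partial>tau) - (\<integral>t. f (Inf I) t \<partial>lam)"
begin

definition rhs :: "(real \<Rightarrow> real \<Rightarrow> real) \<Rightarrow> real" where
  "rhs f = (\<integral>y. f y T \<partial>N T) - (\<integral>y. f y 0 \<partial>m0) + (\<integral>t. f (Sup I) t \<partial>tau) - (\<integral>t. f (Inf I) t \<partial>lam)"

lemma sets_eq_borel_measurable:
  "sets M = sets borel \<Longrightarrow> f \<in> borel_measurable borel \<Longrightarrow> f \<in> borel_measurable M"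
  by (simp cong: measurable_cong_sets)

lemma finite_measure_dct:
  fixes f :: "nat \<Rightarrow> real \<Rightarrow> real"
  assumes M: "sets M = sets borel" "finite_measure M" and m: "\<And>n. f n \<in> borel_measurable borel"
    and m': "g \<in> borel_measurable borel" and B: "\<And>n. AE y in M. \<bar>f n y\<bar> \<le> B"
    and lim: "\<And>y. (\<lambda>n. f n y) \<longlonglongrightarrow> g y"
  shows "(\<lambda>n. \<integral>y. f n y \<partial>M) \<longlonglongrightarrow> (\<integral>y. g y \<partial>M)"
proof (rule integral_dominated_convergence[where w = "\<lambda>_. B"])
  show "integrable M (\<lambda>_. B)" by (rule finite_measure.integrable_const[OF M(2)])
qed (use m m' B lim sets_eq_borel_measurable[OF M(1)] in auto)

lemma pair_sections:
  assumes "(\<lambda>(t, y). F t y) \<in> borel_measurable (borel \<Otimes>\<^sub>M borel)"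
  shows "F t \<in> borel_measurable borel" "(\<lambda>t. F t y) \<in> borel_measurable borel"
  using measurable_compose[OF measurable_Pair1'[of t borel borel] assms]
    measurable_compose[OF measurable_Pair2'[of y borel borel] assms] by simp_all

lemma weak_limit:
  fixes F f :: "nat \<Rightarrow> real \<Rightarrow> real \<Rightarrow> real"
  assumes eq: "\<And>n. (LINT t:{0..T}|lborel. (\<integral>y. F n t y \<partial>N t)) = rhs (f n)"
    and m: "\<And>n. (\<lambda>(t, y). F n t y) \<in> borel_measurable (borel \<Otimes>\<^sub>M borel)"
      "\<And>n. (\<lambda>(y, t). f n y t) \<in> borel_measurable (borel \<Otimes>\<^sub>M borel)"
    and B: "\<And>n t y. t \<in> {0..T} \<Longrightarrow> \<bar>F n t y\<bar> \<le> B" "\<And>n t y. t \<in> {0..T} \<Longrightarrow> \<bar>f n y t\<bar> \<le> C"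
    and lim: "\<And>t y. (\<lambda>n. F n t y) \<longlonglongrightarrow> F' t y" "\<And>t y. (\<lambda>n. f n y t) \<longlonglongrightarrow> f' y t"
  shows "(LINT t:{0..T}|lborel. (\<integral>y. F' t y \<partial>N t)) = rhs f'"
proof -
  have m': "(\<lambda>(t, y). F' t y) \<in> borel_measurable (borel \<Otimes>\<^sub>M borel)"
    by (rule borel_measurable_LIMSEQ_real[where u = "\<lambda>n (t, y). F n t y"]) (use lim(1) m(1) in auto)
  have n': "(\<lambda>(y, t). f' y t) \<in> borel_measurable (borel \<Otimes>\<^sub>M borel)"
    by (rule borel_measurable_LIMSEQ_real[where u = "\<lambda>n (y, t). f n y t"]) (use lim(2) m(2) in auto)
  have l: "(\<lambda>n. LINT t:{0..T}|lborel. (\<integral>y. F n t y \<partial>N t)) \<longlonglongrightarrow> (LINT t:{0..T}|lborel. (\<integral>y. F' t y \<partial>N t))"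
    by (rule kernel_dominated_convergence[of _ B]) (use m(1) m' B(1) lim(1) in auto)
  have T: "T \<in> {0..T}" "0 \<in> {0..T}" using T_pos by auto
  have r: "(\<lambda>n. rhs (f n)) \<longlonglongrightarrow> rhs f'"
    unfolding rhs_def
  proof (intro tendsto_intros)
    show "(\<lambda>n. \<integral>y. f n y T \<partial>N T) \<longlonglongrightarrow> (\<integral>y. f' y T \<partial>N T)"
      by (rule finite_measure_dct[OF N_sets N_fin, of _ _ C])
         (use pair_sections(2)[OF m(2)] pair_sections(2)[OF n'] B(2)[OF T(1)] lim(2) in auto)
    show "(\<lambda>n. \<integral>y. f n y 0 \<partial>m0) \<longlonglongrightarrow> (\<integral>y. f' y 0 \<partial>m0)"
      by (rule finite_measure_dct[OF m0_sets m0_fin, of _ _ C])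
         (use pair_sections(2)[OF m(2)] pair_sections(2)[OF n'] B(2)[OF T(2)] lim(2) in auto)
    show "(\<lambda>n. \<integral>t. f n (Sup I) t \<partial>tau) \<longlonglongrightarrow> (\<integral>t. f' (Sup I) t \<partial>tau)"
    proof (rule finite_measure_dct[OF tau_sets tau_fin, of _ _ C])
      show "AE t in tau. \<bar>f n (Sup I) t\<bar> \<le> C" for n
        using tau_T by eventually_elim (rule B(2))
    qed (use pair_sections(1)[OF m(2)] pair_sections(1)[OF n'] lim(2) in auto)
    show "(\<lambda>n. \<integral>t. f n (Inf I) t \<partial>lam) \<longlonglongrightarrow> (\<integral>t. f' (Inf I) t \<partial>lam)"
    proof (rule finite_measure_dct[OF lam_sets lam_fin, of _ _ C])
      show "AE t in lam. \<bar>f n (Inf I) t\<bar> \<le> C" for n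
        using lam_T by eventually_elim (rule B(2))
    qed (use pair_sections(1)[OF m(2)] pair_sections(1)[OF n'] lim(2) in auto)
  qed
  show ?thesis using LIMSEQ_unique[OF l] r eq by simp
qed

lemma continuous_bounded_Icc:
  fixes c :: "real \<Rightarrow> real"
  assumes "continuous_on UNIV c" obtains B where "0 \<le> B" "\<And>t. t \<in> {0..T} \<Longrightarrow> \<bar>c t\<bar> \<le> B"
proof -
  have "bounded (c ` {0..T})"
    by (intro compact_imp_bounded compact_continuous_image continuous_on_subset[OF assms]) auto
  then obtain B where "\<forall>t\<in>{0..T}. \<bar>c t\<bar> \<le> B" by (auto simp: bounded_iff)
  then show thesis by (intro that[of "\<bar>B\<bar>"]) (auto intro: order_trans[OF _ abs_ge_self])
qed

text \<open>A profile moving with the characteristic has time derivative \<open>- \<rho>'\<close>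
  times the velocity of the characteristic; together with the transport term this leaves
  \<open>\<rho>'\<close> times the difference of two velocities, the combination that survives
  sharpening the profile.\<close>

lemma weak_along_characteristic:
  assumes chi: "\<And>t. (\<kappa> has_real_derivative \<kappa>' t) (at t)" and chi': "continuous_on UNIV \<kappa>'"
    and rho: "\<And>x. (\<rho> has_real_derivative \<rho>' x) (at x)" and rho': "continuous_on UNIV \<rho>'"
    and psi: "\<And>x. (\<psi> has_real_derivative \<psi>' x) (at x)" and psi': "continuous_on UNIV \<psi>'"
    and rho_le: "\<And>x. \<bar>\<rho> x\<bar> \<le> 1" "\<And>x. \<bar>\<rho>' x\<bar> \<le> R" and psi_le: "\<And>x. \<bar>\<psi> x\<bar> \<le> 1" "\<And>x. \<bar>\<psi>' x\<bar> \<le> 1"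
    and van: "\<And>\<epsilon>. \<epsilon> > 0 \<Longrightarrow> \<exists>R. \<forall>y. R < \<bar>y\<bar> \<longrightarrow> \<bar>\<psi> y\<bar> < \<epsilon>"
  shows "(LINT t:{0..T}|lborel. (\<integral>y. \<kappa>' t * \<rho> (y - Fl 0 w t) * \<psi> y
      + \<kappa> t * \<rho>' (y - Fl 0 w t) * (u t y - u t (Fl 0 w t)) * \<psi> y
      + \<kappa> t * \<rho> (y - Fl 0 w t) * u t y * \<psi>' y \<partial>N t)) = rhs (\<lambda>y t. \<kappa> t * \<rho> (y - Fl 0 w t) * \<psi> y)"
proof -
  define X where "X = Fl 0 w"
  obtain Y where Y: "\<And>x. (Y has_real_derivative X x) (at x)"
    using continuous_antiderivative[of X] Fl_continuous unfolding X_def by blast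
  \<comment> \<open>The mean of \<open>X\<close> over the interval from \<open>t\<close> to
    \<open>t + 1 / (n + 1)\<close>, which is C^1 whereas \<open>X\<close> is merely Lipschitz. It
    looks forward because \<open>u\<close> is right-continuous: \<open>Z' n t\<close> then tends to
    \<open>u t (X t)\<close> at every \<open>t\<close>.\<close>
  define Z where "Z n t = real (Suc n) * (Y (t + 1 / real (Suc n)) - Y t)" for n t
  define Z' where "Z' n t = real (Suc n) * (X (t + 1 / real (Suc n)) - X t)" for n t
  have cont: "continuous_on UNIV f" if "\<And>x. (f has_real_derivative f' x) (at x)" for f f' :: "real \<Rightarrow> real"
    using that by (intro DERIV_continuous_on) auto
  have ZD: "(Z n has_real_derivative Z' n t) (at t)" for n t
    unfolding Z_def Z'_def
    by (intro DERIV_cmult DERIV_diff Y DERIV_chain'[where g = "\<lambda>t. t + 1 / real (Suc n)" and s = UNIV, THEN DERIV_cong]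
          DERIV_shift[THEN iffD1, OF Y])
  have Xc: "continuous_on A X" for A unfolding X_def by (rule Fl_continuous)
  have Z'c: "continuous_on UNIV (Z' n)" for n
    unfolding Z'_def by (intro continuous_intros continuous_on_compose2[OF Xc]) auto
  have Zc: "continuous_on UNIV (Z n)" for n by (rule cont[OF ZD])
  have chic: "continuous_on UNIV \<kappa>" and rhoc: "continuous_on UNIV \<rho>" and psic: "continuous_on UNIV \<psi>"
    using cont chi rho psi by blast+
  have Z'b: "\<bar>Z' n t\<bar> \<le> V" for n t
  proof -
    have "0 \<le> X (t + 1 / real (Suc n)) - X t" "X (t + 1 / real (Suc n)) - X t \<le> V * (1 / real (Suc n))"
      using Fl_mono_time[of t "t + 1 / real (Suc n)" 0 w] Fl_speed[of t "t + 1 / real (Suc n)" 0 w]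
      by (simp_all add: X_def)
    then show ?thesis
      unfolding Z'_def by (simp add: abs_mult pos_le_divide_eq mult.commute del: of_nat_Suc)
  qed
  have Zlim: "(\<lambda>n. Z n t) \<longlonglongrightarrow> X t" for t
    unfolding Z_def
  proof (rule has_integral_average_right_continuous)
    show "(X has_integral (Y b - Y a)) {a..b}" if "a \<le> b" for a b
      by (rule fundamental_theorem_of_calculus[OF that])
         (use Y in \<open>auto simp flip: has_real_derivative_iff_has_vector_derivative intro: has_field_derivative_at_within\<close>)
    show "(X \<longlongrightarrow> X t) (at_right t)"
      using Fl_isCont[of t 0 w] unfolding isCont_def filterlim_at_split X_def by (rule conjunct2)
  qed
  have Z'lim: "(\<lambda>n. Z' n t) \<longlonglongrightarrow> u t (X t)" for t
    unfolding Z'_def X_def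
  proof (rule has_integral_average_right_continuous[where g = "\<lambda>r. u r (Fl 0 w r)"])
    show "((\<lambda>r. u r (Fl 0 w r)) has_integral (Fl 0 w b - Fl 0 w a)) {a..b}" if "a \<le> b" for a b
      by (rule sol_onD[OF Fl_sol order_refl that order_refl])
  qed (rule u_along_right_continuous[OF Fl_isCont])
  define f where "f n y t = \<kappa> t * \<rho> (y - Z n t) * \<psi> y" for n y t
  define fy where "fy n y t = \<kappa> t * (\<rho>' (y - Z n t) * \<psi> y + \<rho> (y - Z n t) * \<psi>' y)" for n y t
  define ft where "ft n y t = \<kappa>' t * \<rho> (y - Z n t) * \<psi> y - \<kappa> t * \<rho>' (y - Z n t) * Z' n t * \<psi> y" for n y t
  obtain B1 where B1: "0 \<le> B1" "\<And>t. t \<in> {0..T} \<Longrightarrow> \<bar>\<kappa> t\<bar> \<le> B1" using continuous_bounded_Icc[OF chic] by blast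
  obtain B2 where B2: "0 \<le> B2" "\<And>t. t \<in> {0..T} \<Longrightarrow> \<bar>\<kappa>' t\<bar> \<le> B2" using continuous_bounded_Icc[OF chi'] by blast
  have R0: "0 \<le> R" using rho_le(2)[of 0] by linarith
  have mult3: "\<bar>a * b * c\<bar> \<le> A * B * 1" if "\<bar>a\<bar> \<le> A" "\<bar>b\<bar> \<le> B" "\<bar>c\<bar> \<le> 1" for a b c A B :: real
    unfolding abs_mult using that by (intro mult_mono) auto
  have mult4: "\<bar>a * b * c * d\<bar> \<le> A * B * C * 1" if "\<bar>a\<bar> \<le> A" "\<bar>b\<bar> \<le> B" "\<bar>c\<bar> \<le> C" "\<bar>d\<bar> \<le> 1" for a b c d A B C :: real
    unfolding abs_mult using that by (intro mult_mono) auto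
  have ub: "\<bar>u t y\<bar> \<le> V" for t y using u_nonneg[of t y] u_le[of t y] by simp
  have tf: "test_fun I T (f n) (fy n) (ft n)" for n
    unfolding test_fun_def
  proof (intro conjI allI)
    show "continuous_on UNIV (\<lambda>(y, t). f n y t)" "continuous_on UNIV (\<lambda>(y, t). fy n y t)"
      "continuous_on UNIV (\<lambda>(y, t). ft n y t)"
      unfolding f_def fy_def ft_def case_prod_beta
      by (intro continuous_intros continuous_on_compose2[OF chic] continuous_on_compose2[OF chi']
          continuous_on_compose2[OF rhoc] continuous_on_compose2[OF rho'] continuous_on_compose2[OF psic]
          continuous_on_compose2[OF psi'] continuous_on_compose2[OF Zc] continuous_on_compose2[OF Z'c]; simp)+
    show "((\<lambda>z. f n z t) has_real_derivative fy n y t) (at y)" for y t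
      unfolding f_def fy_def
      by (rule derivative_eq_intros DERIV_chain2[OF rho] psi refl)+ (simp add: algebra_simps)
    show "((\<lambda>r. f n y r) has_real_derivative ft n y t) (at t)" for y t
      unfolding f_def ft_def
      by (rule derivative_eq_intros DERIV_chain2[OF rho] chi ZD refl)+ (simp add: algebra_simps)
    show "\<exists>B. \<forall>y\<in>I. \<forall>t\<in>{0..T}. \<bar>fy n y t\<bar> \<le> B \<and> \<bar>ft n y t\<bar> \<le> B"
    proof (intro exI ballI)
      fix y t assume t: "t \<in> {0..T}"
      have 1: "\<bar>fy n y t\<bar> \<le> B1 * R * 1 + B1 * 1 * 1"
      proof -
        have "fy n y t = \<kappa> t * \<rho>' (y - Z n t) * \<psi> y + \<kappa> t * \<rho> (y - Z n t) * \<psi>' y"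
          by (simp add: fy_def algebra_simps)
        then show ?thesis
          using mult3[OF B1(2)[OF t] rho_le(2) psi_le(1), of "y - Z n t" y]
            mult3[OF B1(2)[OF t] rho_le(1) psi_le(2), of "y - Z n t" y] by linarith
      qed
      have 2: "\<bar>ft n y t\<bar> \<le> B2 * 1 * 1 + B1 * R * V * 1"
        using mult3[OF B2(2)[OF t] rho_le(1) psi_le(1), of "y - Z n t" y]
          mult4[OF B1(2)[OF t] rho_le(2) Z'b psi_le(1), of "y - Z n t" n t y] unfolding ft_def by linarith
      show "\<bar>fy n y t\<bar> \<le> B1 * R * 1 + B1 * 1 * 1 + (B2 * 1 * 1 + B1 * R * V * 1) \<and>
          \<bar>ft n y t\<bar> \<le> B1 * R * 1 + B1 * 1 * 1 + (B2 * 1 * 1 + B1 * R * V * 1)"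
        using 1 2 B1(1) B2(1) R0 V_nonneg by (smt (verit) mult_nonneg_nonneg)
    qed
    show "\<epsilon> > 0 \<longrightarrow> (\<exists>R. \<forall>y\<in>I. \<forall>t\<in>{0..T}. R < \<bar>y\<bar> \<longrightarrow> \<bar>f n y t\<bar> < \<epsilon>)" for \<epsilon>
    proof
      assume e: "\<epsilon> > 0"
      obtain R where R: "\<And>y. R < \<bar>y\<bar> \<Longrightarrow> \<bar>\<psi> y\<bar> < \<epsilon> / (B1 + 1)" using van[of "\<epsilon> / (B1 + 1)"] e B1(1) by auto
      have "\<bar>f n y t\<bar> < \<epsilon>" if "t \<in> {0..T}" "R < \<bar>y\<bar>" for y t
      proof -
        have "\<bar>f n y t\<bar> = \<bar>\<kappa> t * \<rho> (y - Z n t)\<bar> * \<bar>\<psi> y\<bar>" by (simp add: f_def abs_mult)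
        also have "\<dots> \<le> (B1 * 1) * \<bar>\<psi> y\<bar>"
          unfolding abs_mult using B1 that rho_le(1) by (intro mult_right_mono mult_mono) auto
        also have "\<dots> \<le> (B1 + 1) * \<bar>\<psi> y\<bar>" by (simp add: mult_right_mono)
        also have "\<dots> < (B1 + 1) * (\<epsilon> / (B1 + 1))" using R[OF that(2)] B1(1) by (intro mult_strict_left_mono) auto
        finally show ?thesis using B1(1) by simp
      qed
      then show "\<exists>R. \<forall>y\<in>I. \<forall>t\<in>{0..T}. R < \<bar>y\<bar> \<longrightarrow> \<bar>f n y t\<bar> < \<epsilon>" by blast
    qed
  qed
  define F where "F n t y = ft n y t + u t y * fy n y t" for n t y
  have meas: "(\<lambda>(y, t). f n y t) \<in> borel_measurable (borel \<Otimes>\<^sub>M borel)" "(\<lambda>(t, y). fy n y t) \<in> borel_measurable (borel \<Otimes>\<^sub>M borel)"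
    "(\<lambda>(t, y). ft n y t) \<in> borel_measurable (borel \<Otimes>\<^sub>M borel)" for n
  proof -
    have c: "(\<lambda>(t, y). g y t) \<in> borel_measurable (borel \<Otimes>\<^sub>M borel) \<and> (\<lambda>(y, t). g y t) \<in> borel_measurable (borel \<Otimes>\<^sub>M borel)"
      if "continuous_on UNIV (\<lambda>(y, t). g y t)" for g :: "real \<Rightarrow> real \<Rightarrow> real"
    proof -
      have m: "(\<lambda>(y, t). g y t) \<in> borel_measurable (borel \<Otimes>\<^sub>M borel)"
        using borel_measurable_continuous_onI[OF that] by (simp add: borel_prod)
      have "(\<lambda>z. (\<lambda>(y, t). g y t) (snd z, fst z)) \<in> borel_measurable (borel \<Otimes>\<^sub>M borel)"
        by (rule measurable_compose[OF _ m]) simp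
      with m show ?thesis by (simp add: case_prod_beta')
    qed
    show "(\<lambda>(y, t). f n y t) \<in> borel_measurable (borel \<Otimes>\<^sub>M borel)" "(\<lambda>(t, y). fy n y t) \<in> borel_measurable (borel \<Otimes>\<^sub>M borel)"
      "(\<lambda>(t, y). ft n y t) \<in> borel_measurable (borel \<Otimes>\<^sub>M borel)"
      using c[of "f n"] c[of "fy n"] c[of "ft n"] tf[of n] by (auto simp: test_fun_def)
  qed
  have lim0: "(\<lambda>n. g (y - Z n t)) \<longlonglongrightarrow> g (y - X t)" if "continuous_on UNIV g" for g :: "real \<Rightarrow> real" and y t
    by (rule continuous_on_tendsto_compose[OF that]) (use Zlim in \<open>auto intro!: tendsto_intros\<close>)
  have "(LINT t:{0..T}|lborel. (\<integral>y. (\<kappa>' t * \<rho> (y - X t) * \<psi> y - \<kappa> t * \<rho>' (y - X t) * u t (X t) * \<psi> y)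
        + u t y * (\<kappa> t * (\<rho>' (y - X t) * \<psi> y + \<rho> (y - X t) * \<psi>' y)) \<partial>N t)) = rhs (\<lambda>y t. \<kappa> t * \<rho> (y - X t) * \<psi> y)"
  proof (rule weak_limit[where F = F and f = f])
    show "(LINT t:{0..T}|lborel. (\<integral>y. F n t y \<partial>N t)) = rhs (f n)" for n
      using weak[OF tf] unfolding F_def rhs_def .
    show "(\<lambda>(t, y). F n t y) \<in> borel_measurable (borel \<Otimes>\<^sub>M borel)" for n
    proof -
      have "(\<lambda>z. (\<lambda>(t, y). ft n y t) z + (\<lambda>(t, y). u t y) z * (\<lambda>(t, y). fy n y t) z) \<in> borel_measurable (borel \<Otimes>\<^sub>M borel)"
        by (intro borel_measurable_add borel_measurable_times meas u_pair_measurable)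
      then show ?thesis by (simp add: F_def case_prod_beta')
    qed
    show "(\<lambda>(y, t). f n y t) \<in> borel_measurable (borel \<Otimes>\<^sub>M borel)" for n by (rule meas)
    show "\<bar>F n t y\<bar> \<le> (B2 * 1 * 1 + B1 * R * V * 1) + (B1 * R * V * 1 + B1 * 1 * V * 1)" if t: "t \<in> {0..T}" for n t y
    proof -
      have "F n t y = \<kappa>' t * \<rho> (y - Z n t) * \<psi> y - \<kappa> t * \<rho>' (y - Z n t) * Z' n t * \<psi> y
          + \<kappa> t * \<rho>' (y - Z n t) * u t y * \<psi> y + \<kappa> t * \<rho> (y - Z n t) * u t y * \<psi>' y"
        by (simp add: F_def ft_def fy_def algebra_simps)
      then show ?thesis
        using mult3[OF B2(2)[OF t] rho_le(1) psi_le(1), of "y - Z n t" y]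
          mult4[OF B1(2)[OF t] rho_le(2) Z'b psi_le(1), of "y - Z n t" n t y]
          mult4[OF B1(2)[OF t] rho_le(2) ub psi_le(1), of "y - Z n t" t y y]
          mult4[OF B1(2)[OF t] rho_le(1) ub psi_le(2), of "y - Z n t" t y y] by linarith
    qed
    show "\<bar>f n y t\<bar> \<le> B1 * 1 * 1" if t: "t \<in> {0..T}" for n t y
      unfolding f_def by (rule mult3[OF B1(2)[OF t] rho_le(1) psi_le(1)])
    show "(\<lambda>n. F n t y) \<longlonglongrightarrow> (\<kappa>' t * \<rho> (y - X t) * \<psi> y - \<kappa> t * \<rho>' (y - X t) * u t (X t) * \<psi> y)
        + u t y * (\<kappa> t * (\<rho>' (y - X t) * \<psi> y + \<rho> (y - X t) * \<psi>' y))" for t y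
      unfolding F_def ft_def fy_def by (intro tendsto_intros lim0 rhoc rho' Z'lim)
    show "(\<lambda>n. f n y t) \<longlonglongrightarrow> \<kappa> t * \<rho> (y - X t) * \<psi> y" for t y
      unfolding f_def by (intro tendsto_intros lim0 rhoc)
  qed
  then show ?thesis unfolding X_def[symmetric] by (simp add: algebra_simps)
qed

text \<open>The indicator is approached by dilated cutoffs along the characteristic, times a bump
  for decay at infinity. The weight \<open>\<kappa>\<close> in time is kept in order to localise the
  balance in time afterwards.\<close>

lemma mass_right_of_characteristic:
  assumes chi: "\<And>t. (\<kappa> has_real_derivative \<kappa>' t) (at t)" and chi': "continuous_on UNIV \<kappa>'"
  shows "(LINT t:{0..T}|lborel. (\<integral>y. \<kappa>' t * indicator {Fl 0 w t<..} y \<partial>N t))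
    = rhs (\<lambda>y t. \<kappa> t * indicator {Fl 0 w t<..} y)"
proof -
  define X where "X = Fl 0 w"
  have Xc: "continuous_on UNIV X" unfolding X_def by (rule Fl_continuous)
  have chic: "continuous_on UNIV \<kappa>" using chi by (intro DERIV_continuous_on) auto
  obtain B1 where B1: "0 \<le> B1" "\<And>t. t \<in> {0..T} \<Longrightarrow> \<bar>\<kappa> t\<bar> \<le> B1" using continuous_bounded_Icc[OF chic] by blast
  obtain B2 where B2: "0 \<le> B2" "\<And>t. t \<in> {0..T} \<Longrightarrow> \<bar>\<kappa>' t\<bar> \<le> B2" using continuous_bounded_Icc[OF chi'] by blast
  define \<rho> where "\<rho> n x = cutoff (real (Suc n) * x)" for n x
  define \<rho>' where "\<rho>' n x = real (Suc n) * cutoff_deriv (real (Suc n) * x)" for n x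
  define f where "f n y t = \<kappa> t * \<rho> n (y - X t) * bump n y" for n y t
  define F where "F n t y = \<kappa>' t * \<rho> n (y - X t) * bump n y
      + \<kappa> t * \<rho>' n (y - X t) * (u t y - u t (X t)) * bump n y
      + \<kappa> t * \<rho> n (y - X t) * u t y * bump_deriv n y" for n t y
  have rhoD: "(\<rho> n has_real_derivative \<rho>' n x) (at x)" for n x
  proof -
    have "((\<lambda>x. real (Suc n) * x) has_real_derivative real (Suc n)) (at x)"
      by (auto intro!: derivative_eq_intros simp del: of_nat_Suc)
    from DERIV_chain2[OF cutoff_has_derivative this] show ?thesis
      unfolding \<rho>_def \<rho>'_def by (simp add: mult.commute del: of_nat_Suc)
  qed
  have rho'c: "continuous_on UNIV (\<rho>' n)" for n
    unfolding \<rho>'_def by (intro continuous_intros continuous_on_compose2[OF cutoff_deriv_continuous]) auto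
  have rhoc: "continuous_on UNIV (\<rho> n)" for n
    using rhoD[of n] by (intro DERIV_continuous_on) auto
  have bumpc: "continuous_on UNIV (bump n)" for n
    using bump_has_derivative[of n] by (intro DERIV_continuous_on) auto
  have rho1: "\<bar>\<rho> n x\<bar> \<le> 1" for n x unfolding \<rho>_def using cutoff_bounds by simp
  have bd1: "\<bar>bump_deriv n y\<bar> \<le> 1" for n y
    using bump_deriv_bound[of n y] by (rule order_trans) simp
  have eq: "(LINT t:{0..T}|lborel. (\<integral>y. F n t y \<partial>N t)) = rhs (f n)" for n
    unfolding F_def f_def X_def
  proof (rule weak_along_characteristic[OF chi chi' rhoD rho'c bump_has_derivative bump_deriv_continuous])
    show "\<bar>\<rho>' n x\<bar> \<le> real (Suc n)" for x
      unfolding \<rho>'_def abs_mult using cutoff_deriv_le[of "real (Suc n) * x"]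
      by (simp add: mult_left_le del: of_nat_Suc)
  qed (use rho1 bump_bounds bd1 bump_vanishes in auto)
  \<comment> \<open>The factor \<open>n + 1\<close> in \<open>\<rho>' n\<close> is absorbed by the
    Lipschitz bound of the velocity difference, leaving the bounded and vanishing quantity
    \<open>cutoff_deriv x * x\<close> at the dilated point.\<close>
  have diff: "\<bar>\<rho>' n (y - X t) * (u t y - u t (X t))\<bar> \<le> L * \<bar>cutoff_deriv (real (Suc n) * (y - X t)) * (real (Suc n) * (y - X t))\<bar>" for n t y
  proof -
    have "\<bar>\<rho>' n (y - X t) * (u t y - u t (X t))\<bar> \<le> \<bar>\<rho>' n (y - X t)\<bar> * (L * \<bar>y - X t\<bar>)"
      unfolding abs_mult by (intro mult_left_mono u_lip) simp
    then show ?thesis by (simp add: \<rho>'_def abs_mult ac_simps del: of_nat_Suc)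
  qed
  have diff1: "\<bar>\<rho>' n (y - X t) * (u t y - u t (X t))\<bar> \<le> L" for n t y
    using order_trans[OF diff mult_left_mono[OF cutoff_deriv_mult_le]] L_pos by simp
  have difflim: "(\<lambda>n. \<rho>' n (y - X t) * (u t y - u t (X t))) \<longlonglongrightarrow> 0" for t y
  proof (rule tendsto_null_abs_le[OF _ diff])
    show "(\<lambda>n. L * \<bar>cutoff_deriv (real (Suc n) * (y - X t)) * (real (Suc n) * (y - X t))\<bar>) \<longlonglongrightarrow> 0"
      using tendsto_mult[OF tendsto_const[of L] tendsto_rabs[OF cutoff_deriv_scaled_tendsto[of "y - X t"]]] by simp
  qed
  have "(LINT t:{0..T}|lborel. (\<integral>y. \<kappa>' t * indicator {0<..} (y - X t) * 1 + \<kappa> t * 0 * 1 + \<kappa> t * indicator {0<..} (y - X t) * u t y * 0 \<partial>N t))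
     = rhs (\<lambda>y t. \<kappa> t * indicator {0<..} (y - X t) * 1)"
  proof (rule weak_limit[where F = F and f = f, OF eq])
    have cm: "(\<lambda>z::real\<times>real. g (fst z) (snd z)) \<in> borel_measurable (borel \<Otimes>\<^sub>M borel)"
      if "continuous_on UNIV (\<lambda>z. g (fst z) (snd z))" for g :: "real \<Rightarrow> real \<Rightarrow> real"
      using borel_measurable_continuous_onI[OF that] by (simp add: borel_prod)
    have c: "continuous_on UNIV (\<lambda>z. \<kappa>' (fst z))" "continuous_on UNIV (\<lambda>z. \<kappa> (fst z))"
      "continuous_on UNIV (\<lambda>z. \<rho> n (snd z - X (fst z)))" "continuous_on UNIV (\<lambda>z. \<rho>' n (snd z - X (fst z)))"
      "continuous_on UNIV (\<lambda>z. bump n (snd z))" "continuous_on UNIV (\<lambda>z. bump_deriv n (snd z))" for n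
      by (intro continuous_on_compose2[OF chi'] continuous_on_compose2[OF chic] continuous_on_compose2[OF rhoc]
          continuous_on_compose2[OF rho'c] continuous_on_compose2[OF bumpc] continuous_on_compose2[OF bump_deriv_continuous]
          continuous_on_compose2[OF Xc] continuous_intros; simp)+
    have um: "(\<lambda>z. u (fst z) (snd z)) \<in> borel_measurable (borel \<Otimes>\<^sub>M borel)"
      using u_pair_measurable by (simp add: case_prod_beta')
    have uX: "(\<lambda>z::real\<times>real. u (fst z) (X (fst z))) \<in> borel_measurable (borel \<Otimes>\<^sub>M borel)"
      by (rule measurable_compose[OF measurable_fst u_along_measurable[OF borel_measurable_continuous_onI[OF Xc]]])
    show "(\<lambda>(t, y). F n t y) \<in> borel_measurable (borel \<Otimes>\<^sub>M borel)" for n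
      unfolding F_def case_prod_beta
      by (intro borel_measurable_add borel_measurable_times borel_measurable_diff um uX cm c)
    have c': "continuous_on UNIV (\<lambda>z. f n (fst z) (snd z))" for n
      unfolding f_def
      by (intro continuous_on_compose2[OF chic] continuous_on_compose2[OF rhoc]
          continuous_on_compose2[OF bumpc] continuous_on_compose2[OF Xc] continuous_intros; simp)
    show "(\<lambda>(y, t). f n y t) \<in> borel_measurable (borel \<Otimes>\<^sub>M borel)" for n
      unfolding case_prod_beta by (rule cm[OF c'])
    show "\<bar>f n y t\<bar> \<le> B1 * 1 * 1" if "t \<in> {0..T}" for n t y
      unfolding f_def abs_mult using that B1 rho1 bump_bounds by (intro mult_mono) auto
    show "\<bar>F n t y\<bar> \<le> B2 * 1 * 1 + B1 * L * 1 + B1 * 1 * V * 1" if "t \<in> {0..T}" for n t y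
    proof -
      have 1: "\<bar>\<kappa>' t * \<rho> n (y - X t) * bump n y\<bar> \<le> B2 * 1 * 1"
        unfolding abs_mult using that B2 rho1 bump_bounds by (intro mult_mono) auto
      have 2: "\<bar>\<kappa> t * (\<rho>' n (y - X t) * (u t y - u t (X t))) * bump n y\<bar> \<le> B1 * L * 1"
        unfolding abs_mult[of "\<kappa> t * _"] abs_mult[of "\<kappa> t"]
        using that B1 diff1 bump_bounds L_pos by (intro mult_mono) auto
      have 3: "\<bar>\<kappa> t * \<rho> n (y - X t) * u t y * bump_deriv n y\<bar> \<le> B1 * 1 * V * 1"
        unfolding abs_mult using that B1 rho1 bd1 u_nonneg[of t y] u_le[of t y] V_nonneg by (intro mult_mono) auto
      show ?thesis using 1 2 3 unfolding F_def mult.assoc[of "\<kappa> t" "\<rho>' n (y - X t)"] by linarith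
    qed
    show "(\<lambda>n. F n t y) \<longlonglongrightarrow> \<kappa>' t * indicator {0<..} (y - X t) * 1 + \<kappa> t * 0 * 1
        + \<kappa> t * indicator {0<..} (y - X t) * u t y * 0" for t y
      unfolding F_def mult.assoc[of "\<kappa> t" "\<rho>' _ (y - X t)"]
      by (intro tendsto_intros difflim bump_tendsto bump_deriv_tendsto cutoff_scaled_tendsto[folded \<rho>_def])
    show "(\<lambda>n. f n y t) \<longlonglongrightarrow> \<kappa> t * indicator {0<..} (y - X t) * 1" for t y
      unfolding f_def by (intro tendsto_intros bump_tendsto cutoff_scaled_tendsto[folded \<rho>_def])
  qed
  moreover have "indicator {0<..} (y - X t) = (indicator {X t<..} y :: real)" for y t
    by (auto split: split_indicator)
  ultimately show ?thesis by (simp add: X_def)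
qed

end

section \<open>Measures cut at a time, and integration by parts\<close>

definition cut :: "real measure \<Rightarrow> real \<Rightarrow> real measure" where
  "cut M t = density M (\<lambda>s. ennreal (indicator {..t} s))"

lemma sets_cut [simp]: "sets (cut M t) = sets M" and space_cut [simp]: "space (cut M t) = space M"
  by (simp_all add: cut_def)

lemma emeasure_cut:
  assumes "sets M = sets borel" "S \<in> sets borel"
  shows "emeasure (cut M t) S = emeasure M (S \<inter> {..t})"
proof -
  have "emeasure (cut M t) S = (\<integral>\<^sup>+s. ennreal (indicator {..t} s) * indicator S s \<partial>M)"
    unfolding cut_def using assms by (intro emeasure_density) (auto cong: measurable_cong_sets)
  also have "\<dots> = (\<integral>\<^sup>+s. indicator (S \<inter> {..t}) s \<partial>M)"
    by (intro nn_integral_cong) (auto split: split_indicator)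
  finally show ?thesis using assms by simp
qed

lemma finite_measure_cut:
  assumes "sets M = sets borel" "finite_measure M" shows "finite_measure (cut M t)"
proof
  have "space M = UNIV" using sets_eq_imp_space_eq[OF assms(1)] by simp
  then show "emeasure (cut M t) (space (cut M t)) \<noteq> \<infinity>"
    using emeasure_cut[OF assms(1), of UNIV t] finite_measure.emeasure_finite[OF assms(2)] by simp
qed

lemma integral_cut:
  fixes g :: "real \<Rightarrow> real"
  assumes "sets M = sets borel" "g \<in> borel_measurable borel"
  shows "(\<integral>s. g s \<partial>cut M t) = (\<integral>s. indicator {..t} s * g s \<partial>M)"
  unfolding cut_def using assms by (intro integral_real_density) (auto cong: measurable_cong_sets)

lemma measure_atMost_mono:
  assumes "sets M = sets borel" "finite_measure M" "S \<in> sets borel"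
  shows "mono (\<lambda>t::real. measure M ({..t} \<inter> S))"
proof (rule monoI)
  fix s t :: real assume "s \<le> t"
  then show "measure M ({..s} \<inter> S) \<le> measure M ({..t} \<inter> S)"
    by (intro finite_measure.finite_measure_mono[OF assms(2)]) (use assms in auto)
qed

lemma integrable_Icc_bounded:
  fixes f :: "real \<Rightarrow> real"
  assumes "f \<in> borel_measurable borel" "\<And>t. t \<in> {0..T} \<Longrightarrow> \<bar>f t\<bar> \<le> B"
  shows "integrable lborel (\<lambda>t. indicator {0..T} t * f t)"
  using integrableI_bounded_set_indicator[of "{0..T}" lborel f B] assms by (simp add: emeasure_lborel_Icc_eq)

text \<open>Integration by parts of \<open>\<Psi>\<close> against the distribution function of
  \<open>M\<close> on \<open>S\<close>: writing the mass up to \<open>t\<close> as an integral and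
  exchanging the order leaves the integral of \<open>\<psi>\<close> over
  \<open>{s..T}\<close>.\<close>

lemma fubini_cut:
  fixes \<psi> \<Psi> :: "real \<Rightarrow> real"
  assumes M: "sets M = sets borel" "finite_measure M" "AE s in M. s \<in> {0..T}" and S: "S \<in> sets borel"
    and psi: "continuous_on UNIV \<psi>" and Psi: "\<And>t. (\<Psi> has_real_derivative \<psi> t) (at t)"
  shows "(\<integral>t. indicator {0..T} t * (\<psi> t * measure M ({..t} \<inter> S)) \<partial>lborel) = (\<integral>s. (\<Psi> T - \<Psi> s) * indicator S s \<partial>M)"
proof -
  interpret M: finite_measure M by (rule M(2))
  interpret P: pair_sigma_finite lborel M ..
  have space: "space M = UNIV" using sets_eq_imp_space_eq[OF M(1)] by simp
  define k where "k t s = indicator {0..T} t * (\<psi> t * (indicator {..t} s * indicator S s))" for t s :: real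
  obtain B where B: "\<And>t. t \<in> {0..T} \<Longrightarrow> \<bar>\<psi> t\<bar> \<le> B"
  proof -
    have "bounded (\<psi> ` {0..T})"
      by (intro compact_imp_bounded compact_continuous_image continuous_on_subset[OF psi]) auto
    then obtain B where "\<forall>t\<in>{0..T}. \<bar>\<psi> t\<bar> \<le> B" by (auto simp: bounded_iff)
    then show thesis using that by blast
  qed
  have psim: "\<psi> \<in> borel_measurable borel" by (rule borel_measurable_continuous_onI[OF psi])
  have Psim: "\<Psi> \<in> borel_measurable borel"
    using Psi by (intro borel_measurable_continuous_onI DERIV_continuous_on) auto
  have km: "(\<lambda>z. \<psi> (fst z) * (indicator {..fst z} (snd z) * indicator S (snd z))) \<in> borel_measurable (lborel \<Otimes>\<^sub>M M)"
  proof -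
    have 1: "(\<lambda>z. \<psi> (fst z)) \<in> borel_measurable (lborel \<Otimes>\<^sub>M M)"
      by (rule measurable_compose[OF measurable_fst]) (use psim in simp)
    have 2: "(\<lambda>z. indicator S (snd z) :: real) \<in> borel_measurable (lborel \<Otimes>\<^sub>M M)"
      by (rule measurable_compose[OF measurable_snd]) (use S M(1) in simp)
    have f: "fst \<in> borel_measurable (lborel \<Otimes>\<^sub>M M)" "snd \<in> borel_measurable (lborel \<Otimes>\<^sub>M M)"
      using measurable_fst[of lborel M] measurable_snd[of lborel M] M(1)
      by (simp_all cong: measurable_cong_sets)
    have "{z \<in> space (lborel \<Otimes>\<^sub>M M). snd z \<le> fst z} \<in> sets (lborel \<Otimes>\<^sub>M M)"
      by (rule borel_measurable_le[OF f(2) f(1)])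
    then have "(\<lambda>z. indicator {z \<in> space (lborel \<Otimes>\<^sub>M M). snd z \<le> fst z} z :: real) \<in> borel_measurable (lborel \<Otimes>\<^sub>M M)"
      by simp
    moreover have "indicator {z \<in> space (lborel \<Otimes>\<^sub>M M). snd z \<le> fst z} z = (indicator {..fst z} (snd z) :: real)" for z
      by (auto simp: space_pair_measure space split: split_indicator)
    ultimately have 3: "(\<lambda>z. indicator {..fst z} (snd z) :: real) \<in> borel_measurable (lborel \<Otimes>\<^sub>M M)" by simp
    show ?thesis by (intro borel_measurable_times 1 2 3)
  qed
  have ki: "integrable (lborel \<Otimes>\<^sub>M M) (case_prod k)"
  proof -
    have "integrable (lborel \<Otimes>\<^sub>M M) (\<lambda>z. indicator ({0..T} \<times> UNIV) z *\<^sub>R (\<psi> (fst z) * (indicator {..fst z} (snd z) * indicator S (snd z))))"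
    proof (rule integrableI_bounded_set_indicator[OF _ km, of _ B])
      show "{0..T} \<times> UNIV \<in> sets (lborel \<Otimes>\<^sub>M M)" using sets.top[of M] space by (intro pair_measureI) auto
      have "emeasure (lborel \<Otimes>\<^sub>M M) ({0..T} \<times> space M) = emeasure lborel {0..T} * emeasure M (space M)"
        by (rule M.emeasure_pair_measure_Times) auto
      then show "emeasure (lborel \<Otimes>\<^sub>M M) ({0..T} \<times> UNIV) < \<infinity>"
        using M.emeasure_finite[of UNIV] by (auto simp: space ennreal_mult_eq_top_iff emeasure_lborel_Icc_eq less_top[symmetric])
      show "AE z in lborel \<Otimes>\<^sub>M M. z \<in> {0..T} \<times> UNIV \<longrightarrow> norm (\<psi> (fst z) * (indicator {..fst z} (snd z) * indicator S (snd z))) \<le> B"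
        using B by (intro always_eventually) (fastforce split: split_indicator intro: order_trans[OF abs_ge_zero])
    qed
    then show ?thesis unfolding k_def case_prod_beta
      by (rule Bochner_Integration.integrable_cong[THEN iffD1, OF refl, rotated]) (auto split: split_indicator)
  qed
  have in1: "(\<integral>s. k t s \<partial>M) = indicator {0..T} t * (\<psi> t * measure M ({..t} \<inter> S))" for t
  proof -
    have "(\<integral>s. k t s \<partial>M) = (\<integral>s. indicator {0..T} t * \<psi> t * indicator ({..t} \<inter> S) s \<partial>M)"
      unfolding k_def by (intro Bochner_Integration.integral_cong) (auto split: split_indicator)
    then show ?thesis using space by simp
  qed
  have in2: "(\<integral>t. k t s \<partial>lborel) = (\<Psi> T - \<Psi> s) * indicator S s" if s: "s \<in> {0..T}" for s
  proof -
    have "(\<integral>t. indicator {s..T} t *\<^sub>R \<psi> t \<partial>lborel) = \<Psi> T - \<Psi> s"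
      by (rule integral_FTC_Icc)
         (use s Psi psi in \<open>auto simp flip: has_real_derivative_iff_has_vector_derivative
            intro: has_field_derivative_at_within continuous_on_subset\<close>)
    moreover have "(\<integral>t. k t s \<partial>lborel) = (\<integral>t. indicator S s * (indicator {s..T} t *\<^sub>R \<psi> t) \<partial>lborel)"
      unfolding k_def using s by (intro Bochner_Integration.integral_cong) (auto split: split_indicator)
    ultimately show ?thesis by simp
  qed
  have "(\<integral>t. indicator {0..T} t * (\<psi> t * measure M ({..t} \<inter> S)) \<partial>lborel) = (\<integral>t. \<integral>s. k t s \<partial>M \<partial>lborel)"
    by (simp add: in1)
  also have "\<dots> = (\<integral>s. \<integral>t. k t s \<partial>lborel \<partial>M)"
    by (rule P.Fubini_integral[OF ki, symmetric])
  also have "\<dots> = (\<integral>s. (\<Psi> T - \<Psi> s) * indicator S s \<partial>M)"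
  proof (rule integral_cong_AE)
    show "(\<lambda>s. \<integral>t. k t s \<partial>lborel) \<in> borel_measurable M"
      using P.integrable_snd[OF ki] by simp
    show "(\<lambda>s. (\<Psi> T - \<Psi> s) * indicator S s) \<in> borel_measurable M"
      using Psim S M(1) by (simp cong: measurable_cong_sets)
    show "AE s in M. (\<integral>t. k t s \<partial>lborel) = (\<Psi> T - \<Psi> s) * indicator S s"
      using M(3) by eventually_elim (rule in2)
  qed
  finally show ?thesis .
qed

section \<open>The mass balance to the right of a characteristic\<close>

context arc_problem
begin

lemma m0_space [simp]: "space m0 = UNIV" and lam_space [simp]: "space lam = UNIV" and tau_space [simp]: "space tau = UNIV"
  using sets_eq_imp_space_eq[OF m0_sets] sets_eq_imp_space_eq[OF lam_sets] sets_eq_imp_space_eq[OF tau_sets] by simp_all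

text \<open>Mass right of the characteristic starting from \<open>w\<close>, present or departed,
  minus what was there initially or has entered there. Mass crossing an end at time \<open>s\<close>
  counts as right of the characteristic exactly when the latter is still below that end at
  \<open>s\<close>.\<close>

definition deficit :: "real \<Rightarrow> real \<Rightarrow> real" where
  "deficit w t = measure (N t) {Fl 0 w t<..} + measure tau ({..t} \<inter> {s. Fl 0 w s < Sup I})
     - (measure m0 {w<..} + measure lam ({..t} \<inter> {s. Fl 0 w s < Inf I}))"

lemma below_sets: "{s. Fl 0 w s < c} \<in> sets borel"
  using borel_measurable_continuous_onI[OF Fl_continuous[of UNIV 0 w]] by measurable

lemma right_indicator_measurable: "(\<lambda>(t, y). indicator {Fl 0 w t<..} y :: real) \<in> borel_measurable (borel \<Otimes>\<^sub>M borel)"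
proof -
  have "(\<lambda>z::real\<times>real. Fl 0 w (fst z)) \<in> borel_measurable (borel \<Otimes>\<^sub>M borel)"
    by (rule measurable_compose[OF measurable_fst borel_measurable_continuous_onI[OF Fl_continuous]])
  then have "{z \<in> space (borel \<Otimes>\<^sub>M borel). Fl 0 w (fst z) < snd z} \<in> sets (borel \<Otimes>\<^sub>M borel)"
    by (intro borel_measurable_less) auto
  then have "(\<lambda>z. indicator {z \<in> space (borel \<Otimes>\<^sub>M borel). Fl 0 w (fst z) < snd z} z :: real) \<in> borel_measurable (borel \<Otimes>\<^sub>M borel)"
    by simp
  moreover have "indicator {z \<in> space (borel \<Otimes>\<^sub>M borel). Fl 0 w (fst z) < snd z} z = (\<lambda>(t, y). indicator {Fl 0 w t<..} y :: real) z" for z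
    by (simp add: space_pair_measure case_prod_beta indicator_def)
  ultimately show ?thesis by simp
qed

lemma rhs_right_indicator:
  "rhs (\<lambda>y t. \<kappa> t * indicator {Fl 0 w t<..} y) = \<kappa> T * measure (N T) {Fl 0 w T<..} - \<kappa> 0 * measure m0 {w<..}
     + (\<integral>t. \<kappa> t * indicator {s. Fl 0 w s < Sup I} t \<partial>tau) - (\<integral>t. \<kappa> t * indicator {s. Fl 0 w s < Inf I} t \<partial>lam)"
proof -
  have ind: "indicator {Fl 0 w t<..} c = (indicator {s. Fl 0 w s < c} t :: real)" for t c
    by (auto split: split_indicator)
  show ?thesis unfolding rhs_def ind[where c = "Sup I"] ind[where c = "Inf I"] by simp
qed

text \<open>A constant weight in time makes the left side of the weak identity vanish. As the weak
  equation contains \<open>N T\<close> explicitly, the time \<open>T\<close> does not fall into an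
  exceptional null set.\<close>

lemma deficit_final: "deficit w T = 0"
proof -
  have "rhs (\<lambda>y t. 1 * indicator {Fl 0 w t<..} y) = 0"
    using mass_right_of_characteristic[of "\<lambda>_. 1" "\<lambda>_. 0" w] by (simp add: set_lebesgue_integral_def)
  then have eq: "measure (N T) {Fl 0 w T<..} - measure m0 {w<..} + (\<integral>t. indicator {s. Fl 0 w s < Sup I} t \<partial>tau)
      - (\<integral>t. indicator {s. Fl 0 w s < Inf I} t \<partial>lam) = 0"
    unfolding rhs_right_indicator[of "\<lambda>_. 1" w] by (simp only: mult_1)
  have trim: "measure M ({..T} \<inter> S) = (\<integral>t. indicator S t \<partial>M)"
    if "sets M = sets borel" "AE s in M. s \<in> {0..T}" "S \<in> sets borel" for M :: "real measure" and S
  proof -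
    have "(\<integral>t. indicator S t \<partial>M) = measure M S"
      using sets_eq_imp_space_eq[OF that(1)] by simp
    also have "\<dots> = measure M ({..T} \<inter> S)"
      by (rule measure_eq_AE) (use that in auto)
    finally show ?thesis ..
  qed
  show ?thesis
    using eq unfolding deficit_def trim[OF tau_sets tau_T below_sets] trim[OF lam_sets lam_T below_sets] by linarith
qed

text \<open>An antiderivative \<open>\<Psi>\<close> of \<open>\<psi>\<close> serves as weight in
  time. After integrating the inflow and the outflow by parts, all boundary terms collect into
  \<open>\<Psi> T * deficit w T\<close>, which is zero.\<close>

lemma indicator_deficit_integrable: "integrable lborel (\<lambda>t. indicator {0..T} t * deficit w t)"
  and integral_mult_deficit: "continuous_on UNIV \<psi> \<Longrightarrow> (\<integral>t. \<psi> t * (indicator {0..T} t * deficit w t) \<partial>lborel) = 0"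
proof -
  let ?Q = "\<lambda>t. measure (N t) {Fl 0 w t<..}"
  let ?B = "\<lambda>t. measure tau ({..t} \<inter> {s. Fl 0 w s < Sup I})"
  let ?A = "\<lambda>t. measure lam ({..t} \<inter> {s. Fl 0 w s < Inf I})"
  have mA: "?A \<in> borel_measurable borel" and mB: "?B \<in> borel_measurable borel"
    by (intro borel_measurable_mono measure_atMost_mono lam_fin tau_fin below_sets lam_sets tau_sets)+
  have all: "(\<integral>t. \<psi> t * (indicator {0..T} t * deficit w t) \<partial>lborel) = 0 \<and>
     integrable lborel (\<lambda>t. \<psi> t * (indicator {0..T} t * deficit w t))" if psi: "continuous_on UNIV \<psi>" for \<psi>
  proof -
    obtain \<Psi> where Psi: "\<And>t. (\<Psi> has_real_derivative \<psi> t) (at t)"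
      using continuous_antiderivative[OF psi] by blast
    have Psim: "\<Psi> \<in> borel_measurable borel"
      using Psi by (intro borel_measurable_continuous_onI DERIV_continuous_on) auto
    obtain C where C: "0 \<le> C" "\<And>t. t \<in> {0..T} \<Longrightarrow> \<bar>\<psi> t\<bar> \<le> C" using continuous_bounded_Icc[OF psi] by blast
    obtain D where D: "0 \<le> D" "\<And>t. t \<in> {0..T} \<Longrightarrow> \<bar>\<Psi> t\<bar> \<le> D"
    proof -
      have "continuous_on UNIV \<Psi>" using Psi by (intro DERIV_continuous_on) auto
      then show thesis using continuous_bounded_Icc that by blast
    qed
    have psim: "\<psi> \<in> borel_measurable borel" by (rule borel_measurable_continuous_onI[OF psi])
    have inner: "(\<integral>y. \<psi> t * indicator {Fl 0 w t<..} y \<partial>N t) = \<psi> t * ?Q t" for t by simp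
    have iQ: "integrable lborel (\<lambda>t. indicator {0..T} t * (\<psi> t * ?Q t))"
    proof -
      have "integrable lborel (\<lambda>t. indicator {0..T} t * (\<integral>y. \<psi> t * indicator {Fl 0 w t<..} y \<partial>N t))"
      proof (rule kernel_integral_integrable[of _ C])
        have "(\<lambda>z. \<psi> (fst z) * (\<lambda>(t, y). indicator {Fl 0 w t<..} y :: real) z) \<in> borel_measurable (borel \<Otimes>\<^sub>M borel)"
          by (intro borel_measurable_times right_indicator_measurable measurable_compose[OF measurable_fst psim])
        then show "(\<lambda>(t, y). \<psi> t * indicator {Fl 0 w t<..} y) \<in> borel_measurable (borel \<Otimes>\<^sub>M borel)"
          by (simp add: case_prod_beta')
        show "AE y in N t. \<bar>\<psi> t * indicator {Fl 0 w t<..} y\<bar> \<le> C" if "t \<in> {0..T}" for t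
          using C(2)[OF that] C(1) by (intro always_eventually) (auto split: split_indicator)
      qed
      then show ?thesis by (simp only: inner)
    qed
    have bd: "\<bar>\<psi> t * measure M S\<bar> \<le> C * measure M UNIV" if "finite_measure M" "sets M = sets borel" "t \<in> {0..T}" for M S t
      unfolding abs_mult
      using C that finite_measure.bounded_measure[OF that(1), of S] sets_eq_imp_space_eq[OF that(2)]
      by (intro mult_mono) auto
    have iB: "integrable lborel (\<lambda>t. indicator {0..T} t * (\<psi> t * ?B t))"
    proof (rule integrable_Icc_bounded)
      show "\<bar>\<psi> t * ?B t\<bar> \<le> C * measure tau UNIV" if "t \<in> {0..T}" for t
        by (rule bd[OF tau_fin tau_sets that])
    qed (use psim mB in simp)
    have iA: "integrable lborel (\<lambda>t. indicator {0..T} t * (\<psi> t * ?A t))"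
    proof (rule integrable_Icc_bounded)
      show "\<bar>\<psi> t * ?A t\<bar> \<le> C * measure lam UNIV" if "t \<in> {0..T}" for t
        by (rule bd[OF lam_fin lam_sets that])
    qed (use psim mA in simp)
    have iM: "integrable lborel (\<lambda>t. indicator {0..T} t * \<psi> t)"
      by (rule integrable_Icc_bounded[OF psim C(2)])
    have eq: "\<psi> t * (indicator {0..T} t * deficit w t) = indicator {0..T} t * (\<psi> t * ?Q t) + indicator {0..T} t * (\<psi> t * ?B t)
        - (measure m0 {w<..} * (indicator {0..T} t * \<psi> t) + indicator {0..T} t * (\<psi> t * ?A t))" for t
      by (simp add: deficit_def algebra_simps)
    have vQ: "(\<integral>t. indicator {0..T} t * (\<psi> t * ?Q t) \<partial>lborel)
       = \<Psi> T * ?Q T - \<Psi> 0 * measure m0 {w<..} + (\<integral>t. \<Psi> t * indicator {s. Fl 0 w s < Sup I} t \<partial>tau)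
          - (\<integral>t. \<Psi> t * indicator {s. Fl 0 w s < Inf I} t \<partial>lam)"
      using mass_right_of_characteristic[OF Psi psi, of w]
      by (simp add: rhs_right_indicator set_lebesgue_integral_def)
    have vM: "(\<integral>t. indicator {0..T} t * \<psi> t \<partial>lborel) = \<Psi> T - \<Psi> 0"
      using integral_FTC_Icc[of 0 T \<Psi> \<psi>] T_pos Psi psi
      by (auto simp flip: has_real_derivative_iff_has_vector_derivative
            intro: has_field_derivative_at_within continuous_on_subset)
    have fub: "(\<integral>t. indicator {0..T} t * (\<psi> t * measure M ({..t} \<inter> S)) \<partial>lborel)
        = \<Psi> T * measure M ({..T} \<inter> S) - (\<integral>s. \<Psi> s * indicator S s \<partial>M)"
      if M: "sets M = sets borel" "finite_measure M" "AE s in M. s \<in> {0..T}" and S: "S \<in> sets borel" for M :: "real measure" and S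
    proof -
      have "integrable M (\<lambda>s. \<Psi> T * indicator S s)"
        by (rule integrable_bounded_finite[OF M(2), where B = "\<bar>\<Psi> T\<bar>"])
           (use S M in \<open>auto cong: measurable_cong_sets split: split_indicator\<close>)
      moreover have "integrable M (\<lambda>s. \<Psi> s * indicator S s)"
        by (rule finite_measure.integrable_const_bound[OF M(2), of _ D])
           (use S M Psim D in \<open>auto cong: measurable_cong_sets split: split_indicator\<close>)
      ultimately have "(\<integral>s. (\<Psi> T - \<Psi> s) * indicator S s \<partial>M) = \<Psi> T * measure M S - (\<integral>s. \<Psi> s * indicator S s \<partial>M)"
        using sets_eq_imp_space_eq[OF M(1)] by (simp add: left_diff_distrib)
      moreover have "measure M S = measure M ({..T} \<inter> S)"
        by (rule measure_eq_AE) (use M S in auto)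
      ultimately show ?thesis using fubini_cut[OF M S psi Psi] by simp
    qed
    have "(\<integral>t. \<psi> t * (indicator {0..T} t * deficit w t) \<partial>lborel)
        = (\<integral>t. indicator {0..T} t * (\<psi> t * ?Q t) \<partial>lborel) + (\<integral>t. indicator {0..T} t * (\<psi> t * ?B t) \<partial>lborel)
          - (measure m0 {w<..} * (\<integral>t. indicator {0..T} t * \<psi> t \<partial>lborel) + (\<integral>t. indicator {0..T} t * (\<psi> t * ?A t) \<partial>lborel))"
      unfolding eq
      by (subst Bochner_Integration.integral_diff, (intro Bochner_Integration.integrable_add integrable_mult_right iQ iB iA iM)+,
          subst Bochner_Integration.integral_add[OF iQ iB],
          subst Bochner_Integration.integral_add[OF integrable_mult_right[OF iM] iA]) simp
    also have "\<dots> = \<Psi> T * deficit w T"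
      unfolding vQ vM fub[OF tau_sets tau_fin tau_T below_sets] fub[OF lam_sets lam_fin lam_T below_sets] deficit_def
      by (simp add: algebra_simps)
    finally have "(\<integral>t. \<psi> t * (indicator {0..T} t * deficit w t) \<partial>lborel) = \<Psi> T * deficit w T" .
    moreover
    have "integrable lborel (\<lambda>t. \<psi> t * (indicator {0..T} t * deficit w t))"
      unfolding eq using iQ iB iA iM by simp
    ultimately show ?thesis by (simp add: deficit_final)
  qed
  show "continuous_on UNIV \<psi> \<Longrightarrow> (\<integral>t. \<psi> t * (indicator {0..T} t * deficit w t) \<partial>lborel) = 0" using all by blast
  show "integrable lborel (\<lambda>t. indicator {0..T} t * deficit w t)" using all[of "\<lambda>_. 1"] by simp
qed

lemma AE_deficit_zero: "AE t in lborel. indicator {0..T} t * deficit w t = 0"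
proof (rule AE_zero_if_integral_atMost_zero[OF indicator_deficit_integrable])
  show "(\<integral>t. indicator {0..T} t * deficit w t \<partial>lborel) = 0"
    using integral_mult_deficit[of "\<lambda>_. 1" w] by simp
  fix c
  \<comment> \<open>For positive \<open>n\<close> this is 1 up to \<open>c\<close> and falls
    linearly to 0 at \<open>c + 1 / n\<close>: continuous functions approaching the indicator of
    \<open>{..c}\<close>.\<close>
  define \<psi> where "\<psi> n t = max 0 (min 1 (1 - real n * (t - c)))" for n t
  have "(\<lambda>n. \<integral>t. \<psi> n t * (indicator {0..T} t * deficit w t) \<partial>lborel)
      \<longlonglongrightarrow> (\<integral>t. indicator {..c} t * (indicator {0..T} t * deficit w t) \<partial>lborel)"
  proof (rule integral_dominated_convergence[where w = "\<lambda>t. \<bar>indicator {0..T} t * deficit w t\<bar>"])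
    have dm: "(\<lambda>t. indicator {0..T} t * deficit w t) \<in> borel_measurable borel"
      using borel_measurable_integrable[OF indicator_deficit_integrable] by simp
    show "integrable lborel (\<lambda>t. \<bar>indicator {0..T} t * deficit w t\<bar>)"
      by (intro integrable_abs indicator_deficit_integrable)
    show "(\<lambda>t. indicator {..c} t * (indicator {0..T} t * deficit w t)) \<in> borel_measurable lborel"
      using dm by simp
    have "\<psi> n \<in> borel_measurable borel" for n
      unfolding \<psi>_def by (intro borel_measurable_continuous_onI continuous_intros)
    then show "(\<lambda>t. \<psi> n t * (indicator {0..T} t * deficit w t)) \<in> borel_measurable lborel" for n
      using dm by simp
    have psi_lim: "(\<lambda>n. \<psi> n t) \<longlonglongrightarrow> indicator {..c} t" for t
    proof (cases "t \<le> c")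
      case True
      then have "\<psi> n t = 1" for n by (simp add: \<psi>_def mult_nonneg_nonpos)
      then show ?thesis using True by simp
    next
      case False
      then obtain n0 where n0: "1 / real (Suc n0) < t - c" using nat_approx_posE[of "t - c"] by auto
      have "\<psi> n t = 0" if "n \<ge> Suc n0" for n
      proof -
        have "1 < real (Suc n0) * (t - c)" using n0 by (simp add: divide_less_eq mult.commute del: of_nat_Suc)
        also have "\<dots> \<le> real n * (t - c)" using that False by (intro mult_right_mono) auto
        finally show ?thesis by (simp add: \<psi>_def)
      qed
      then have "(\<lambda>n. \<psi> n t) \<longlonglongrightarrow> 0" by (intro tendsto_eventually) (auto simp: eventually_sequentially)
      then show ?thesis using False by simp
    qed
    then show "AE t in lborel. (\<lambda>n. \<psi> n t * (indicator {0..T} t * deficit w t)) \<longlonglongrightarrow> indicator {..c} t * (indicator {0..T} t * deficit w t)"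
      by (intro always_eventually allI tendsto_mult tendsto_const)
    show "AE t in lborel. norm (\<psi> n t * (indicator {0..T} t * deficit w t)) \<le> \<bar>indicator {0..T} t * deficit w t\<bar>" for n
    proof (intro always_eventually allI)
      fix t
      have "\<bar>\<psi> n t\<bar> * \<bar>indicator {0..T} t * deficit w t\<bar> \<le> 1 * \<bar>indicator {0..T} t * deficit w t\<bar>"
        by (intro mult_right_mono) (auto simp: \<psi>_def)
      then show "norm (\<psi> n t * (indicator {0..T} t * deficit w t)) \<le> \<bar>indicator {0..T} t * deficit w t\<bar>"
        by (simp add: abs_mult)
    qed
  qed
  moreover have "(\<integral>t. \<psi> n t * (indicator {0..T} t * deficit w t) \<partial>lborel) = 0" for n
    unfolding \<psi>_def by (intro integral_mult_deficit continuous_intros)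
  ultimately have "(\<integral>t. indicator {..c} t * (indicator {0..T} t * deficit w t) \<partial>lborel) = 0"
    using LIMSEQ_unique[OF tendsto_const] by fastforce
  then show "(LINT t:{..c}|lborel. indicator {0..T} t * deficit w t) = 0"
    by (simp add: set_lebesgue_integral_def)
qed

text \<open>The index \<open>True\<close> stands for the mass on the arc, \<open>False\<close> for
  the mass that has crossed an end by time \<open>t\<close>; both are followed back to time 0.
  Labels of entering mass may lie below the arc, which makes sense because the field lives on the
  whole line.\<close>

definition final_labels :: "real \<Rightarrow> real measure" where
  "final_labels t = sum_distr UNIV borel (\<lambda>i. if i then N t else cut tau t)
     (\<lambda>i y. if i then Fl t y 0 else Fl y (Sup I) 0)"

definition initial_labels :: "real \<Rightarrow> real measure" where
  "initial_labels t = sum_distr UNIV borel (\<lambda>i. if i then m0 else cut lam t)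
     (\<lambda>i y. if i then y else Fl y (Inf I) 0)"

definition good :: "real \<Rightarrow> bool" where
  "good t \<longleftrightarrow> final_labels t = initial_labels t"

lemma label_maps_measurable:
  "(\<lambda>y. if i then Fl t y 0 else Fl y (Sup I) 0) \<in> measurable (if i then N t else cut tau t) borel"
  "(\<lambda>y. if i then y else Fl y (Inf I) 0) \<in> measurable (if i then m0 else cut lam t) borel"
  using Fl_measurable_point Fl_measurable_start
  by (cases i; simp cong: measurable_cong_sets)+

lemma label_measures_finite:
  "finite_measure (if i then N t else cut tau t)" "finite_measure (if i then m0 else cut lam t)"
  by (simp_all add: N_fin m0_fin finite_measure_cut tau_fin lam_fin)

lemma label_less_iff: "w < Fl t y 0 \<longleftrightarrow> Fl 0 w t < y"
  using Fl_shift_less_iff[of 0 w 0 t y] by simp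

lemma label_le_iff: "w \<le> Fl t y 0 \<longleftrightarrow> Fl 0 w t \<le> y"
proof -
  have "Fl t y 0 < w \<longleftrightarrow> y < Fl 0 w t" using Fl_less_iff[of t y 0 "Fl 0 w t"] by simp
  then show ?thesis by linarith
qed

text \<open>By monotonicity of the flow, a label exceeds \<open>w\<close> exactly when the mass is
  right of the characteristic from \<open>w\<close>. The two label measures of \<open>{w<..}\<close>
  are therefore the two halves of \<open>deficit w t\<close>.\<close>

lemma good_if_deficit_zero:
  assumes "\<And>w. w \<in> \<rat> \<Longrightarrow> deficit w t = 0"
  shows "good t"
  unfolding good_def
proof (rule measure_eqI_rat_greaterThan)
  show "finite_measure (final_labels t)" "finite_measure (initial_labels t)"
    unfolding final_labels_def initial_labels_def
    by (intro finite_measure_sum_distr label_maps_measurable label_measures_finite)+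
  fix w :: real assume w: "w \<in> \<rat>"
  have 1: "emeasure (final_labels t) {w<..} = emeasure (N t) {Fl 0 w t<..} + emeasure tau ({..t} \<inter> {s. Fl 0 w s < Sup I})"
  proof -
    have "(\<lambda>y. Fl t y 0) -` {w<..} = {Fl 0 w t<..}" "(\<lambda>s. Fl s (Sup I) 0) -` {w<..} = {s. Fl 0 w s < Sup I}"
      by (auto simp: label_less_iff)
    then show ?thesis
      unfolding final_labels_def
      by (subst emeasure_sum_distr[OF label_maps_measurable(1)])
         (simp_all add: UNIV_bool emeasure_cut below_sets Int_commute add.commute)
  qed
  have 2: "emeasure (initial_labels t) {w<..} = emeasure m0 {w<..} + emeasure lam ({..t} \<inter> {s. Fl 0 w s < Inf I})"
  proof -
    have "(\<lambda>y. y) -` {w<..} = {w<..}" "(\<lambda>s. Fl s (Inf I) 0) -` {w<..} = {s. Fl 0 w s < Inf I}"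
      by (auto simp: label_less_iff)
    then show ?thesis
      unfolding initial_labels_def
      by (subst emeasure_sum_distr[OF label_maps_measurable(2)])
         (simp_all add: UNIV_bool emeasure_cut below_sets Int_commute add.commute)
  qed
  show "emeasure (final_labels t) {w<..} = emeasure (initial_labels t) {w<..}"
    using assms[OF w] unfolding 1 2 deficit_def
    by (simp add: finite_measure.emeasure_eq_measure N_fin m0_fin tau_fin lam_fin flip: ennreal_plus)
qed (simp_all add: final_labels_def initial_labels_def)

lemma good_final: "good T"
  by (rule good_if_deficit_zero) (rule deficit_final)

lemma AE_good: "AE t in lborel. t \<in> {0..T} \<longrightarrow> good t"
proof -
  have "AE t in lborel. \<forall>w\<in>\<rat>. indicator {0..T} t * deficit w t = 0"
    using AE_deficit_zero by (subst AE_ball_countable) (auto intro: countable_rat)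
  then show ?thesis
  proof eventually_elim
    case (elim t)
    then show ?case by (auto intro!: good_if_deficit_zero)
  qed
qed

lemma good_dense:
  assumes "0 \<le> r" "r < T" "0 < e" obtains t where "r < t" "t < r + e" "t \<le> T" "good t"
proof -
  let ?d = "min T (r + e)"
  have "\<exists>t\<in>{r<..<?d}. good t"
  proof (rule ccontr)
    assume "\<not> (\<exists>t\<in>{r<..<?d}. good t)"
    moreover have "t \<in> {0..T}" if "t \<in> {r<..<?d}" for t using that assms by auto
    ultimately have "AE t in lborel. t \<notin> {r<..<?d}"
      using AE_good by (auto elim!: eventually_mono)
    then have "{r<..<?d} \<in> null_sets lborel" by (subst AE_iff_null_sets) auto
    then have "emeasure lborel {r<..<?d} = 0" by blast
    then show False using assms by simp
  qed
  then show thesis using that by force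
qed

lemma label_identity:
  fixes g :: "real \<Rightarrow> real"
  assumes "good t" and g: "g \<in> borel_measurable borel" and B: "\<And>w. \<bar>g w\<bar> \<le> B"
  shows "(\<integral>y. g (Fl t y 0) \<partial>N t) + (\<integral>s. indicator {..t} s * g (Fl s (Sup I) 0) \<partial>tau)
    = (\<integral>y. g y \<partial>m0) + (\<integral>s. indicator {..t} s * g (Fl s (Inf I) 0) \<partial>lam)"
proof -
  have gF: "(\<lambda>s. g (Fl s c 0)) \<in> borel_measurable borel" for c
    by (rule measurable_compose[OF Fl_measurable_start g])
  have "(\<integral>w. g w \<partial>final_labels t) = (\<integral>y. g (Fl t y 0) \<partial>N t) + (\<integral>s. indicator {..t} s * g (Fl s (Sup I) 0) \<partial>tau)"
    unfolding final_labels_def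
    by (subst integral_sum_distr[OF label_maps_measurable(1) label_measures_finite(1) g B])
       (simp_all add: UNIV_bool integral_cut gF)
  moreover have "(\<integral>w. g w \<partial>initial_labels t) = (\<integral>y. g y \<partial>m0) + (\<integral>s. indicator {..t} s * g (Fl s (Inf I) 0) \<partial>lam)"
    unfolding initial_labels_def
    by (subst integral_sum_distr[OF label_maps_measurable(2) label_measures_finite(2) g B])
       (simp_all add: UNIV_bool integral_cut gF)
  ultimately show ?thesis using assms(1) by (simp add: good_def)
qed

text \<open>Mass that has reached the end of the arc is gone at once, because \<open>N t\<close> does not charge the endpoint.\<close>

lemma AE_tau_not_waiting:
  assumes I: "bdd_above I" and r: "r \<in> {0..T}"
  shows "AE s in tau. r < s \<longrightarrow> Fl r (Sup I) s \<noteq> Sup I"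
proof -
  define w where "w = Fl r (Sup I) 0"
  have wF: "Fl 0 w t = Fl r (Sup I) t" for t by (simp add: w_def)
  let ?g = "indicator {w..} :: real \<Rightarrow> real"
  let ?c = "\<lambda>t. (\<integral>s. indicator {..t} s * ?g (Fl s (Sup I) 0) \<partial>tau)"
  \<comment> \<open>Labels of at least \<open>w\<close> belong to mass at or beyond the
    characteristic from the end at time \<open>r\<close>. After \<open>r\<close> no mass present has
    such a label, being strictly below the end, and no mass entering has one, as
    \<open>Inf I < Sup I\<close>. The outflow with these labels is therefore the same at all good
    times after \<open>r\<close>.\<close>
  have const: "?c t = (\<integral>y. ?g y \<partial>m0) + (\<integral>s. indicator {..r} s * ?g (Fl s (Inf I) 0) \<partial>lam)"
    if t: "good t" "r \<le> t" for t
  proof -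
    have "(\<integral>y. ?g (Fl t y 0) \<partial>N t) = (\<integral>y. 0 \<partial>N t)"
    proof (rule integral_cong_AE)
      show "AE y in N t. ?g (Fl t y 0) = 0"
        using N_I[of t] N_end[OF I, of t]
      proof eventually_elim
        case (elim y)
        then have "y < Sup I" using Sup_in[OF I] by force
        also have "Sup I \<le> Fl r (Sup I) t" using Fl_mono_time[OF t(2), of r "Sup I"] by simp
        finally have "\<not> w \<le> Fl t y 0" by (simp add: label_le_iff wF)
        then show ?case by simp
      qed
      show "(\<lambda>y. ?g (Fl t y 0)) \<in> borel_measurable (N t)"
        using measurable_compose[OF Fl_measurable_point[of t 0], of ?g] by (simp cong: measurable_cong_sets)
    qed simp
    moreover have "(\<integral>s. indicator {..t} s * ?g (Fl s (Inf I) 0) \<partial>lam) = (\<integral>s. indicator {..r} s * ?g (Fl s (Inf I) 0) \<partial>lam)"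
    proof (rule integral_cong_AE)
      have m: "(\<lambda>s. ?g (Fl s (Inf I) 0)) \<in> borel_measurable lam"
        using measurable_compose[OF Fl_measurable_start[of "Inf I" 0], of ?g] by (simp cong: measurable_cong_sets)
      show "(\<lambda>s. indicator {..t} s * ?g (Fl s (Inf I) 0)) \<in> borel_measurable lam"
        "(\<lambda>s. indicator {..r} s * ?g (Fl s (Inf I) 0)) \<in> borel_measurable lam"
        by (intro borel_measurable_times borel_measurable_indicator m; simp)+
      show "AE s in lam. indicator {..t} s * ?g (Fl s (Inf I) 0) = indicator {..r} s * ?g (Fl s (Inf I) 0)"
      proof (cases "bdd_below I")
        case True
        have "indicator {..t} s * ?g (Fl s (Inf I) 0) = indicator {..r} s * ?g (Fl s (Inf I) 0)" for s
        proof (cases "r < s")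
          case rs: True
          have "Inf I < Sup I" by (rule Inf_less[OF True I])
          also have "Sup I \<le> Fl r (Sup I) s" using Fl_mono_time[of r s r "Sup I"] rs by simp
          finally have "\<not> w \<le> Fl s (Inf I) 0" by (simp add: label_le_iff wF)
          then show ?thesis by simp
        next
          case False
          then show ?thesis using t(2) by (simp add: indicator_def)
        qed
        then show ?thesis by simp
      next
        case False
        then show ?thesis using lam_null by (auto elim: eventually_mono)
      qed
    qed
    ultimately show ?thesis
      using label_identity[OF t(1), of ?g 1] by (simp add: indicator_def)
  qed
  \<comment> \<open>Comparison of a good time \<open>t\<close> with \<open>T\<close>, which is good
    as well: the outflow with labels of at least \<open>w\<close> no longer changes in
    between.\<close>
  have gone: "AE s in tau. \<not> (t < s \<and> w \<le> Fl s (Sup I) 0)" if t: "good t" "r \<le> t" "t \<le> T" for t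
  proof -
    have m: "(\<lambda>s. ?g (Fl s (Sup I) 0)) \<in> borel_measurable tau"
      using measurable_compose[OF Fl_measurable_start[of "Sup I" 0], of ?g] by (simp cong: measurable_cong_sets)
    let ?h = "\<lambda>s. indicator {t<..T} s * ?g (Fl s (Sup I) 0)"
    have i: "integrable tau (\<lambda>s. indicator A s * ?g (Fl s (Sup I) 0))" if "A \<in> sets borel" for A
    proof (rule integrable_bounded_finite[OF tau_fin])
      show "(\<lambda>s. indicator A s * ?g (Fl s (Sup I) 0)) \<in> borel_measurable tau"
        by (intro borel_measurable_times borel_measurable_indicator m) (use that in simp)
      show "\<bar>indicator A s * ?g (Fl s (Sup I) 0)\<bar> \<le> 1" for s by (simp split: split_indicator)
    qed
    have "?h s = indicator {..T} s * ?g (Fl s (Sup I) 0) - indicator {..t} s * ?g (Fl s (Sup I) 0)" for s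
      using t(3) by (auto split: split_indicator)
    then have "(\<integral>s. ?h s \<partial>tau) = ?c T - ?c t" using i by simp
    also have "\<dots> = 0" using const[OF good_final] const[OF t(1,2)] r by simp
    finally have "AE s in tau. ?h s = 0"
      by (subst (asm) integral_nonneg_eq_0_iff_AE) (use i in auto)
    with tau_T show ?thesis
    proof eventually_elim
      case (elim s)
      then show ?case by (auto simp: indicator_def split: if_splits)
    qed
  qed
  show ?thesis
  proof (cases "r = T")
    case True
    show ?thesis using tau_T by eventually_elim (use True in auto)
  next
    case False
    then have rT: "r < T" using r by auto
    \<comment> \<open>\<open>r\<close> itself need not be good, so it is approached by good times
      from the right.\<close>
    have "\<exists>t. r < t \<and> t < r + 1 / real (Suc n) \<and> t \<le> T \<and> good t" for n
      by (rule good_dense[of r "1 / real (Suc n)"]) (use r rT in auto)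
    then obtain q where q: "\<And>n. r < q n" "\<And>n. q n < r + 1 / real (Suc n)" "\<And>n. q n \<le> T" "\<And>n::nat. good (q n)"
      by metis
    have "AE s in tau. \<forall>n. \<not> (q n < s \<and> w \<le> Fl s (Sup I) 0)"
      unfolding AE_all_countable by (intro allI gone[OF q(4) less_imp_le[OF q(1)] q(3)])
    then show ?thesis
    proof eventually_elim
      case (elim s)
      show ?case
      proof (intro impI notI)
        assume rs: "r < s" and eq: "Fl r (Sup I) s = Sup I"
        obtain n where "1 / real (Suc n) < s - r" using nat_approx_posE[of "s - r"] rs by auto
        then have "q n < s" using q(2)[of n] by linarith
        moreover have "w \<le> Fl s (Sup I) 0" by (simp add: label_le_iff wF eq)
        ultimately show False using elim by blast
      qed
    qed
  qed
qed

text \<open>The infimum is that of a nonempty set because \<open>T\<close> is inserted; when the end is not reached before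
  \<open>T\<close> the value is irrelevant.\<close>

definition hit :: "real \<Rightarrow> real" where
  "hit w = Inf (insert T {r \<in> {0..T}. Sup I \<le> Fl 0 w r})"

text \<open>A larger label reaches the end no later, so \<open>- hit\<close> is monotone.\<close>

lemma hit_measurable: "hit \<in> borel_measurable borel"
proof -
  have "mono (\<lambda>w. - hit w)"
  proof (rule monoI)
    fix w z :: real assume "w \<le> z"
    then have "Fl 0 w r \<le> Fl 0 z r" for r by (simp add: Fl_le_iff)
    then have "hit z \<le> hit w"
      unfolding hit_def
      by (intro cInf_superset_mono) (auto intro: order_trans bdd_belowI[of _ 0] simp: less_imp_le[OF T_pos])
    then show "- hit w \<le> - hit z" by simp
  qed
  from borel_measurable_uminus[OF borel_measurable_mono[OF this]] show ?thesis by simp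
qed

lemma hit_eq:
  assumes "0 \<le> e" "e \<le> T" "Sup I \<le> Fl s y e" "\<And>r. 0 \<le> r \<Longrightarrow> r < e \<Longrightarrow> Fl s y r < Sup I"
  shows "hit (Fl s y 0) = e"
  unfolding hit_def
proof (rule cInf_eq_minimum)
  show "e \<in> insert T {r \<in> {0..T}. Sup I \<le> Fl 0 (Fl s y 0) r}" using assms by simp
  show "e \<le> x" if "x \<in> insert T {r \<in> {0..T}. Sup I \<le> Fl 0 (Fl s y 0) r}" for x
    using that assms(2) assms(4)[of x] by force
qed

text \<open>Were the end reached before \<open>s\<close>, the trajectory would rest there until
  \<open>s\<close> by monotonicity, in particular from some rational time on.
  \<open>AE_tau_not_waiting\<close> excludes this for almost every \<open>s\<close>, simultaneously
  for the countably many rational times.\<close>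

lemma AE_tau_hit:
  assumes I: "bdd_above I"
  shows "AE s in tau. hit (Fl s (Sup I) 0) = s"
proof -
  have "AE s in tau. \<forall>r\<in>\<rat> \<inter> {0..T}. r < s \<longrightarrow> Fl r (Sup I) s \<noteq> Sup I"
    using AE_tau_not_waiting[OF I] countable_rat by (subst AE_ball_countable) (auto intro: countable_Int1)
  with tau_T show ?thesis
  proof eventually_elim
    case (elim s)
    show ?case
    proof (rule hit_eq)
      fix r assume r: "0 \<le> r" "r < s"
      show "Fl s (Sup I) r < Sup I"
      proof (rule ccontr)
        assume "\<not> Fl s (Sup I) r < Sup I"
        then have ge: "Sup I \<le> Fl s (Sup I) r" by simp
        obtain q where q: "q \<in> \<rat>" "r < q" "q < s" using Rats_dense_in_real[OF r(2)] by auto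
        have "Fl s (Sup I) q = Sup I"
          using ge Fl_mono_time[of r q s "Sup I"] Fl_mono_time[of q s s "Sup I"] q by simp
        then have "Fl q (Sup I) s = Sup I" using Fl_comp[of q s "Sup I" s] by simp
        moreover have "q \<in> \<rat> \<inter> {0..T}" using q r elim by auto
        ultimately show False using elim q by blast
      qed
    qed (use elim in auto)
  qed
qed

text \<open>The observable written as a function of the label alone, so that it can be integrated
  against both label measures.\<close>

definition state :: "real \<Rightarrow> (real \<Rightarrow> real) \<Rightarrow> (real \<Rightarrow> real) \<Rightarrow> real \<Rightarrow> real" where
  "state t \<phi> \<gamma> w = (if bdd_above I \<and> Sup I \<le> Fl 0 w t then \<gamma> (hit w) else \<phi> (Fl 0 w t))"

lemma state_measurable:
  assumes "\<phi> \<in> borel_measurable borel" "\<gamma> \<in> borel_measurable borel"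
  shows "state t \<phi> \<gamma> \<in> borel_measurable borel"
proof -
  note [measurable] = Fl_measurable_point[of 0 t]
    measurable_compose[OF Fl_measurable_point[of 0 t] assms(1)] measurable_compose[OF hit_measurable assms(2)]
  show ?thesis unfolding state_def by measurable
qed

text \<open>\<open>label_identity\<close> applied to \<open>state\<close>. Mass present is strictly
  below the end and yields \<open>\<phi>\<close>; mass that leaves at \<open>s\<close> has
  \<open>s\<close> as its first hitting time, up to a null set, and yields
  \<open>\<gamma> s\<close>.\<close>

theorem arc_identity:
  assumes good: "good t" and phi: "\<phi> \<in> borel_measurable borel" "\<And>y. \<bar>\<phi> y\<bar> \<le> B"
    and gam: "\<gamma> \<in> borel_measurable borel" "\<And>s. \<bar>\<gamma> s\<bar> \<le> B"
  shows "(\<integral>y. \<phi> y \<partial>N t) + (\<integral>s. indicator {..t} s * \<gamma> s \<partial>tau)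
    = (\<integral>y. state t \<phi> \<gamma> y \<partial>m0) + (\<integral>s. indicator {..t} s * state t \<phi> \<gamma> (Fl s (Inf I) 0) \<partial>lam)"
proof -
  let ?g = "state t \<phi> \<gamma>"
  have gm: "?g \<in> borel_measurable borel" by (rule state_measurable[OF phi(1) gam(1)])
  have "\<bar>?g w\<bar> \<le> B" for w using phi(2) gam(2) by (simp add: state_def)
  note id = label_identity[OF good gm this]
  have 1: "(\<integral>y. ?g (Fl t y 0) \<partial>N t) = (\<integral>y. \<phi> y \<partial>N t)"
  proof (rule integral_cong_AE)
    show "(\<lambda>y. ?g (Fl t y 0)) \<in> borel_measurable (N t)" "\<phi> \<in> borel_measurable (N t)"
      using measurable_compose[OF Fl_measurable_point gm] phi(1) by (simp_all cong: measurable_cong_sets)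
    show "AE y in N t. ?g (Fl t y 0) = \<phi> y"
    proof (cases "bdd_above I")
      case True
      show ?thesis
        using N_I[of t] N_end[OF True, of t]
      proof eventually_elim
        case (elim y)
        then have "y < Sup I" using Sup_in[OF True] by force
        then show ?case by (simp add: state_def)
      qed
    qed (simp add: state_def)
  qed
  have 2: "(\<integral>s. indicator {..t} s * ?g (Fl s (Sup I) 0) \<partial>tau) = (\<integral>s. indicator {..t} s * \<gamma> s \<partial>tau)"
  proof (rule integral_cong_AE)
    show "(\<lambda>s. indicator {..t} s * ?g (Fl s (Sup I) 0)) \<in> borel_measurable tau"
      "(\<lambda>s. indicator {..t} s * \<gamma> s) \<in> borel_measurable tau"
      using measurable_compose[OF Fl_measurable_start gm] gam(1) by (simp_all cong: measurable_cong_sets)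
    show "AE s in tau. indicator {..t} s * ?g (Fl s (Sup I) 0) = indicator {..t} s * \<gamma> s"
    proof (cases "bdd_above I")
      case True
      show ?thesis
        using AE_tau_hit[OF True]
      proof eventually_elim
        case (elim s)
        have "Sup I \<le> Fl s (Sup I) t" if "s \<le> t" using Fl_mono_time[OF that, of s "Sup I"] by simp
        then show ?case using elim True by (auto simp: state_def split: split_indicator)
      qed
    next
      case False
      then show ?thesis using tau_null by (auto elim: eventually_mono)
    qed
  qed
  show ?thesis using id unfolding 1 2 .
qed

end

section \<open>Paths and trajectories in a network\<close>

text \<open>The nearest-point projection onto a closed interval, bounded or not, and hence
  1-Lipschitz.\<close>

definition clamp_to :: "real set \<Rightarrow> real \<Rightarrow> real" where
  "clamp_to I y = (let z = (if bdd_above I then min (Sup I) y else y) in if bdd_below I then max (Inf I) z else z)"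

lemma first_hitting:
  fixes f :: "real \<Rightarrow> real"
  assumes c: "continuous_on {s..T} f" and s: "f s \<le> b" and r: "r \<in> {s..T}" "b \<le> f r"
  shows "\<exists>e\<in>{s..T}. f e = b \<and> (\<forall>q\<in>{s..<e}. f q < b) \<and> e \<le> r"
proof -
  let ?S = "{s..T} \<inter> f -` {b..}"
  have cl: "closed ?S" by (rule continuous_closed_preimage[OF c]) auto
  have ne: "?S \<noteq> {}" using r by auto
  have bb: "bdd_below ?S" by (rule bdd_belowI[of _ s]) auto
  define e where "e = Inf ?S"
  have e: "e \<in> ?S" unfolding e_def by (rule closed_contains_Inf[OF ne bb cl])
  have lt: "f q < b" if "q \<in> {s..<e}" for q
  proof (rule ccontr)
    assume "\<not> f q < b"
    then have "q \<in> ?S" using that e by auto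
    then have "e \<le> q" unfolding e_def by (intro cInf_lower bb)
    then show False using that by simp
  qed
  have "f e = b"
  proof (rule ccontr)
    assume "f e \<noteq> b"
    then have gt: "b < f e" using e by auto
    then have "s < e" using s e by (cases "s = e") auto
    have "\<exists>x\<ge>s. x \<le> e \<and> f x = b"
      by (rule IVT') (use s gt \<open>s < e\<close> e c in \<open>auto intro: continuous_on_subset\<close>)
    then obtain x where x: "s \<le> x" "x \<le> e" "f x = b" by blast
    then have "x \<noteq> e" using gt by auto
    then show False using lt[of x] x by auto
  qed
  moreover have "e \<le> r" unfolding e_def by (rule cInf_lower[OF _ bb]) (use r in auto)
  ultimately show ?thesis using e lt by auto
qed

section \<open>The geometry of arcs and paths\<close>

locale network =
  fixes G :: "('j, 'a::euclidean_space) network"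
  assumes net: "oriented_network G"
begin

abbreviation "lo j \<equiv> Inf (pdom G j)"
abbreviation "hi j \<equiv> Sup (pdom G j)"
abbreviation "has_lo j \<equiv> bdd_below (pdom G j)"
abbreviation "has_hi j \<equiv> bdd_above (pdom G j)"

lemma finite_arcs: "finite (arcs G)" and finite_verts: "finite (verts G)"
  using net by (auto simp: oriented_network_def)

lemma pdom_cases:
  assumes "j \<in> arcs G"
  obtains (bounded) l where "l > 0" "pdom G j = {0..l}" "has_lo j" "has_hi j" "lo j = 0" "hi j = l"
  | (incoming) "pdom G j = {..0}" "\<not> has_lo j" "has_hi j" "hi j = 0"
  | (outgoing) "pdom G j = {0..}" "has_lo j" "\<not> has_hi j" "lo j = 0"
proof -
  have "(\<exists>l>0. pdom G j = {0..l}) \<or> pdom G j = {..0} \<or> pdom G j = {0..}"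
    using net assms by (auto simp: oriented_network_def)
  then consider l where "l > 0" "pdom G j = {0..l}" | "pdom G j = {..0}" | "pdom G j = {0..}" by blast
  then show thesis
  proof cases
    case 2
    have "\<not> bdd_below {..(0::real)}"
    proof
      assume "bdd_below {..(0::real)}"
      then obtain b where b: "\<forall>x\<in>{..(0::real)}. b \<le> x" by (auto simp only: bdd_below_def)
      have "min b 0 - 1 \<in> {..(0::real)}" by simp
      with b have "b \<le> min b 0 - 1" by blast
      then show False by linarith
    qed
    then show thesis using 2 that(2) by simp
  next
    case 3
    have "\<not> bdd_above {(0::real)..}"
    proof
      assume "bdd_above {(0::real)..}"
      then obtain b where b: "\<forall>x\<in>{(0::real)..}. x \<le> b" by (auto simp only: bdd_above_def)
      have "max b 0 + 1 \<in> {(0::real)..}" by simp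
      with b have "max b 0 + 1 \<le> b" by blast
      then show False by linarith
    qed
    then show thesis using 3 that(3) by simp
  qed (auto intro: that(1))
qed

lemma pdom_iff: "j \<in> arcs G \<Longrightarrow> y \<in> pdom G j \<longleftrightarrow> (has_lo j \<longrightarrow> lo j \<le> y) \<and> (has_hi j \<longrightarrow> y \<le> hi j)"
  by (cases j rule: pdom_cases) auto

lemma lo_less_hi: "j \<in> arcs G \<Longrightarrow> has_lo j \<Longrightarrow> has_hi j \<Longrightarrow> lo j < hi j"
  by (cases j rule: pdom_cases) auto

lemma lo_in: "j \<in> arcs G \<Longrightarrow> has_lo j \<Longrightarrow> lo j \<in> pdom G j"
  using lo_less_hi[of j] by (auto simp: pdom_iff)

lemma hi_in: "j \<in> arcs G \<Longrightarrow> has_hi j \<Longrightarrow> hi j \<in> pdom G j"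
  using lo_less_hi[of j] by (auto simp: pdom_iff)

lemma below_or_above: "j \<in> arcs G \<Longrightarrow> has_lo j \<or> has_hi j"
  by (cases j rule: pdom_cases) auto

lemma clamp_to_in: "j \<in> arcs G \<Longrightarrow> clamp_to (pdom G j) y \<in> pdom G j"
  using lo_less_hi[of j] by (auto simp: pdom_iff clamp_to_def Let_def)

lemma clamp_to_id: "j \<in> arcs G \<Longrightarrow> y \<in> pdom G j \<Longrightarrow> clamp_to (pdom G j) y = y"
  by (auto simp: pdom_iff clamp_to_def Let_def)

lemma clamp_to_lip: "j \<in> arcs G \<Longrightarrow> \<bar>clamp_to (pdom G j) y - clamp_to (pdom G j) z\<bar> \<le> \<bar>y - z\<bar>"
  by (auto simp: clamp_to_def Let_def)

lemma par_inj: "j \<in> arcs G \<Longrightarrow> inj_on (par G j) (pdom G j)"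
  using net by (auto simp: oriented_network_def)

lemma arc_end_vertex:
  "j \<in> arcs G \<Longrightarrow> has_lo j \<Longrightarrow> par G j (lo j) \<in> verts G" "j \<in> arcs G \<Longrightarrow> has_hi j \<Longrightarrow> par G j (hi j) \<in> verts G"
  using net by (auto simp: oriented_network_def)

lemma Out_nonempty: "x \<in> verts G \<Longrightarrow> Out G x \<noteq> {}"
  using net by (auto simp: oriented_network_def)

lemma min_length: "\<exists>d>0. \<forall>j\<in>arcs G. has_lo j \<longrightarrow> has_hi j \<longrightarrow> d \<le> hi j - lo j"
proof -
  \<comment> \<open>The inserted 1 keeps the minimum defined if no arc is bounded.\<close>
  let ?S = "insert 1 ((\<lambda>j. hi j - lo j) ` {j \<in> arcs G. has_lo j \<and> has_hi j})"
  have "finite ?S" using finite_arcs by simp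
  then have "Min ?S > 0" using lo_less_hi by (subst Min_gr_iff) auto
  moreover have "Min ?S \<le> hi j - lo j" if "j \<in> arcs G" "has_lo j" "has_hi j" for j
    using that finite_arcs by (intro Min_le) auto
  ultimately show ?thesis by blast
qed

definition succs :: "'j \<Rightarrow> 'j set" where
  "succs j = {k. \<exists>x\<in>verts G. j \<in> Inc G x \<and> k \<in> Out G x}"

lemma succsD:
  assumes "k \<in> succs j"
  shows "k \<in> arcs G" "has_lo k" "has_hi j" "j \<in> arcs G" "par G k (lo k) = par G j (hi j)"
  using assms by (auto simp: succs_def Out_def Inc_def)

lemma succs_eq: "j \<in> arcs G \<Longrightarrow> has_hi j \<Longrightarrow> succs j = Out G (par G j (hi j))"
  using arc_end_vertex(2) by (auto simp: succs_def Inc_def)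

lemma succs_nonempty: "j \<in> arcs G \<Longrightarrow> has_hi j \<Longrightarrow> succs j \<noteq> {}"
  using succs_eq Out_nonempty arc_end_vertex(2) by metis

lemma finite_succs: "finite (succs j)"
  using finite_subset[OF _ finite_arcs, of "succs j"] succsD(1) by blast

lemma pathsD:
  assumes "\<gamma> \<in> paths G j"
  shows "\<gamma> 0 = j" "\<gamma> i \<in> arcs G" "has_hi (\<gamma> i) \<Longrightarrow> \<gamma> (Suc i) \<in> succs (\<gamma> i)" "\<not> has_hi (\<gamma> i) \<Longrightarrow> \<gamma> (Suc i) = \<gamma> i"
  using assms by (auto simp: paths_def succs_def split: if_splits)

lemma pathsI:
  assumes "\<gamma> 0 = j" "\<And>i. \<gamma> i \<in> arcs G" "\<And>i. has_hi (\<gamma> i) \<Longrightarrow> \<gamma> (Suc i) \<in> succs (\<gamma> i)"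
    "\<And>i. \<not> has_hi (\<gamma> i) \<Longrightarrow> \<gamma> (Suc i) = \<gamma> i"
  shows "\<gamma> \<in> paths G j"
  using assms by (auto simp: paths_def succs_def)

lemma paths_tail: "\<gamma> \<in> paths G j \<Longrightarrow> \<gamma> \<circ> Suc \<in> paths G (\<gamma> (Suc 0))"
  by (intro pathsI) (auto dest: pathsD)

lemma paths_cons:
  assumes "j \<in> arcs G" "has_hi j" "k \<in> succs j" "\<gamma> \<in> paths G k"
  shows "case_nat j \<gamma> \<in> paths G j"
  by (intro pathsI) (use assms pathsD[OF assms(4)] in \<open>auto split: nat.splits\<close>)

lemma paths_nonempty: "j \<in> arcs G \<Longrightarrow> paths G j \<noteq> {}"
proof -
  assume j: "j \<in> arcs G"
  define f where "f k = (if has_hi k then SOME k'. k' \<in> succs k else k)" for k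
  have f: "has_hi k \<Longrightarrow> f k \<in> succs k" "\<not> has_hi k \<Longrightarrow> f k = k" if "k \<in> arcs G" for k
    using succs_nonempty[OF that] by (auto simp: f_def some_in_eq)
  have arcs: "(f ^^ i) j \<in> arcs G" for i
  proof (induction i)
    case (Suc i)
    then show ?case using f succsD(1) by (cases "has_hi ((f ^^ i) j)") auto
  qed (use j in simp)
  have "(\<lambda>i. (f ^^ i) j) \<in> paths G j" by (rule pathsI) (use arcs f in auto)
  then show ?thesis by blast
qed

lemma path_below: "\<gamma> \<in> paths G j \<Longrightarrow> \<forall>i\<le>k. has_hi (\<gamma> i) \<Longrightarrow> has_lo (\<gamma> (Suc k))"
  using succsD(2)[OF pathsD(3)[of \<gamma> j k]] by auto

lemma arc_end_0: "arc_end G \<gamma> y 0 = (if has_hi (\<gamma> 0) then ereal (hi (\<gamma> 0) - y) else \<infinity>)"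
  by (simp add: arc_end_def)

lemma arc_end_Suc:
  assumes "has_hi (\<gamma> 0)"
  shows "arc_end G \<gamma> y (Suc k) = ereal (hi (\<gamma> 0) - y) + arc_end G (\<gamma> \<circ> Suc) (lo (\<gamma> (Suc 0))) k"
proof -
  have all: "(\<forall>i\<le>Suc k. has_hi (\<gamma> i)) \<longleftrightarrow> (\<forall>i\<le>k. has_hi (\<gamma> (Suc i)))"
    using assms by (metis Suc_le_mono le0 not0_implies_Suc)
  have "(\<Sum>i=1..Suc k. hi (\<gamma> i) - lo (\<gamma> i)) = (hi (\<gamma> (Suc 0)) - lo (\<gamma> (Suc 0))) + (\<Sum>i=1..k. hi (\<gamma> (Suc i)) - lo (\<gamma> (Suc i)))"
  proof -
    have "(\<Sum>i=1..Suc k. hi (\<gamma> i) - lo (\<gamma> i)) = (hi (\<gamma> 1) - lo (\<gamma> 1)) + (\<Sum>i=Suc 1..Suc k. hi (\<gamma> i) - lo (\<gamma> i))"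
      by (rule sum.atLeast_Suc_atMost) simp
    also have "(\<Sum>i=Suc 1..Suc k. hi (\<gamma> i) - lo (\<gamma> i)) = (\<Sum>i=1..k. hi (\<gamma> (Suc i)) - lo (\<gamma> (Suc i)))"
      by (rule sum.shift_bounds_cl_Suc_ivl)
    finally show ?thesis by simp
  qed
  then show ?thesis using all by (simp add: arc_end_def)
qed

text \<open>Either some arc of the path is unbounded, or infinitely many arcs have at least the
  minimal length. This is what makes the \<open>LEAST\<close> in \<open>arc_index\<close> an
  attained minimum.\<close>

lemma arc_end_unbounded:
  assumes "\<gamma> \<in> paths G j" "y \<in> pdom G j"
  shows "\<exists>k. ereal r < arc_end G \<gamma> y k"
proof (cases "\<forall>i. has_hi (\<gamma> i)")
  case False
  then obtain k where "\<not> has_hi (\<gamma> k)" by auto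
  then have "arc_end G \<gamma> y k = \<infinity>" by (auto simp: arc_end_def)
  then show ?thesis by (intro exI[of _ k]) simp
next
  case True
  obtain d where d0: "d > 0" and d1: "\<forall>j\<in>arcs G. has_lo j \<longrightarrow> has_hi j \<longrightarrow> d \<le> hi j - lo j"
    using min_length by auto
  note d = d0 d1[rule_format]
  obtain k where k: "\<bar>r\<bar> + 1 < real k * d" using reals_Archimedean3[OF d(1)] by blast
  have "real k * d = (\<Sum>i=1..k. d)" by simp
  also have "\<dots> \<le> (\<Sum>i=1..k. hi (\<gamma> i) - lo (\<gamma> i))"
  proof (rule sum_mono)
    fix i assume "i \<in> {1..k}"
    then obtain i' where "i = Suc i'" by (cases i) auto
    then show "d \<le> hi (\<gamma> i) - lo (\<gamma> i)"
      using d(2)[OF pathsD(2)[OF assms(1)]] path_below[OF assms(1), of i'] True by auto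
  qed
  finally have "real k * d \<le> (\<Sum>i=1..k. hi (\<gamma> i) - lo (\<gamma> i))" .
  moreover have "y \<le> hi (\<gamma> 0)"
    using assms(2) pathsD(1)[OF assms(1)] True pdom_iff pathsD(2)[OF assms(1)] by metis
  ultimately have "r < hi (\<gamma> 0) - y + (\<Sum>i=1..k. hi (\<gamma> i) - lo (\<gamma> i))" using k by linarith
  then show ?thesis using True by (intro exI[of _ k]) (simp add: arc_end_def)
qed

lemma arc_index_first:
  assumes "ereal r < arc_end G \<gamma> y 0"
  shows "arc_index G \<gamma> y r = 0" "arc_param G \<gamma> y r = y + r"
proof -
  show "arc_index G \<gamma> y r = 0" unfolding arc_index_def by (rule Least_eq_0) (rule assms)
  then show "arc_param G \<gamma> y r = y + r" by (simp add: arc_param_def)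
qed

text \<open>Beyond the first junction a path looks like its tail, with distances shifted by the
  length of the first arc. Every recursion on paths rests on this.\<close>

lemma arc_index_later:
  assumes g: "\<gamma> \<in> paths G j" and y: "y \<in> pdom G j" and ab: "has_hi j" and r: "hi j - y \<le> r"
  shows "arc_index G \<gamma> y r = Suc (arc_index G (\<gamma> \<circ> Suc) (lo (\<gamma> (Suc 0))) (r - (hi j - y)))"
    and "arc_param G \<gamma> y r = arc_param G (\<gamma> \<circ> Suc) (lo (\<gamma> (Suc 0))) (r - (hi j - y))"
proof -
  let ?d = "hi j - y" and ?g = "\<gamma> \<circ> Suc" and ?a = "lo (\<gamma> (Suc 0))"
  have g0: "\<gamma> 0 = j" using pathsD(1)[OF g] .
  have S: "ereal r < arc_end G \<gamma> y (Suc m) \<longleftrightarrow> ereal (r - ?d) < arc_end G ?g ?a m" for m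
    using arc_end_Suc[of \<gamma> y m] ab g0
    by (cases "arc_end G ?g ?a m") (auto simp: algebra_simps)
  obtain k where "ereal r < arc_end G \<gamma> y k" using arc_end_unbounded[OF g y] by blast
  moreover have "\<not> ereal r < arc_end G \<gamma> y 0" using r ab g0 by (simp add: arc_end_0)
  ultimately have "(LEAST k. ereal r < arc_end G \<gamma> y k) = Suc (LEAST m. ereal r < arc_end G \<gamma> y (Suc m))"
    by (rule Least_Suc)
  then show idx: "arc_index G \<gamma> y r = Suc (arc_index G ?g ?a (r - ?d))"
    by (simp add: arc_index_def S)
  show "arc_param G \<gamma> y r = arc_param G ?g ?a (r - ?d)"
  proof (cases "arc_index G ?g ?a (r - ?d)")
    case 0
    then show ?thesis using idx ab g0 by (simp add: arc_param_def arc_end_0)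
  next
    case (Suc m)
    have "\<not> ereal (r - ?d) < arc_end G ?g ?a m"
      using not_less_Least[of m "\<lambda>k. ereal (r - ?d) < arc_end G ?g ?a k"] Suc by (simp add: arc_index_def)
    then obtain c where "arc_end G ?g ?a m = ereal c" by (auto simp: arc_end_def split: if_splits)
    then show ?thesis using idx Suc ab g0 arc_end_Suc[of \<gamma> y m] by (simp add: arc_param_def)
  qed
qed

lemma arc_param_in:
  assumes g: "\<gamma> \<in> paths G j" and y: "y \<in> pdom G j" and r: "0 \<le> r"
  shows "arc_param G \<gamma> y r \<in> pdom G (\<gamma> (arc_index G \<gamma> y r))"
proof -
  obtain k where "ereal r < arc_end G \<gamma> y k" using arc_end_unbounded[OF g y] by blast
  then have lt: "ereal r < arc_end G \<gamma> y (arc_index G \<gamma> y r)" unfolding arc_index_def by (rule LeastI)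
  show ?thesis
  proof (cases "arc_index G \<gamma> y r")
    case 0
    then show ?thesis using lt y r pathsD(1)[OF g] pathsD(2)[OF g, of 0]
      by (auto simp: arc_param_def arc_end_0 pdom_iff split: if_splits)
  next
    case (Suc m)
    have "\<not> ereal r < arc_end G \<gamma> y m"
      using not_less_Least[of m "\<lambda>k. ereal r < arc_end G \<gamma> y k"] Suc by (simp add: arc_index_def)
    then have fin: "\<forall>i\<le>m. has_hi (\<gamma> i)"
      and le: "hi (\<gamma> 0) - y + (\<Sum>i=1..m. hi (\<gamma> i) - lo (\<gamma> i)) \<le> r"
      by (auto simp: arc_end_def split: if_splits)
    have "has_hi (\<gamma> (Suc m)) \<Longrightarrow> \<forall>i\<le>Suc m. has_hi (\<gamma> i)" using fin by (auto simp: le_Suc_eq)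
    then show ?thesis
      using lt Suc fin le pathsD(2)[OF g, of "Suc m"]
      by (auto simp: arc_param_def pdom_iff arc_end_def split: if_splits)
  qed
qed

lemma path_point_first: "ereal r < arc_end G \<gamma> y 0 \<Longrightarrow> path_point G \<gamma> y r = par G (\<gamma> 0) (y + r)"
  by (simp add: path_point_def arc_index_first)

lemma path_point_later:
  "\<gamma> \<in> paths G j \<Longrightarrow> y \<in> pdom G j \<Longrightarrow> has_hi j \<Longrightarrow> hi j - y \<le> r \<Longrightarrow>
    path_point G \<gamma> y r = path_point G (\<gamma> \<circ> Suc) (lo (\<gamma> (Suc 0))) (r - (hi j - y))"
  by (simp add: path_point_def arc_index_later)

end

text \<open>\<open>u\<close> agrees with the velocity of the solution on the arcs and for times in
  \<open>{0..T}\<close>; elsewhere it is an arbitrary extension within the class of transport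
  fields.\<close>

locale network_flow = network G
  for G :: "('j, 'a::euclidean_space) network" +
  fixes T V K :: real and v :: "'a measure \<Rightarrow> 'j \<Rightarrow> real \<Rightarrow> real"
    and \<nu> :: "real \<Rightarrow> 'j \<Rightarrow> real measure" and p :: "'j \<Rightarrow> 'j \<Rightarrow> real \<Rightarrow> real"
    and u :: "'j \<Rightarrow> real \<Rightarrow> real \<Rightarrow> real"
  assumes T_pos: "0 < T" and V_pos: "0 < V"
    and field: "j \<in> arcs G \<Longrightarrow> transport_field (u j) V K"
    and u_eq: "j \<in> arcs G \<Longrightarrow> t \<in> {0..T} \<Longrightarrow> y \<in> pdom G j \<Longrightarrow> u j t y = v (glue G (\<nu> t)) j y"
    and p_sum: "j \<in> arcs G \<Longrightarrow> has_hi j \<Longrightarrow> t \<in> {0..T} \<Longrightarrow> (\<Sum>k\<in>succs j. p j k t) = 1"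
    and p_nonneg: "j \<in> arcs G \<Longrightarrow> k \<in> arcs G \<Longrightarrow> t \<in> {0..T} \<Longrightarrow> 0 \<le> p j k t"
begin

abbreviation "X j \<equiv> transport_field.Fl (u j)"

text \<open>\<open>X\<close> is the flow of the extended field and passes the end of the arc, so
  exits are read off from its first hitting of the maximal parameter.\<close>

definition exits :: "'j \<Rightarrow> real \<Rightarrow> real \<Rightarrow> real \<Rightarrow> bool" where
  "exits j y s e \<longleftrightarrow> has_hi j \<and> s \<le> e \<and> e \<le> T \<and> X j s y e = hi j \<and> (\<forall>r\<in>{s..<e}. X j s y r < hi j)"

definition stays :: "'j \<Rightarrow> real \<Rightarrow> real \<Rightarrow> bool" where
  "stays j y s \<longleftrightarrow> (\<forall>r\<in>{s..T}. has_hi j \<longrightarrow> X j s y r < hi j)"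

lemma X_start: "j \<in> arcs G \<Longrightarrow> X j s y s = y"
  and X_mono: "j \<in> arcs G \<Longrightarrow> r \<le> t \<Longrightarrow> X j s y r \<le> X j s y t"
  and X_speed: "j \<in> arcs G \<Longrightarrow> r \<le> t \<Longrightarrow> X j s y t - X j s y r \<le> V * (t - r)"
  and X_cont: "j \<in> arcs G \<Longrightarrow> continuous_on A (X j s y)"
  using transport_field.Fl_start[OF field] transport_field.Fl_mono_time[OF field]
    transport_field.Fl_speed[OF field] transport_field.Fl_continuous[OF field] by auto

lemma stays_or_exits:
  assumes "j \<in> arcs G" "y \<in> pdom G j"
  shows "stays j y s \<or> (\<exists>e. exits j y s e)"
proof (rule disjCI)
  assume "\<not> (\<exists>e. exits j y s e)"
  show "stays j y s"
    unfolding stays_def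
  proof (intro ballI impI)
    fix r assume r: "r \<in> {s..T}" and hi: "has_hi j"
    show "X j s y r < hi j"
    proof (rule ccontr)
      assume "\<not> X j s y r < hi j"
      then have "\<exists>e\<in>{s..T}. X j s y e = hi j \<and> (\<forall>q\<in>{s..<e}. X j s y q < hi j) \<and> e \<le> r"
        by (intro first_hitting X_cont) (use assms r hi X_start pdom_iff in auto)
      then show False using \<open>\<not> (\<exists>e. exits j y s e)\<close> hi by (auto simp: exits_def)
    qed
  qed
qed

lemma exits_in: "exits j y s e \<Longrightarrow> s \<in> {0..T} \<Longrightarrow> e \<in> {0..T}"
  by (auto simp: exits_def)

text \<open>Each full arc takes a time bounded below, so at most finitely many exits occur up to time \<open>T\<close>.\<close>

lemma hop_induct [consumes 3, case_names stays exits]: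
  assumes "j \<in> arcs G" "y \<in> pdom G j" "s \<in> {0..T}"
    and stays: "\<And>j y s. j \<in> arcs G \<Longrightarrow> y \<in> pdom G j \<Longrightarrow> s \<in> {0..T} \<Longrightarrow> stays j y s \<Longrightarrow> P j y s"
    and exits: "\<And>j y s e. j \<in> arcs G \<Longrightarrow> y \<in> pdom G j \<Longrightarrow> s \<in> {0..T} \<Longrightarrow> exits j y s e \<Longrightarrow>
        (\<And>k. k \<in> succs j \<Longrightarrow> P k (lo k) e) \<Longrightarrow> P j y s"
  shows "P j y s"
proof -
  obtain d where d0: "d > 0" and d1: "\<forall>j\<in>arcs G. has_lo j \<longrightarrow> has_hi j \<longrightarrow> d \<le> hi j - lo j"
    using min_length by auto
  note d = d0 d1[rule_format]
  \<comment> \<open>The induction measures how close to \<open>T\<close> the exit is. On a successor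
    the whole length, at least \<open>d\<close>, has to be covered at speed at most
    \<open>V\<close>, so the next exit comes at least \<open>d / V\<close> later.\<close>
  have main: "\<forall>j\<in>arcs G. \<forall>y\<in>pdom G j. \<forall>s\<in>{0..T}. (\<forall>e. exits j y s e \<longrightarrow> T - real n * (d / V) < e) \<longrightarrow> P j y s" for n
  proof (induction n)
    case 0
    show ?case
    proof (intro ballI impI)
      fix j y s assume A: "j \<in> arcs G" "y \<in> pdom G j" "s \<in> {0..T}" "\<forall>e. exits j y s e \<longrightarrow> T - real 0 * (d / V) < e"
      then have "\<not> (\<exists>e. exits j y s e)" by (auto simp: exits_def)
      then show "P j y s" using stays_or_exits[OF A(1,2)] stays A by blast
    qed
  next
    case (Suc n)
    show ?case
    proof (intro ballI impI)
      fix j y s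
      assume A: "j \<in> arcs G" "y \<in> pdom G j" "s \<in> {0..T}" "\<forall>e. exits j y s e \<longrightarrow> T - real (Suc n) * (d / V) < e"
      show "P j y s"
      proof (cases "stays j y s")
        case True
        then show ?thesis using stays A by blast
      next
        case False
        then obtain e where e: "exits j y s e" using stays_or_exits[OF A(1,2)] by blast
        show ?thesis
        proof (rule exits[OF A(1-3) e])
          fix k assume k: "k \<in> succs j"
          note kD = succsD[OF k]
          have "T - real n * (d / V) < e'" if e': "exits k (lo k) e e'" for e'
          proof -
            have "d \<le> hi k - lo k" using d(2) kD e' by (simp add: exits_def)
            also have "\<dots> = X k e (lo k) e' - X k e (lo k) e" using e' kD(1) X_start by (simp add: exits_def)
            also have "\<dots> \<le> V * (e' - e)"
              by (rule X_speed[OF kD(1)]) (use e' in \<open>simp add: exits_def\<close>)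
            finally have "d / V \<le> e' - e" using V_pos by (simp add: divide_le_eq mult.commute)
            moreover have "T - real (Suc n) * (d / V) < e" using A(4) e by blast
            ultimately show ?thesis by (simp add: algebra_simps)
          qed
          moreover have "lo k \<in> pdom G k" using lo_in kD by blast
          ultimately show "P k (lo k) e" using Suc kD(1) exits_in[OF e A(3)] by blast
        qed
      qed
    qed
  qed
  obtain n where n: "T < real n * (d / V)" using reals_Archimedean3[of "d / V"] d(1) V_pos by auto
  have "\<forall>e. exits j y s e \<longrightarrow> T - real n * (d / V) < e"
    using n assms(3) by (auto simp: exits_def)
  then show ?thesis using main[of n] assms(1-3) by blast
qed

abbreviation traj where "traj \<equiv> trajectory G T v \<nu>"

lemma trajectory_props:
  assumes g: "\<gamma> \<in> paths G j" and y: "y \<in> pdom G j" and s: "s \<in> {0..T}" and R: "traj \<gamma> y s R"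
  shows "continuous_on {s..T} R" "\<And>t t'. s \<le> t \<Longrightarrow> t \<le> t' \<Longrightarrow> t' \<le> T \<Longrightarrow> R t \<le> R t'" "R s = 0"
    and "\<And>t t'. s \<le> t \<Longrightarrow> t \<le> t' \<Longrightarrow> t' \<le> T \<Longrightarrow>
      ((\<lambda>r. v (glue G (\<nu> r)) (\<gamma> (arc_index G \<gamma> y (R r))) (arc_param G \<gamma> y (R r))) has_integral (R t' - R t)) {t..t'}"
proof -
  define F where "F r = v (glue G (\<nu> r)) (\<gamma> (arc_index G \<gamma> y (R r))) (arc_param G \<gamma> y (R r))" for r
  have hi: "(F has_integral R t) {s..t}" and R0: "0 \<le> R t" if "t \<in> {s..T}" for t
    using R that unfolding trajectory_def F_def by auto
  have int: "F integrable_on {s..T}" using hi[of T] s by (auto simp: has_integral_integrable_integral)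
  have Req: "R t = integral {s..t} F" if "t \<in> {s..T}" for t using hi[OF that] by (simp add: integral_unique)
  show "continuous_on {s..T} R"
    using indefinite_integral_continuous_1[OF int] by (rule continuous_on_eq) (simp add: Req)
  show "R s = 0" using Req[of s] s by simp
  show diff: "(F has_integral (R t' - R t)) {t..t'}" if t: "s \<le> t" "t \<le> t'" "t' \<le> T" for t t'
  proof -
    have i: "F integrable_on {s..t'}" using hi[of t'] t by auto
    have "integral {s..t} F + integral {t..t'} F = integral {s..t'} F"
      by (rule Henstock_Kurzweil_Integration.integral_combine[OF t(1,2) i])
    moreover have "F integrable_on {t..t'}" by (rule integrable_subinterval_real[OF i]) (use t in auto)
    ultimately show ?thesis using Req t by (simp add: has_integral_integrable_integral algebra_simps)
  qed
  show "R t \<le> R t'" if t: "s \<le> t" "t \<le> t'" "t' \<le> T" for t t'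
  proof -
    have "0 \<le> F r" if r: "r \<in> {t..t'}" for r
    proof -
      let ?i = "arc_index G \<gamma> y (R r)" and ?z = "arc_param G \<gamma> y (R r)"
      have arc: "\<gamma> ?i \<in> arcs G" by (rule pathsD(2)[OF g])
      have "?z \<in> pdom G (\<gamma> ?i)" by (rule arc_param_in[OF g y]) (use R0 r t in auto)
      then have "F r = u (\<gamma> ?i) r ?z" unfolding F_def using u_eq[OF arc] r t s by simp
      then show ?thesis using transport_field.u_nonneg[OF field[OF arc]] by simp
    qed
    then have "0 \<le> R t' - R t" using has_integral_nonneg[OF diff[OF t]] by blast
    then show ?thesis by simp
  qed
qed

text \<open>As long as the path is on its first arc, the position solves the equation whose unique
  solution is \<open>X\<close>.\<close>

lemma trajectory_on_first_arc:
  assumes g: "\<gamma> \<in> paths G j" and y: "y \<in> pdom G j" and s: "s \<in> {0..T}" and R: "traj \<gamma> y s R"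
    and t: "t \<in> {s..T}" and before: "\<And>r. r \<in> {s..<t} \<Longrightarrow> has_hi j \<Longrightarrow> y + R r < hi j"
  shows "y + R t = X j s y t"
proof -
  have j: "j \<in> arcs G" and g0: "\<gamma> 0 = j" using pathsD(1,2)[OF g] by auto
  interpret F: transport_field "u j" V K by (rule field[OF j])
  note props = trajectory_props[OF g y s R]
  have "F.sol_on s t (\<lambda>r. y + R r)"
    unfolding F.sol_on_def
  proof (intro allI impI)
    fix c d assume cd: "s \<le> c \<and> c \<le> d \<and> d \<le> t"
    have "((\<lambda>r. u j r (y + R r)) has_integral (R d - R c)) {c..d}"
    \<comment> \<open>At the final instant the position may already be counted on the next arc; a
      single time does not affect the integral.\<close>
    proof (rule has_integral_spike_finite[where S = "{d}"])
      show "((\<lambda>r. v (glue G (\<nu> r)) (\<gamma> (arc_index G \<gamma> y (R r))) (arc_param G \<gamma> y (R r))) has_integral (R d - R c)) {c..d}"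
        by (rule props(4)) (use cd t in auto)
      fix r assume r: "r \<in> {c..d} - {d}"
      then have rt: "r \<in> {s..<t}" using cd by auto
      have "ereal (R r) < arc_end G \<gamma> y 0" using before[OF rt] g0 by (auto simp: arc_end_0)
      moreover have "0 \<le> R r" using props(2)[of s r] props(3) rt t by auto
      then have "y + R r \<in> pdom G j" using before[OF rt] y pdom_iff[OF j] by fastforce
      ultimately show "u j r (y + R r) = v (glue G (\<nu> r)) (\<gamma> (arc_index G \<gamma> y (R r))) (arc_param G \<gamma> y (R r))"
        using u_eq[OF j] rt s t by (simp add: arc_index_first g0)
    qed simp
    then show "((\<lambda>r. u j r (y + R r)) has_integral (y + R d - (y + R c))) {c..d}" by simp
  qed
  from F.Fl_unique[OF this, of s t] show ?thesis using props(3) t by simp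
qed

lemma trajectory_stays:
  assumes g: "\<gamma> \<in> paths G j" and y: "y \<in> pdom G j" and s: "s \<in> {0..T}" and R: "traj \<gamma> y s R"
    and st: "stays j y s" and t: "t \<in> {s..T}"
  shows "R t = X j s y t - y"
proof -
  have j: "j \<in> arcs G" using pathsD(1,2)[OF g] by auto
  note props = trajectory_props[OF g y s R]
  \<comment> \<open>A bootstrap: up to the first time at which \<open>R\<close> would reach the end
    it coincides with \<open>X\<close>, which stays below the end.\<close>
  have "y + R r < hi j" if r: "r \<in> {s..T}" and hi: "has_hi j" for r
  proof (rule ccontr)
    assume "\<not> y + R r < hi j"
    then have "\<exists>e\<in>{s..T}. y + R e = hi j \<and> (\<forall>q\<in>{s..<e}. y + R q < hi j) \<and> e \<le> r"
      by (intro first_hitting continuous_intros props(1)) (use r hi y props(3) pdom_iff[OF j] in auto)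
    then obtain e where e: "e \<in> {s..T}" "y + R e = hi j" "\<forall>q\<in>{s..<e}. y + R q < hi j" by blast
    have "y + R e = X j s y e" by (rule trajectory_on_first_arc[OF g y s R e(1)]) (use e in auto)
    then show False using st e hi by (auto simp: stays_def)
  qed
  then have "y + R t = X j s y t" using trajectory_on_first_arc[OF g y s R t] t by auto
  then show ?thesis by simp
qed

lemma trajectory_exits:
  assumes g: "\<gamma> \<in> paths G j" and y: "y \<in> pdom G j" and s: "s \<in> {0..T}" and R: "traj \<gamma> y s R"
    and ex: "exits j y s e"
  shows "\<And>t. t \<in> {s..e} \<Longrightarrow> R t = X j s y t - y"
    and "traj (\<gamma> \<circ> Suc) (lo (\<gamma> (Suc 0))) e (\<lambda>t. R t - (hi j - y))"
proof -
  have j: "j \<in> arcs G" and g0: "\<gamma> 0 = j" using pathsD(1,2)[OF g] by auto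
  have hi: "has_hi j" and se: "s \<le> e" "e \<le> T" and Xe: "X j s y e = hi j" and lt: "\<And>r. r \<in> {s..<e} \<Longrightarrow> X j s y r < hi j"
    using ex by (auto simp: exits_def)
  note props = trajectory_props[OF g y s R]
  have before: "y + R r < hi j" if r: "r \<in> {s..<e}" for r
  proof (rule ccontr)
    assume "\<not> y + R r < hi j"
    then have "\<exists>q\<in>{s..T}. y + R q = hi j \<and> (\<forall>q'\<in>{s..<q}. y + R q' < hi j) \<and> q \<le> r"
      by (intro first_hitting continuous_intros props(1)) (use r se hi y props(3) pdom_iff[OF j] in auto)
    then obtain q where q: "q \<in> {s..T}" "y + R q = hi j" "\<forall>q'\<in>{s..<q}. y + R q' < hi j" "q \<le> r" by blast
    have "y + R q = X j s y q" by (rule trajectory_on_first_arc[OF g y s R q(1)]) (use q in auto)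
    then show False using lt[of q] q r by auto
  qed
  show first: "R t = X j s y t - y" if "t \<in> {s..e}" for t
    using trajectory_on_first_arc[OF g y s R, of t] before that se by force
  have Re: "R e = hi j - y" using first[of e] Xe se by simp
  show "traj (\<gamma> \<circ> Suc) (lo (\<gamma> (Suc 0))) e (\<lambda>t. R t - (hi j - y))"
    unfolding trajectory_def
  proof (intro ballI conjI)
    fix t assume t: "t \<in> {e..T}"
    have ge: "hi j - y \<le> R r" if "r \<in> {e..T}" for r using props(2)[of e r] that se Re by auto
    show "0 \<le> R t - (hi j - y)" using ge[OF t] by simp
    have "((\<lambda>r. v (glue G (\<nu> r)) (\<gamma> (arc_index G \<gamma> y (R r))) (arc_param G \<gamma> y (R r))) has_integral (R t - R e)) {e..t}"
      by (rule props(4)) (use se t in auto)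
    then have "((\<lambda>r. v (glue G (\<nu> r)) ((\<gamma> \<circ> Suc) (arc_index G (\<gamma> \<circ> Suc) (lo (\<gamma> (Suc 0))) (R r - (hi j - y))))
        (arc_param G (\<gamma> \<circ> Suc) (lo (\<gamma> (Suc 0))) (R r - (hi j - y)))) has_integral (R t - R e)) {e..t}"
    proof (rule has_integral_eq[rotated])
      fix r assume "r \<in> {e..t}"
      then have "hi j - y \<le> R r" using ge t by auto
      from arc_index_later[OF g y hi this]
      show "v (glue G (\<nu> r)) (\<gamma> (arc_index G \<gamma> y (R r))) (arc_param G \<gamma> y (R r)) =
         v (glue G (\<nu> r)) ((\<gamma> \<circ> Suc) (arc_index G (\<gamma> \<circ> Suc) (lo (\<gamma> (Suc 0))) (R r - (hi j - y))))
        (arc_param G (\<gamma> \<circ> Suc) (lo (\<gamma> (Suc 0))) (R r - (hi j - y)))" by simp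
    qed
    then show "((\<lambda>r. v (glue G (\<nu> r)) ((\<gamma> \<circ> Suc) (arc_index G (\<gamma> \<circ> Suc) (lo (\<gamma> (Suc 0))) (R r - (hi j - y))))
        (arc_param G (\<gamma> \<circ> Suc) (lo (\<gamma> (Suc 0))) (R r - (hi j - y)))) has_integral (R t - (hi j - y))) {e..t}"
      using Re by simp
  qed
qed

lemma first_arc_has_integral:
  assumes g: "\<gamma> \<in> paths G j" and y: "y \<in> pdom G j" and s: "s \<in> {0..T}" and t: "t \<in> {s..T}"
    and R: "\<And>r. r \<in> {s..<t} \<Longrightarrow> R r = X j s y r - y"
    and before: "\<And>r. r \<in> {s..<t} \<Longrightarrow> has_hi j \<Longrightarrow> X j s y r < hi j"
  shows "((\<lambda>r. v (glue G (\<nu> r)) (\<gamma> (arc_index G \<gamma> y (R r))) (arc_param G \<gamma> y (R r))) has_integral (X j s y t - y)) {s..t}"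
proof -
  have j: "j \<in> arcs G" and g0: "\<gamma> 0 = j" using pathsD(1,2)[OF g] by auto
  interpret F: transport_field "u j" V K by (rule field[OF j])
  have i: "((\<lambda>r. u j r (X j s y r)) has_integral (X j s y t - X j s y s)) {s..t}"
    using F.sol_onD[OF F.Fl_sol, of s s t t s y] t by simp
  have "((\<lambda>r. v (glue G (\<nu> r)) (\<gamma> (arc_index G \<gamma> y (R r))) (arc_param G \<gamma> y (R r))) has_integral (X j s y t - X j s y s)) {s..t}"
  proof (rule has_integral_spike_finite[OF _ _ i, where S = "{t}"])
    fix r assume "r \<in> {s..t} - {t}"
    then have r: "r \<in> {s..<t}" by auto
    have "ereal (R r) < arc_end G \<gamma> y 0" using before[OF r] g0 R[OF r] by (auto simp: arc_end_0)
    moreover have "y \<le> X j s y r" using X_mono[OF j, of s r s y] X_start[OF j] r by simp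
    then have "X j s y r \<in> pdom G j" using before[OF r] y pdom_iff[OF j] by fastforce
    ultimately show "v (glue G (\<nu> r)) (\<gamma> (arc_index G \<gamma> y (R r))) (arc_param G \<gamma> y (R r)) = u j r (X j s y r)"
      using u_eq[OF j] r s t R[OF r] by (simp add: arc_index_first g0)
  qed simp
  then show ?thesis by simp
qed

lemma trajectory_build_stays:
  assumes g: "\<gamma> \<in> paths G j" and y: "y \<in> pdom G j" and s: "s \<in> {0..T}" and st: "stays j y s"
  shows "traj \<gamma> y s (\<lambda>t. X j s y t - y)"
  unfolding trajectory_def
proof (intro ballI conjI)
  have j: "j \<in> arcs G" using pathsD(1,2)[OF g] by auto
  fix t assume t: "t \<in> {s..T}"
  show "0 \<le> X j s y t - y" using X_mono[OF j, of s t s y] X_start[OF j] t by simp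
  show "((\<lambda>r. v (glue G (\<nu> r)) (\<gamma> (arc_index G \<gamma> y (X j s y r - y))) (arc_param G \<gamma> y (X j s y r - y))) has_integral (X j s y t - y)) {s..t}"
    by (rule first_arc_has_integral[OF g y s t refl]) (use st t in \<open>auto simp: stays_def\<close>)
qed

text \<open>Concatenation of the first arc with a trajectory of the tail. The exit time itself
  belongs to the tail, in accordance with \<open>arc_index\<close>, which assigns junctions to the
  later arc.\<close>

lemma trajectory_build_exits:
  assumes g: "\<gamma> \<in> paths G j" and y: "y \<in> pdom G j" and s: "s \<in> {0..T}" and ex: "exits j y s e"
    and R: "traj (\<gamma> \<circ> Suc) (lo (\<gamma> (Suc 0))) e R"
  shows "traj \<gamma> y s (\<lambda>t. if t < e then X j s y t - y else (hi j - y) + R t)"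
  unfolding trajectory_def
proof (intro ballI conjI)
  have j: "j \<in> arcs G" using pathsD(1,2)[OF g] by auto
  have hi: "has_hi j" and se: "s \<le> e" "e \<le> T" and Xe: "X j s y e = hi j" and lt: "\<And>r. r \<in> {s..<e} \<Longrightarrow> X j s y r < hi j"
    using ex by (auto simp: exits_def)
  let ?R = "\<lambda>t. if t < e then X j s y t - y else (hi j - y) + R t"
  let ?F = "\<lambda>r. v (glue G (\<nu> r)) (\<gamma> (arc_index G \<gamma> y (?R r))) (arc_param G \<gamma> y (?R r))"
  have R0: "0 \<le> R t" if "t \<in> {e..T}" for t using R that by (auto simp: trajectory_def)
  fix t assume t: "t \<in> {s..T}"
  have yhi: "y \<le> hi j" using y pdom_iff[OF j] hi by simp
  show "0 \<le> ?R t" using X_mono[OF j, of s t s y] X_start[OF j] t R0[of t] yhi by auto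
  show "(?F has_integral ?R t) {s..t}"
  proof (cases "t < e")
    case True
    have "(?F has_integral (X j s y t - y)) {s..t}"
      by (rule first_arc_has_integral[OF g y s t]) (use lt True in auto)
    then show ?thesis using True by simp
  next
    case False
    have 1: "(?F has_integral (X j s y e - y)) {s..e}"
      by (rule first_arc_has_integral[OF g y s]) (use lt se in auto)
    have "((\<lambda>r. v (glue G (\<nu> r)) ((\<gamma> \<circ> Suc) (arc_index G (\<gamma> \<circ> Suc) (lo (\<gamma> (Suc 0))) (R r)))
        (arc_param G (\<gamma> \<circ> Suc) (lo (\<gamma> (Suc 0))) (R r))) has_integral R t) {e..t}"
      using R False t by (auto simp: trajectory_def)
    then have 2: "(?F has_integral R t) {e..t}"
    proof (rule has_integral_eq[rotated])
      fix r assume r: "r \<in> {e..t}"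
      then have "hi j - y \<le> hi j - y + R r" using R0[of r] t by auto
      from arc_index_later[OF g y hi this] r
      show "v (glue G (\<nu> r)) ((\<gamma> \<circ> Suc) (arc_index G (\<gamma> \<circ> Suc) (lo (\<gamma> (Suc 0))) (R r)))
        (arc_param G (\<gamma> \<circ> Suc) (lo (\<gamma> (Suc 0))) (R r)) = ?F r" by simp
    qed
    show ?thesis
      using has_integral_combine[OF se(1) _ 1 2] False Xe by simp
  qed
qed

text \<open>Uniqueness in value on \<open>{s..T}\<close> is the form required by the
  \<open>THE\<close> in \<open>travelled\<close>, as nothing determines \<open>R\<close> outside
  this interval.\<close>

lemma trajectory_ex1:
  assumes "j \<in> arcs G" "y \<in> pdom G j" "s \<in> {0..T}" "\<gamma> \<in> paths G j"
  shows "(\<exists>R. traj \<gamma> y s R) \<and> (\<forall>R R' t. traj \<gamma> y s R \<longrightarrow> traj \<gamma> y s R' \<longrightarrow> t \<in> {s..T} \<longrightarrow> R t = R' t)"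
  using assms
proof (induction arbitrary: \<gamma> rule: hop_induct)
  case (stays j y s)
  then show ?case using trajectory_build_stays trajectory_stays by metis
next
  case (exits j y s e)
  have hi: "has_hi j" using exits(4) by (simp add: exits_def)
  have g0: "\<gamma> 0 = j" using pathsD(1)[OF exits(6)] .
  have k: "\<gamma> (Suc 0) \<in> succs j" using pathsD(3)[OF exits(6), of 0] g0 hi by simp
  note IH = exits(5)[OF k paths_tail[OF exits(6)]]
  show ?case
  proof (intro conjI allI impI)
    show "\<exists>R. traj \<gamma> y s R" using IH trajectory_build_exits[OF exits(6,2,3,4)] by blast
    fix R R' t assume R: "traj \<gamma> y s R" and R': "traj \<gamma> y s R'" and t: "t \<in> {s..T}"
    show "R t = R' t"
    proof (cases "t \<le> e")
      case True
      then show ?thesis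
        using trajectory_exits(1)[OF exits(6,2,3) R exits(4), of t] trajectory_exits(1)[OF exits(6,2,3) R' exits(4), of t] t
        by auto
    next
      case False
      then have "t \<in> {e..T}" using t by auto
      then have "R t - (hi j - y) = R' t - (hi j - y)"
        using IH trajectory_exits(2)[OF exits(6,2,3) R exits(4)] trajectory_exits(2)[OF exits(6,2,3) R' exits(4)] by blast
      then show ?thesis by simp
    qed
  qed
qed

lemma travelled_eq:
  assumes "j \<in> arcs G" "y \<in> pdom G j" "s \<in> {0..T}" "\<gamma> \<in> paths G j" "traj \<gamma> y s R" "t \<in> {s..T}"
  shows "travelled G T v \<nu> \<gamma> y s t = R t"
  unfolding travelled_def
proof (rule the_equality)
  show "\<exists>R'. traj \<gamma> y s R' \<and> R' t = R t" using assms(5) by blast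
  show "d = R t" if "\<exists>R'. traj \<gamma> y s R' \<and> R' t = d" for d
    using that trajectory_ex1[OF assms(1-4)] assms(5,6) by blast
qed

abbreviation flw where "flw \<equiv> flow G T v \<nu>"

lemma flow_stays:
  assumes "j \<in> arcs G" "y \<in> pdom G j" "s \<in> {0..T}" "\<gamma> \<in> paths G j" "stays j y s" "t \<in> {s..T}"
  shows "flw \<gamma> y s t = par G j (X j s y t)"
proof -
  have "travelled G T v \<nu> \<gamma> y s t = X j s y t - y"
    by (rule travelled_eq[OF assms(1-4) trajectory_build_stays[OF assms(4,2,3,5)] assms(6)])
  moreover have "ereal (X j s y t - y) < arc_end G \<gamma> y 0"
    using assms(5,6) pathsD(1)[OF assms(4)] by (auto simp: stays_def arc_end_0)
  ultimately show ?thesis using pathsD(1)[OF assms(4)] by (simp add: flow_def path_point_first)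
qed

lemma flow_exits:
  assumes "j \<in> arcs G" "y \<in> pdom G j" "s \<in> {0..T}" "\<gamma> \<in> paths G j" "exits j y s e"
  shows "t \<in> {s..<e} \<Longrightarrow> flw \<gamma> y s t = par G j (X j s y t)"
    and "t \<in> {e..T} \<Longrightarrow> flw \<gamma> y s t = flw (\<gamma> \<circ> Suc) (lo (\<gamma> (Suc 0))) e t"
proof -
  have hi: "has_hi j" and se: "s \<le> e" "e \<le> T" and lt: "\<And>r. r \<in> {s..<e} \<Longrightarrow> X j s y r < hi j"
    using assms(5) by (auto simp: exits_def)
  have g0: "\<gamma> 0 = j" using pathsD(1)[OF assms(4)] .
  have k: "\<gamma> (Suc 0) \<in> succs j" using pathsD(3)[OF assms(4), of 0] g0 hi by simp
  have e: "e \<in> {0..T}" using exits_in assms(3,5) by blast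
  note k' = succsD(1)[OF k] lo_in[OF succsD(1,2)[OF k]] e paths_tail[OF assms(4)]
  obtain R where R: "traj (\<gamma> \<circ> Suc) (lo (\<gamma> (Suc 0))) e R" using trajectory_ex1[OF k'] by blast
  note tr = travelled_eq[OF assms(1-4) trajectory_build_exits[OF assms(4,2,3,5) R]]
  {
    assume t: "t \<in> {s..<e}"
    then have "travelled G T v \<nu> \<gamma> y s t = X j s y t - y" using tr[of t] se by simp
    moreover have "ereal (X j s y t - y) < arc_end G \<gamma> y 0" using lt[OF t] g0 by (simp add: arc_end_0)
    ultimately show "flw \<gamma> y s t = par G j (X j s y t)" using g0 by (simp add: flow_def path_point_first)
  }
  {
    assume t: "t \<in> {e..T}"
    then have 1: "travelled G T v \<nu> \<gamma> y s t = (hi j - y) + R t" using tr[of t] se by simp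
    have 2: "travelled G T v \<nu> (\<gamma> \<circ> Suc) (lo (\<gamma> (Suc 0))) e t = R t" by (rule travelled_eq[OF k' R t])
    have "0 \<le> R t" using R t by (auto simp: trajectory_def)
    then show "flw \<gamma> y s t = flw (\<gamma> \<circ> Suc) (lo (\<gamma> (Suc 0))) e t"
      using path_point_later[OF assms(4,2) hi, of "(hi j - y) + R t"] by (simp add: flow_def 1 2)
  }
qed

lemma flow_start:
  assumes "k \<in> succs j" "e \<in> {0..T}" "\<gamma> \<in> paths G k"
  shows "flw \<gamma> (lo k) e e = par G j (hi j)"
proof -
  note k = succsD[OF assms(1)] lo_in[OF succsD(1,2)[OF assms(1)]]
  obtain R where R: "traj \<gamma> (lo k) e R" using trajectory_ex1[OF k(1,6) assms(2,3)] by blast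
  have "travelled G T v \<nu> \<gamma> (lo k) e e = R e" by (rule travelled_eq[OF k(1,6) assms(2,3) R]) (use assms in auto)
  also have "\<dots> = 0" by (rule trajectory_props(3)[OF assms(3) k(6) assms(2) R])
  finally have tr: "travelled G T v \<nu> \<gamma> (lo k) e e = 0" .
  have "ereal 0 < arc_end G \<gamma> (lo k) 0"
    using pathsD(1)[OF assms(3)] lo_less_hi[OF k(1,2)] by (simp add: arc_end_0)
  from path_point_first[OF this] show ?thesis
    using k(5) pathsD(1)[OF assms(3)] by (simp add: flow_def tr)
qed

end

section \<open>Recursion for path sums\<close>

context network_flow
begin

abbreviation "ext \<equiv> exit_time G T v \<nu>"
abbreviation "pcoef \<equiv> path_coeff G T v \<nu> p"
abbreviation "visited \<equiv> visited_arcs G T v \<nu>"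
abbreviation "psum \<equiv> path_sum G T v \<nu> p"

lemma exit_time_ge: "ereal s \<le> ext \<gamma> y s k"
proof (induction k)
  case 0
  show ?case by (auto intro!: Inf_greatest)
next
  case (Suc k)
  then show ?case by (auto intro!: Inf_greatest elim: order_trans)
qed

text \<open>\<open>exit_time\<close> asks when the flow is at the terminal vertex as a point of the
  network, \<open>exits\<close> when the parameter is maximal. Injectivity of the parametrization
  reconciles the two.\<close>

lemma par_neq_end:
  assumes "j \<in> arcs G" "y \<in> pdom G j" "has_hi j" "s \<le> t" "X j s y t < hi j"
  shows "par G j (X j s y t) \<noteq> par G j (hi j)"
proof
  assume eq: "par G j (X j s y t) = par G j (hi j)"
  have "y \<le> X j s y t" using X_mono[OF assms(1,4), of s y] X_start[OF assms(1)] by simp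
  then have "X j s y t \<in> pdom G j" using assms(2,5) pdom_iff[OF assms(1)] by fastforce
  then have "X j s y t = hi j"
    using inj_onD[OF par_inj[OF assms(1)] eq] hi_in[OF assms(1,3)] by simp
  then show False using assms(5) by simp
qed

lemma exit_time_stays:
  assumes A: "j \<in> arcs G" "y \<in> pdom G j" "s \<in> {0..T}" "\<gamma> \<in> paths G j" "stays j y s"
  shows "ext \<gamma> y s k = \<infinity>"
proof (induction k)
  case 0
  have "{ereal t |t. s \<le> t \<and> t \<le> T \<and> has_hi (\<gamma> 0) \<and> flw \<gamma> y s t = par G (\<gamma> 0) (hi (\<gamma> 0))} = {}"
  proof -
    have "flw \<gamma> y s t \<noteq> par G j (hi j)" if "s \<le> t" "t \<le> T" "has_hi j" for t
      using flow_stays[OF A, of t] par_neq_end[OF A(1,2) that(3,1)] A(5) that by (auto simp: stays_def)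
    then show ?thesis using pathsD(1)[OF A(4)] by auto
  qed
  then show ?case by (simp only: exit_time.simps Inf_empty top_ereal_def)
next
  case (Suc k)
  then show ?case by (simp add: top_ereal_def)
qed

lemma exits_tail:
  assumes A: "j \<in> arcs G" "y \<in> pdom G j" "s \<in> {0..T}" "\<gamma> \<in> paths G j" "exits j y s e"
  shows "\<gamma> (Suc 0) \<in> succs j" "\<gamma> \<circ> Suc \<in> paths G (\<gamma> (Suc 0))" "\<gamma> (Suc 0) \<in> arcs G"
    "lo (\<gamma> (Suc 0)) \<in> pdom G (\<gamma> (Suc 0))" "e \<in> {0..T}" "has_hi j" "\<gamma> 0 = j" "s \<le> e" "e \<le> T"
proof -
  show hi: "has_hi j" and g0: "\<gamma> 0 = j" and "s \<le> e" "e \<le> T" using A pathsD(1) by (auto simp: exits_def)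
  show k: "\<gamma> (Suc 0) \<in> succs j" using pathsD(3)[OF A(4), of 0] g0 hi by simp
  show "\<gamma> \<circ> Suc \<in> paths G (\<gamma> (Suc 0))" by (rule paths_tail[OF A(4)])
  show "\<gamma> (Suc 0) \<in> arcs G" "lo (\<gamma> (Suc 0)) \<in> pdom G (\<gamma> (Suc 0))" using succsD[OF k] lo_in by auto
  show "e \<in> {0..T}" using exits_in A by blast
qed

text \<open>The first exit is \<open>e\<close>, and from \<open>e\<close> on the flow is that of the
  tail started at its initial vertex; the later exits of the path are therefore the exits of the
  tail.\<close>

lemma exit_time_exits:
  assumes A: "j \<in> arcs G" "y \<in> pdom G j" "s \<in> {0..T}" "\<gamma> \<in> paths G j" "exits j y s e"
  shows "ext \<gamma> y s 0 = ereal e" and "ext \<gamma> y s (Suc k) = ext (\<gamma> \<circ> Suc) (lo (\<gamma> (Suc 0))) e k"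
proof -
  note B = exits_tail[OF A]
  show e0: "ext \<gamma> y s 0 = ereal e"
    unfolding exit_time.simps
  proof (rule Inf_eqI)
    have "flw \<gamma> y s e = par G j (hi j)"
      using flow_exits(2)[OF A, of e] B flow_start[OF B(1,5,2)] by simp
    then have e: "ereal e \<in> {ereal t |t. s \<le> t \<and> t \<le> T \<and> has_hi (\<gamma> 0) \<and> flw \<gamma> y s t = par G (\<gamma> 0) (hi (\<gamma> 0))}"
      using B by auto
    show "ereal e \<le> i" if "i \<in> {ereal t |t. s \<le> t \<and> t \<le> T \<and> has_hi (\<gamma> 0) \<and> flw \<gamma> y s t = par G (\<gamma> 0) (hi (\<gamma> 0))}" for i
    proof -
      from that obtain t where t: "i = ereal t" "s \<le> t" "t \<le> T" "flw \<gamma> y s t = par G j (hi j)" using B(7) by auto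
      have "e \<le> t"
      proof (rule ccontr)
        assume "\<not> e \<le> t"
        then have "t \<in> {s..<e}" using t by auto
        moreover from this have "X j s y t < hi j" using A(5) by (auto simp: exits_def)
        ultimately show False
          using flow_exits(1)[OF A] par_neq_end[OF A(1,2) B(6) t(2)] t(4) by simp
      qed
      then show ?thesis using t by simp
    qed
    show "x \<le> ereal e" if "\<And>i. i \<in> {ereal t |t. s \<le> t \<and> t \<le> T \<and> has_hi (\<gamma> 0) \<and> flw \<gamma> y s t = par G (\<gamma> 0) (hi (\<gamma> 0))} \<Longrightarrow> x \<le> i" for x
      using that e by blast
  qed
  have flw: "flw \<gamma> y s t = flw (\<gamma> \<circ> Suc) (lo (\<gamma> (Suc 0))) e t" if "e \<le> t" "t \<le> T" for t
    using flow_exits(2)[OF A] that by simp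
  show "ext \<gamma> y s (Suc k) = ext (\<gamma> \<circ> Suc) (lo (\<gamma> (Suc 0))) e k"
  proof (induction k)
    case 0
    have "{ereal t |t. ereal e \<le> ereal t \<and> t \<le> T \<and> has_hi (\<gamma> (Suc 0)) \<and> flw \<gamma> y s t = par G (\<gamma> (Suc 0)) (hi (\<gamma> (Suc 0)))}
      = {ereal t |t. e \<le> t \<and> t \<le> T \<and> has_hi ((\<gamma> \<circ> Suc) 0) \<and>
          flw (\<gamma> \<circ> Suc) (lo (\<gamma> (Suc 0))) e t = par G ((\<gamma> \<circ> Suc) 0) (hi ((\<gamma> \<circ> Suc) 0))}"
      using flw by (auto simp del: exit_time.simps)
    then show ?case unfolding exit_time.simps(2)[of _ _ _ _ _ _ _ 0] e0 by (simp only: exit_time.simps(1))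
  next
    case (Suc k)
    let ?E = "ext (\<gamma> \<circ> Suc) (lo (\<gamma> (Suc 0))) e k"
    \<comment> \<open>Exit times of the tail are never before its starting time \<open>e\<close>, so
      both sets contain only times at which the two flows agree.\<close>
    have ge: "e \<le> t" if "?E \<le> ereal t" for t
      using order_trans[OF exit_time_ge that] by simp
    have "{ereal t |t. ?E \<le> ereal t \<and> t \<le> T \<and> has_hi (\<gamma> (Suc (Suc k))) \<and> flw \<gamma> y s t = par G (\<gamma> (Suc (Suc k))) (hi (\<gamma> (Suc (Suc k))))}
      = {ereal t |t. ?E \<le> ereal t \<and> t \<le> T \<and> has_hi ((\<gamma> \<circ> Suc) (Suc k)) \<and>
          flw (\<gamma> \<circ> Suc) (lo (\<gamma> (Suc 0))) e t = par G ((\<gamma> \<circ> Suc) (Suc k)) (hi ((\<gamma> \<circ> Suc) (Suc k)))}"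
      using flw ge by (auto simp del: exit_time.simps)
    then show ?case
      unfolding exit_time.simps(2)[of _ _ _ _ _ _ _ "Suc k"] Suc.IH by (simp only: exit_time.simps(2))
  qed
qed

lemma exit_set_stays:
  assumes "j \<in> arcs G" "y \<in> pdom G j" "s \<in> {0..T}" "\<gamma> \<in> paths G j" "stays j y s"
  shows "{k. ext \<gamma> y s k \<le> ereal T} = {}"
  using exit_time_stays[OF assms] by simp

lemma exit_set_exits:
  assumes A: "j \<in> arcs G" "y \<in> pdom G j" "s \<in> {0..T}" "\<gamma> \<in> paths G j" "exits j y s e"
  shows "{k. ext \<gamma> y s k \<le> ereal T} = insert 0 (Suc ` {k. ext (\<gamma> \<circ> Suc) (lo (\<gamma> (Suc 0))) e k \<le> ereal T})"
proof -
  have "ext \<gamma> y s k \<le> ereal T \<longleftrightarrow> k = 0 \<or> (\<exists>k'. k = Suc k' \<and> ext (\<gamma> \<circ> Suc) (lo (\<gamma> (Suc 0))) e k' \<le> ereal T)" for k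
    using exit_time_exits[OF A] exits_tail(9)[OF A] by (cases k) (simp_all del: exit_time.simps)
  then show ?thesis by (auto simp del: exit_time.simps)
qed

text \<open>Finiteness keeps the cardinality in \<open>visited_arcs\<close> and the product in
  \<open>path_coeff\<close> from taking their default values.\<close>

lemma finite_exit_set:
  assumes "j \<in> arcs G" "y \<in> pdom G j" "s \<in> {0..T}" "\<gamma> \<in> paths G j"
  shows "finite {k. ext \<gamma> y s k \<le> ereal T}"
  using assms
proof (induction arbitrary: \<gamma> rule: hop_induct)
  case (stays j y s)
  then show ?case using exit_set_stays by simp
next
  case (exits j y s e)
  note A = exits(1-3,6,4)
  show ?case
    unfolding exit_set_exits[OF A] by (intro finite.insertI finite_imageI exits(5)[OF exits_tail(1,2)[OF A]])
qed

lemma visited_stays: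
  assumes "j \<in> arcs G" "y \<in> pdom G j" "s \<in> {0..T}" "\<gamma> \<in> paths G j" "stays j y s"
  shows "visited y s \<gamma> = [j]" "pcoef \<gamma> y s = 1"
  using exit_set_stays[OF assms] pathsD(1)[OF assms(4)] by (simp_all add: visited_arcs_def path_coeff_def)

lemma visited_exits:
  assumes A: "j \<in> arcs G" "y \<in> pdom G j" "s \<in> {0..T}" "\<gamma> \<in> paths G j" "exits j y s e"
  shows "visited y s \<gamma> = j # visited (lo (\<gamma> (Suc 0))) e (\<gamma> \<circ> Suc)"
    and "pcoef \<gamma> y s = p j (\<gamma> (Suc 0)) e * pcoef (\<gamma> \<circ> Suc) (lo (\<gamma> (Suc 0))) e"
proof -
  note B = exits_tail[OF A]
  let ?S = "{k. ext (\<gamma> \<circ> Suc) (lo (\<gamma> (Suc 0))) e k \<le> ereal T}"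
  have fin: "finite ?S" by (rule finite_exit_set[OF B(3,4,5,2)])
  have card: "card {k. ext \<gamma> y s k \<le> ereal T} = Suc (card ?S)"
    unfolding exit_set_exits[OF A] using fin by (subst card_insert_disjoint) (auto simp: card_image)
  have "map \<gamma> [0..<Suc (Suc (card ?S))] = \<gamma> 0 # map (\<gamma> \<circ> Suc) [0..<Suc (card ?S)]"
    by (subst upt_conv_Cons) (simp_all add: map_Suc_upt[symmetric] del: upt_Suc)
  then show "visited y s \<gamma> = j # visited (lo (\<gamma> (Suc 0))) e (\<gamma> \<circ> Suc)"
    unfolding visited_arcs_def card B(7) .
  have "pcoef \<gamma> y s = p (\<gamma> 0) (\<gamma> (Suc 0)) (real_of_ereal (ext \<gamma> y s 0)) *
      (\<Prod>k\<in>?S. p (\<gamma> (Suc k)) (\<gamma> (Suc (Suc k))) (real_of_ereal (ext \<gamma> y s (Suc k))))"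
    unfolding path_coeff_def exit_set_exits[OF A] using fin
    by (subst prod.insert) (auto simp: prod.reindex simp del: exit_time.simps)
  then show "pcoef \<gamma> y s = p j (\<gamma> (Suc 0)) e * pcoef (\<gamma> \<circ> Suc) (lo (\<gamma> (Suc 0))) e"
    unfolding exit_time_exits[OF A] B(7) by (simp add: path_coeff_def)
qed

lemma hd_visited: "visited y s \<gamma> = k # \<xi> \<Longrightarrow> \<gamma> 0 = k"
  by (simp add: visited_arcs_def upt_conv_Cons del: upt_Suc)

text \<open>This makes the choice of representative in \<open>path_sum\<close> immaterial: up to
  \<open>T\<close>, flow and coefficient depend on nothing but the list.\<close>

lemma visited_determines:
  assumes "j \<in> arcs G" "y \<in> pdom G j" "s \<in> {0..T}" "\<gamma> \<in> paths G j" "\<gamma>' \<in> paths G j" "visited y s \<gamma> = visited y s \<gamma>'"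
  shows "pcoef \<gamma> y s = pcoef \<gamma>' y s \<and> (\<forall>t\<in>{s..T}. flw \<gamma> y s t = flw \<gamma>' y s t)"
  using assms
proof (induction arbitrary: \<gamma> \<gamma>' rule: hop_induct)
  case (stays j y s)
  then show ?case using visited_stays(2) flow_stays by metis
next
  case (exits j y s e)
  note A = exits(1-3,6,4) and A' = exits(1-3,7,4)
  note B = exits_tail[OF A] and B' = exits_tail[OF A']
  have eq: "visited (lo (\<gamma> (Suc 0))) e (\<gamma> \<circ> Suc) = visited (lo (\<gamma>' (Suc 0))) e (\<gamma>' \<circ> Suc)"
    using exits(8) visited_exits(1)[OF A] visited_exits(1)[OF A'] by simp
  have k: "\<gamma>' (Suc 0) = \<gamma> (Suc 0)"
  proof -
    obtain k \<xi> where k: "visited (lo (\<gamma> (Suc 0))) e (\<gamma> \<circ> Suc) = k # \<xi>"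
      by (simp add: visited_arcs_def upt_conv_Cons del: upt_Suc)
    show ?thesis using hd_visited[OF k] hd_visited[OF k[unfolded eq]] by simp
  qed
  have IH: "pcoef (\<gamma> \<circ> Suc) (lo (\<gamma> (Suc 0))) e = pcoef (\<gamma>' \<circ> Suc) (lo (\<gamma> (Suc 0))) e \<and>
      (\<forall>t\<in>{e..T}. flw (\<gamma> \<circ> Suc) (lo (\<gamma> (Suc 0))) e t = flw (\<gamma>' \<circ> Suc) (lo (\<gamma> (Suc 0))) e t)"
    by (rule exits(5)[OF B(1,2) B'(2)[unfolded k] eq[unfolded k]])
  show ?case
  proof (intro conjI ballI)
    show "pcoef \<gamma> y s = pcoef \<gamma>' y s"
      using visited_exits(2)[OF A] visited_exits(2)[OF A'] IH k by simp
    fix t assume t: "t \<in> {s..T}"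
    show "flw \<gamma> y s t = flw \<gamma>' y s t"
      using flow_exits[OF A, of t] flow_exits[OF A', of t] IH k t by (cases "t < e") auto
  qed
qed

lemma finite_visited:
  assumes "j \<in> arcs G" "y \<in> pdom G j" "s \<in> {0..T}"
  shows "finite (visited y s ` paths G j)"
  using assms
proof (induction rule: hop_induct)
  case (stays j y s)
  then have "visited y s ` paths G j \<subseteq> {[j]}" using visited_stays(1) by blast
  then show ?case by (rule finite_subset) simp
next
  case (exits j y s e)
  have "visited y s ` paths G j \<subseteq> (\<Union>k\<in>succs j. (#) j ` (visited (lo k) e ` paths G k))"
  proof
    fix \<xi> assume "\<xi> \<in> visited y s ` paths G j"
    then obtain \<gamma> where g: "\<gamma> \<in> paths G j" "\<xi> = visited y s \<gamma>" by auto
    note A = exits(1-3) g(1) exits(4)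
    show "\<xi> \<in> (\<Union>k\<in>succs j. (#) j ` (visited (lo k) e ` paths G k))"
      using visited_exits(1)[OF A] exits_tail(1,2)[OF A] g(2) by auto
  qed
  then show ?case by (rule finite_subset) (use exits(5) finite_succs in auto)
qed

lemma path_sum_stays:
  assumes "j \<in> arcs G" "y \<in> pdom G j" "s \<in> {0..T}" "stays j y s" "t \<in> {s..T}"
  shows "psum \<phi> j y s t = \<phi> (par G j (X j s y t))"
proof -
  have v: "visited y s \<gamma> = [j]" if "\<gamma> \<in> paths G j" for \<gamma>
    using visited_stays(1)[OF assms(1-3) that assms(4)] .
  then have im: "visited y s ` paths G j = {[j]}" using paths_nonempty[OF assms(1)] by auto
  let ?g = "inv_into (paths G j) (visited y s) [j]"
  have g: "?g \<in> paths G j" by (rule inv_into_into) (simp add: im)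
  show ?thesis
    unfolding path_sum_def im using flow_stays[OF assms(1-3) g assms(4,5)] visited_stays(2)[OF assms(1-3) g assms(4)]
    by (simp add: Let_def)
qed

text \<open>The lists are sorted by their second arc. Before the exit the position is on the first
  arc, common to all paths, and factors out; what remains is a sum of coefficients, written as a
  path sum of the constant 1.\<close>

lemma path_sum_step:
  assumes A: "j \<in> arcs G" "y \<in> pdom G j" "s \<in> {0..T}" "exits j y s e"
  shows "t \<in> {e..T} \<Longrightarrow> psum \<phi> j y s t = (\<Sum>k\<in>succs j. p j k e * psum \<phi> k (lo k) e t)"
    and "t \<in> {s..<e} \<Longrightarrow> psum \<phi> j y s t = \<phi> (par G j (X j s y t)) * (\<Sum>k\<in>succs j. p j k e * psum (\<lambda>_. 1) k (lo k) e T)"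
proof -
  have hi: "has_hi j" and se: "s \<le> e" "e \<le> T" using A(4) by (auto simp: exits_def)
  have e: "e \<in> {0..T}" using exits_in A by blast
  let ?W = "\<lambda>\<xi>. let \<gamma> = inv_into (paths G j) (visited y s) \<xi> in \<phi> (flw \<gamma> y s t) * pcoef \<gamma> y s"
  let ?g = "\<lambda>k \<xi>. inv_into (paths G k) (visited (lo k) e) \<xi>"
  let ?V = "\<lambda>k. visited (lo k) e ` paths G k"
  have im: "visited y s ` paths G j = (\<Union>k\<in>succs j. (#) j ` ?V k)"
  proof (intro equalityI subsetI)
    fix \<xi> assume "\<xi> \<in> visited y s ` paths G j"
    then obtain \<gamma> where g: "\<gamma> \<in> paths G j" "\<xi> = visited y s \<gamma>" by auto
    note A' = A(1-3) g(1) A(4)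
    show "\<xi> \<in> (\<Union>k\<in>succs j. (#) j ` ?V k)"
      using visited_exits(1)[OF A'] exits_tail(1,2)[OF A'] g(2) by auto
  next
    fix \<xi> assume "\<xi> \<in> (\<Union>k\<in>succs j. (#) j ` ?V k)"
    then obtain k \<gamma> where k: "k \<in> succs j" "\<gamma> \<in> paths G k" "\<xi> = j # visited (lo k) e \<gamma>" by auto
    have g: "case_nat j \<gamma> \<in> paths G j" by (rule paths_cons[OF A(1) hi k(1,2)])
    have c: "case_nat j \<gamma> \<circ> Suc = \<gamma>" by auto
    have "visited y s (case_nat j \<gamma>) = \<xi>"
      using visited_exits(1)[OF A(1-3) g A(4)] k pathsD(1)[OF k(2)] by (simp add: c)
    then show "\<xi> \<in> visited y s ` paths G j" using g by blast
  qed
  \<comment> \<open>The list of a tail starts with the successor chosen, so lists belonging to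
    different successors are different.\<close>
  have disj: "((#) j ` ?V k) \<inter> ((#) j ` ?V k') = {}" if "k \<noteq> k'" for k k'
  proof -
    have "k = k'" if "\<gamma> \<in> paths G k" "\<gamma>' \<in> paths G k'" "visited (lo k) e \<gamma> = visited (lo k') e \<gamma>'" for \<gamma> \<gamma>'
    proof -
      obtain i \<xi> where i: "visited (lo k) e \<gamma> = i # \<xi>" by (simp add: visited_arcs_def upt_conv_Cons del: upt_Suc)
      show ?thesis
        using hd_visited[OF i] hd_visited[OF i[unfolded that(3)]] pathsD(1)[OF that(1)] pathsD(1)[OF that(2)] by simp
    qed
    then show ?thesis using that by auto
  qed
  have finV: "finite (?V k)" if "k \<in> succs j" for k
    using finite_visited[OF succsD(1)[OF that] lo_in[OF succsD(1,2)[OF that]] e] .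
  have sum: "psum \<phi> j y s t = (\<Sum>k\<in>succs j. \<Sum>\<xi>\<in>?V k. ?W (j # \<xi>))"
  proof -
    have "psum \<phi> j y s t = (\<Sum>k\<in>succs j. \<Sum>\<xi>\<in>(#) j ` ?V k. ?W \<xi>)"
      unfolding path_sum_def im
      by (rule sum.UNION_disjoint) (use finite_succs finV disj in auto)
    also have "\<dots> = (\<Sum>k\<in>succs j. \<Sum>\<xi>\<in>?V k. ?W (j # \<xi>))"
      by (intro sum.cong refl sum.reindex[unfolded o_def]) simp
    finally show ?thesis .
  qed
  have W: "?W (j # \<xi>) = \<phi> (if t < e then par G j (X j s y t) else flw (?g k \<xi>) (lo k) e t) * (p j k e * pcoef (?g k \<xi>) (lo k) e)"
    if k: "k \<in> succs j" and xi: "\<xi> \<in> ?V k" and t: "t \<in> {s..T}" for k \<xi>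
  proof -
    let ?c = "inv_into (paths G j) (visited y s) (j # \<xi>)"
    have mem: "j # \<xi> \<in> visited y s ` paths G j" unfolding im using k xi by auto
    have c: "?c \<in> paths G j" "visited y s ?c = j # \<xi>"
      using inv_into_into[OF mem] f_inv_into_f[OF mem] by auto
    have g: "?g k \<xi> \<in> paths G k" "visited (lo k) e (?g k \<xi>) = \<xi>"
      using inv_into_into[OF xi] f_inv_into_f[OF xi] by auto
    note A' = A(1-3) c(1) A(4)
    note B = exits_tail[OF A']
    have v: "visited (lo (?c (Suc 0))) e (?c \<circ> Suc) = \<xi>" using visited_exits(1)[OF A'] c(2) by simp
    obtain i \<xi>' where i: "\<xi> = i # \<xi>'"
      using v by (cases \<xi>) (auto simp: visited_arcs_def upt_conv_Cons simp del: upt_Suc)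
    have ck: "?c (Suc 0) = k"
      using hd_visited[OF v[unfolded i]] hd_visited[OF g(2)[unfolded i]] pathsD(1)[OF g(1)] i by simp
    \<comment> \<open>The tail of the path chosen for \<open>j # \<xi>\<close> need not be the path
      chosen for \<open>\<xi>\<close>, but both realise the same list.\<close>
    have det: "pcoef (?c \<circ> Suc) (lo k) e = pcoef (?g k \<xi>) (lo k) e \<and> (\<forall>t\<in>{e..T}. flw (?c \<circ> Suc) (lo k) e t = flw (?g k \<xi>) (lo k) e t)"
      by (rule visited_determines) (use B ck g v in simp_all)
    show ?thesis
      using flow_exits[OF A', of t] visited_exits(2)[OF A'] det t by (auto simp: Let_def ck)
  qed
  {
    assume t: "t \<in> {e..T}"
    then have t': "t \<in> {s..T}" "\<not> t < e" using se by auto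
    have "psum \<phi> j y s t = (\<Sum>k\<in>succs j. \<Sum>\<xi>\<in>?V k. p j k e * (\<phi> (flw (?g k \<xi>) (lo k) e t) * pcoef (?g k \<xi>) (lo k) e))"
      unfolding sum by (intro sum.cong refl) (simp add: W[OF _ _ t'(1)] t'(2))
    then show "psum \<phi> j y s t = (\<Sum>k\<in>succs j. p j k e * psum \<phi> k (lo k) e t)"
      by (simp add: path_sum_def Let_def sum_distrib_left)
  }
  {
    assume t: "t \<in> {s..<e}"
    then have t': "t \<in> {s..T}" "t < e" using se by auto
    have "psum \<phi> j y s t = (\<Sum>k\<in>succs j. \<Sum>\<xi>\<in>?V k. \<phi> (par G j (X j s y t)) * (p j k e * pcoef (?g k \<xi>) (lo k) e))"
      unfolding sum by (intro sum.cong refl) (simp add: W[OF _ _ t'(1)] t'(2))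
    then show "psum \<phi> j y s t = \<phi> (par G j (X j s y t)) * (\<Sum>k\<in>succs j. p j k e * psum (\<lambda>_. 1) k (lo k) e T)"
      by (simp add: path_sum_def Let_def sum_distrib_left)
  }
qed

text \<open>At each junction the coefficients of the successors sum to 1. As coefficients run over
  all exits up to \<open>T\<close>, this removes those after the time of observation and turns
  \<open>path_sum_step\<close> into \<open>path_sum_exits\<close>.\<close>

lemma path_sum_one:
  assumes "j \<in> arcs G" "y \<in> pdom G j" "s \<in> {0..T}"
  shows "psum (\<lambda>_. 1) j y s T = 1"
  using assms
proof (induction rule: hop_induct)
  case (stays j y s)
  then show ?case using path_sum_stays[OF stays, of T "\<lambda>_. 1"] by simp
next
  case (exits j y s e)
  have e: "e \<in> {0..T}" "has_hi j" using exits exits_in by (auto simp: exits_def)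
  have "psum (\<lambda>_. 1) j y s T = (\<Sum>k\<in>succs j. p j k e * psum (\<lambda>_. 1) k (lo k) e T)"
    by (rule path_sum_step(1)[OF exits(1-4)]) (use e in auto)
  also have "\<dots> = (\<Sum>k\<in>succs j. p j k e)" by (intro sum.cong refl) (simp add: exits(5))
  also have "\<dots> = 1" by (rule p_sum[OF exits(1) e(2,1)])
  finally show ?case .
qed

lemma path_sum_exits:
  assumes A: "j \<in> arcs G" "y \<in> pdom G j" "s \<in> {0..T}" "exits j y s e"
  shows "t \<in> {e..T} \<Longrightarrow> psum \<phi> j y s t = (\<Sum>k\<in>succs j. p j k e * psum \<phi> k (lo k) e t)"
    and "t \<in> {s..<e} \<Longrightarrow> psum \<phi> j y s t = \<phi> (par G j (X j s y t))"
proof -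
  show "t \<in> {e..T} \<Longrightarrow> psum \<phi> j y s t = (\<Sum>k\<in>succs j. p j k e * psum \<phi> k (lo k) e t)"
    by (rule path_sum_step(1)[OF A])
  have e: "e \<in> {0..T}" "has_hi j" using A exits_in by (auto simp: exits_def)
  have "(\<Sum>k\<in>succs j. p j k e * psum (\<lambda>_. 1) k (lo k) e T) = (\<Sum>k\<in>succs j. p j k e)"
    by (intro sum.cong refl) (simp add: path_sum_one[OF succsD(1) lo_in[OF succsD(1,2)] e(1)])
  also have "\<dots> = 1" by (rule p_sum[OF A(1) e(2,1)])
  finally show "t \<in> {s..<e} \<Longrightarrow> psum \<phi> j y s t = \<phi> (par G j (X j s y t))"
    using path_sum_step(2)[OF A] by simp
qed

end

section \<open>Test functions on the network\<close>

text \<open>The traces \<open>\<tau>\<close>, which exist by the notion of solution, are fixed here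
  so that inflows and outflows of the arcs can be defined from them.\<close>

locale network_solution = network G
  for G :: "('j, 'a::euclidean_space) network" +
  fixes T Vmax L :: real
    and v :: "'a measure \<Rightarrow> 'j \<Rightarrow> real \<Rightarrow> real"
    and p :: "'j \<Rightarrow> 'j \<Rightarrow> real \<Rightarrow> real"
    and m0 :: "'j \<Rightarrow> real measure"
    and \<sigma>0 :: "'a \<Rightarrow> real measure"
    and m :: "('a \<times> real) measure"
    and \<nu> :: "real \<Rightarrow> 'j \<Rightarrow> real measure"
    and \<tau> :: "'j \<Rightarrow> 'a \<Rightarrow> real measure"
  assumes T_pos: "T > 0" and Vmax_pos: "Vmax > 0"
    and vel: "velocity_field G Vmax L v"
    and coeffs: "distribution_coefficients G T p"
    and m0_line: "\<And>j. j \<in> arcs G \<Longrightarrow> m0 j \<in> line_measures (pdom G j)"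
    and s0_line: "\<And>x. x \<in> sources G \<Longrightarrow> \<sigma>0 x \<in> line_measures {0..T}"
    and sol: "measure_valued_solution G T v p m0 \<sigma>0 m \<nu>"
    and traces: "\<And>x j. x \<in> verts G - sources G \<Longrightarrow> j \<in> Inc G x \<union> Out G x \<Longrightarrow> is_trace G T v m0 \<nu> j x (\<tau> j x)"
    and junction: "\<And>x j f. x \<in> verts G - sources G \<Longrightarrow> j \<in> Out G x \<Longrightarrow> f \<in> C1_0 G T \<Longrightarrow>
      (\<integral>t. f x t \<partial>\<tau> j x) = (\<Sum>k\<in>Inc G x. \<integral>t. p k j t * f x t \<partial>\<tau> k x)"
begin

abbreviation "net_borel \<equiv> restrict_space borel (points G)"

lemma space_net_borel [simp]: "space net_borel = points G"
  by (simp add: space_restrict_space)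

lemma nu_line: "t \<in> {0..T} \<Longrightarrow> j \<in> arcs G \<Longrightarrow> \<nu> t j \<in> line_measures (pdom G j)"
  using sol by (auto simp: measure_valued_solution_def)

lemma line_measuresD:
  assumes "\<mu> \<in> line_measures I"
  shows "sets \<mu> = sets (restrict_space borel I)" "finite_measure \<mu>" "space \<mu> = I"
  using assms sets_eq_imp_space_eq[of \<mu> "restrict_space borel I"]
  by (auto simp: line_measures_def space_restrict_space)

lemma par_continuous: "j \<in> arcs G \<Longrightarrow> continuous_on (pdom G j) (par G j)"
proof -
  assume "j \<in> arcs G"
  then have "smooth_on_interval (pdom G j) (par G j)" using net by (simp add: oriented_network_def)
  then obtain g :: "nat \<Rightarrow> real \<Rightarrow> 'a" where g: "\<forall>y\<in>pdom G j. g 0 y = par G j y"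
    "\<forall>n. \<forall>y\<in>pdom G j. (g n has_vector_derivative g (Suc n) y) (at y within pdom G j)"
    unfolding smooth_on_interval_def by auto
  have "continuous_on (pdom G j) (g 0)"
    by (rule continuous_on_vector_derivative) (rule g(2)[rule_format])
  then show ?thesis by (rule continuous_on_eq) (rule g(1)[rule_format])
qed

lemma par_measurable:
  assumes "j \<in> arcs G" "sets \<mu> = sets (restrict_space borel (pdom G j))"
  shows "par G j \<in> measurable \<mu> net_borel"
proof -
  have "par G j \<in> measurable (restrict_space borel (pdom G j)) net_borel"
    by (rule measurable_restrict_space2[OF _ borel_measurable_continuous_on_restrict[OF par_continuous[OF assms(1)]]])
       (use assms(1) in \<open>auto simp: points_def space_restrict_space\<close>)
  then show ?thesis using assms(2) by (simp cong: measurable_cong_sets)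
qed

lemma glue_eq:
  assumes "\<And>j. j \<in> arcs G \<Longrightarrow> space (\<mu> j) = pdom G j"
  shows "glue G \<mu> = sum_distr (arcs G) net_borel \<mu> (par G)"
proof -
  have "(\<Sum>j\<in>arcs G. emeasure (\<mu> j) {y \<in> pdom G j. par G j y \<in> B}) = (\<Sum>j\<in>arcs G. emeasure (\<mu> j) (par G j -` B \<inter> space (\<mu> j)))" for B
    by (intro sum.cong refl arg_cong2[where f = emeasure]) (use assms in auto)
  then show ?thesis unfolding glue_def sum_distr_def by simp
qed

lemma glue_line:
  fixes \<phi> :: "'a \<Rightarrow> real"
  assumes "\<And>j. j \<in> arcs G \<Longrightarrow> \<mu> j \<in> line_measures (pdom G j)"
  shows "sets (glue G \<mu>) = sets net_borel" "finite_measure (glue G \<mu>)"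
    "B \<in> sets net_borel \<Longrightarrow> emeasure (glue G \<mu>) B = (\<Sum>j\<in>arcs G. emeasure (\<mu> j) {y \<in> pdom G j. par G j y \<in> B})"
    "\<phi> \<in> borel_measurable net_borel \<Longrightarrow> (\<And>x. x \<in> points G \<Longrightarrow> \<bar>\<phi> x\<bar> \<le> C) \<Longrightarrow>
      (\<integral>x. \<phi> x \<partial>glue G \<mu>) = (\<Sum>j\<in>arcs G. \<integral>y. \<phi> (par G j y) \<partial>\<mu> j)"
proof -
  note D = line_measuresD[OF assms]
  have eq: "glue G \<mu> = sum_distr (arcs G) net_borel \<mu> (par G)" by (rule glue_eq[OF D(3)])
  have pm: "par G j \<in> measurable (\<mu> j) net_borel" if "j \<in> arcs G" for j
    by (rule par_measurable[OF that D(1)[OF that]])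
  show "sets (glue G \<mu>) = sets net_borel" unfolding eq by simp
  show "finite_measure (glue G \<mu>)" unfolding eq by (rule finite_measure_sum_distr[OF pm D(2)])
  show "emeasure (glue G \<mu>) B = (\<Sum>j\<in>arcs G. emeasure (\<mu> j) {y \<in> pdom G j. par G j y \<in> B})" if "B \<in> sets net_borel"
  proof -
    have "emeasure (glue G \<mu>) B = (\<Sum>j\<in>arcs G. emeasure (\<mu> j) (par G j -` B \<inter> space (\<mu> j)))"
      unfolding eq by (rule emeasure_sum_distr[OF pm that])
    also have "\<dots> = (\<Sum>j\<in>arcs G. emeasure (\<mu> j) {y \<in> pdom G j. par G j y \<in> B})"
      by (intro sum.cong refl arg_cong2[where f = emeasure]) (use D(3) in auto)
    finally show ?thesis .
  qed
  show "(\<integral>x. \<phi> x \<partial>glue G \<mu>) = (\<Sum>j\<in>arcs G. \<integral>y. \<phi> (par G j y) \<partial>\<mu> j)"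
    if "\<phi> \<in> borel_measurable net_borel" "\<And>x. x \<in> points G \<Longrightarrow> \<bar>\<phi> x\<bar> \<le> C"
    unfolding eq
    by (rule integral_sum_distr[where B = C]) (use pm D(2) that in auto)
qed

text \<open>The bounds on \<open>v\<close> hold for measures without Cantorian part, so the glued
  measure must be shown to be one. Its exceptional countable set is the union of the images of those
  on the arcs.\<close>

lemma glue_in_net_measures:
  assumes "\<And>j. j \<in> arcs G \<Longrightarrow> \<mu> j \<in> line_measures (pdom G j)"
  shows "glue G \<mu> \<in> net_measures G"
proof -
  note gl = glue_line(1,2)[of \<mu>, OF assms] glue_line(3)[where \<mu> = \<mu>, OF assms]
  have "\<forall>j\<in>arcs G. \<exists>A. countable A \<and> (\<forall>N\<in>sets (\<mu> j). N \<in> null_sets lborel \<longrightarrow> emeasure (\<mu> j) (N - A) = 0)"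
  proof
    fix j assume "j \<in> arcs G"
    from assms[OF this] show "\<exists>A. countable A \<and> (\<forall>N\<in>sets (\<mu> j). N \<in> null_sets lborel \<longrightarrow> emeasure (\<mu> j) (N - A) = 0)"
      unfolding line_measures_def by blast
  qed
  then obtain A where A: "\<And>j. j \<in> arcs G \<Longrightarrow> countable (A j)"
    "\<And>j N. j \<in> arcs G \<Longrightarrow> N \<in> sets (\<mu> j) \<Longrightarrow> N \<in> null_sets lborel \<Longrightarrow> emeasure (\<mu> j) (N - A j) = 0"
    by metis
  let ?A = "\<Union>j\<in>arcs G. par G j ` A j"
  have "countable ?A" using A(1) finite_arcs by (auto intro: countable_finite)
  moreover have "emeasure (glue G \<mu>) (B - ?A) = 0"
    if B: "B \<in> sets (glue G \<mu>)" and null: "\<forall>j\<in>arcs G. {y \<in> pdom G j. par G j y \<in> B} \<in> null_sets lborel" for B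
  \<comment> \<open>The case distinction spares a proof that the set is Borel, as
    \<open>emeasure\<close> is 0 on sets that are not measurable.\<close>
  proof (cases "B - ?A \<in> sets net_borel")
    case True
    have "emeasure (\<mu> j) {y \<in> pdom G j. par G j y \<in> B - ?A} = 0" if j: "j \<in> arcs G" for j
    proof -
      note D = line_measuresD[OF assms[OF j]]
      have N: "{y \<in> pdom G j. par G j y \<in> B} \<in> sets (\<mu> j)"
        using measurable_sets[OF par_measurable[OF j D(1)], of B] B gl(1) D(3) by (simp add: vimage_def Int_def conj_commute)
      have cA: "A j \<inter> pdom G j \<in> sets (\<mu> j)"
      proof -
        have "A j \<in> sets borel" by (rule sets.countable[OF _ A(1)[OF j]]) simp
        then show ?thesis unfolding D(1) sets_restrict_space by (auto simp: Int_commute)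
      qed
      have "emeasure (\<mu> j) {y \<in> pdom G j. par G j y \<in> B - ?A} \<le> emeasure (\<mu> j) ({y \<in> pdom G j. par G j y \<in> B} - A j \<inter> pdom G j)"
        by (rule emeasure_mono) (use j N cA in auto)
      also have "{y \<in> pdom G j. par G j y \<in> B} - A j \<inter> pdom G j = {y \<in> pdom G j. par G j y \<in> B} - A j" by auto
      also have "emeasure (\<mu> j) \<dots> = 0" using A(2)[OF j N] null j by blast
      finally show ?thesis by simp
    qed
    then show ?thesis using gl(3)[OF _ True] by simp
  qed (simp add: emeasure_notin_sets gl(1))
  ultimately show ?thesis
    unfolding net_measures_def using gl(1,2) by blast
qed

lemma net_measuresD:
  assumes "\<mu> \<in> net_measures G" shows "finite_measure \<mu>" "space \<mu> = points G" "sets \<mu> = sets net_borel"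
  using assms sets_eq_imp_space_eq[of \<mu> net_borel] by (auto simp: net_measures_def)

lemma walk_nonneg: "walk G x l y \<Longrightarrow> 0 \<le> l"
  by (induction rule: walk.induct) auto

lemma path_dist_nonneg: "x \<in> points G \<Longrightarrow> y \<in> points G \<Longrightarrow> 0 \<le> path_dist G x y"
proof -
  assume "x \<in> points G" "y \<in> points G"
  then have "\<exists>l. walk G x l y" using net by (auto simp: oriented_network_def)
  then show ?thesis unfolding path_dist_def by (intro cInf_greatest) (auto intro: walk_nonneg)
qed

text \<open>Division by \<open>B + K\<close> puts \<open>\<phi>\<close> into the unit ball. That the
  supremum in \<open>BL_dist\<close> is one of a set bounded above, by the sum of the two masses,
  has to be checked as well.\<close>

lemma BL_dist_bound:
  assumes mu: "\<mu> \<in> net_measures G" and ka: "\<kappa> \<in> net_measures G"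
    and phi: "\<And>x. x \<in> points G \<Longrightarrow> \<bar>\<phi> x\<bar> \<le> B"
      "\<And>x y. x \<in> points G \<Longrightarrow> y \<in> points G \<Longrightarrow> \<bar>\<phi> x - \<phi> y\<bar> \<le> K * path_dist G x y" and K: "0 \<le> K" and B: "0 < B"
    and ne: "points G \<noteq> {}"
  shows "\<bar>(\<integral>x. \<phi> x \<partial>\<mu>) - (\<integral>x. \<phi> x \<partial>\<kappa>)\<bar> \<le> (B + K) * BL_dist G \<mu> \<kappa>"
proof -
  have fin: "finite_measure \<mu>" "finite_measure \<kappa>" and sp: "space \<mu> = points G" "space \<kappa> = points G"
    using net_measuresD mu ka by auto
  let ?S = "{\<bar>(\<integral>x. \<phi> x \<partial>\<mu>) - (\<integral>x. \<phi> x \<partial>\<kappa>)\<bar> | \<phi>. \<phi> \<in> BL_space G \<and> BL_norm G \<phi> \<le> 1}"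
  have bound: "\<bar>\<integral>x. \<psi> x \<partial>\<mu>'\<bar> \<le> measure \<mu>' (points G)"
    if \<mu>': "finite_measure \<mu>'" "space \<mu>' = points G" and psi: "\<And>x. x \<in> points G \<Longrightarrow> \<bar>\<psi> x\<bar> \<le> 1" for \<mu>' and \<psi> :: "'a \<Rightarrow> real"
  proof (cases "integrable \<mu>' \<psi>")
    case True
    have "\<bar>\<integral>x. \<psi> x \<partial>\<mu>'\<bar> \<le> (\<integral>x. \<bar>\<psi> x\<bar> \<partial>\<mu>')" by (rule integral_abs_bound)
    also have "\<dots> \<le> (\<integral>x. 1 \<partial>\<mu>')"
      by (rule integral_mono) (use True psi \<mu>' finite_measure.integrable_const[OF \<mu>'(1)] in auto)
    also have "\<dots> = measure \<mu>' (points G)" using \<mu>' by simp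
    finally show ?thesis .
  qed (simp add: not_integrable_integral_eq)
  have bdd: "bdd_above ?S"
  proof (rule bdd_aboveI)
    fix z assume "z \<in> ?S"
    then obtain \<psi> where z: "z = \<bar>(\<integral>x. \<psi> x \<partial>\<mu>) - (\<integral>x. \<psi> x \<partial>\<kappa>)\<bar>" "\<psi> \<in> BL_space G" "BL_norm G \<psi> \<le> 1" by auto
    obtain K' where K': "\<forall>x\<in>points G. \<forall>y\<in>points G. \<bar>\<psi> x - \<psi> y\<bar> \<le> K' * path_dist G x y"
      using z(2) by (auto simp: BL_space_def)
    have "0 \<le> lip_const G \<psi>"
      unfolding lip_const_def
    proof (rule cInf_greatest)
      have "\<bar>\<psi> x - \<psi> y\<bar> \<le> max 0 K' * path_dist G x y" if "x \<in> points G" "y \<in> points G" for x y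
      proof -
        have "\<bar>\<psi> x - \<psi> y\<bar> \<le> K' * path_dist G x y" using K' that by blast
        also have "\<dots> \<le> max 0 K' * path_dist G x y" by (intro mult_right_mono path_dist_nonneg that) simp
        finally show ?thesis .
      qed
      then show "{K. 0 \<le> K \<and> (\<forall>x\<in>points G. \<forall>y\<in>points G. \<bar>\<psi> x - \<psi> y\<bar> \<le> K * path_dist G x y)} \<noteq> {}"
        by (auto intro!: exI[of _ "max 0 K'"])
    qed simp
    then have sup: "(SUP x\<in>points G. \<bar>\<psi> x\<bar>) \<le> 1" using z(3) by (simp add: BL_norm_def)
    obtain C where "\<forall>x\<in>points G. \<bar>\<psi> x\<bar> \<le> C" using z(2) by (auto simp: BL_space_def bounded_iff)
    then have ba: "bdd_above ((\<lambda>x. \<bar>\<psi> x\<bar>) ` points G)" by (intro bdd_aboveI2) blast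
    have psi1: "\<bar>\<psi> x\<bar> \<le> 1" if "x \<in> points G" for x
      using cSUP_upper[OF that ba] sup by linarith
    from bound[where \<psi> = \<psi>, OF fin(1) sp(1) psi1] bound[where \<psi> = \<psi>, OF fin(2) sp(2) psi1]
    show "z \<le> measure \<mu> (points G) + measure \<kappa> (points G)" unfolding z(1) by linarith
  qed
  let ?\<psi> = "\<lambda>x. \<phi> x / (B + K)"
  have BK: "0 < B + K" using B K by simp
  have lipc: "\<bar>?\<psi> x - ?\<psi> y\<bar> \<le> K / (B + K) * path_dist G x y" if "x \<in> points G" "y \<in> points G" for x y
  proof -
    have "\<bar>?\<psi> x - ?\<psi> y\<bar> = \<bar>\<phi> x - \<phi> y\<bar> / (B + K)" using BK by (simp add: diff_divide_distrib[symmetric] abs_divide)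
    also have "\<dots> \<le> K * path_dist G x y / (B + K)" using phi(2)[OF that] BK by (intro divide_right_mono) auto
    finally show ?thesis by simp
  qed
  have sb: "\<bar>?\<psi> x\<bar> \<le> B / (B + K)" if "x \<in> points G" for x
    using phi(1)[OF that] BK by (simp add: abs_divide divide_right_mono)
  have "?\<psi> \<in> BL_space G"
    unfolding BL_space_def
    by (intro CollectI conjI exI[of _ "K / (B + K)"] ballI lipc) (use sb in \<open>auto simp: bounded_iff simp del: abs_divide\<close>)
  moreover have "BL_norm G ?\<psi> \<le> 1"
  proof -
    have "(SUP x\<in>points G. \<bar>?\<psi> x\<bar>) \<le> B / (B + K)" by (rule cSUP_least[OF ne sb])
    moreover have "lip_const G ?\<psi> \<le> K / (B + K)"
      unfolding lip_const_def by (rule cInf_lower) (use lipc K BK in \<open>auto intro: bdd_belowI[of _ 0]\<close>)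
    moreover have "B / (B + K) + K / (B + K) = 1" using BK by (simp add: add_divide_distrib[symmetric])
    ultimately show ?thesis unfolding BL_norm_def by linarith
  qed
  ultimately have "\<bar>(\<integral>x. ?\<psi> x \<partial>\<mu>) - (\<integral>x. ?\<psi> x \<partial>\<kappa>)\<bar> \<in> ?S" by blast
  then have "\<bar>(\<integral>x. ?\<psi> x \<partial>\<mu>) - (\<integral>x. ?\<psi> x \<partial>\<kappa>)\<bar> \<le> BL_dist G \<mu> \<kappa>"
    unfolding BL_dist_def by (rule cSup_upper[OF _ bdd])
  moreover have "(\<integral>x. ?\<psi> x \<partial>\<mu>) - (\<integral>x. ?\<psi> x \<partial>\<kappa>) = ((\<integral>x. \<phi> x \<partial>\<mu>) - (\<integral>x. \<phi> x \<partial>\<kappa>)) / (B + K)"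
    by (simp add: diff_divide_distrib)
  ultimately show ?thesis using BK by (simp add: abs_divide divide_le_eq mult.commute)
qed

definition clampT :: "real \<Rightarrow> real" where "clampT t = max 0 (min T t)"

lemma clampT_in: "clampT t \<in> {0..T}" and clampT_id: "t \<in> {0..T} \<Longrightarrow> clampT t = t"
  using T_pos by (auto simp: clampT_def)

abbreviation mt :: "real \<Rightarrow> 'a measure" where "mt t \<equiv> glue G (\<nu> t)"

text \<open>The velocity frozen along the given solution. Clamping time and parameter extends it to
  the plane and preserves the Lipschitz bound, the range and right continuity.\<close>

definition u :: "'j \<Rightarrow> real \<Rightarrow> real \<Rightarrow> real" where
  "u j t y = v (mt (clampT t)) j (clamp_to (pdom G j) y)"

text \<open>\<open>L\<close> may be nonpositive, while the flow estimates need a positive Lipschitz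
  constant.\<close>

definition K :: real where "K = max L 1"

lemma mt_net: "t \<in> {0..T} \<Longrightarrow> mt t \<in> net_measures G"
  by (rule glue_in_net_measures) (rule nu_line)

lemma mt_right_continuous: "t \<in> {0..<T} \<Longrightarrow> ((\<lambda>s. BL_dist G (mt s) (mt t)) \<longlongrightarrow> 0) (at_right t)"
  using sol by (simp add: measure_valued_solution_def)

text \<open>Within \<open>{0..<T}\<close> the velocity is controlled by the right-continuous
  distance of the measures; outside, the clamped time is constant to the right of
  \<open>t\<close>.\<close>

lemma u_right_continuous:
  assumes j: "j \<in> arcs G"
  shows "((\<lambda>s. u j s y) \<longlongrightarrow> u j t y) (at_right t)"
proof -
  consider "t < 0" | "t \<in> {0..<T}" | "T \<le> t" by force
  then show ?thesis
  proof cases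
    case 1
    then have "\<forall>\<^sub>F s in at_right t. u j s y = u j t y"
      by (auto simp: eventually_at_right_field u_def clampT_def intro!: exI[of _ 0])
    then show ?thesis by (rule tendsto_eventually)
  next
    case 2
    have "((\<lambda>s. u j s y - u j t y) \<longlongrightarrow> 0) (at_right t)"
    proof (rule Lim_null_comparison)
      show "((\<lambda>s. L * BL_dist G (mt s) (mt t)) \<longlongrightarrow> 0) (at_right t)"
        using tendsto_mult[OF tendsto_const[of L] mt_right_continuous[OF 2]] by simp
      show "\<forall>\<^sub>F s in at_right t. norm (u j s y - u j t y) \<le> L * BL_dist G (mt s) (mt t)"
      proof -
        have "norm (u j s y - u j t y) \<le> L * BL_dist G (mt s) (mt t)" if "t < s" "s < T" for s
        proof -
          have st: "clampT s = s" "clampT t = t" "s \<in> {0..T}" "t \<in> {0..T}" using that 2 by (auto simp: clampT_def)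
          then show ?thesis
            using vel mt_net j clamp_to_in[OF j] by (simp add: u_def velocity_field_def)
        qed
        then show ?thesis using 2 by (auto simp: eventually_at_right_field intro!: exI[of _ T])
      qed
    qed
    then show ?thesis by (simp add: LIM_zero_iff)
  next
    case 3
    then have "\<forall>\<^sub>F s in at_right t. u j s y = u j t y"
      by (auto simp: eventually_at_right_field u_def clampT_def intro!: exI[of _ "t + 1"])
    then show ?thesis by (rule tendsto_eventually)
  qed
qed

lemma field:
  assumes j: "j \<in> arcs G"
  shows "transport_field (u j) Vmax K"
proof -
  have n: "mt (clampT t) \<in> net_measures G" for t by (rule mt_net[OF clampT_in])
  have "0 < K" by (simp add: K_def)
  moreover have "0 \<le> u j t y" "u j t y \<le> Vmax" for t y
    using vel n clamp_to_in[OF j] j by (auto simp: velocity_field_def u_def)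
  moreover have "\<bar>u j t y - u j t z\<bar> \<le> K * \<bar>y - z\<bar>" for t y z
  proof -
    let ?c = "clamp_to (pdom G j)"
    have "\<bar>u j t y - u j t z\<bar> \<le> L * \<bar>?c y - ?c z\<bar>"
      using vel n[of t] clamp_to_in[OF j] j by (simp add: velocity_field_def u_def)
    also have "\<dots> \<le> K * \<bar>?c y - ?c z\<bar>" by (intro mult_right_mono) (auto simp: K_def)
    also have "\<dots> \<le> K * \<bar>y - z\<bar>" by (intro mult_left_mono clamp_to_lip j) (simp add: K_def)
    finally show ?thesis .
  qed
  ultimately show ?thesis
    by (intro transport_field.intro u_right_continuous[OF j])
qed

lemma succs_arcs: "k \<in> succs j \<longleftrightarrow> k \<in> arcs G \<and> (\<exists>x. x \<in> verts G \<and> j \<in> Inc G x \<and> k \<in> Out G x)"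
  using succsD(1) by (auto simp: succs_def)

lemma p_bounds: "j \<in> arcs G \<Longrightarrow> k \<in> arcs G \<Longrightarrow> t \<in> {0..T} \<Longrightarrow> 0 \<le> p j k t \<and> p j k t \<le> 1"
  using coeffs by (simp add: distribution_coefficients_def)

lemma u_eq: "j \<in> arcs G \<Longrightarrow> t \<in> {0..T} \<Longrightarrow> y \<in> pdom G j \<Longrightarrow> u j t y = v (mt t) j y"
  by (simp add: u_def clampT_id clamp_to_id)

lemma p_sum:
  assumes that: "j \<in> arcs G" "has_hi j" "t \<in> {0..T}"
  shows "(\<Sum>k\<in>succs j. p j k t) = 1"
  proof -
    have "(\<Sum>k\<in>succs j. p j k t) = (\<Sum>k\<in>arcs G. p j k t)"
    proof (rule sum.mono_neutral_left[OF finite_arcs])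
      show "succs j \<subseteq> arcs G" using succsD(1) by blast
      show "\<forall>k\<in>arcs G - succs j. p j k t = 0"
        using coeffs that succs_arcs by (auto simp: distribution_coefficients_def)
    qed
    also have "\<dots> = 1" using coeffs that by (simp add: distribution_coefficients_def)
    finally show ?thesis .
  qed

sublocale network_flow G T Vmax K v \<nu> p u
  by (intro network_flow.intro network_flow_axioms.intro network_axioms T_pos Vmax_pos field u_eq p_sum)
     (use p_bounds in blast)+

text \<open>Extension by zero of a measure on an interval to the whole line.\<close>

definition line :: "real measure \<Rightarrow> real measure" where
  "line \<mu> = distr \<mu> borel (\<lambda>y. y)"

lemma line_props:
  assumes "sets \<mu> = sets (restrict_space borel I)" "finite_measure \<mu>"
  shows "sets (line \<mu>) = sets borel" "finite_measure (line \<mu>)"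
    "A \<in> sets borel \<Longrightarrow> emeasure (line \<mu>) A = emeasure \<mu> (A \<inter> I)"
    "I \<in> sets borel \<Longrightarrow> AE y in line \<mu>. y \<in> I"
    "g \<in> borel_measurable borel \<Longrightarrow> (\<integral>y. g y \<partial>line \<mu>) = (\<integral>y. (g y :: real) \<partial>\<mu>)"
proof -
  have m: "(\<lambda>y. y) \<in> measurable \<mu> borel"
    using assms(1) measurable_restrict_space1[of "\<lambda>y. y" borel borel I] by (simp cong: measurable_cong_sets)
  have sp: "space \<mu> = I" using sets_eq_imp_space_eq[OF assms(1)] by (simp add: space_restrict_space)
  show "sets (line \<mu>) = sets borel" by (simp add: line_def)
  show "finite_measure (line \<mu>)" unfolding line_def by (rule finite_measure.finite_measure_distr[OF assms(2) m])
  show "emeasure (line \<mu>) A = emeasure \<mu> (A \<inter> I)" if "A \<in> sets borel"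
    unfolding line_def using emeasure_distr[OF m that] by (simp add: sp vimage_def Int_def)
  show "AE y in line \<mu>. y \<in> I" if "I \<in> sets borel"
    unfolding line_def using that by (subst AE_distr_iff[OF m]) (auto simp: sp)
  show "(\<integral>y. g y \<partial>line \<mu>) = (\<integral>y. g y \<partial>\<mu>)" if "g \<in> borel_measurable borel"
    unfolding line_def by (rule integral_distr[OF m that])
qed

lemma pdom_borel: "j \<in> arcs G \<Longrightarrow> pdom G j \<in> sets borel"
  by (cases j rule: pdom_cases) auto

definition N :: "'j \<Rightarrow> real \<Rightarrow> real measure" where
  "N j t = line (\<nu> (clampT t) j)"

lemma nuD: "t \<in> {0..T} \<Longrightarrow> j \<in> arcs G \<Longrightarrow> sets (\<nu> t j) = sets (restrict_space borel (pdom G j))"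
  "t \<in> {0..T} \<Longrightarrow> j \<in> arcs G \<Longrightarrow> finite_measure (\<nu> t j)"
  "t \<in> {0..T} \<Longrightarrow> j \<in> arcs G \<Longrightarrow> space (\<nu> t j) = pdom G j"
  using line_measuresD[OF nu_line] by blast+

lemma clampT_measurable: "clampT \<in> measurable borel (restrict_space borel {0..T})"
proof (rule measurable_restrict_space2)
  show "clampT \<in> space borel \<rightarrow> {0..T}" using clampT_in by auto
  show "clampT \<in> borel_measurable borel" unfolding clampT_def by measurable
qed

lemma disint: "disintegration G T m \<nu>" and m_sets: "sets m = sets (restrict_space borel (points G \<times> {0..T}))"
  and m_fin: "finite_measure m"
  and nu_end: "t \<in> {0..T} \<Longrightarrow> j \<in> arcs G \<Longrightarrow> has_hi j \<Longrightarrow> emeasure (\<nu> t j) {hi j} = 0"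
  using sol by (auto simp: measure_valued_solution_def)

text \<open>The masses on one arc are integrable in time because their integral is at most the total
  mass of the finite measure \<open>m\<close>.\<close>

lemma kernel:
  assumes j: "j \<in> arcs G"
  shows "real_kernel (N j) T"
proof (rule real_kernel.intro)
  note P = line_props[OF nuD(1,2)[OF clampT_in j]]
  show "sets (N j t) = sets borel" "finite_measure (N j t)" for t unfolding N_def by (rule P)+
  show "(\<lambda>t. emeasure (N j t) A) \<in> borel_measurable borel" if A: "A \<in> sets borel" for A
  proof -
    have "A \<inter> pdom G j \<in> sets (restrict_space borel (pdom G j))"
      using A by (auto simp: sets_restrict_space Int_commute)
    then have "(\<lambda>t. emeasure (\<nu> t j) (A \<inter> pdom G j)) \<in> borel_measurable (restrict_space borel {0..T})"
      using disint j by (simp add: disintegration_def)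
    from measurable_compose[OF clampT_measurable this] show ?thesis
      unfolding N_def P(3)[OF A] .
  qed
  show "(\<integral>\<^sup>+t\<in>{0..T}. emeasure (N j t) UNIV \<partial>lborel) < \<infinity>"
  proof -
    have "(\<integral>\<^sup>+t\<in>{0..T}. emeasure (N j t) UNIV \<partial>lborel)
      \<le> (\<integral>\<^sup>+t\<in>{0..T}. (\<Sum>j\<in>arcs G. emeasure (\<nu> t j) {y \<in> pdom G j. (par G j y, t) \<in> space m}) \<partial>lborel)"
    proof (intro nn_integral_mono)
      fix t :: real
      show "emeasure (N j t) UNIV * indicator {0..T} t \<le> (\<Sum>j\<in>arcs G. emeasure (\<nu> t j) {y \<in> pdom G j. (par G j y, t) \<in> space m}) * indicator {0..T} t"
      proof (cases "t \<in> {0..T}")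
        case True
        have "space m = points G \<times> {0..T}"
          using sets_eq_imp_space_eq[OF m_sets] by (simp add: space_restrict_space)
        then have "{y \<in> pdom G j. (par G j y, t) \<in> space m} = pdom G j" using j True by (auto simp: points_def)
        moreover have "emeasure (N j t) UNIV = emeasure (\<nu> t j) (pdom G j)"
          using P(3)[of UNIV t] True by (simp add: N_def clampT_id)
        ultimately have "emeasure (N j t) UNIV = emeasure (\<nu> t j) {y \<in> pdom G j. (par G j y, t) \<in> space m}" by simp
        also have "\<dots> \<le> (\<Sum>j\<in>arcs G. emeasure (\<nu> t j) {y \<in> pdom G j. (par G j y, t) \<in> space m})"
          by (rule member_le_sum[OF j _ finite_arcs]) simp
        finally show ?thesis using True by simp
      qed simp
    qed
    also have "\<dots> = emeasure m (space m)" using disint by (simp add: disintegration_def)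
    also have "\<dots> < \<infinity>" using finite_measure.emeasure_finite[OF m_fin] by (simp add: less_top)
    finally show ?thesis .
  qed
qed

end

section \<open>Test functions on an arc and their extension to the network\<close>

lemma test_fun_bounded:
  assumes c: "continuous_on UNIV (\<lambda>(y, t). f y t)" "continuous_on UNIV (\<lambda>(y, t). fy y t)" "continuous_on UNIV (\<lambda>(y, t). ft y t)"
    and d: "\<And>y t. ((\<lambda>z. f z t) has_real_derivative fy y t) (at y)" "\<And>y t. ((\<lambda>r. f y r) has_real_derivative ft y t) (at t)"
  shows "test_fun {0..l} T f fy ft"
  unfolding test_fun_def
proof (intro conjI allI impI)
  have bdd: "\<exists>B. \<forall>y\<in>{0..l}. \<forall>t\<in>{0..T}. \<bar>g y t\<bar> \<le> B" if "continuous_on UNIV (\<lambda>(y, t). g y t)" for g :: "real \<Rightarrow> real \<Rightarrow> real"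
  proof -
    have "bounded ((\<lambda>(y, t). g y t) ` ({0..l} \<times> {0..T}))"
      by (intro compact_imp_bounded compact_continuous_image continuous_on_subset[OF that] compact_Times) auto
    then show ?thesis by (fastforce simp: bounded_iff)
  qed
  obtain B where B: "\<forall>y\<in>{0..l}. \<forall>t\<in>{0..T}. \<bar>fy y t\<bar> \<le> B" using bdd[OF c(2)] by auto
  obtain C where C: "\<forall>y\<in>{0..l}. \<forall>t\<in>{0..T}. \<bar>ft y t\<bar> \<le> C" using bdd[OF c(3)] by auto
  show "\<exists>B. \<forall>y\<in>{0..l}. \<forall>t\<in>{0..T}. \<bar>fy y t\<bar> \<le> B \<and> \<bar>ft y t\<bar> \<le> B"
    using B C by (intro exI[of _ "max B C"]) (auto simp: le_max_iff_disj)
  show "\<exists>R. \<forall>y\<in>{0..l}. \<forall>t\<in>{0..T}. R < \<bar>y\<bar> \<longrightarrow> \<bar>f y t\<bar> < \<epsilon>" for \<epsilon>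
    by (intro exI[of _ l]) auto
qed (use assms in auto)

text \<open>A profile in the distance \<open>d \<ge> 0\<close> from a vertex, equal to 1 at the
  vertex and 0 from \<open>\<delta>\<close> on. Its slope at the vertex is not 0, in keeping with
  test functions that are C^1 on each closed arc separately.\<close>

definition fade :: "real \<Rightarrow> real \<Rightarrow> real" where "fade \<delta> d = (max 0 (1 - d / \<delta>))\<^sup>2"
definition fade_deriv :: "real \<Rightarrow> real \<Rightarrow> real" where "fade_deriv \<delta> d = - (2 * max 0 (1 - d / \<delta>) / \<delta>)"

lemma fade_has_derivative:
  assumes "\<delta> > 0"
  shows "(fade \<delta> has_real_derivative fade_deriv \<delta> d) (at d)"
proof -
  have "((\<lambda>d. 1 - d / \<delta>) has_real_derivative - (1 / \<delta>)) (at d)"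
    using assms by (auto intro!: derivative_eq_intros)
  from DERIV_chain2[OF has_derivative_pos_part_square this] show ?thesis
    by (simp add: fade_def[abs_def] fade_deriv_def)
qed

lemma fade_continuous:
  assumes "\<delta> > 0"
  shows "continuous_on A (fade \<delta>)" "continuous_on A (fade_deriv \<delta>)"
proof -
  have c: "continuous_on A (\<lambda>d. max 0 (1 - d / \<delta>))" using assms by (intro continuous_intros) auto
  show "continuous_on A (fade \<delta>)" unfolding fade_def[abs_def] by (intro continuous_on_power c)
  show "continuous_on A (fade_deriv \<delta>)"
    unfolding fade_deriv_def[abs_def] using assms by (intro continuous_intros c) auto
qed

lemma fade_zero [simp]: "fade \<delta> 0 = 1" and fade_far: "\<delta> > 0 \<Longrightarrow> \<delta> \<le> d \<Longrightarrow> fade \<delta> d = 0"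
  by (simp_all add: fade_def max_def le_divide_eq)

lemma fade_deriv_bound: "\<delta> > 0 \<Longrightarrow> 0 \<le> d \<Longrightarrow> \<bar>fade_deriv \<delta> d\<bar> \<le> 2 / \<delta>"
  by (auto simp: fade_deriv_def max_def divide_simps)

text \<open>The sign \<open>s\<close> is 1 at an initial endpoint and -1 at a terminal one, so that
  \<open>s * (z - e)\<close> is the distance to the endpoint \<open>e\<close> within the
  arc.\<close>

lemma test_fun_fade:
  assumes del: "\<delta> > 0" and s: "s = 1 \<or> s = - 1" and I: "\<And>z. z \<in> I \<Longrightarrow> 0 \<le> s * (z - e)"
    and a: "\<And>t. (a has_real_derivative a' t) (at t)" and a': "continuous_on UNIV a'"
  shows "test_fun I T (\<lambda>z t. a t * fade \<delta> (s * (z - e))) (\<lambda>z t. a t * (s * fade_deriv \<delta> (s * (z - e)))) (\<lambda>z t. a' t * fade \<delta> (s * (z - e)))"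
  unfolding test_fun_def
proof (intro conjI allI impI)
  have ac: "continuous_on UNIV a" using a by (intro DERIV_continuous_on) auto
  show "continuous_on UNIV (\<lambda>(z, t). a t * fade \<delta> (s * (z - e)))" "continuous_on UNIV (\<lambda>(z, t). a t * (s * fade_deriv \<delta> (s * (z - e))))"
    "continuous_on UNIV (\<lambda>(z, t). a' t * fade \<delta> (s * (z - e)))"
    unfolding case_prod_beta
    by (intro continuous_intros continuous_on_compose2[OF ac] continuous_on_compose2[OF a'] continuous_on_compose2[OF fade_continuous(1)[OF del, of UNIV]]
        continuous_on_compose2[OF fade_continuous(2)[OF del, of UNIV]]; simp)+
  show "((\<lambda>z. a t * fade \<delta> (s * (z - e))) has_real_derivative a t * (s * fade_deriv \<delta> (s * (y - e)))) (at y)" for y t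
  proof -
    have "((\<lambda>z. s * (z - e)) has_real_derivative s) (at y)" by (auto intro!: derivative_eq_intros)
    from DERIV_cmult[OF DERIV_chain2[OF fade_has_derivative[OF del] this]] show ?thesis by (simp add: mult.commute)
  qed
  show "((\<lambda>r. a r * fade \<delta> (s * (y - e))) has_real_derivative a' t * fade \<delta> (s * (y - e))) (at t)" for y t
    by (rule DERIV_cmult_right[OF a])
  obtain A where A: "\<forall>t\<in>{0..T}. \<bar>a t\<bar> \<le> A"
    using compact_imp_bounded[OF compact_continuous_image[OF continuous_on_subset[OF ac subset_UNIV] compact_Icc], of 0 T]
    by (auto simp: bounded_iff)
  obtain A' where A': "\<forall>t\<in>{0..T}. \<bar>a' t\<bar> \<le> A'"
    using compact_imp_bounded[OF compact_continuous_image[OF continuous_on_subset[OF a' subset_UNIV] compact_Icc], of 0 T]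
    by (auto simp: bounded_iff)
  have f1: "\<bar>fade \<delta> d\<bar> \<le> 1" if "0 \<le> d" for d
    using that del by (auto simp: fade_def max_def power_le_one)
  show "\<exists>B. \<forall>y\<in>I. \<forall>t\<in>{0..T}. \<bar>a t * (s * fade_deriv \<delta> (s * (y - e)))\<bar> \<le> B \<and> \<bar>a' t * fade \<delta> (s * (y - e))\<bar> \<le> B"
  proof (intro exI ballI)
    fix y t assume y: "y \<in> I" and t: "t \<in> {0..T}"
    have AA: "0 \<le> A" "0 \<le> A'" using A[rule_format, OF t] A'[rule_format, OF t] by linarith+
    have "\<bar>a t * (s * fade_deriv \<delta> (s * (y - e)))\<bar> = \<bar>a t\<bar> * \<bar>fade_deriv \<delta> (s * (y - e))\<bar>"
      using s by (auto simp: abs_mult)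
    also have "\<dots> \<le> A * (2 / \<delta>)"
      using A t fade_deriv_bound[OF del I[OF y]] AA by (intro mult_mono) auto
    finally have 1: "\<bar>a t * (s * fade_deriv \<delta> (s * (y - e)))\<bar> \<le> A * (2 / \<delta>)" .
    have 2: "\<bar>a' t * fade \<delta> (s * (y - e))\<bar> \<le> A' * 1"
      unfolding abs_mult using A' t f1[OF I[OF y]] AA by (intro mult_mono) auto
    have "0 \<le> A * (2 / \<delta>)" using AA del by simp
    then show "\<bar>a t * (s * fade_deriv \<delta> (s * (y - e)))\<bar> \<le> A * (2 / \<delta>) + A' * 1 \<and> \<bar>a' t * fade \<delta> (s * (y - e))\<bar> \<le> A * (2 / \<delta>) + A' * 1"
      using 1 2 AA by linarith
  qed
  show "\<exists>R. \<forall>y\<in>I. \<forall>t\<in>{0..T}. R < \<bar>y\<bar> \<longrightarrow> \<bar>a t * fade \<delta> (s * (y - e))\<bar> < \<epsilon>" if "0 < \<epsilon>" for \<epsilon>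
  proof (intro exI[of _ "\<bar>e\<bar> + \<delta>"] ballI impI)
    fix y t assume y: "y \<in> I" "\<bar>e\<bar> + \<delta> < \<bar>y\<bar>"
    have "\<delta> \<le> \<bar>y - e\<bar>" using y by linarith
    also have "\<dots> = s * (y - e)" using I[OF y(1)] s by auto
    finally show "\<bar>a t * fade \<delta> (s * (y - e))\<bar> < \<epsilon>" using that fade_far[OF del] by simp
  qed
qed

lemma test_fun_zero: "test_fun I T (\<lambda>_ _. 0) (\<lambda>_ _. 0) (\<lambda>_ _. 0)"
  unfolding test_fun_def by (auto simp: case_prod_beta)

lemma not_in_closure_far:
  fixes y t :: real and S :: "(real \<times> real) set"
  assumes "\<eta> > 0" "\<And>z s. (z, s) \<in> S \<Longrightarrow> \<eta> \<le> \<bar>z - y\<bar>"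
  shows "(y, t) \<notin> closure S"
proof -
  let ?C = "{w :: real \<times> real. \<eta> \<le> \<bar>fst w - y\<bar>}"
  have "closed ?C" by (intro closed_Collect_le continuous_intros)
  moreover have "S \<subseteq> ?C" using assms(2) by auto
  ultimately have "closure S \<subseteq> ?C" by (simp add: closure_minimal)
  then show ?thesis using assms(1) by auto
qed

context network_solution
begin

lemma arcs_meet: "i \<in> arcs G \<Longrightarrow> k \<in> arcs G \<Longrightarrow> i \<noteq> k \<Longrightarrow> y \<in> pdom G i \<Longrightarrow> z \<in> pdom G k \<Longrightarrow> par G i y = par G k z \<Longrightarrow> par G i y \<in> verts G"
  using net unfolding oriented_network_def by blast

lemma vertex_is_end:
  assumes "k \<in> arcs G" "z \<in> pdom G k" "par G k z \<in> verts G"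
  shows "has_lo k \<and> z = lo k \<or> has_hi k \<and> z = hi k"
  using net assms by (simp add: oriented_network_def)

text \<open>Distinct arcs meet only at vertices, and these are endpoints of the arcs on which they
  lie; agreement with common values \<open>q0\<close> at the endpoints is thus enough for a
  single-valued function.\<close>

lemma glue_functions:
  fixes q :: "'j \<Rightarrow> real \<Rightarrow> real \<Rightarrow> real"
  assumes "\<And>k t. k \<in> arcs G \<Longrightarrow> has_lo k \<Longrightarrow> q k (lo k) t = q0 (par G k (lo k)) t"
    and "\<And>k t. k \<in> arcs G \<Longrightarrow> has_hi k \<Longrightarrow> q k (hi k) t = q0 (par G k (hi k)) t"
  shows "\<exists>F. \<forall>k\<in>arcs G. \<forall>z\<in>pdom G k. \<forall>t. F (par G k z) t = q k z t"
proof -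
  define F where "F P t = (SOME r. \<exists>k\<in>arcs G. \<exists>z\<in>pdom G k. par G k z = P \<and> r = q k z t)" for P t
  have uniq: "q k z t = q k' z' t" if "k \<in> arcs G" "k' \<in> arcs G" "z \<in> pdom G k" "z' \<in> pdom G k'" "par G k z = par G k' z'" for k k' z z' t
  proof (cases "k = k'")
    case True
    then show ?thesis using inj_onD[OF par_inj that(5)[unfolded True]] that by metis
  next
    case False
    have V: "par G k z \<in> verts G" by (rule arcs_meet[OF that(1,2) False that(3-5)])
    have "q k z t = q0 (par G k z) t" using vertex_is_end[OF that(1,3) V] assms that(1) by metis
    moreover have "q k' z' t = q0 (par G k' z') t" using vertex_is_end[OF that(2,4)] V that(5) assms that(2) by metis
    ultimately show ?thesis using that(5) by simp
  qed
  have "F (par G k z) t = q k z t" if k: "k \<in> arcs G" "z \<in> pdom G k" for k z t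
    unfolding F_def
  proof (rule some_equality)
    show "\<exists>k'\<in>arcs G. \<exists>z'\<in>pdom G k'. par G k' z' = par G k z \<and> q k z t = q k' z' t" using k by blast
    show "r = q k z t" if "\<exists>k'\<in>arcs G. \<exists>z'\<in>pdom G k'. par G k' z' = par G k z \<and> r = q k' z' t" for r
    proof -
      from that obtain k' z' where "k' \<in> arcs G" "z' \<in> pdom G k'" "par G k' z' = par G k z" "r = q k' z' t" by blast
      then show ?thesis using uniq[of k' k z' z t] k by simp
    qed
  qed
  then show ?thesis by blast
qed

text \<open>Derivatives within the parameter interval are unique, so \<open>dx\<close> is the
  derivative supplied with a test function, endpoints included.\<close>

lemma pdom_not_isolated:
  assumes k: "k \<in> arcs G" and y: "y \<in> pdom G k"
  shows "at y within pdom G k \<noteq> bot"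
proof -
  have "connected (pdom G k)" by (cases rule: pdom_cases[OF k]) simp_all
  moreover have "\<nexists>a. pdom G k = {a}"
  proof
    assume "\<exists>a. pdom G k = {a}"
    then obtain a where a: "pdom G k = {a}" by blast
    have "(0 \<in> pdom G k \<and> (1 \<in> pdom G k \<or> - 1 \<in> pdom G k)) \<or> (\<exists>l>0. pdom G k = {0..l})"
      by (rule pdom_cases[OF k]) auto
    then show False
    proof
      assume "\<exists>l>0. pdom G k = {0..l}"
      then obtain l where l: "l > 0" "pdom G k = {0..l}" by blast
      have "0 \<in> pdom G k" "l \<in> pdom G k" using l by simp_all
      then show False using l(1) unfolding a singleton_iff by linarith
    next
      assume "0 \<in> pdom G k \<and> (1 \<in> pdom G k \<or> - 1 \<in> pdom G k)"
      then show False unfolding a singleton_iff by linarith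
    qed
  qed
  ultimately have "y islimpt pdom G k" using connected_imp_perfect[of "pdom G k" y] y by blast
  then show ?thesis by (simp add: trivial_limit_within)
qed

lemma time_not_isolated: "t \<in> {0..T} \<Longrightarrow> at t within {0..T} \<noteq> bot"
  using connected_imp_perfect[of "{0..T}" t] T_pos by (simp add: trivial_limit_within)

lemma network_test_fun:
  assumes tf: "\<And>k. k \<in> arcs G \<Longrightarrow> test_fun (pdom G k) T (q k) (qy k) (qt k)"
    and F: "\<And>k z t. k \<in> arcs G \<Longrightarrow> z \<in> pdom G k \<Longrightarrow> F (par G k z) t = q k z t"
  shows "F \<in> C1_0 G T"
    and "\<And>k y t. k \<in> arcs G \<Longrightarrow> y \<in> pdom G k \<Longrightarrow> t \<in> {0..T} \<Longrightarrow> dx G F k y t = qy k y t"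
    and "\<And>k y t. k \<in> arcs G \<Longrightarrow> y \<in> pdom G k \<Longrightarrow> t \<in> {0..T} \<Longrightarrow> dt G T F k y t = qt k y t"
proof -
  have dy: "((\<lambda>z. F (par G k z) t) has_vector_derivative qy k y t) (at y within pdom G k)"
    if k: "k \<in> arcs G" "y \<in> pdom G k" for k y t
  proof (rule has_vector_derivative_transform[OF k(2)])
    show "F (par G k z) t = q k z t" if "z \<in> pdom G k" for z by (rule F[OF k(1) that])
    show "((\<lambda>z. q k z t) has_vector_derivative qy k y t) (at y within pdom G k)"
      using tf[OF k(1)] unfolding test_fun_def
      by (auto simp flip: has_real_derivative_iff_has_vector_derivative intro: has_field_derivative_at_within)
  qed
  have dt: "((\<lambda>r. F (par G k y) r) has_vector_derivative qt k y t) (at t within {0..T})"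
    if k: "k \<in> arcs G" "y \<in> pdom G k" for k y t
  proof -
    have "((\<lambda>r. q k y r) has_vector_derivative qt k y t) (at t within {0..T})"
      using tf[OF k(1)] unfolding test_fun_def
      by (auto simp flip: has_real_derivative_iff_has_vector_derivative intro: has_field_derivative_at_within)
    then show ?thesis by (simp add: F[OF k])
  qed
  show dxe: "dx G F k y t = qy k y t" if "k \<in> arcs G" "y \<in> pdom G k" "t \<in> {0..T}" for k y t
    unfolding dx_def by (rule vector_derivative_within[OF pdom_not_isolated[OF that(1,2)] dy[OF that(1,2)]])
  show dte: "dt G T F k y t = qt k y t" if "k \<in> arcs G" "y \<in> pdom G k" "t \<in> {0..T}" for k y t
    unfolding dt_def by (rule vector_derivative_within[OF time_not_isolated[OF that(3)] dt[OF that(1,2)]])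
  show "F \<in> C1_0 G T"
    unfolding C1_0_def
  proof (intro CollectI ballI conjI)
    fix k assume k: "k \<in> arcs G"
    have c: "continuous_on (pdom G k \<times> {0..T}) (\<lambda>(y, t). q k y t)" "continuous_on (pdom G k \<times> {0..T}) (\<lambda>(y, t). qy k y t)"
      "continuous_on (pdom G k \<times> {0..T}) (\<lambda>(y, t). qt k y t)"
      using tf[OF k] unfolding test_fun_def by (auto intro: continuous_on_subset)
    show "continuous_on (pdom G k \<times> {0..T}) (\<lambda>(y, t). F (par G k y) t)"
      by (rule continuous_on_eq[OF c(1)]) (auto simp: F[OF k])
    show "continuous_on (pdom G k \<times> {0..T}) (\<lambda>(y, t). dx G F k y t)"
      by (rule continuous_on_eq[OF c(2)]) (auto simp: dxe[OF k])
    show "continuous_on (pdom G k \<times> {0..T}) (\<lambda>(y, t). dt G T F k y t)"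
      by (rule continuous_on_eq[OF c(3)]) (auto simp: dte[OF k])
    show "\<forall>\<epsilon>>0. \<exists>R. \<forall>y\<in>pdom G k. \<forall>t\<in>{0..T}. R < \<bar>y\<bar> \<longrightarrow> \<bar>F (par G k y) t\<bar> < \<epsilon>"
      using tf[OF k] by (simp add: test_fun_def F[OF k])
    fix y t assume y: "y \<in> pdom G k"
    show "(\<lambda>z. F (par G k z) t) differentiable at y within pdom G k"
      by (rule differentiableI_vector[OF dy[OF k y]])
    show "(\<lambda>r. F (par G k y) r) differentiable at t within {0..T}"
      by (rule differentiableI_vector[OF dt[OF k y]])
  qed
qed

lemma test_fun_measurable:
  assumes "test_fun I T f fy ft"
  shows "(\<lambda>(t, y). fy y t) \<in> borel_measurable (borel \<Otimes>\<^sub>M borel)" "(\<lambda>(t, y). ft y t) \<in> borel_measurable (borel \<Otimes>\<^sub>M borel)"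
    "(\<lambda>y. f y t) \<in> borel_measurable borel" "(\<lambda>t. f y t) \<in> borel_measurable borel"
proof -
  have c: "(\<lambda>(t, y). g y t) \<in> borel_measurable (borel \<Otimes>\<^sub>M borel)"
    if "continuous_on UNIV (\<lambda>(y, t). g y t)" for g :: "real \<Rightarrow> real \<Rightarrow> real"
  proof -
    have m: "(\<lambda>(y, t). g y t) \<in> borel_measurable (borel \<Otimes>\<^sub>M borel)"
      using borel_measurable_continuous_onI[OF that] by (simp add: borel_prod)
    have "(\<lambda>z. (\<lambda>(y, t). g y t) (snd z, fst z)) \<in> borel_measurable (borel \<Otimes>\<^sub>M borel)"
      by (rule measurable_compose[OF _ m]) simp
    then show ?thesis by (simp add: case_prod_beta')
  qed
  show "(\<lambda>(t, y). fy y t) \<in> borel_measurable (borel \<Otimes>\<^sub>M borel)" "(\<lambda>(t, y). ft y t) \<in> borel_measurable (borel \<Otimes>\<^sub>M borel)"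
    using assms by (auto simp: test_fun_def intro!: c)
  have "continuous_on UNIV (\<lambda>y. f y t)" "continuous_on UNIV (\<lambda>t. f y t)"
    using assms unfolding test_fun_def by (auto intro!: DERIV_continuous_on)
  then show "(\<lambda>y. f y t) \<in> borel_measurable borel" "(\<lambda>t. f y t) \<in> borel_measurable borel"
    by (auto intro: borel_measurable_continuous_onI)
qed

definition integrand :: "'j \<Rightarrow> (real \<Rightarrow> real \<Rightarrow> real) \<Rightarrow> (real \<Rightarrow> real \<Rightarrow> real) \<Rightarrow> real \<Rightarrow> real \<Rightarrow> real" where
  "integrand j fy ft t y = ft y t + u j t y * fy y t"

lemma integrand_measurable:
  assumes j: "j \<in> arcs G" and tf: "test_fun I T f fy ft"
  shows "(\<lambda>(t, y). integrand j fy ft t y) \<in> borel_measurable (borel \<Otimes>\<^sub>M borel)"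
proof -
  have "(\<lambda>z. (\<lambda>(t, y). ft y t) z + (\<lambda>(t, y). u j t y) z * (\<lambda>(t, y). fy y t) z) \<in> borel_measurable (borel \<Otimes>\<^sub>M borel)"
    by (intro borel_measurable_add borel_measurable_times test_fun_measurable[OF tf] transport_field.u_pair_measurable[OF field[OF j]])
  then show ?thesis by (simp add: integrand_def case_prod_beta')
qed

lemma integrand_bound:
  assumes j: "j \<in> arcs G" and tf: "test_fun (pdom G j) T f fy ft"
  shows "\<exists>B. \<forall>y\<in>pdom G j. \<forall>t\<in>{0..T}. \<bar>integrand j fy ft t y\<bar> \<le> B"
proof -
  obtain B where B: "\<forall>y\<in>pdom G j. \<forall>t\<in>{0..T}. \<bar>fy y t\<bar> \<le> B \<and> \<bar>ft y t\<bar> \<le> B" using tf by (auto simp: test_fun_def)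
  interpret F: transport_field "u j" Vmax K by (rule field[OF j])
  have "\<bar>integrand j fy ft t y\<bar> \<le> B + Vmax * B" if y: "y \<in> pdom G j" and t: "t \<in> {0..T}" for y t
  proof -
    have "\<bar>u j t y * fy y t\<bar> \<le> Vmax * B"
      unfolding abs_mult using B y t F.u_nonneg[of t y] F.u_le[of t y] Vmax_pos by (intro mult_mono) auto
    moreover have "\<bar>ft y t\<bar> \<le> B" using B y t by blast
    ultimately show ?thesis unfolding integrand_def by linarith
  qed
  then show ?thesis by blast
qed

lemma N_props: "j \<in> arcs G \<Longrightarrow> AE y in N j t. y \<in> pdom G j"
  "j \<in> arcs G \<Longrightarrow> t \<in> {0..T} \<Longrightarrow> g \<in> borel_measurable borel \<Longrightarrow> (\<integral>y. g y \<partial>N j t) = (\<integral>y. (g y :: real) \<partial>\<nu> t j)"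
proof -
  show "j \<in> arcs G \<Longrightarrow> AE y in N j t. y \<in> pdom G j"
    unfolding N_def using line_props(4)[OF nuD(1,2)[OF clampT_in]] pdom_borel by simp
  show "j \<in> arcs G \<Longrightarrow> t \<in> {0..T} \<Longrightarrow> g \<in> borel_measurable borel \<Longrightarrow> (\<integral>y. g y \<partial>N j t) = (\<integral>y. g y \<partial>\<nu> t j)"
    using line_props(5)[OF nuD(1,2)[of t j]] by (simp add: N_def clampT_id)
qed

lemma transport_of_test_fun:
  assumes j: "j \<in> arcs G" and tf: "test_fun (pdom G j) T f fy ft"
    and d: "\<And>y t. y \<in> pdom G j \<Longrightarrow> t \<in> {0..T} \<Longrightarrow> dx G F j y t = fy y t \<and> dt G T F j y t = ft y t"
  shows "transport_converges G T v \<nu> F j"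
    and "transport_pairing G T v \<nu> F j = (LINT t:{0..T}|lborel. (\<integral>y. integrand j fy ft t y \<partial>N j t))"
proof -
  have eq: "transport_integrand G T v \<nu> F j t y = integrand j fy ft t y" if "y \<in> pdom G j" "t \<in> {0..T}" for y t
    using d[OF that] u_eq[OF j that(2,1)] by (simp add: transport_integrand_def integrand_def)
  obtain B where B: "\<forall>y\<in>pdom G j. \<forall>t\<in>{0..T}. \<bar>integrand j fy ft t y\<bar> \<le> B" using integrand_bound[OF j tf] by auto
  interpret kn: real_kernel "N j" T by (rule kernel[OF j])
  have "(\<integral>\<^sup>+t\<in>{0..T}. (\<integral>\<^sup>+y. ennreal \<bar>transport_integrand G T v \<nu> F j t y\<bar> \<partial>\<nu> t j) \<partial>lborel)
      \<le> (\<integral>\<^sup>+t. ennreal B * (emeasure (N j t) UNIV * indicator {0..T} t) \<partial>lborel)"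
  proof (rule nn_integral_mono)
    fix t :: real
    show "(\<integral>\<^sup>+y. ennreal \<bar>transport_integrand G T v \<nu> F j t y\<bar> \<partial>\<nu> t j) * indicator {0..T} t
        \<le> ennreal B * (emeasure (N j t) UNIV * indicator {0..T} t)"
    proof (cases "t \<in> {0..T}")
      case True
      have "(\<integral>\<^sup>+y. ennreal \<bar>transport_integrand G T v \<nu> F j t y\<bar> \<partial>\<nu> t j) \<le> (\<integral>\<^sup>+y. ennreal B \<partial>\<nu> t j)"
        by (rule nn_integral_mono) (use eq B True nuD(3)[OF True j] in \<open>auto intro!: ennreal_leI\<close>)
      also have "\<dots> = ennreal B * emeasure (N j t) UNIV"
        using line_props(3)[OF nuD(1,2)[OF True j], of UNIV] nuD(3)[OF True j] by (simp add: N_def clampT_id[OF True])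
      finally show ?thesis using True by simp
    qed simp
  qed
  also have "\<dots> = ennreal B * (\<integral>\<^sup>+t\<in>{0..T}. emeasure (N j t) UNIV \<partial>lborel)"
    by (rule nn_integral_cmult) (use kn.N_kernel[of UNIV] in simp)
  also have "\<dots> < \<infinity>" using kn.N_int by (simp add: ennreal_mult_less_top)
  finally show "transport_converges G T v \<nu> F j" unfolding transport_converges_def .
  show "transport_pairing G T v \<nu> F j = (LINT t:{0..T}|lborel. (\<integral>y. integrand j fy ft t y \<partial>N j t))"
    unfolding transport_pairing_def
  proof (rule set_lebesgue_integral_cong)
    show "\<forall>t. t \<in> {0..T} \<longrightarrow> (\<integral>y. transport_integrand G T v \<nu> F j t y \<partial>\<nu> t j) = (\<integral>y. integrand j fy ft t y \<partial>N j t)"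
    proof (intro allI impI)
      fix t assume t: "t \<in> {0..T}"
      have m: "integrand j fy ft t \<in> borel_measurable borel"
        using measurable_compose[OF measurable_Pair1'[of t borel borel] integrand_measurable[OF j tf]] by simp
      have "(\<integral>y. transport_integrand G T v \<nu> F j t y \<partial>\<nu> t j) = (\<integral>y. integrand j fy ft t y \<partial>\<nu> t j)"
        by (rule Bochner_Integration.integral_cong) (use eq t nuD(3)[OF t j] in auto)
      then show "(\<integral>y. transport_integrand G T v \<nu> F j t y \<partial>\<nu> t j) = (\<integral>y. integrand j fy ft t y \<partial>N j t)"
        using N_props(2)[OF j t m] by simp
    qed
  qed simp
qed

text \<open>Trace and weak equations are tested with functions on the whole network. A function on
  \<open>j\<close> that vanishes near the other end is extended to the remaining arcs at
  \<open>x\<close> by fading out its value there; the trace equation for \<open>j\<close> sees it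
  only on \<open>j\<close> and at \<open>x\<close>. The assertions about other arcs and vertices are
  for \<open>x\<close> a source.\<close>

lemma local_extension:
  assumes j: "j \<in> arcs G" and x: "x \<in> verts G" and c: "c \<in> pdom G j" "par G j c = x"
    and tf: "test_fun (pdom G j) T f fy ft" and eta: "\<eta> > 0"
    and lo0: "\<And>z t. has_lo j \<Longrightarrow> lo j \<noteq> c \<Longrightarrow> z < lo j + \<eta> \<Longrightarrow> f z t = 0"
    and hi0: "\<And>z t. has_hi j \<Longrightarrow> hi j \<noteq> c \<Longrightarrow> hi j - \<eta> < z \<Longrightarrow> f z t = 0"
  obtains F where "F \<in> C1_0 G T" "supp_off_other_verts G T x F"
    "\<And>z t. z \<in> pdom G j \<Longrightarrow> F (par G j z) t = f z t"
    "transport_converges G T v \<nu> F j"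
    "transport_pairing G T v \<nu> F j = (LINT t:{0..T}|lborel. (\<integral>y. integrand j fy ft t y \<partial>N j t))"
    "\<And>k z t. k \<in> arcs G \<Longrightarrow> k \<noteq> j \<Longrightarrow> k \<notin> Out G x \<Longrightarrow> k \<notin> Inc G x \<Longrightarrow> z \<in> pdom G k \<Longrightarrow> F (par G k z) t = 0"
    "\<And>k. k \<in> arcs G \<Longrightarrow> k \<noteq> j \<Longrightarrow> k \<notin> Out G x \<Longrightarrow> k \<notin> Inc G x \<Longrightarrow>
        transport_converges G T v \<nu> F k \<and> transport_pairing G T v \<nu> F k = 0"
    "\<And>x' t. x' \<in> verts G \<Longrightarrow> x' \<noteq> x \<Longrightarrow> F x' t = 0"
proof -
  obtain d where d: "d > 0" "\<forall>j\<in>arcs G. has_lo j \<longrightarrow> has_hi j \<longrightarrow> d \<le> hi j - lo j"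
    using min_length by auto
  \<comment> \<open>Half the minimal length: on an arc with two ends the extension dies out at least
    \<open>\<delta>\<close> before the end other than \<open>x\<close>, as the condition on the
    support requires.\<close>
  define \<delta> where "\<delta> = d / 2"
  have del: "\<delta> > 0" using d by (simp add: \<delta>_def)
  have len: "2 * \<delta> \<le> hi k - lo k" if "k \<in> arcs G" "has_lo k" "has_hi k" for k
    using d(2) that by (simp add: \<delta>_def)
  define q where "q k = (if k = j then f else if k \<in> Out G x then (\<lambda>z t. f c t * fade \<delta> (1 * (z - lo k)))
      else if k \<in> Inc G x then (\<lambda>z t. f c t * fade \<delta> (- 1 * (z - hi k))) else (\<lambda>_ _. 0))" for k
  define qy where "qy k = (if k = j then fy else if k \<in> Out G x then (\<lambda>z t. f c t * (1 * fade_deriv \<delta> (1 * (z - lo k))))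
      else if k \<in> Inc G x then (\<lambda>z t. f c t * (- 1 * fade_deriv \<delta> (- 1 * (z - hi k)))) else (\<lambda>_ _. 0))" for k
  define qt where "qt k = (if k = j then ft else if k \<in> Out G x then (\<lambda>z t. ft c t * fade \<delta> (1 * (z - lo k)))
      else if k \<in> Inc G x then (\<lambda>z t. ft c t * fade \<delta> (- 1 * (z - hi k))) else (\<lambda>_ _. 0))" for k
  have OutD: "has_lo k \<and> par G k (lo k) = x" if "k \<in> Out G x" for k using that by (simp add: Out_def)
  have IncD: "has_hi k \<and> par G k (hi k) = x" if "k \<in> Inc G x" for k using that by (simp add: Inc_def)
  have OutI: "k \<in> Out G x" if "k \<in> arcs G" "has_lo k" "par G k (lo k) = x" for k using that by (simp add: Out_def)
  have IncI: "k \<in> Inc G x" if "k \<in> arcs G" "has_hi k" "par G k (hi k) = x" for k using that by (simp add: Inc_def)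
  have notboth: "\<not> (k \<in> Out G x \<and> k \<in> Inc G x)" if k: "k \<in> arcs G" for k
  proof
    assume "k \<in> Out G x \<and> k \<in> Inc G x"
    then have h: "has_lo k" "has_hi k" "par G k (lo k) = par G k (hi k)" using OutD IncD by auto
    have "lo k = hi k" by (rule inj_onD[OF par_inj[OF k] h(3) lo_in[OF k h(1)] hi_in[OF k h(2)]])
    then show False using lo_less_hi[OF k h(1,2)] by simp
  qed
  have fc: "(f c has_real_derivative ft c t) (at t)" for t using tf by (simp add: test_fun_def)
  have ftc: "continuous_on UNIV (ft c)"
  proof -
    have "continuous_on UNIV (\<lambda>z. ft (fst z) (snd z))" using tf by (simp add: test_fun_def case_prod_beta')
    then have "continuous_on UNIV (\<lambda>t. ft (fst (c, t)) (snd (c, t)))"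
      by (rule continuous_on_compose2) (auto intro!: continuous_intros)
    then show ?thesis by simp
  qed
  have tfq: "test_fun (pdom G k) T (q k) (qy k) (qt k)" if k: "k \<in> arcs G" for k
  proof -
    consider "k = j" | "k \<noteq> j" "k \<in> Out G x" | "k \<noteq> j" "k \<notin> Out G x" "k \<in> Inc G x" | "k \<noteq> j" "k \<notin> Out G x" "k \<notin> Inc G x" by auto
    then show ?thesis
    proof cases
      case 2
      have "test_fun (pdom G k) T (\<lambda>z t. f c t * fade \<delta> (1 * (z - lo k))) (\<lambda>z t. f c t * (1 * fade_deriv \<delta> (1 * (z - lo k)))) (\<lambda>z t. ft c t * fade \<delta> (1 * (z - lo k)))"
        by (rule test_fun_fade[OF del _ _ fc ftc]) (use OutD[OF 2(2)] pdom_iff[OF k] in auto)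
      then show ?thesis using 2 by (simp add: q_def qy_def qt_def)
    next
      case 3
      have "test_fun (pdom G k) T (\<lambda>z t. f c t * fade \<delta> (- 1 * (z - hi k))) (\<lambda>z t. f c t * (- 1 * fade_deriv \<delta> (- 1 * (z - hi k)))) (\<lambda>z t. ft c t * fade \<delta> (- 1 * (z - hi k)))"
        by (rule test_fun_fade[OF del _ _ fc ftc]) (use IncD[OF 3(3)] pdom_iff[OF k] in auto)
      then show ?thesis using 3 by (simp add: q_def qy_def qt_def)
    qed (use tf test_fun_zero in \<open>simp_all add: q_def qy_def qt_def\<close>)
  qed
  define q0 where "q0 x' t = (if x' = x then f c t else 0)" for x' t
  have qlo: "q k (lo k) t = q0 (par G k (lo k)) t" if k: "k \<in> arcs G" "has_lo k" for k t
  proof (cases "k = j")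
    case True
    show ?thesis
    proof (cases "lo k = c")
      case True
      then show ?thesis using c \<open>k = j\<close> by (simp add: q_def q0_def)
    next
      case False
      then have "par G k (lo k) \<noteq> x"
        using inj_onD[OF par_inj[OF j], of "lo j" c] lo_in[OF j] k c True by auto
      then show ?thesis using lo0[of "lo j"] False True k eta by (simp add: q_def q0_def)
    qed
  next
    case False
    show ?thesis
    proof (cases "par G k (lo k) = x")
      case True
      then show ?thesis using False OutI[OF k True] by (simp add: q_def q0_def)
    next
      case ne: False
      have "fade \<delta> (hi k - lo k) = 0" if "has_hi k" using len[OF k that] del by (intro fade_far) auto
      then show ?thesis using False ne OutD IncD by (auto simp: q_def q0_def)
    qed
  qed
  have qhi: "q k (hi k) t = q0 (par G k (hi k)) t" if k: "k \<in> arcs G" "has_hi k" for k t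
  proof (cases "k = j")
    case True
    show ?thesis
    proof (cases "hi k = c")
      case True
      then show ?thesis using c \<open>k = j\<close> by (simp add: q_def q0_def)
    next
      case False
      then have "par G k (hi k) \<noteq> x"
        using inj_onD[OF par_inj[OF j], of "hi j" c] hi_in[OF j] k c True by auto
      then show ?thesis using hi0[of "hi j"] False True k eta by (simp add: q_def q0_def)
    qed
  next
    case False
    show ?thesis
    proof (cases "par G k (hi k) = x")
      case True
      then show ?thesis using False IncI[OF k True] notboth[OF k(1)] by (simp add: q_def q0_def)
    next
      case ne: False
      have "fade \<delta> (hi k - lo k) = 0" if "has_lo k" using len[OF k(1) that k(2)] del by (intro fade_far) auto
      then show ?thesis using False ne OutD IncD by (auto simp: q_def q0_def)
    qed
  qed
  obtain F where "\<forall>k\<in>arcs G. \<forall>z\<in>pdom G k. \<forall>t. F (par G k z) t = q k z t"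
    using glue_functions[of q q0, OF qlo qhi] by auto
  then have F: "F (par G k z) t = q k z t" if "k \<in> arcs G" "z \<in> pdom G k" for k z t using that by blast
  note nt = network_test_fun[of q qy qt F, OF tfq F]
  have FC: "F \<in> C1_0 G T" by (rule nt(1)) auto
  have dd: "dx G F k y t = qy k y t \<and> dt G T F k y t = qt k y t" if "k \<in> arcs G" "y \<in> pdom G k" "t \<in> {0..T}" for k y t
    using nt(2,3) that by simp
  show thesis
  proof (rule that[OF FC])
    show "F (par G j z) t = f z t" if "z \<in> pdom G j" for z t using F[OF j that] by (simp add: q_def)
    have dj: "dx G F j y t = fy y t \<and> dt G T F j y t = ft y t" if "y \<in> pdom G j" "t \<in> {0..T}" for y t
      using dd[OF j that] by (simp add: qy_def qt_def)
    show "transport_converges G T v \<nu> F j"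
      "transport_pairing G T v \<nu> F j = (LINT t:{0..T}|lborel. (\<integral>y. integrand j fy ft t y \<partial>N j t))"
      using transport_of_test_fun[OF j tf dj] by auto
    show "F (par G k z) t = 0" if "k \<in> arcs G" "k \<noteq> j" "k \<notin> Out G x" "k \<notin> Inc G x" "z \<in> pdom G k" for k z t
      using F[OF that(1,5)] that by (simp add: q_def)
    show "transport_converges G T v \<nu> F k \<and> transport_pairing G T v \<nu> F k = 0"
      if k: "k \<in> arcs G" "k \<noteq> j" "k \<notin> Out G x" "k \<notin> Inc G x" for k
    proof -
      have "dx G F k y t = 0 \<and> dt G T F k y t = 0" if "y \<in> pdom G k" "t \<in> {0..T}" for y t
        using dd[OF k(1) that] k by (simp add: qy_def qt_def)
      from transport_of_test_fun[OF k(1) test_fun_zero, of F, OF this] show ?thesis by (simp add: integrand_def)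
    qed
    show "F x' t = 0" if x': "x' \<in> verts G" "x' \<noteq> x" for x' t
    proof -
      obtain k where "k \<in> Out G x'" using Out_nonempty[OF x'(1)] by auto
      then have k: "k \<in> arcs G" "has_lo k" "par G k (lo k) = x'" by (auto simp: Out_def)
      have "F (par G k (lo k)) t = q0 (par G k (lo k)) t" using F[OF k(1) lo_in[OF k(1,2)]] qlo[OF k(1,2)] by simp
      then show ?thesis using k(3) x'(2) by (simp add: q0_def)
    qed
    show "supp_off_other_verts G T x F"
      unfolding supp_off_other_verts_def
    proof (intro ballI impI)
      fix k y t assume k: "k \<in> arcs G" and y: "y \<in> pdom G k" and v: "par G k y \<in> verts G - {x}"
      let ?S = "{(z, s). z \<in> pdom G k \<and> s \<in> {0..T} \<and> F (par G k z) s \<noteq> 0}"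
      have e: "has_lo k \<and> y = lo k \<or> has_hi k \<and> y = hi k" using vertex_is_end[OF k y] v by simp
      consider "k = j" | "k \<noteq> j" "k \<in> Out G x" | "k \<noteq> j" "k \<notin> Out G x" "k \<in> Inc G x" | "k \<noteq> j" "k \<notin> Out G x" "k \<notin> Inc G x" by auto
      then show "(y, t) \<notin> closure ?S"
      proof cases
        case 1
        have yc: "y \<noteq> c" using v c 1 by auto
        show ?thesis
        proof (rule not_in_closure_far[OF eta])
          fix z s assume "(z, s) \<in> ?S"
          then have z: "z \<in> pdom G j" "f z s \<noteq> 0" using F[OF k] 1 by (auto simp: q_def)
          show "\<eta> \<le> \<bar>z - y\<bar>"
            using e yc lo0[of z s] hi0[of z s] z(2) 1 by (cases "z < lo j + \<eta>"; cases "hi j - \<eta> < z") auto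
        qed
      next
        case 2
        then have yh: "has_hi k" "y = hi k" using e v OutD[OF 2(2)] by auto
        show ?thesis
        proof (rule not_in_closure_far[OF del])
          fix z s assume "(z, s) \<in> ?S"
          then have "z \<in> pdom G k" "fade \<delta> (z - lo k) \<noteq> 0" using F[OF k] 2 by (auto simp: q_def)
          then have "z - lo k < \<delta>" using fade_far[OF del, of "z - lo k"] by linarith
          then show "\<delta> \<le> \<bar>z - y\<bar>" using len[OF k _ yh(1)] OutD[OF 2(2)] yh(2) by auto
        qed
      next
        case 3
        then have yl: "has_lo k" "y = lo k" using e v IncD[OF 3(3)] by auto
        show ?thesis
        proof (rule not_in_closure_far[OF del])
          fix z s assume "(z, s) \<in> ?S"
          then have "z \<in> pdom G k" "fade \<delta> (hi k - z) \<noteq> 0" using F[OF k] 3 by (auto simp: q_def)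
          then have "hi k - z < \<delta>" using fade_far[OF del, of "hi k - z"] by linarith
          then show "\<delta> \<le> \<bar>z - y\<bar>" using len[OF k yl(1)] IncD[OF 3(3)] yl(2) by auto
        qed
      next
        case 4
        show ?thesis by (rule not_in_closure_far[OF del]) (use F[OF k] 4 in \<open>auto simp: q_def\<close>)
      qed
    qed
  qed
qed

end

lemma AE_null_measure: "AE x in null_measure M. P x"
  by (rule AE_I[of _ _ "space M"]) auto

lemma integral_null_measure_eq: "(\<integral>x. f x \<partial>null_measure M) = (0::real)"
  by (rule integral_eq_zero_AE[OF AE_null_measure])

lemma test_fun_bound:
  assumes "test_fun I T f fy ft"
  shows "\<exists>B. \<forall>y\<in>I. \<forall>t\<in>{0..T}. \<bar>f y t\<bar> \<le> B"
proof -
  have c: "continuous_on UNIV (\<lambda>(y, t). f y t)" using assms by (simp add: test_fun_def)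
  have "\<forall>\<epsilon>>0. \<exists>R. \<forall>y\<in>I. \<forall>t\<in>{0..T}. R < \<bar>y\<bar> \<longrightarrow> \<bar>f y t\<bar> < \<epsilon>" using assms by (simp add: test_fun_def)
  then obtain R where R: "\<forall>y\<in>I. \<forall>t\<in>{0..T}. R < \<bar>y\<bar> \<longrightarrow> \<bar>f y t\<bar> < 1" by (meson zero_less_one)
  have "bounded ((\<lambda>(y, t). f y t) ` ({- R..R} \<times> {0..T}))"
    by (intro compact_imp_bounded compact_continuous_image continuous_on_subset[OF c] compact_Times) auto
  then obtain B where B: "\<forall>z\<in>{- R..R} \<times> {0..T}. \<bar>f (fst z) (snd z)\<bar> \<le> B"
    by (auto simp: bounded_iff case_prod_beta)
  have "\<bar>f y t\<bar> \<le> max 1 B" if "y \<in> I" "t \<in> {0..T}" for y t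
  proof (cases "R < \<bar>y\<bar>")
    case True
    then have "\<bar>f y t\<bar> < 1" using R that by blast
    then show ?thesis by simp
  next
    case False
    then have "(y, t) \<in> {- R..R} \<times> {0..T}" using that by auto
    then have "\<bar>f y t\<bar> \<le> B" using B by fastforce
    then show ?thesis by simp
  qed
  then show ?thesis by blast
qed

lemma test_fun_mult_bounded:
  assumes tf: "test_fun {0..l} T f fy ft" and b: "\<And>y. (b has_real_derivative b' y) (at y)" and b': "continuous_on UNIV b'"
  shows "test_fun {0..l} T (\<lambda>y t. f y t * b y) (\<lambda>y t. fy y t * b y + f y t * b' y) (\<lambda>y t. ft y t * b y)"
proof (rule test_fun_bounded)
  have bc: "continuous_on UNIV b" using b by (intro DERIV_continuous_on) auto
  have c: "continuous_on UNIV (\<lambda>z. f (fst z) (snd z))" "continuous_on UNIV (\<lambda>z. fy (fst z) (snd z))" "continuous_on UNIV (\<lambda>z. ft (fst z) (snd z))"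
    using tf by (simp_all add: test_fun_def case_prod_beta')
  show "continuous_on UNIV (\<lambda>(y, t). f y t * b y)" "continuous_on UNIV (\<lambda>(y, t). fy y t * b y + f y t * b' y)"
    "continuous_on UNIV (\<lambda>(y, t). ft y t * b y)"
    unfolding case_prod_beta
    by (intro continuous_on_add continuous_on_mult c continuous_on_compose2[OF bc] continuous_on_compose2[OF b'] continuous_on_fst continuous_on_id; simp)+
  have d: "((\<lambda>z. f z t) has_real_derivative fy y t) (at y)" "((\<lambda>r. f y r) has_real_derivative ft y t) (at t)" for y t
    using tf by (simp_all add: test_fun_def)
  show "((\<lambda>z. f z t * b z) has_real_derivative fy y t * b y + f y t * b' y) (at y)" for y t
    using DERIV_mult[OF d(1) b] by (simp add: algebra_simps)
  show "((\<lambda>r. f y r * b y) has_real_derivative ft y t * b y) (at t)" for y t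
    by (rule DERIV_cmult_right[OF d(2)])
qed

text \<open>The quotient \<open>A / (A + B)\<close> of two squared positive parts. The denominator
  does not vanish because the regions where \<open>A\<close> and \<open>B\<close> are positive
  overlap between \<open>l / 3\<close> and \<open>2 * l / 3\<close>.\<close>

lemma cutoff_partition:
  assumes l: "(0::real) < l"
  shows "\<exists>b b'. (\<forall>y. (b has_real_derivative b' y) (at y)) \<and> continuous_on UNIV b' \<and>
    (\<forall>y. y < l / 3 \<longrightarrow> b y = 1) \<and> (\<forall>y. 2 * l / 3 < y \<longrightarrow> b y = (0::real))"
proof -
  define A where "A y = (max 0 (2 * l / 3 - y))\<^sup>2" for y
  define B where "B y = (max 0 (y - l / 3))\<^sup>2" for y
  define A' where "A' y = - (2 * max 0 (2 * l / 3 - y))" for y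
  define B' where "B' y = 2 * max 0 (y - l / 3)" for y
  have A: "(A has_real_derivative A' y) (at y)" for y
  proof -
    have "((\<lambda>y. 2 * l / 3 - y) has_real_derivative - 1) (at y)" by (auto intro!: derivative_eq_intros)
    from DERIV_chain2[OF has_derivative_pos_part_square this] show ?thesis by (simp add: A_def[abs_def] A'_def)
  qed
  have B: "(B has_real_derivative B' y) (at y)" for y
  proof -
    have "((\<lambda>y. y - l / 3) has_real_derivative 1) (at y)" by (auto intro!: derivative_eq_intros)
    from DERIV_chain2[OF has_derivative_pos_part_square this] show ?thesis by (simp add: B_def[abs_def] B'_def)
  qed
  have ne: "A y + B y \<noteq> 0" for y
  proof -
    have "0 < A y \<or> 0 < B y" using l by (cases "y < 2 * l / 3") (auto simp: A_def B_def max_def)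
    moreover have "0 \<le> A y" "0 \<le> B y" by (simp_all add: A_def B_def)
    ultimately show ?thesis by linarith
  qed
  have c: "continuous_on UNIV A" "continuous_on UNIV B" "continuous_on UNIV A'" "continuous_on UNIV B'"
    unfolding A_def[abs_def] B_def[abs_def] A'_def[abs_def] B'_def[abs_def] by (intro continuous_intros)+
  show ?thesis
  proof (intro exI conjI allI impI)
    show "((\<lambda>y. A y / (A y + B y)) has_real_derivative (A' y * (A y + B y) - A y * (A' y + B' y)) / ((A y + B y) * (A y + B y))) (at y)" for y
      by (rule DERIV_divide[OF A DERIV_add[OF A B] ne])
    show "continuous_on UNIV (\<lambda>y. (A' y * (A y + B y) - A y * (A' y + B' y)) / ((A y + B y) * (A y + B y)))"
      by (intro continuous_intros c) (use ne in auto)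
    show "A y / (A y + B y) = 1" if "y < l / 3" for y
    proof -
      have "B y = 0" using that by (simp add: B_def max_def)
      then show ?thesis using ne[of y] by simp
    qed
    show "A y / (A y + B y) = 0" if "2 * l / 3 < y" for y
      using that by (simp add: A_def max_def)
  qed
qed

context network_solution
begin

section \<open>From the network to the arcs\<close>

text \<open>Traces are given at the vertices other than sources; at a source the boundary datum
  takes this role. The null measure neutralises the default value of \<open>lo j\<close> on an arc
  without initial vertex.\<close>

definition inflow :: "'j \<Rightarrow> real measure" where
  "inflow j = (if has_lo j then if par G j (lo j) \<in> sources G then line (\<sigma>0 (par G j (lo j))) else line (\<tau> j (par G j (lo j)))
     else null_measure borel)"

definition outflow :: "'j \<Rightarrow> real measure" where
  "outflow j = (if has_hi j then line (\<tau> j (par G j (hi j))) else null_measure borel)"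

lemma hi_vertex: "j \<in> arcs G \<Longrightarrow> has_hi j \<Longrightarrow> par G j (hi j) \<in> verts G - sources G \<and> j \<in> Inc G (par G j (hi j))"
  using arc_end_vertex(2)[of j] by (auto simp: sources_def Inc_def)

lemma lo_vertex: "j \<in> arcs G \<Longrightarrow> has_lo j \<Longrightarrow> par G j (lo j) \<in> verts G \<and> j \<in> Out G (par G j (lo j))"
  using arc_end_vertex(1)[of j] by (auto simp: Out_def)

lemma no_loop: "j \<in> Out G x \<Longrightarrow> j \<notin> Inc G x"
proof
  assume "j \<in> Out G x" "j \<in> Inc G x"
  then have h: "j \<in> arcs G" "has_lo j" "has_hi j" "par G j (lo j) = par G j (hi j)" by (auto simp: Out_def Inc_def)
  have "lo j = hi j" by (rule inj_onD[OF par_inj[OF h(1)] h(4) lo_in[OF h(1,2)] hi_in[OF h(1,3)]])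
  then show False using lo_less_hi[OF h(1-3)] by simp
qed

lemma traceD:
  assumes "x \<in> verts G - sources G" "j \<in> Inc G x \<union> Out G x"
  shows "sets (\<tau> j x) = sets (restrict_space borel {0..T})" "finite_measure (\<tau> j x)"
  using traces[OF assms] by (auto simp: is_trace_def)

lemma sigmaD:
  assumes "x \<in> sources G"
  shows "sets (\<sigma>0 x) = sets (restrict_space borel {0..T})" "finite_measure (\<sigma>0 x)"
  using line_measuresD[OF s0_line[OF assms]] by auto

lemma Icc_borel: "{0..T} \<in> sets borel" by simp

lemma outflow_props:
  assumes "j \<in> arcs G"
  shows "sets (outflow j) = sets borel" "finite_measure (outflow j)" "AE s in outflow j. s \<in> {0..T}"
    "\<not> has_hi j \<Longrightarrow> AE s in outflow j. False"
proof -
  have "sets (outflow j) = sets borel \<and> finite_measure (outflow j) \<and> (AE s in outflow j. s \<in> {0..T})"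
  proof (cases "has_hi j")
    case True
    have "par G j (hi j) \<in> verts G - sources G" "j \<in> Inc G (par G j (hi j)) \<union> Out G (par G j (hi j))"
      using hi_vertex[OF assms True] by auto
    note t = traceD[OF this]
    show ?thesis unfolding outflow_def using True line_props(1,2)[OF t] line_props(4)[OF t Icc_borel] by simp
  next
    case False
    then have o: "outflow j = null_measure borel" by (simp add: outflow_def)
    show ?thesis unfolding o by (intro conjI AE_null_measure finite_measureI) auto
  qed
  then show "sets (outflow j) = sets borel" "finite_measure (outflow j)" "AE s in outflow j. s \<in> {0..T}" by auto
  show "AE s in outflow j. False" if "\<not> has_hi j"
  proof -
    have o: "outflow j = null_measure borel" using that by (simp add: outflow_def)
    show ?thesis unfolding o by (rule AE_null_measure)
  qed
qed

lemma inflow_props: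
  assumes "j \<in> arcs G"
  shows "sets (inflow j) = sets borel" "finite_measure (inflow j)" "AE s in inflow j. s \<in> {0..T}"
    "\<not> has_lo j \<Longrightarrow> AE s in inflow j. False"
proof -
  have "sets (inflow j) = sets borel \<and> finite_measure (inflow j) \<and> (AE s in inflow j. s \<in> {0..T})"
  proof (cases "has_lo j")
    case True
    show ?thesis
    proof (cases "par G j (lo j) \<in> sources G")
      case s: True
      note t = sigmaD[OF s]
      show ?thesis unfolding inflow_def using True s line_props(1,2)[OF t] line_props(4)[OF t Icc_borel] by simp
    next
      case False
      have "par G j (lo j) \<in> verts G - sources G" "j \<in> Inc G (par G j (lo j)) \<union> Out G (par G j (lo j))"
        using lo_vertex[OF assms True] False by auto
      note t = traceD[OF this]
      show ?thesis unfolding inflow_def using True False line_props(1,2)[OF t] line_props(4)[OF t Icc_borel] by simp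
    qed
  next
    case False
    then have o: "inflow j = null_measure borel" by (simp add: inflow_def)
    show ?thesis unfolding o by (intro conjI AE_null_measure finite_measureI) auto
  qed
  then show "sets (inflow j) = sets borel" "finite_measure (inflow j)" "AE s in inflow j. s \<in> {0..T}" by auto
  show "AE s in inflow j. False" if "\<not> has_lo j"
  proof -
    have o: "inflow j = null_measure borel" using that by (simp add: inflow_def)
    show ?thesis unfolding o by (rule AE_null_measure)
  qed
qed

lemma m0D: "j \<in> arcs G \<Longrightarrow> sets (m0 j) = sets (restrict_space borel (pdom G j))"
  "j \<in> arcs G \<Longrightarrow> finite_measure (m0 j)" "j \<in> arcs G \<Longrightarrow> space (m0 j) = pdom G j"
  using line_measuresD[OF m0_line] by blast+

definition weak_eq :: "'j \<Rightarrow> (real \<Rightarrow> real \<Rightarrow> real) \<Rightarrow> (real \<Rightarrow> real \<Rightarrow> real) \<Rightarrow> (real \<Rightarrow> real \<Rightarrow> real) \<Rightarrow> bool" where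
  "weak_eq j f fy ft \<longleftrightarrow> (LINT t:{0..T}|lborel. (\<integral>y. integrand j fy ft t y \<partial>N j t))
     = (\<integral>y. f y T \<partial>N j T) - (\<integral>y. f y 0 \<partial>line (m0 j)) + (\<integral>t. f (hi j) t \<partial>outflow j) - (\<integral>t. f (lo j) t \<partial>inflow j)"

lemma pairing_ends:
  assumes j: "j \<in> arcs G" and tf: "test_fun (pdom G j) T f fy ft"
    and F: "\<And>z t. z \<in> pdom G j \<Longrightarrow> F (par G j z) t = f z t"
  shows "(\<integral>y. F (par G j y) T \<partial>\<nu> T j) = (\<integral>y. f y T \<partial>N j T)" "(\<integral>y. F (par G j y) 0 \<partial>m0 j) = (\<integral>y. f y 0 \<partial>line (m0 j))"
proof -
  have TT: "T \<in> {0..T}" using T_pos by simp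
  have "(\<integral>y. F (par G j y) T \<partial>\<nu> T j) = (\<integral>y. f y T \<partial>\<nu> T j)"
    by (rule Bochner_Integration.integral_cong) (use F nuD(3)[OF TT j] in auto)
  then show "(\<integral>y. F (par G j y) T \<partial>\<nu> T j) = (\<integral>y. f y T \<partial>N j T)"
    using N_props(2)[OF j TT test_fun_measurable(3)[OF tf]] by simp
  have "(\<integral>y. F (par G j y) 0 \<partial>m0 j) = (\<integral>y. f y 0 \<partial>m0 j)"
    by (rule Bochner_Integration.integral_cong) (use F m0D(3)[OF j] in auto)
  then show "(\<integral>y. F (par G j y) 0 \<partial>m0 j) = (\<integral>y. f y 0 \<partial>line (m0 j))"
    using line_props(5)[OF m0D(1)[OF j] m0D(2)[OF j] test_fun_measurable(3)[OF tf]] by simp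
qed

text \<open>A terminal vertex has an incoming arc and so is not a source; the trace identity applies
  to the extension of \<open>f\<close>, and the inflow term vanishes with \<open>f\<close> near the
  initial end.\<close>

lemma weak_eq_near_hi:
  assumes j: "j \<in> arcs G" and hi: "has_hi j" and tf: "test_fun (pdom G j) T f fy ft" and eta: "\<eta> > 0"
    and lo0: "\<And>z t. has_lo j \<Longrightarrow> z < lo j + \<eta> \<Longrightarrow> f z t = 0"
  shows "weak_eq j f fy ft"
proof -
  let ?x = "par G j (hi j)"
  have x: "?x \<in> verts G - sources G" "j \<in> Inc G ?x" using hi_vertex[OF j hi] by auto
  obtain F where F: "F \<in> C1_0 G T" "supp_off_other_verts G T ?x F"
    "\<And>z t. z \<in> pdom G j \<Longrightarrow> F (par G j z) t = f z t"
    "transport_converges G T v \<nu> F j"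
    "transport_pairing G T v \<nu> F j = (LINT t:{0..T}|lborel. (\<integral>y. integrand j fy ft t y \<partial>N j t))"
    by (rule local_extension[OF j _ hi_in[OF j hi] refl tf eta lo0]) (use x in auto)
  have "(\<integral>t. F ?x t \<partial>\<tau> j ?x) = transport_pairing G T v \<nu> F j
      - ((\<integral>y. F (par G j y) T \<partial>\<nu> T j) - (\<integral>y. F (par G j y) 0 \<partial>m0 j))"
    using traces[OF x(1), of j] x F(1,2,4) by (simp add: is_trace_def)
  moreover have "(\<integral>t. F ?x t \<partial>\<tau> j ?x) = (\<integral>t. f (hi j) t \<partial>outflow j)"
    using F(3)[OF hi_in[OF j hi]] hi line_props(5)[OF traceD[OF x(1), of j] test_fun_measurable(4)[OF tf]] x(2)
    by (simp add: outflow_def)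
  moreover have "(\<integral>t. f (lo j) t \<partial>inflow j) = 0"
    using lo0[of "lo j"] eta by (cases "has_lo j") (simp_all add: inflow_def integral_null_measure_eq)
  ultimately show ?thesis
    unfolding weak_eq_def F(5)[symmetric] using pairing_ends[OF j tf F(3)] by simp
qed

text \<open>The image of an unbounded arc need not be closed in the ambient space. Sublevel sets are
  therefore written as countable unions of images of compact parameter sets.\<close>

lemma arcwise_continuous_measurable:
  fixes \<phi> :: "'a \<Rightarrow> real"
  assumes "\<And>k. k \<in> arcs G \<Longrightarrow> continuous_on (pdom G k) (\<lambda>z. \<phi> (par G k z))"
  shows "\<phi> \<in> borel_measurable net_borel"
  unfolding borel_measurable_iff_le
proof
  fix a
  let ?C = "\<lambda>k n. par G k ` {z \<in> pdom G k \<inter> {- real n..real n}. \<phi> (par G k z) \<le> a}"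
  let ?U = "\<Union>k\<in>arcs G. \<Union>n. ?C k n"
  have eq: "{w \<in> points G. \<phi> w \<le> a} = ?U"
  proof (intro equalityI subsetI)
    fix w assume "w \<in> {w \<in> points G. \<phi> w \<le> a}"
    then have w': "w \<in> points G" "\<phi> w \<le> a" by auto
    then obtain k z where w: "k \<in> arcs G" "z \<in> pdom G k" "w = par G k z" by (auto simp: points_def)
    obtain n where "\<bar>z\<bar> \<le> real n" using real_arch_simple by blast
    then have "w \<in> ?C k n" using w w'(2) by auto
    then show "w \<in> (\<Union>k\<in>arcs G. \<Union>n. ?C k n)" using w(1) by blast
  qed (auto simp: points_def)
  have "?C k n \<in> sets borel" if k: "k \<in> arcs G" for k n
  proof -
    have cl: "closed (pdom G k)" by (rule pdom_cases[OF k]) simp_all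
    have cc: "compact (pdom G k \<inter> {- real n..real n})" by (rule closed_Int_compact[OF cl compact_Icc])
    let ?S = "pdom G k \<inter> {- real n..real n}"
    have "closed (?S \<inter> (\<lambda>z. \<phi> (par G k z)) -` {..a})"
      by (rule continuous_closed_preimage[OF continuous_on_subset[OF assms[OF k]] compact_imp_closed[OF cc] closed_atMost]) simp
    then have "compact (?S \<inter> (?S \<inter> (\<lambda>z. \<phi> (par G k z)) -` {..a}))" by (rule compact_Int_closed[OF cc])
    moreover have "?S \<inter> (?S \<inter> (\<lambda>z. \<phi> (par G k z)) -` {..a}) = {z \<in> ?S. \<phi> (par G k z) \<le> a}" by blast
    ultimately have "compact {z \<in> ?S. \<phi> (par G k z) \<le> a}" by simp
    then have "compact (?C k n)"
      by (intro compact_continuous_image continuous_on_subset[OF par_continuous[OF k]]) auto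
    then show ?thesis by (rule borel_closed[OF compact_imp_closed])
  qed
  then have "(\<Union>k\<in>arcs G. \<Union>n. ?C k n) \<in> sets borel" using finite_arcs by (intro sets.finite_UN sets.countable_nat_UN) auto
  moreover have "?U = points G \<inter> ?U" unfolding eq[symmetric] by blast
  ultimately have "?U \<in> sets net_borel" unfolding sets_restrict_space by (intro image_eqI)
  then show "{w \<in> space net_borel. \<phi> w \<le> a} \<in> sets net_borel" using eq by simp
qed

text \<open>Away from sources this is the trace identity. At a source, where no trace is available,
  the global weak equation replaces it: the single outgoing arc is the only arc at that vertex, so
  the extension vanishes on all others and every sum reduces to one term.\<close>

lemma weak_eq_near_lo:
  assumes j: "j \<in> arcs G" and lo: "has_lo j" and tf: "test_fun (pdom G j) T f fy ft" and eta: "\<eta> > 0"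
    and hi0: "\<And>z t. has_hi j \<Longrightarrow> hi j - \<eta> < z \<Longrightarrow> f z t = 0"
  shows "weak_eq j f fy ft"
proof -
  let ?x = "par G j (lo j)"
  have x: "?x \<in> verts G" "j \<in> Out G ?x" using lo_vertex[OF j lo] by auto
  obtain F where F: "F \<in> C1_0 G T" "supp_off_other_verts G T ?x F"
    "\<And>z t. z \<in> pdom G j \<Longrightarrow> F (par G j z) t = f z t"
    "transport_converges G T v \<nu> F j"
    "transport_pairing G T v \<nu> F j = (LINT t:{0..T}|lborel. (\<integral>y. integrand j fy ft t y \<partial>N j t))"
    and F0: "\<And>k z t. k \<in> arcs G \<Longrightarrow> k \<noteq> j \<Longrightarrow> k \<notin> Out G ?x \<Longrightarrow> k \<notin> Inc G ?x \<Longrightarrow> z \<in> pdom G k \<Longrightarrow> F (par G k z) t = 0"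
    "\<And>k. k \<in> arcs G \<Longrightarrow> k \<noteq> j \<Longrightarrow> k \<notin> Out G ?x \<Longrightarrow> k \<notin> Inc G ?x \<Longrightarrow>
        transport_converges G T v \<nu> F k \<and> transport_pairing G T v \<nu> F k = 0"
    "\<And>x' t. x' \<in> verts G \<Longrightarrow> x' \<noteq> ?x \<Longrightarrow> F x' t = 0"
    by (rule local_extension[OF j x(1) lo_in[OF j lo] refl tf eta _ hi0]) auto
  note ends = pairing_ends[OF j tf F(3)]
  have out0: "(\<integral>t. f (hi j) t \<partial>outflow j) = 0"
    using hi0[of "hi j"] eta by (cases "has_hi j") (simp_all add: outflow_def integral_null_measure_eq)
  have Fx: "F ?x t = f (lo j) t" for t by (rule F(3)[OF lo_in[OF j lo]])
  have "(LINT t:{0..T}|lborel. (\<integral>y. integrand j fy ft t y \<partial>N j t))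
      = (\<integral>y. f y T \<partial>N j T) - (\<integral>y. f y 0 \<partial>line (m0 j)) - (\<integral>t. f (lo j) t \<partial>inflow j)"
  proof (cases "?x \<in> sources G")
    case False
    then have x': "?x \<in> verts G - sources G" using x by simp
    have "- (\<integral>t. F ?x t \<partial>\<tau> j ?x) = transport_pairing G T v \<nu> F j
      - ((\<integral>y. F (par G j y) T \<partial>\<nu> T j) - (\<integral>y. F (par G j y) 0 \<partial>m0 j))"
      using traces[OF x', of j] x no_loop[OF x(2)] F(1,2,4) by (simp add: is_trace_def)
    moreover have "(\<integral>t. F ?x t \<partial>\<tau> j ?x) = (\<integral>t. f (lo j) t \<partial>inflow j)"
      using Fx lo False line_props(5)[OF traceD[OF x', of j] test_fun_measurable(4)[OF tf]] x(2)
      by (simp add: inflow_def)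
    ultimately show ?thesis unfolding F(5)[symmetric] using ends by simp
  next
    case True
    have "Inc G ?x = {}" using True by (simp add: sources_def)
    moreover have "card (Out G ?x) = 1" using net True by (simp add: oriented_network_def)
    then have "Out G ?x = {j}" using x(2) by (auto simp: card_1_singleton_iff)
    ultimately have other: "k \<notin> Out G ?x \<and> k \<notin> Inc G ?x" if "k \<noteq> j" for k using that by auto
    have conv: "\<forall>k\<in>arcs G. transport_converges G T v \<nu> F k"
    proof
      fix k assume "k \<in> arcs G"
      then show "transport_converges G T v \<nu> F k" using F(4) F0(2)[of k] other[of k] by (cases "k = j") auto
    qed
    have pair: "(\<Sum>k\<in>arcs G. transport_pairing G T v \<nu> F k) = transport_pairing G T v \<nu> F j"
    proof -
      have "(\<Sum>k\<in>arcs G - {j}. transport_pairing G T v \<nu> F k) = 0" by (rule sum.neutral) (use F0(2) other in auto)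
      then show ?thesis using sum.remove[OF finite_arcs j, of "transport_pairing G T v \<nu> F"] by simp
    qed
    obtain B where B: "\<forall>y\<in>pdom G j. \<forall>t\<in>{0..T}. \<bar>f y t\<bar> \<le> B" using test_fun_bound[OF tf] by auto
    have gl: "(\<integral>P. F P t \<partial>glue G \<mu>) = (\<integral>y. F (par G j y) t \<partial>\<mu> j)"
      if t: "t \<in> {0..T}" and mu: "\<And>k. k \<in> arcs G \<Longrightarrow> \<mu> k \<in> line_measures (pdom G k)" for \<mu> t
    proof -
      have "(\<integral>P. F P t \<partial>glue G \<mu>) = (\<Sum>k\<in>arcs G. \<integral>y. F (par G k y) t \<partial>\<mu> k)"
      proof (rule glue_line(4)[OF mu])
        show "(\<lambda>P. F P t) \<in> borel_measurable net_borel"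
        proof (rule arcwise_continuous_measurable)
          fix k assume k: "k \<in> arcs G"
          have "continuous_on (pdom G k \<times> {0..T}) (\<lambda>(y, t). F (par G k y) t)" using F(1) k by (auto simp: C1_0_def)
          then have "continuous_on (pdom G k) (\<lambda>z. (\<lambda>(y, t). F (par G k y) t) (z, t))"
            by (rule continuous_on_compose2) (use t in \<open>auto intro!: continuous_intros\<close>)
          then show "continuous_on (pdom G k) (\<lambda>z. F (par G k z) t)" by simp
        qed
        show "\<bar>F P t\<bar> \<le> \<bar>B\<bar>" if "P \<in> points G" for P
        proof -
          from that obtain k z where P: "k \<in> arcs G" "z \<in> pdom G k" "P = par G k z" by (auto simp: points_def)
          show ?thesis
          proof (cases "k = j")
            case True
            then have "\<bar>F P t\<bar> \<le> B" using F(3)[of z t] B P t by simp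
            then show ?thesis by simp
          next
            case False
            then show ?thesis using F0(1)[OF P(1) False _ _ P(2)] other[OF False] P(3) by simp
          qed
        qed
      qed
      also have "\<dots> = (\<integral>y. F (par G j y) t \<partial>\<mu> j)"
      proof -
        have "(\<integral>y. F (par G k y) t \<partial>\<mu> k) = 0" if k: "k \<in> arcs G - {j}" for k
        proof -
          have "(\<integral>y. F (par G k y) t \<partial>\<mu> k) = (\<integral>y. 0 \<partial>\<mu> k)"
            by (rule Bochner_Integration.integral_cong)
               (use k F0(1) other line_measuresD(3)[OF mu, of k] in auto)
          then show ?thesis by simp
        qed
        then have "(\<Sum>k\<in>arcs G - {j}. \<integral>y. F (par G k y) t \<partial>\<mu> k) = 0" by (intro sum.neutral) blast
        then show ?thesis using sum.remove[OF finite_arcs j, of "\<lambda>k. \<integral>y. F (par G k y) t \<partial>\<mu> k"] by simp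
      qed
      finally show ?thesis .
    qed
    have src: "(\<Sum>x'\<in>sources G. \<integral>t. F x' t \<partial>\<sigma>0 x') = (\<integral>t. f (lo j) t \<partial>inflow j)"
    proof -
      have fs: "finite (sources G)" using finite_verts by (simp add: sources_def)
      have "(\<Sum>x'\<in>sources G - {?x}. \<integral>t. F x' t \<partial>\<sigma>0 x') = 0"
        by (rule sum.neutral) (use F0(3) in \<open>auto simp: sources_def\<close>)
      then have "(\<Sum>x'\<in>sources G. \<integral>t. F x' t \<partial>\<sigma>0 x') = (\<integral>t. F ?x t \<partial>\<sigma>0 ?x)"
        using sum.remove[OF fs True, of "\<lambda>x'. \<integral>t. F x' t \<partial>\<sigma>0 x'"] by simp
      also have "\<dots> = (\<integral>t. f (lo j) t \<partial>inflow j)"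
        using Fx lo True line_props(5)[OF sigmaD[OF True] test_fun_measurable(4)[OF tf]] by (simp add: inflow_def)
      finally show ?thesis .
    qed
    have TT: "T \<in> {0..T}" "0 \<in> {0..T}" using T_pos by auto
    have gT: "(\<integral>P. F P T \<partial>glue G (\<nu> T)) = (\<integral>y. F (par G j y) T \<partial>\<nu> T j)"
      by (rule gl[OF TT(1) nu_line[OF TT(1)]])
    have g0: "(\<integral>P. F P 0 \<partial>glue G m0) = (\<integral>y. F (par G j y) 0 \<partial>m0 j)" by (rule gl[OF TT(2) m0_line])
    have "((\<integral>P. F P T \<partial>glue G (\<nu> T)) - (\<integral>P. F P 0 \<partial>glue G m0)) - (\<Sum>x'\<in>sources G. \<integral>t. F x' t \<partial>\<sigma>0 x')
          = (\<Sum>k\<in>arcs G. transport_pairing G T v \<nu> F k)"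
      using sol F(1) conv by (simp add: measure_valued_solution_def)
    then show ?thesis
      unfolding pair src gT g0 F(5)[symmetric] using ends by simp
  qed
  then show ?thesis unfolding weak_eq_def out0 by simp
qed

lemma weak_eq_add:
  assumes j: "j \<in> arcs G" and t1: "test_fun (pdom G j) T f1 fy1 ft1" and t2: "test_fun (pdom G j) T f2 fy2 ft2"
    and w1: "weak_eq j f1 fy1 ft1" and w2: "weak_eq j f2 fy2 ft2"
  shows "weak_eq j (\<lambda>y t. f1 y t + f2 y t) (\<lambda>y t. fy1 y t + fy2 y t) (\<lambda>y t. ft1 y t + ft2 y t)"
proof -
  interpret kn: real_kernel "N j" T by (rule kernel[OF j])
  have bd: "\<exists>B. \<forall>t\<in>{0..T}. AE y in N j t. \<bar>integrand j fy ft t y\<bar> \<le> B" if tfx: "test_fun (pdom G j) T f fy ft" for f fy ft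
  proof -
    obtain B where B: "\<forall>y\<in>pdom G j. \<forall>t\<in>{0..T}. \<bar>integrand j fy ft t y\<bar> \<le> B" using integrand_bound[OF j tfx] by auto
    have "AE y in N j t. \<bar>integrand j fy ft t y\<bar> \<le> B" if "t \<in> {0..T}" for t
      using N_props(1)[OF j, of t] by eventually_elim (use B that in blast)
    then show ?thesis by blast
  qed
  obtain B1 where B1: "\<And>t. t \<in> {0..T} \<Longrightarrow> AE y in N j t. \<bar>integrand j fy1 ft1 t y\<bar> \<le> B1" using bd[OF t1] by blast
  obtain B2 where B2: "\<And>t. t \<in> {0..T} \<Longrightarrow> AE y in N j t. \<bar>integrand j fy2 ft2 t y\<bar> \<le> B2" using bd[OF t2] by blast
  note m1 = integrand_measurable[OF j t1] and m2 = integrand_measurable[OF j t2]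
  let ?I1 = "\<lambda>t. \<integral>y. integrand j fy1 ft1 t y \<partial>N j t" and ?I2 = "\<lambda>t. \<integral>y. integrand j fy2 ft2 t y \<partial>N j t"
  have "(LINT t:{0..T}|lborel. (\<integral>y. integrand j (\<lambda>y t. fy1 y t + fy2 y t) (\<lambda>y t. ft1 y t + ft2 y t) t y \<partial>N j t))
      = (LINT t:{0..T}|lborel. ?I1 t + ?I2 t)"
  proof (rule set_lebesgue_integral_cong)
    show "\<forall>t. t \<in> {0..T} \<longrightarrow> (\<integral>y. integrand j (\<lambda>y t. fy1 y t + fy2 y t) (\<lambda>y t. ft1 y t + ft2 y t) t y \<partial>N j t) = ?I1 t + ?I2 t"
    proof (intro allI impI)
      fix t assume t: "t \<in> {0..T}"
      have "integrand j (\<lambda>y t. fy1 y t + fy2 y t) (\<lambda>y t. ft1 y t + ft2 y t) t y = integrand j fy1 ft1 t y + integrand j fy2 ft2 t y" for y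
        by (simp add: integrand_def algebra_simps)
      then show "(\<integral>y. integrand j (\<lambda>y t. fy1 y t + fy2 y t) (\<lambda>y t. ft1 y t + ft2 y t) t y \<partial>N j t) = ?I1 t + ?I2 t"
        using Bochner_Integration.integral_add[OF kn.kernel_section_integrable[OF m1 B1[OF t]] kn.kernel_section_integrable[OF m2 B2[OF t]]]
        by simp
    qed
  qed simp
  also have "\<dots> = (LINT t:{0..T}|lborel. ?I1 t) + (LINT t:{0..T}|lborel. ?I2 t)"
    by (rule set_integral_add(2))
       (use kn.kernel_integral_integrable[OF m1 B1] kn.kernel_integral_integrable[OF m2 B2] in \<open>simp_all add: set_integrable_def\<close>)
  finally have lhs: "(LINT t:{0..T}|lborel. (\<integral>y. integrand j (\<lambda>y t. fy1 y t + fy2 y t) (\<lambda>y t. ft1 y t + ft2 y t) t y \<partial>N j t))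
      = (LINT t:{0..T}|lborel. ?I1 t) + (LINT t:{0..T}|lborel. ?I2 t)" .
  have TT: "T \<in> {0..T}" "0 \<in> {0..T}" using T_pos by auto
  have addM: "(\<integral>y. g1 y + g2 y \<partial>M) = (\<integral>y. g1 y \<partial>M) + (\<integral>y. (g2 y :: real) \<partial>M)"
    if M: "finite_measure M" "sets M = sets borel" and g: "g1 \<in> borel_measurable borel" "g2 \<in> borel_measurable borel"
      and b: "AE y in M. \<bar>g1 y\<bar> \<le> C1" "AE y in M. \<bar>g2 y\<bar> \<le> C2" for M :: "real measure" and g1 g2 C1 C2
    by (rule Bochner_Integration.integral_add; rule finite_measure.integrable_const_bound[OF M(1)])
       (use b g M(2) in \<open>auto cong: measurable_cong_sets\<close>)
  obtain C1 where C1: "\<forall>y\<in>pdom G j. \<forall>t\<in>{0..T}. \<bar>f1 y t\<bar> \<le> C1" using test_fun_bound[OF t1] by auto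
  obtain C2 where C2: "\<forall>y\<in>pdom G j. \<forall>t\<in>{0..T}. \<bar>f2 y t\<bar> \<le> C2" using test_fun_bound[OF t2] by auto
  have aeN: "AE y in M. \<bar>f1 y t\<bar> \<le> C1" "AE y in M. \<bar>f2 y t\<bar> \<le> C2" if "AE y in M. y \<in> pdom G j" "t \<in> {0..T}" for M t
    using that(1) C1 C2 that(2) by (auto elim!: eventually_mono)
  have aeT: "AE t in M. \<bar>f1 y t\<bar> \<le> C1" "AE t in M. \<bar>f2 y t\<bar> \<le> C2" if "AE t in M. t \<in> {0..T}" "y \<in> pdom G j" for M y
  proof -
    show "AE t in M. \<bar>f1 y t\<bar> \<le> C1" using that(1) by eventually_elim (use C1 that(2) in blast)
    show "AE t in M. \<bar>f2 y t\<bar> \<le> C2" using that(1) by eventually_elim (use C2 that(2) in blast)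
  qed
  note lm = line_props[OF m0D(1)[OF j] m0D(2)[OF j]]
  have a: "(\<integral>y. f1 y T + f2 y T \<partial>N j T) = (\<integral>y. f1 y T \<partial>N j T) + (\<integral>y. f2 y T \<partial>N j T)"
    by (rule addM[OF kn.N_fin kn.N_sets test_fun_measurable(3)[OF t1] test_fun_measurable(3)[OF t2] aeN[OF N_props(1)[OF j] TT(1)]])
  have b: "(\<integral>y. f1 y 0 + f2 y 0 \<partial>line (m0 j)) = (\<integral>y. f1 y 0 \<partial>line (m0 j)) + (\<integral>y. f2 y 0 \<partial>line (m0 j))"
    by (rule addM[OF lm(2) lm(1) test_fun_measurable(3)[OF t1] test_fun_measurable(3)[OF t2] aeN[OF lm(4)[OF pdom_borel[OF j]] TT(2)]])
  have c: "(\<integral>t. f1 (hi j) t + f2 (hi j) t \<partial>outflow j) = (\<integral>t. f1 (hi j) t \<partial>outflow j) + (\<integral>t. f2 (hi j) t \<partial>outflow j)"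
  proof (cases "has_hi j")
    case True
    show ?thesis
      by (rule addM[OF outflow_props(2)[OF j] outflow_props(1)[OF j] test_fun_measurable(4)[OF t1] test_fun_measurable(4)[OF t2] aeT[OF outflow_props(3)[OF j] hi_in[OF j True]]])
  qed (simp add: outflow_def integral_null_measure_eq)
  have d: "(\<integral>t. f1 (lo j) t + f2 (lo j) t \<partial>inflow j) = (\<integral>t. f1 (lo j) t \<partial>inflow j) + (\<integral>t. f2 (lo j) t \<partial>inflow j)"
  proof (cases "has_lo j")
    case True
    show ?thesis
      by (rule addM[OF inflow_props(2)[OF j] inflow_props(1)[OF j] test_fun_measurable(4)[OF t1] test_fun_measurable(4)[OF t2] aeT[OF inflow_props(3)[OF j] lo_in[OF j True]]])
  qed (simp add: inflow_def integral_null_measure_eq)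
  show ?thesis
    using w1 w2 unfolding weak_eq_def lhs a b c d by linarith
qed

text \<open>An unbounded arc has just one end to take care of. On a bounded arc the function is
  split by a partition of unity into parts vanishing near one end each, since a trace identity
  admits the vertex of a single end.\<close>

lemma weak_eq_test_fun:
  assumes j: "j \<in> arcs G" and tf: "test_fun (pdom G j) T f fy ft"
  shows "weak_eq j f fy ft"
proof (cases "has_lo j \<and> has_hi j")
  case False
  then consider "\<not> has_lo j" "has_hi j" | "\<not> has_hi j" "has_lo j" using below_or_above[OF j] by auto
  then show ?thesis
  proof cases
    case 1
    then show ?thesis using weak_eq_near_hi[OF j _ tf zero_less_one] by simp
  next
    case 2
    then show ?thesis using weak_eq_near_lo[OF j _ tf zero_less_one] by simp
  qed
next
  case True
  obtain l where l: "l > 0" "pdom G j = {0..l}" "lo j = 0" "hi j = l"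
    by (rule pdom_cases[OF j]) (use True in auto)
  obtain b b' where b: "\<And>y. (b has_real_derivative b' y) (at y)" "continuous_on UNIV b'"
    "\<And>y. y < l / 3 \<Longrightarrow> b y = 1" "\<And>y. 2 * l / 3 < y \<Longrightarrow> b y = 0"
    using cutoff_partition[OF l(1)] by auto
  have c: "((\<lambda>y. 1 - b y) has_real_derivative - b' y) (at y)" for y
    by (auto intro!: derivative_eq_intros b(1))
  have tf': "test_fun {0..l} T f fy ft" using tf l by simp
  note t1 = test_fun_mult_bounded[OF tf' b(1,2)]
  note t2 = test_fun_mult_bounded[OF tf' c continuous_on_minus[OF b(2)]]
  have l3: "l / 3 > 0" using l by simp
  have "weak_eq j (\<lambda>y t. f y t * b y) (\<lambda>y t. fy y t * b y + f y t * b' y) (\<lambda>y t. ft y t * b y)"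
    by (rule weak_eq_near_lo[OF j _ _ l3]) (use True t1 l b(4) in auto)
  moreover have "weak_eq j (\<lambda>y t. f y t * (1 - b y)) (\<lambda>y t. fy y t * (1 - b y) + f y t * - b' y) (\<lambda>y t. ft y t * (1 - b y))"
    by (rule weak_eq_near_hi[OF j _ _ l3]) (use True t2 l b(3) in auto)
  ultimately have "weak_eq j (\<lambda>y t. f y t * b y + f y t * (1 - b y)) (\<lambda>y t. (fy y t * b y + f y t * b' y) + (fy y t * (1 - b y) + f y t * - b' y))
      (\<lambda>y t. ft y t * b y + ft y t * (1 - b y))"
    by (rule weak_eq_add[OF j t1[folded l(2)] t2[folded l(2)]])
  then show ?thesis by (simp add: algebra_simps)
qed

lemma arc_problem:
  assumes j: "j \<in> arcs G"
  shows "arc_problem (u j) Vmax K (N j) T (pdom G j) (line (m0 j)) (inflow j) (outflow j)"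
proof (intro arc_problem.intro arc_problem_axioms.intro field[OF j] kernel[OF j])
  note lm = line_props[OF m0D(1)[OF j] m0D(2)[OF j]]
  show "0 < T" by (rule T_pos)
  show "AE y in N j t. y \<in> pdom G j" for t by (rule N_props(1)[OF j])
  show "AE y in N j t. y \<noteq> hi j" if "has_hi j" for t
  proof -
    note P = line_props[OF nuD(1,2)[OF clampT_in j]]
    have "emeasure (N j t) {hi j} = emeasure (\<nu> (clampT t) j) ({hi j} \<inter> pdom G j)"
      unfolding N_def by (rule P(3)) simp
    also have "{hi j} \<inter> pdom G j = {hi j}" using hi_in[OF j that] by auto
    also have "emeasure (\<nu> (clampT t) j) {hi j} = 0" by (rule nu_end[OF clampT_in j that])
    finally have "{hi j} \<in> null_sets (N j t)"
      by (intro null_setsI) (simp_all add: N_def P(1))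
    from AE_not_in[OF this] show ?thesis by (auto elim: eventually_mono)
  qed
  show "y \<le> hi j" if "has_hi j" "y \<in> pdom G j" for y using that pdom_iff[OF j] by simp
  show "lo j < hi j" if "has_lo j" "has_hi j" using lo_less_hi[OF j that] .
  show "sets (line (m0 j)) = sets borel" "finite_measure (line (m0 j))" by (rule lm(1) lm(2))+
  show "AE y in line (m0 j). y \<in> pdom G j" by (rule lm(4)[OF pdom_borel[OF j]])
  show "sets (inflow j) = sets borel" "finite_measure (inflow j)" "AE s in inflow j. s \<in> {0..T}"
    "\<not> has_lo j \<Longrightarrow> AE s in inflow j. False" by (rule inflow_props[OF j] | assumption)+
  show "sets (outflow j) = sets borel" "finite_measure (outflow j)" "AE s in outflow j. s \<in> {0..T}"
    "\<not> has_hi j \<Longrightarrow> AE s in outflow j. False" by (rule outflow_props[OF j] | assumption)+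
  show "(LINT t:{0..T}|lborel. (\<integral>y. ft y t + u j t y * fy y t \<partial>N j t))
      = (\<integral>y. f y T \<partial>N j T) - (\<integral>y. f y 0 \<partial>line (m0 j)) + (\<integral>t. f (hi j) t \<partial>outflow j) - (\<integral>t. f (lo j) t \<partial>inflow j)"
    if "test_fun (pdom G j) T f fy ft" for f fy ft
    using weak_eq_test_fun[OF j that] unfolding weak_eq_def integrand_def .
qed

end

text \<open>The Jordan decomposition: with \<open>W\<close> the variation on the interval from 0,
  both \<open>W\<close> and \<open>W - q\<close> are nondecreasing.\<close>

lemma BV_on_measurable:
  assumes bv: "BV_on 0 T q"
  shows "(\<lambda>t. indicator {0..T} t * q t) \<in> borel_measurable borel"
proof -
  define S where "S t = {z. \<exists>n (w :: nat \<Rightarrow> real). (\<forall>i\<le>n. w i \<in> {0..t}) \<and> (\<forall>i<n. w i \<le> w (Suc i)) \<and> z = (\<Sum>i<n. \<bar>q (w (Suc i)) - q (w i)\<bar>)}" for t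
  obtain B where B: "\<And>n (w :: nat \<Rightarrow> real). (\<forall>i\<le>n. w i \<in> {0..T}) \<and> (\<forall>i<n. w i \<le> w (Suc i)) \<Longrightarrow> (\<Sum>i<n. \<bar>q (w (Suc i)) - q (w i)\<bar>) \<le> B"
    using bv by (auto simp: BV_on_def)
  have bdd: "bdd_above (S t)" if "t \<in> {0..T}" for t
  proof (rule bdd_aboveI)
    fix z assume "z \<in> S t"
    then obtain n w where w: "\<forall>i\<le>n. w i \<in> {0..t}" "\<forall>i<n. w i \<le> w (Suc i)" "z = (\<Sum>i<n. \<bar>q (w (Suc i)) - q (w i)\<bar>)"
      unfolding S_def by blast
    have "\<forall>i\<le>n. w i \<in> {0..T}" using w(1) that by force
    then show "z \<le> B" using B w(2,3) by blast
  qed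
  have ne: "0 \<in> S t" if "0 \<le> t" for t
    unfolding S_def using that by (intro CollectI exI[of _ 0] exI[of _ "\<lambda>_. 0"]) auto
  define W where "W t = Sup (S t)" for t
  have step: "W s + \<bar>q t - q s\<bar> \<le> W t" if st: "0 \<le> s" "s \<le> t" "t \<le> T" for s t
  proof -
    have "W s \<le> W t - \<bar>q t - q s\<bar>"
      unfolding W_def
    proof (rule cSup_least)
      show "S s \<noteq> {}" using ne[OF st(1)] by blast
      fix z assume "z \<in> S s"
      then obtain n w where w: "\<forall>i\<le>n. w i \<in> {0..s}" "\<forall>i<n. w i \<le> w (Suc i)" "z = (\<Sum>i<n. \<bar>q (w (Suc i)) - q (w i)\<bar>)"
        unfolding S_def by blast
      \<comment> \<open>A partition of \<open>{0..s}\<close> is continued by \<open>s\<close> and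
        \<open>t\<close>; the point \<open>s\<close> is added because the partition need not end
        there.\<close>
      define w' where "w' i = (if i \<le> n then w i else if i = Suc n then s else t)" for i
      have sum: "(\<Sum>i<Suc (Suc n). \<bar>q (w' (Suc i)) - q (w' i)\<bar>) = z + \<bar>q s - q (w n)\<bar> + \<bar>q t - q s\<bar>"
        unfolding w(3) by (simp add: w'_def)
      have "(\<Sum>i<Suc (Suc n). \<bar>q (w' (Suc i)) - q (w' i)\<bar>) \<in> S t"
        unfolding S_def
      proof (intro CollectI exI conjI)
        show "\<forall>i\<le>Suc (Suc n). w' i \<in> {0..t}" using w(1) st by (force simp: w'_def)
        show "\<forall>i<Suc (Suc n). w' i \<le> w' (Suc i)"
        proof (intro allI impI)
          fix i assume "i < Suc (Suc n)"
          then consider "i < n" | "i = n" | "i = Suc n" by linarith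
          then show "w' i \<le> w' (Suc i)"
            by cases (use w(1,2) st in \<open>auto simp: w'_def\<close>)
        qed
      qed (rule refl)
      then have "z + \<bar>q s - q (w n)\<bar> + \<bar>q t - q s\<bar> \<le> Sup (S t)"
        unfolding sum using bdd[of t] st by (intro cSup_upper) auto
      then show "z \<le> Sup (S t) - \<bar>q t - q s\<bar>" by linarith
    qed
    then show ?thesis by simp
  qed
  have m1: "mono_on {0..T} W"
  proof (rule mono_onI)
    fix r s assume "r \<in> {0..T}" "s \<in> {0..T}" "r \<le> s"
    then show "W r \<le> W s" using step[of r s] by force
  qed
  have m2: "mono_on {0..T} (\<lambda>t. W t - q t)"
  proof (rule mono_onI)
    fix r s assume "r \<in> {0..T}" "s \<in> {0..T}" "r \<le> s"
    then show "W r - q r \<le> W s - q s" using step[of r s] by force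
  qed
  have "(\<lambda>t. W t - (W t - q t)) \<in> borel_measurable (restrict_space borel {0..T})"
    by (intro borel_measurable_diff borel_measurable_mono_on_fnc m1 m2)
  then have "q \<in> borel_measurable (restrict_space borel {0..T})" by simp
  then show ?thesis by (subst (asm) borel_measurable_restrict_space_iff) (auto simp: mult.commute)
qed

context network_solution
begin

section \<open>The identity on each arc\<close>

text \<open>The times and parameters at which mass can appear on the arc \<open>j\<close>.\<close>

definition start :: "'j \<Rightarrow> real \<Rightarrow> real \<Rightarrow> bool" where
  "start j s y \<longleftrightarrow> s = 0 \<and> y \<in> pdom G j \<or> has_lo j \<and> y = lo j \<and> s \<in> {0..T}"

lemma startD: "j \<in> arcs G \<Longrightarrow> start j s y \<Longrightarrow> y \<in> pdom G j \<and> s \<in> {0..T}"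
  using lo_in T_pos by (auto simp: start_def)

text \<open>\<open>g\<close> is the observable, as a function of the label, which equals \<open>\<gamma>\<close> of the exit time for mass that
  has left by time \<open>t\<close> and \<open>\<phi>\<close> of the position at time \<open>t\<close> for the rest.\<close>

definition transfer :: "'j \<Rightarrow> real \<Rightarrow> real set \<Rightarrow> (real \<Rightarrow> real) \<Rightarrow> (real \<Rightarrow> real) \<Rightarrow> (real \<Rightarrow> real) \<Rightarrow> bool" where
  "transfer j t D \<phi> \<gamma> g \<longleftrightarrow> g \<in> borel_measurable borel \<and>
     (\<forall>s y e. start j s y \<longrightarrow> exits j y s e \<longrightarrow> e \<le> t \<longrightarrow> g (X j s y 0) = \<gamma> e) \<and>
     (\<forall>s y. start j s y \<longrightarrow> s \<le> t \<longrightarrow> (\<forall>e. exits j y s e \<longrightarrow> t < e) \<longrightarrow> g (X j s y 0) = \<phi> (X j s y t)) \<and>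
     (t \<in> D \<longrightarrow> (\<integral>y. \<phi> y \<partial>N j t) + (\<integral>s. indicator {..t} s * \<gamma> s \<partial>outflow j)
       = (\<integral>y. g y \<partial>line (m0 j)) + (\<integral>s. indicator {..t} s * g (X j s (lo j) 0) \<partial>inflow j))"

text \<open>Passes the identity on one arc on without reference to labels of that arc problem.
  \<open>D\<close> is chosen before the observables, so that the null sets of finitely many arcs can
  later be joined.\<close>

lemma arc_transfer:
  assumes j: "j \<in> arcs G"
  obtains D where "AE t in lborel. t \<in> {0..T} \<longrightarrow> t \<in> D" "T \<in> D"
    "\<And>t (\<phi> :: real \<Rightarrow> real) (\<gamma> :: real \<Rightarrow> real) B. t \<in> {0..T} \<Longrightarrow> \<phi> \<in> borel_measurable borel \<Longrightarrow> \<gamma> \<in> borel_measurable borel \<Longrightarrow>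
      (\<And>y. \<bar>\<phi> y\<bar> \<le> B) \<Longrightarrow> (\<And>s. \<bar>\<gamma> s\<bar> \<le> B) \<Longrightarrow>
      \<exists>g. transfer j t D \<phi> \<gamma> g"
proof -
  interpret A: arc_problem "u j" Vmax K "N j" T "pdom G j" "line (m0 j)" "inflow j" "outflow j"
    by (rule arc_problem[OF j])
  show thesis
  proof (rule that[of "{t. A.good t}"])
    show "AE t in lborel. t \<in> {0..T} \<longrightarrow> t \<in> {t. A.good t}" using A.AE_good by simp
    show "T \<in> {t. A.good t}" using A.good_final by simp
    fix t B and \<phi> \<gamma> :: "real \<Rightarrow> real"
    assume t: "t \<in> {0..T}" and phi: "\<phi> \<in> borel_measurable borel" and gam: "\<gamma> \<in> borel_measurable borel"
      and bp: "\<And>y. \<bar>\<phi> y\<bar> \<le> B" and bg: "\<And>s. \<bar>\<gamma> s\<bar> \<le> B"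
    let ?g = "A.state t \<phi> \<gamma>"
    have ex: "?g (X j s y 0) = \<gamma> e" if st: "start j s y" and e: "exits j y s e" "e \<le> t" for s y e
    proof -
      have e': "has_hi j" "s \<le> e" "e \<le> T" "X j s y e = hi j" "\<And>r. r \<in> {s..<e} \<Longrightarrow> X j s y r < hi j"
        using e(1) by (auto simp: exits_def)
      have s0: "0 \<le> s" using startD[OF j st] by simp
      have "X j s y r < hi j" if r: "0 \<le> r" "r < e" for r
      proof (cases "s \<le> r")
        case True
        then show ?thesis using e'(5) r by simp
      next
        case False
        \<comment> \<open>A positive starting time means that the mass entered through the initial
          end; before entering, its characteristic is at or below that end and so cannot have hit
          the other one.\<close>
        then have "s \<noteq> 0" using r by auto
        then have lo: "has_lo j" "y = lo j" using st by (auto simp: start_def)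
        have "X j s y r \<le> X j s y s" using X_mono[OF j, of r s s y] False by simp
        also have "\<dots> = lo j" using lo X_start[OF j] by simp
        finally show ?thesis using lo_less_hi[OF j lo(1) e'(1)] by simp
      qed
      then have "A.hit (X j s y 0) = e" using e' s0 by (intro A.hit_eq) auto
      moreover have "hi j \<le> X j s y t" using X_mono[OF j e(2), of s y] e'(4) by simp
      ultimately show ?thesis using e'(1) by (simp add: A.state_def)
    qed
    have noex: "?g (X j s y 0) = \<phi> (X j s y t)" if st: "start j s y" "s \<le> t" and e: "\<forall>e. exits j y s e \<longrightarrow> t < e" for s y
    proof -
      have "\<not> (has_hi j \<and> hi j \<le> X j s y t)"
      proof
        assume h: "has_hi j \<and> hi j \<le> X j s y t"
        have "\<not> stays j y s" using h t st by (auto simp: stays_def not_less)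
        then obtain e' where e': "exits j y s e'" using stays_or_exits[OF j, of y s] startD[OF j st(1)] by blast
        then have "t < e'" using e by blast
        moreover have "\<forall>r\<in>{s..<e'}. X j s y r < hi j" using e' by (simp add: exits_def)
        ultimately have "X j s y t < hi j" using st(2) by simp
        then show False using h by simp
      qed
      then show ?thesis by (auto simp: A.state_def)
    qed
    show "\<exists>g. transfer j t {t. A.good t} \<phi> \<gamma> g"
      unfolding transfer_def using A.state_measurable[OF phi gam] ex noex A.arc_identity[OF _ phi bp gam bg]
      by (intro exI[of _ ?g] conjI) auto
  qed
qed

lemma X_in: "j \<in> arcs G \<Longrightarrow> y \<in> pdom G j \<Longrightarrow> s \<le> t \<Longrightarrow> (has_hi j \<Longrightarrow> X j s y t \<le> hi j) \<Longrightarrow> X j s y t \<in> pdom G j"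
  using X_mono[of j s t s y] X_start[of j s y] pdom_iff[of j y] pdom_iff[of j "X j s y t"] by auto

text \<open>From the initial end the whole length, at least the minimal one, has to be run at speed
  at most \<open>Vmax\<close>.\<close>

lemma exit_delay: "\<exists>\<delta>>0. \<forall>k\<in>arcs G. has_lo k \<longrightarrow> (\<forall>s e. exits k (lo k) s e \<longrightarrow> s + \<delta> \<le> e)"
proof -
  obtain d where d: "d > 0" "\<forall>j\<in>arcs G. has_lo j \<longrightarrow> has_hi j \<longrightarrow> d \<le> hi j - lo j"
    using min_length by auto
  have "s + d / Vmax \<le> e" if k: "k \<in> arcs G" "has_lo k" and e: "exits k (lo k) s e" for k s e
  proof -
    have "d \<le> hi k - lo k" using d(2) k e by (simp add: exits_def)
    also have "\<dots> = X k s (lo k) e - X k s (lo k) s" using e k(1) X_start by (simp add: exits_def)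
    also have "\<dots> \<le> Vmax * (e - s)" by (rule X_speed[OF k(1)]) (use e in \<open>simp add: exits_def\<close>)
    finally have "d / Vmax \<le> e - s" using Vmax_pos by (simp add: divide_le_eq mult.commute)
    then show ?thesis by simp
  qed
  then show ?thesis using d(1) Vmax_pos by (intro exI[of _ "d / Vmax"]) auto
qed

lemma convex_bound:
  assumes "\<And>k. k \<in> S \<Longrightarrow> 0 \<le> a k" "sum a S = (1::real)" "\<And>k. k \<in> S \<Longrightarrow> \<bar>b k\<bar> \<le> B"
  shows "\<bar>\<Sum>k\<in>S. a k * b k\<bar> \<le> B"
proof -
  have "\<bar>\<Sum>k\<in>S. a k * b k\<bar> \<le> (\<Sum>k\<in>S. \<bar>a k * b k\<bar>)" by (rule sum_abs)
  also have "\<dots> \<le> (\<Sum>k\<in>S. a k * B)"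
    by (rule sum_mono) (use assms(1,3) in \<open>auto simp: abs_mult intro!: mult_left_mono\<close>)
  also have "\<dots> = B" using assms(2) by (simp add: sum_distrib_right[symmetric])
  finally show ?thesis .
qed

lemma path_sum_bound:
  assumes "j \<in> arcs G" "y \<in> pdom G j" "s \<in> {0..T}" and t: "t \<in> {s..T}" and B: "\<And>x. x \<in> points G \<Longrightarrow> \<bar>\<phi> x\<bar> \<le> B"
  shows "\<bar>psum \<phi> j y s t\<bar> \<le> B"
  using assms(1-4)
proof (induction rule: hop_induct)
  case (stays j y s)
  have "X j s y t \<in> pdom G j" by (rule X_in[OF stays(1,2)]) (use stays in \<open>auto simp: stays_def less_imp_le\<close>)
  then show ?case using B stays(1) path_sum_stays[OF stays(1-5)] by (auto simp: points_def)
next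
  case (exits j y s e)
  have e: "e \<in> {0..T}" "has_hi j" "s \<le> e" using exits exits_in by (auto simp: exits_def)
  show ?case
  proof (cases "e \<le> t")
    case True
    have "\<bar>\<Sum>k\<in>succs j. p j k e * psum \<phi> k (lo k) e t\<bar> \<le> B"
    proof (rule convex_bound)
      show "0 \<le> p j k e" if "k \<in> succs j" for k using p_bounds[OF exits(1) succsD(1)[OF that] e(1)] by simp
      show "(\<Sum>k\<in>succs j. p j k e) = 1" by (rule p_sum[OF exits(1) e(2,1)])
      show "\<bar>psum \<phi> k (lo k) e t\<bar> \<le> B" if "k \<in> succs j" for k
        using exits(5)[OF that] exits(6) True by simp
    qed
    then show ?thesis using path_sum_exits(1)[OF exits(1-4), of t \<phi>] exits(6) True by simp
  next
    case False
    have "X j s y t \<in> pdom G j"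
      by (rule X_in[OF exits(1,2)]) (use exits(4,6) False in \<open>auto simp: exits_def less_imp_le\<close>)
    then show ?thesis
      using B exits(1) path_sum_exits(2)[OF exits(1-4), of t \<phi>] exits(6) False by (auto simp: points_def)
  qed
qed

definition phi_on :: "('a \<Rightarrow> real) \<Rightarrow> 'j \<Rightarrow> real \<Rightarrow> real" where
  "phi_on \<phi> j y = indicator (pdom G j) y * \<phi> (par G j y)"

lemma phi_on_measurable:
  assumes j: "j \<in> arcs G" and phi: "\<phi> \<in> borel_measurable net_borel"
  shows "phi_on \<phi> j \<in> borel_measurable borel"
proof -
  have "(\<lambda>y. \<phi> (par G j y)) \<in> borel_measurable (restrict_space borel (pdom G j))"
    by (rule measurable_compose[OF par_measurable[OF j refl] phi])
  then show ?thesis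
    unfolding phi_on_def[abs_def]
    by (subst (asm) borel_measurable_restrict_space_iff) (use pdom_borel[OF j] in \<open>auto simp: mult.commute\<close>)
qed

lemma path_sum_cases:
  assumes j: "j \<in> arcs G" and y: "y \<in> pdom G j" and s: "s \<in> {0..T}" and t: "t \<in> {s..T}"
  shows "\<And>e. exits j y s e \<Longrightarrow> e \<le> t \<Longrightarrow> psum \<phi> j y s t = (\<Sum>k\<in>succs j. p j k e * psum \<phi> k (lo k) e t)"
    and "(\<forall>e. exits j y s e \<longrightarrow> t < e) \<Longrightarrow> psum \<phi> j y s t = phi_on \<phi> j (X j s y t)"
proof -
  show "psum \<phi> j y s t = (\<Sum>k\<in>succs j. p j k e * psum \<phi> k (lo k) e t)" if "exits j y s e" "e \<le> t" for e
    using path_sum_exits(1)[OF j y s that(1), of t \<phi>] that t by simp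
  assume ne: "\<forall>e. exits j y s e \<longrightarrow> t < e"
  consider "stays j y s" | e where "exits j y s e" using stays_or_exits[OF j y] by blast
  then show "psum \<phi> j y s t = phi_on \<phi> j (X j s y t)"
  proof cases
    case 1
    have "X j s y t \<in> pdom G j" by (rule X_in[OF j y]) (use t 1 in \<open>auto simp: stays_def less_imp_le\<close>)
    then show ?thesis using path_sum_stays[OF j y s 1 t] by (simp add: phi_on_def)
  next
    case (2 e)
    have te: "t < e" using ne 2 by blast
    have "X j s y t \<in> pdom G j" by (rule X_in[OF j y]) (use t te 2 in \<open>auto simp: exits_def less_imp_le\<close>)
    then show ?thesis using path_sum_exits(2)[OF j y s 2, of t \<phi>] te t by (simp add: phi_on_def)
  qed
qed

lemma p_measurable: "j \<in> arcs G \<Longrightarrow> k \<in> arcs G \<Longrightarrow> (\<lambda>t. indicator {0..T} t * p j k t) \<in> borel_measurable borel"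
  using coeffs by (intro BV_on_measurable) (simp add: distribution_coefficients_def)

lemma succ_sum_bound:
  assumes j: "j \<in> arcs G" and s: "s \<in> {0..t}" and t: "t \<in> {0..T}" and B: "\<And>x. x \<in> points G \<Longrightarrow> \<bar>\<phi> x\<bar> \<le> B" and B0: "0 \<le> B"
  shows "\<bar>\<Sum>k\<in>succs j. p j k s * psum \<phi> k (lo k) s t\<bar> \<le> B"
proof (cases "has_hi j")
  case True
  have s': "s \<in> {0..T}" using s t by auto
  show ?thesis
  proof (rule convex_bound)
    show "0 \<le> p j k s" if "k \<in> succs j" for k using p_bounds[OF j succsD(1)[OF that] s'] by simp
    show "(\<Sum>k\<in>succs j. p j k s) = 1" by (rule p_sum[OF j True s'])
    show "\<bar>psum \<phi> k (lo k) s t\<bar> \<le> B" if k: "k \<in> succs j" for k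
      by (rule path_sum_bound[OF succsD(1)[OF k] lo_in[OF succsD(1,2)[OF k]] s' _ B]) (use s t in auto)
  qed
next
  case False
  then have "succs j = {}" by (auto dest: succsD(3))
  then show ?thesis using B0 by simp
qed

text \<open>Induction over windows \<open>A n\<close> of starting times before \<open>t\<close>.
  Mass entering within window \<open>n + 1\<close> and leaving by \<open>t\<close> leaves within
  window \<open>n\<close>, by the minimal delay, where the path sums of the successors are already
  measurable. On the arc itself the path sum is a Borel function of the label, which depends
  measurably on the entrance time.\<close>

lemma path_sum_start_measurable:
  assumes t: "t \<in> {0..T}" and phi: "\<phi> \<in> borel_measurable net_borel" and B: "\<And>x. x \<in> points G \<Longrightarrow> \<bar>\<phi> x\<bar> \<le> B" and B0: "0 \<le> B"
    and k: "k \<in> arcs G" "has_lo k"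
  shows "(\<lambda>s. indicator {0..t} s * psum \<phi> k (lo k) s t) \<in> borel_measurable borel"
proof -
  obtain \<delta> where del: "\<delta> > 0" "\<forall>k\<in>arcs G. has_lo k \<longrightarrow> (\<forall>s e. exits k (lo k) s e \<longrightarrow> s + \<delta> \<le> e)"
    using exit_delay by auto
  define A where "A n = {0..t} \<inter> {t - real n * \<delta><..}" for n
  have Ab: "A n \<in> sets borel" for n by (simp add: A_def)
  have main: "\<forall>k\<in>arcs G. has_lo k \<longrightarrow> (\<lambda>s. indicator (A n) s * psum \<phi> k (lo k) s t) \<in> borel_measurable borel" for n
  proof (induction n)
    case 0
    have "A 0 = {}" by (auto simp: A_def)
    then show ?case by simp
  next
    case (Suc n)
    show ?case
    proof (intro ballI impI)
      fix j assume j: "j \<in> arcs G" "has_lo j"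
      \<comment> \<open>The indicator restricts exits to the previous window, where the induction
        hypothesis gives measurability.\<close>
      define \<gamma> where "\<gamma> s = indicator (A n) s * (\<Sum>k\<in>succs j. p j k s * psum \<phi> k (lo k) s t)" for s
      have gm: "\<gamma> \<in> borel_measurable borel"
      proof -
        have "\<gamma> = (\<lambda>s. \<Sum>k\<in>succs j. (indicator {0..T} s * p j k s) * (indicator (A n) s * psum \<phi> k (lo k) s t))"
          unfolding \<gamma>_def using t by (auto simp: A_def sum_distrib_left split: split_indicator)
        also have "\<dots> \<in> borel_measurable borel"
        proof (rule borel_measurable_sum)
          fix k assume k: "k \<in> succs j"
          show "(\<lambda>s. (indicator {0..T} s * p j k s) * (indicator (A n) s * psum \<phi> k (lo k) s t)) \<in> borel_measurable borel"
            by (rule borel_measurable_times[OF p_measurable[OF j(1) succsD(1)[OF k]]])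
               (rule Suc[rule_format, OF succsD(1)[OF k] succsD(2)[OF k]])
        qed
        finally show ?thesis .
      qed
      have gb: "\<bar>\<gamma> s\<bar> \<le> B" for s
        using succ_sum_bound[OF j(1) _ t B B0, of s] B0 by (auto simp: \<gamma>_def A_def split: split_indicator)
      have pb: "\<bar>phi_on \<phi> j y\<bar> \<le> B" for y
        using B B0 j(1) by (auto simp: phi_on_def points_def split: split_indicator)
      obtain g where g: "g \<in> borel_measurable borel"
        "\<And>s y e. start j s y \<Longrightarrow> exits j y s e \<Longrightarrow> e \<le> t \<Longrightarrow> g (X j s y 0) = \<gamma> e"
        "\<And>s y. start j s y \<Longrightarrow> s \<le> t \<Longrightarrow> (\<forall>e. exits j y s e \<longrightarrow> t < e) \<Longrightarrow> g (X j s y 0) = phi_on \<phi> j (X j s y t)"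
      proof (rule arc_transfer[OF j(1)])
        fix D assume "\<And>t (\<phi> :: real \<Rightarrow> real) (\<gamma> :: real \<Rightarrow> real) B. t \<in> {0..T} \<Longrightarrow> \<phi> \<in> borel_measurable borel \<Longrightarrow> \<gamma> \<in> borel_measurable borel \<Longrightarrow>
          (\<And>y. \<bar>\<phi> y\<bar> \<le> B) \<Longrightarrow> (\<And>s. \<bar>\<gamma> s\<bar> \<le> B) \<Longrightarrow>
          \<exists>g. transfer j t D \<phi> \<gamma> g"
        from this[OF t phi_on_measurable[OF j(1) phi] gm pb gb] show thesis
          unfolding transfer_def using that by blast
      qed
      have eq: "psum \<phi> j (lo j) s t = g (X j s (lo j) 0)" if s: "s \<in> A (Suc n)" for s
      proof -
        have s': "s \<in> {0..T}" "t \<in> {s..T}" "s \<le> t" using s t by (auto simp: A_def)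
        have st: "start j s (lo j)" using j s' by (simp add: start_def)
        note pc = path_sum_cases[OF j(1) lo_in[OF j] s'(1,2)]
        show ?thesis
        proof (cases "\<exists>e\<le>t. exits j (lo j) s e")
          case True
          then obtain e where e: "e \<le> t" "exits j (lo j) s e" by blast
          have "s + \<delta> \<le> e" using del(2) j e(2) by blast
          then have "e \<in> A n" using s e(1) del(1) unfolding A_def by (auto simp: algebra_simps)
          then show ?thesis using pc(1)[OF e(2,1)] g(2)[OF st e(2,1)] by (simp add: \<gamma>_def)
        next
          case False
          then have "\<forall>e. exits j (lo j) s e \<longrightarrow> t < e" by (metis leI)
          then show ?thesis using pc(2) g(3)[OF st s'(3)] by simp
        qed
      qed
      have "(\<lambda>s. indicator (A (Suc n)) s * psum \<phi> j (lo j) s t) = (\<lambda>s. indicator (A (Suc n)) s * g (X j s (lo j) 0))"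
        using eq by (auto split: split_indicator)
      moreover have "(\<lambda>s. g (X j s (lo j) 0)) \<in> borel_measurable borel"
        by (rule measurable_compose[OF transport_field.Fl_measurable_start[OF field[OF j(1)]] g(1)])
      ultimately show "(\<lambda>s. indicator (A (Suc n)) s * psum \<phi> j (lo j) s t) \<in> borel_measurable borel"
        using Ab[of "Suc n"] by simp
    qed
  qed
  obtain n where n: "t < real n * \<delta>" using reals_Archimedean3[OF del(1)] by blast
  have "A n = {0..t}" using n by (auto simp: A_def)
  then show ?thesis using main[of n] k by simp
qed

definition succ_sum :: "('a \<Rightarrow> real) \<Rightarrow> real \<Rightarrow> 'j \<Rightarrow> real \<Rightarrow> real" where
  "succ_sum \<phi> t j s = indicator {0..t} s * (\<Sum>k\<in>succs j. p j k s * psum \<phi> k (lo k) s t)"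

lemma succ_sum_props:
  assumes t: "t \<in> {0..T}" and phi: "\<phi> \<in> borel_measurable net_borel" and B: "\<And>x. x \<in> points G \<Longrightarrow> \<bar>\<phi> x\<bar> \<le> B" and B0: "0 \<le> B"
    and j: "j \<in> arcs G"
  shows "succ_sum \<phi> t j \<in> borel_measurable borel" "\<bar>succ_sum \<phi> t j s\<bar> \<le> B"
    "succ_sum \<phi> t j = (\<lambda>s. \<Sum>k\<in>succs j. (indicator {0..T} s * p j k s) * (indicator {0..t} s * psum \<phi> k (lo k) s t))"
proof -
  show eq: "succ_sum \<phi> t j = (\<lambda>s. \<Sum>k\<in>succs j. (indicator {0..T} s * p j k s) * (indicator {0..t} s * psum \<phi> k (lo k) s t))"
    unfolding succ_sum_def[abs_def] using t by (auto simp: sum_distrib_left split: split_indicator)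
  show "succ_sum \<phi> t j \<in> borel_measurable borel"
    unfolding eq using succsD(1,2) p_measurable[OF j] path_sum_start_measurable[OF t phi B B0]
    by (auto intro!: borel_measurable_sum borel_measurable_times)
  show "\<bar>succ_sum \<phi> t j s\<bar> \<le> B"
    using succ_sum_bound[OF j _ t B B0, of s] B0 by (auto simp: succ_sum_def split: split_indicator)
qed

lemma phi_on_bound: "(\<And>x. x \<in> points G \<Longrightarrow> \<bar>\<phi> x\<bar> \<le> B) \<Longrightarrow> 0 \<le> B \<Longrightarrow> j \<in> arcs G \<Longrightarrow> \<bar>phi_on \<phi> j y\<bar> \<le> B"
  by (auto simp: phi_on_def points_def split: split_indicator)

text \<open>With the weighted path sums of the successors as \<open>\<gamma>\<close> and the value
  at the current position as \<open>\<phi>\<close>, the observable carried by a label is the path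
  sum from the arc itself. \<open>g\<close> is a Borel function on the whole line that represents
  it, as path sums are meaningful only for parameters of the arc.\<close>

lemma arc_identities:
  obtains D where "AE t in lborel. t \<in> {0..T} \<longrightarrow> t \<in> D" "T \<in> D"
    "\<And>t (\<phi> :: 'a \<Rightarrow> real) B j. t \<in> {0..T} \<Longrightarrow> \<phi> \<in> borel_measurable net_borel \<Longrightarrow> (\<And>x. x \<in> points G \<Longrightarrow> \<bar>\<phi> x\<bar> \<le> B) \<Longrightarrow> 0 \<le> B \<Longrightarrow> j \<in> arcs G \<Longrightarrow>
      \<exists>g \<in> borel_measurable borel. (\<forall>y\<in>pdom G j. psum \<phi> j y 0 t = g y) \<and>
        (t \<in> D \<longrightarrow> (\<integral>y. phi_on \<phi> j y \<partial>N j t) + (\<integral>s. succ_sum \<phi> t j s \<partial>outflow j)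
          = (\<integral>y. g y \<partial>line (m0 j)) + (\<integral>s. indicator {0..t} s * psum \<phi> j (lo j) s t \<partial>inflow j))"
proof -
  define P where "P j D \<longleftrightarrow> (AE t in lborel. t \<in> {0..T} \<longrightarrow> t \<in> D) \<and> T \<in> D \<and>
    (\<forall>t (\<phi> :: real \<Rightarrow> real) (\<gamma> :: real \<Rightarrow> real) B. t \<in> {0..T} \<longrightarrow> \<phi> \<in> borel_measurable borel \<longrightarrow> \<gamma> \<in> borel_measurable borel \<longrightarrow>
      (\<forall>y. \<bar>\<phi> y\<bar> \<le> B) \<longrightarrow> (\<forall>s. \<bar>\<gamma> s\<bar> \<le> B) \<longrightarrow>
      (\<exists>g. transfer j t D \<phi> \<gamma> g))" for j D
  have ex: "\<exists>D. P j D" if "j \<in> arcs G" for j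
  proof (rule arc_transfer[OF that])
    fix D
    assume a: "AE t in lborel. t \<in> {0..T} \<longrightarrow> t \<in> D" "T \<in> D"
      and b: "\<And>t (\<phi> :: real \<Rightarrow> real) (\<gamma> :: real \<Rightarrow> real) B. t \<in> {0..T} \<Longrightarrow> \<phi> \<in> borel_measurable borel \<Longrightarrow> \<gamma> \<in> borel_measurable borel \<Longrightarrow>
        (\<And>y. \<bar>\<phi> y\<bar> \<le> B) \<Longrightarrow> (\<And>s. \<bar>\<gamma> s\<bar> \<le> B) \<Longrightarrow>
        \<exists>g. transfer j t D \<phi> \<gamma> g"
    show ?thesis
      unfolding P_def
      by (intro exI[of _ D] conjI a allI impI, rule b) (assumption | erule spec)+
  qed
  define D where "D j = (SOME D. P j D)" for j
  have D: "P j (D j)" if "j \<in> arcs G" for j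
    unfolding D_def by (rule someI_ex) (rule ex[OF that])
  show thesis
  proof (rule that[of "{t. \<forall>j\<in>arcs G. t \<in> D j}"])
    have "AE t in lborel. \<forall>j\<in>arcs G. t \<in> {0..T} \<longrightarrow> t \<in> D j"
      using D finite_arcs by (subst AE_ball_countable) (auto simp: P_def countable_finite)
    then show "AE t in lborel. t \<in> {0..T} \<longrightarrow> t \<in> {t. \<forall>j\<in>arcs G. t \<in> D j}" by (auto elim: eventually_mono)
    show "T \<in> {t. \<forall>j\<in>arcs G. t \<in> D j}" using D by (auto simp: P_def)
    fix t B j and \<phi> :: "'a \<Rightarrow> real"
    assume t: "t \<in> {0..T}" and phi: "\<phi> \<in> borel_measurable net_borel" and B: "\<And>x. x \<in> points G \<Longrightarrow> \<bar>\<phi> x\<bar> \<le> B"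
      and B0: "0 \<le> B" and j: "j \<in> arcs G"
    have sm: "succ_sum \<phi> t j \<in> borel_measurable borel" and sb: "\<And>s. \<bar>succ_sum \<phi> t j s\<bar> \<le> B"
      by (rule succ_sum_props[OF t phi _ B0 j], erule B)+
    have pb: "\<And>y. \<bar>phi_on \<phi> j y\<bar> \<le> B" by (rule phi_on_bound[OF _ B0 j]) (erule B)
    note D[OF j, unfolded P_def, THEN conjunct2, THEN conjunct2, rule_format, OF t phi_on_measurable[OF j phi] sm pb sb]
    then obtain g where g: "g \<in> borel_measurable borel"
      "\<forall>s y e. start j s y \<longrightarrow> exits j y s e \<longrightarrow> e \<le> t \<longrightarrow> g (X j s y 0) = succ_sum \<phi> t j e"
      "\<forall>s y. start j s y \<longrightarrow> s \<le> t \<longrightarrow> (\<forall>e. exits j y s e \<longrightarrow> t < e) \<longrightarrow> g (X j s y 0) = phi_on \<phi> j (X j s y t)"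
      "t \<in> D j \<longrightarrow> (\<integral>y. phi_on \<phi> j y \<partial>N j t) + (\<integral>s. indicator {..t} s * succ_sum \<phi> t j s \<partial>outflow j)
          = (\<integral>y. g y \<partial>line (m0 j)) + (\<integral>s. indicator {..t} s * g (X j s (lo j) 0) \<partial>inflow j)"
      unfolding transfer_def by (elim exE conjE)
    have eq: "psum \<phi> j y s t = g (X j s y 0)" if st: "start j s y" and s: "s \<le> t" for s y
    proof -
      have ys: "y \<in> pdom G j" "s \<in> {0..T}" "t \<in> {s..T}" using startD[OF j st] s t by auto
      note pc = path_sum_cases[OF j ys]
      show ?thesis
      proof (cases "\<exists>e\<le>t. exits j y s e")
        case True
        then obtain e where e: "e \<le> t" "exits j y s e" by blast
        then have "e \<in> {0..t}" using exits_in ys(2) by auto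
        then show ?thesis using pc(1)[OF e(2,1)] g(2) st e by (simp add: succ_sum_def)
      next
        case False
        then have "\<forall>e. exits j y s e \<longrightarrow> t < e" by (metis leI)
        then show ?thesis using pc(2) g(3) st s by simp
      qed
    qed
    have e1: "psum \<phi> j y 0 t = g y" if "y \<in> pdom G j" for y
      using eq[of 0 y] that t X_start[OF j, of 0 y] by (simp add: start_def)
    have e2: "(\<integral>s. indicator {..t} s * g (X j s (lo j) 0) \<partial>inflow j) = (\<integral>s. indicator {0..t} s * psum \<phi> j (lo j) s t \<partial>inflow j)"
    proof (cases "has_lo j")
      case True
      show ?thesis
      proof (rule integral_cong_AE)
        have gX: "(\<lambda>s. g (X j s (lo j) 0)) \<in> borel_measurable borel"
          by (rule measurable_compose[OF transport_field.Fl_measurable_start[OF field[OF j]] g(1)])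
        show "(\<lambda>s. indicator {..t} s * g (X j s (lo j) 0)) \<in> borel_measurable (inflow j)"
          using gX inflow_props(1)[OF j] by (simp cong: measurable_cong_sets)
        show "(\<lambda>s. indicator {0..t} s * psum \<phi> j (lo j) s t) \<in> borel_measurable (inflow j)"
          using path_sum_start_measurable[OF t phi B B0 j True] inflow_props(1)[OF j] by (simp cong: measurable_cong_sets)
        show "AE s in inflow j. indicator {..t} s * g (X j s (lo j) 0) = indicator {0..t} s * psum \<phi> j (lo j) s t"
          using inflow_props(3)[OF j]
        proof eventually_elim
          case (elim s)
          then show ?case using eq[of s "lo j"] True by (auto simp: start_def split: split_indicator)
        qed
      qed
    qed (simp add: inflow_def integral_null_measure_eq)
    have e3: "indicator {..t} s * succ_sum \<phi> t j s = succ_sum \<phi> t j s" for s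
      by (auto simp: succ_sum_def split: split_indicator)
    show "\<exists>g \<in> borel_measurable borel. (\<forall>y\<in>pdom G j. psum \<phi> j y 0 t = g y) \<and>
        (t \<in> {t. \<forall>j\<in>arcs G. t \<in> D j} \<longrightarrow> (\<integral>y. phi_on \<phi> j y \<partial>N j t) + (\<integral>s. succ_sum \<phi> t j s \<partial>outflow j)
          = (\<integral>y. g y \<partial>line (m0 j)) + (\<integral>s. indicator {0..t} s * psum \<phi> j (lo j) s t \<partial>inflow j))"
      using g(1,4) e1 j unfolding e2 e3 by blast
  qed
qed

text \<open>The junction condition is given for \<open>C\<^sup>1\<close> functions of time only, which is enough to identify the
  measures.\<close>

lemma junction_measure:
  fixes g :: "real \<Rightarrow> real"
  assumes x: "x \<in> verts G - sources G" and k: "k \<in> Out G x"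
    and g: "g \<in> borel_measurable borel" and B: "\<And>s. \<bar>g s\<bar> \<le> B"
  shows "(\<integral>s. g s \<partial>line (\<tau> k x)) = (\<Sum>j\<in>Inc G x. \<integral>s. (indicator {0..T} s * p j k s) * g s \<partial>line (\<tau> j x))"
proof -
  have ka: "k \<in> arcs G" "has_lo k" "par G k (lo k) = x" using k by (auto simp: Out_def)
  have ja: "j \<in> arcs G" if "j \<in> Inc G x" for j using that by (simp add: Inc_def)
  have tk: "sets (\<tau> k x) = sets (restrict_space borel {0..T})" "finite_measure (\<tau> k x)" using traceD[OF x] k by auto
  have tj: "sets (\<tau> j x) = sets (restrict_space borel {0..T})" "finite_measure (\<tau> j x)" if "j \<in> Inc G x" for j
    using traceD[OF x] that by auto
  define q where "q j s = indicator {0..T} s * p j k s" for j s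
  have qm: "q j \<in> borel_measurable borel" if "j \<in> Inc G x" for j
    unfolding q_def using p_measurable[OF ja[OF that] ka(1)] by simp
  have q0: "0 \<le> q j s" "q j s \<le> 1" if "j \<in> Inc G x" for j s
    using p_bounds[OF ja[OF that] ka(1), of s] by (auto simp: q_def split: split_indicator)
  \<comment> \<open>A C^1 function \<open>h\<close> of time becomes an admissible test function with
    value \<open>h\<close> at \<open>x\<close> by fading it out along \<open>k\<close> and extending
    it to the network.\<close>
  have smooth: "(\<integral>s. h s \<partial>line (\<tau> k x)) = (\<Sum>j\<in>Inc G x. \<integral>s. q j s * h s \<partial>line (\<tau> j x))"
    if h: "\<And>s. (h has_real_derivative h' s) (at s)" and h': "continuous_on UNIV h'" for h h'
  proof -
    obtain d where d: "d > 0" "\<forall>j\<in>arcs G. has_lo j \<longrightarrow> has_hi j \<longrightarrow> d \<le> hi j - lo j"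
      using min_length by auto
    have d2: "d / 2 > 0" using d by simp
    have hm: "h \<in> borel_measurable borel" using h by (intro borel_measurable_continuous_onI DERIV_continuous_on) auto
    have tf: "test_fun (pdom G k) T (\<lambda>z t. h t * fade (d / 2) (1 * (z - lo k))) (\<lambda>z t. h t * (1 * fade_deriv (d / 2) (1 * (z - lo k)))) (\<lambda>z t. h' t * fade (d / 2) (1 * (z - lo k)))"
      by (rule test_fun_fade[OF d2 _ _ h h']) (use ka pdom_iff[OF ka(1)] in auto)
    have far: "h t * fade (d / 2) (1 * (z - lo k)) = 0" if "has_hi k" "hi k - d / 2 < z" for z t
    proof -
      have "d \<le> hi k - lo k" using d(2) ka that(1) by blast
      then have "fade (d / 2) (z - lo k) = 0" using that(2) by (intro fade_far d2) linarith
      then show ?thesis by simp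
    qed
    obtain F where F: "F \<in> C1_0 G T" "\<And>z t. z \<in> pdom G k \<Longrightarrow> F (par G k z) t = h t * fade (d / 2) (1 * (z - lo k))"
      by (rule local_extension[OF ka(1) _ lo_in[OF ka(1,2)] ka(3) tf d2 _ far]) (use x in auto)
    have Fx: "F x t = h t" for t using F(2)[OF lo_in[OF ka(1,2)], of t] ka(3) by simp
    have "(\<integral>t. F x t \<partial>\<tau> k x) = (\<Sum>j\<in>Inc G x. \<integral>t. p j k t * F x t \<partial>\<tau> j x)" by (rule junction[OF x k F(1)])
    moreover have "(\<integral>t. p j k t * h t \<partial>\<tau> j x) = (\<integral>s. q j s * h s \<partial>line (\<tau> j x))" if j: "j \<in> Inc G x" for j
    proof -
      have sp: "space (\<tau> j x) = {0..T}" using sets_eq_imp_space_eq[OF tj(1)[OF j]] by (simp add: space_restrict_space)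
      have "(\<integral>t. p j k t * h t \<partial>\<tau> j x) = (\<integral>t. q j t * h t \<partial>\<tau> j x)"
        by (rule Bochner_Integration.integral_cong) (auto simp: sp q_def)
      also have "\<dots> = (\<integral>s. q j s * h s \<partial>line (\<tau> j x))"
        by (rule line_props(5)[OF tj[OF j], symmetric]) (use qm[OF j] hm in simp)
      finally show ?thesis .
    qed
    ultimately show ?thesis using line_props(5)[OF tk hm] by (simp add: Fx)
  qed
  define M where "M j = density (line (\<tau> j x)) (\<lambda>s. ennreal (q j s))" for j
  have lj: "sets (line (\<tau> j x)) = sets borel" "finite_measure (line (\<tau> j x))" if "j \<in> Inc G x" for j
    using line_props(1,2)[OF tj[OF that]] by auto
  have Mfin: "finite_measure (M j)" if j: "j \<in> Inc G x" for j
  proof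
    have "emeasure (M j) (space (M j)) = (\<integral>\<^sup>+s. ennreal (q j s) * indicator (space (line (\<tau> j x))) s \<partial>line (\<tau> j x))"
      unfolding M_def space_density using qm[OF j] lj(1)[OF j]
      by (intro emeasure_density) (auto cong: measurable_cong_sets)
    also have "\<dots> \<le> (\<integral>\<^sup>+s. 1 \<partial>line (\<tau> j x))"
      by (rule nn_integral_mono) (use q0[OF j] in \<open>auto split: split_indicator\<close>)
    also have "\<dots> = emeasure (line (\<tau> j x)) (space (line (\<tau> j x)))" by simp
    also have "\<dots> < \<infinity>" using finite_measure.emeasure_finite[OF lj(2)[OF j]] by (simp add: less_top)
    finally show "emeasure (M j) (space (M j)) \<noteq> \<infinity>" by simp
  qed
  have Mid: "(\<lambda>s. s) \<in> measurable (M j) borel" if "j \<in> Inc G x" for j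
    unfolding M_def using lj(1)[OF that] by (simp cong: measurable_cong_sets)
  have Mint: "(\<integral>s. f s \<partial>M j) = (\<integral>s. q j s * f s \<partial>line (\<tau> j x))" if j: "j \<in> Inc G x" and f: "f \<in> borel_measurable borel" for j f
    unfolding M_def using qm[OF j] q0[OF j] f lj(1)[OF j]
    by (intro integral_real_density) (auto cong: measurable_cong_sets)
  \<comment> \<open>The sum of the incoming traces weighted by the coefficients. The coefficients
    may jump, so the weights are densities instead of factors of a test function.\<close>
  define S where "S = sum_distr (Inc G x) (borel :: real measure) M (\<lambda>_ s. s)"
  have Sint: "(\<integral>s. f s \<partial>S) = (\<Sum>j\<in>Inc G x. \<integral>s. q j s * f s \<partial>line (\<tau> j x))"
    if f: "f \<in> borel_measurable borel" "\<And>s. \<bar>f s\<bar> \<le> C" for f :: "real \<Rightarrow> real" and C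
  proof -
    have "(\<integral>s. f s \<partial>S) = (\<Sum>j\<in>Inc G x. \<integral>s. f s \<partial>M j)"
      unfolding S_def by (rule integral_sum_distr[OF Mid Mfin f(1)]) (use f(2) in auto)
    then show ?thesis using Mint f(1) by simp
  qed
  have Sfin: "finite_measure S" unfolding S_def by (rule finite_measure_sum_distr[OF Mid Mfin])
  have eqS: "line (\<tau> k x) = S"
  proof (rule measure_eqI_lessThan)
    show "sets (line (\<tau> k x)) = sets borel" by (rule line_props(1)[OF tk])
    show "sets S = sets borel" by (simp add: S_def)
    have fk: "finite_measure (line (\<tau> k x))" by (rule line_props(2)[OF tk])
    show "emeasure (line (\<tau> k x)) {w<..} < \<infinity>" for w
      using finite_measure.emeasure_finite[OF fk] by (simp add: less_top)
    show "emeasure (line (\<tau> k x)) {w<..} = emeasure S {w<..}" for w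
    proof -
      \<comment> \<open>C^1 approximations of the indicator of \<open>{w<..}\<close>, on which the
        two measures are compared.\<close>
      define h where "h n s = cutoff (real (Suc n) * (s - w))" for n s
      have hD: "(h n has_real_derivative cutoff_deriv (real (Suc n) * (s - w)) * real (Suc n)) (at s)" for n s
      proof -
        have "((\<lambda>s. real (Suc n) * (s - w)) has_real_derivative real (Suc n)) (at s)"
          by (auto intro!: derivative_eq_intros simp del: of_nat_Suc)
        from DERIV_chain2[OF cutoff_has_derivative this] show ?thesis unfolding h_def[abs_def] .
      qed
      have hc: "continuous_on UNIV (\<lambda>s. cutoff_deriv (real (Suc n) * (s - w)) * real (Suc n))" for n
        by (intro continuous_intros continuous_on_compose2[OF cutoff_deriv_continuous]) auto
      have hm: "h n \<in> borel_measurable borel" for n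
        using hD[of n] by (intro borel_measurable_continuous_onI DERIV_continuous_on) auto
      have hb: "\<bar>h n s\<bar> \<le> 1" for n s using cutoff_bounds by (simp add: h_def)
      have lim: "(\<lambda>n. \<integral>s. h n s \<partial>M') \<longlonglongrightarrow> measure M' {w<..}" if M': "sets M' = sets borel" "finite_measure M'" for M'
      proof -
        have "(\<lambda>n. \<integral>s. h n s \<partial>M') \<longlonglongrightarrow> (\<integral>s. indicator {w<..} s \<partial>M')"
        proof (rule integral_dominated_convergence[where w = "\<lambda>_. 1"])
          show "integrable M' (\<lambda>_. 1 :: real)" by (rule finite_measure.integrable_const[OF M'(2)])
          show "AE s in M'. (\<lambda>n. h n s) \<longlonglongrightarrow> indicator {w<..} s"
          proof (intro always_eventually allI)
            fix s
            have "indicator {0<..} (s - w) = (indicator {w<..} s :: real)" by (auto split: split_indicator)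
            then show "(\<lambda>n. h n s) \<longlonglongrightarrow> indicator {w<..} s" unfolding h_def using cutoff_scaled_tendsto[of "s - w"] by simp
          qed
        qed (use hm hb M'(1) in \<open>auto cong: measurable_cong_sets\<close>)
        then show ?thesis using sets_eq_imp_space_eq[OF M'(1)] by simp
      qed
      have "(\<integral>s. h n s \<partial>line (\<tau> k x)) = (\<integral>s. h n s \<partial>S)" for n
        using smooth[OF hD hc] Sint[OF hm hb] by simp
      then have "measure (line (\<tau> k x)) {w<..} = measure S {w<..}"
        using LIMSEQ_unique[OF lim[OF line_props(1)[OF tk] fk]] lim[OF _ Sfin] by (simp add: S_def)
      then show ?thesis
        by (simp add: finite_measure.emeasure_eq_measure[OF fk] finite_measure.emeasure_eq_measure[OF Sfin])
    qed
  qed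
  show ?thesis unfolding eqS Sint[OF g B] by (simp add: q_def)
qed

end

context network_solution
begin

section \<open>The representation formula\<close>

definition bounded_fun :: "('a \<Rightarrow> real) \<Rightarrow> real \<Rightarrow> bool" where
  "bounded_fun \<phi> B \<longleftrightarrow> \<phi> \<in> borel_measurable net_borel \<and> 0 \<le> B \<and> (\<forall>x\<in>points G. \<bar>\<phi> x\<bar> \<le> B)"

lemma bounded_funD: "bounded_fun \<phi> B \<Longrightarrow> \<phi> \<in> borel_measurable net_borel" "bounded_fun \<phi> B \<Longrightarrow> 0 \<le> B"
  "bounded_fun \<phi> B \<Longrightarrow> x \<in> points G \<Longrightarrow> \<bar>\<phi> x\<bar> \<le> B"
  by (auto simp: bounded_fun_def)

definition rep :: "real \<Rightarrow> ('a \<Rightarrow> real) \<Rightarrow> real" where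
  "rep t \<phi> = (\<Sum>j\<in>arcs G. \<integral>y. psum \<phi> j y 0 t \<partial>m0 j) +
     (\<Sum>x\<in>sources G. \<Sum>j\<in>Out G x. LINT s:{0..t}|\<sigma>0 x. psum \<phi> j (lo j) s t)"

definition err :: "real \<Rightarrow> ('a \<Rightarrow> real) \<Rightarrow> real" where
  "err t \<phi> = (\<integral>x. \<phi> x \<partial>mt t) - rep t \<phi>"

lemma source_start: "x \<in> sources G \<Longrightarrow> j \<in> Out G x \<Longrightarrow> j \<in> arcs G \<and> has_lo j \<and> par G j (lo j) = x"
  by (simp add: Out_def)

lemma source_integrand:
  assumes bf: "bounded_fun \<phi> B" and t: "t \<in> {0..T}" and x: "x \<in> sources G" and j: "j \<in> Out G x"
  shows "(\<lambda>s. indicator {0..t} s * psum \<phi> j (lo j) s t) \<in> borel_measurable (\<sigma>0 x)"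
    "\<bar>indicator {0..t} s * psum \<phi> j (lo j) s t\<bar> \<le> B"
    "set_integrable (\<sigma>0 x) {0..t} (\<lambda>s. psum \<phi> j (lo j) s t)"
proof -
  have ja: "j \<in> arcs G" "has_lo j" using source_start[OF x j] by auto
  have "(\<lambda>s. indicator {0..t} s * psum \<phi> j (lo j) s t) \<in> borel_measurable borel"
    by (rule path_sum_start_measurable[OF t bounded_funD(1)[OF bf] _ bounded_funD(2)[OF bf] ja]) (rule bounded_funD(3)[OF bf])
  from measurable_restrict_space1[OF this]
  show m: "(\<lambda>s. indicator {0..t} s * psum \<phi> j (lo j) s t) \<in> borel_measurable (\<sigma>0 x)"
    using sigmaD(1)[OF x] by (simp cong: measurable_cong_sets)
  show b: "\<bar>indicator {0..t} s * psum \<phi> j (lo j) s t\<bar> \<le> B" for s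
  proof (cases "s \<in> {0..t}")
    case True
    have "\<bar>psum \<phi> j (lo j) s t\<bar> \<le> B"
      by (rule path_sum_bound[OF ja(1) lo_in[OF ja]]) (use True t bounded_funD(3)[OF bf] in auto)
    then show ?thesis using True by simp
  qed (use bounded_funD(2)[OF bf] in simp)
  show "set_integrable (\<sigma>0 x) {0..t} (\<lambda>s. psum \<phi> j (lo j) s t)"
    unfolding set_integrable_def real_scaleR_def by (rule integrable_bounded_finite[OF sigmaD(2)[OF x] m b])
qed

text \<open>Summation over the arcs at a time that is good for all of them. The integrability of the
  initial path sums, at every time, is recorded here because it too comes from the Borel
  representatives.\<close>

lemma good_times:
  obtains D where "AE t in lborel. t \<in> {0..T} \<longrightarrow> t \<in> D" "T \<in> D"
    "\<And>t \<phi> B. t \<in> {0..T} \<Longrightarrow> t \<in> D \<Longrightarrow> bounded_fun \<phi> B \<Longrightarrow> err t \<phi> = 0"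
    "\<And>t \<phi> B j. t \<in> {0..T} \<Longrightarrow> bounded_fun \<phi> B \<Longrightarrow> j \<in> arcs G \<Longrightarrow> integrable (m0 j) (\<lambda>y. psum \<phi> j y 0 t)"
proof (rule arc_identities)
  fix D
  assume D: "AE t in lborel. t \<in> {0..T} \<longrightarrow> t \<in> D" "T \<in> D"
    "\<And>t (\<phi> :: 'a \<Rightarrow> real) B j. t \<in> {0..T} \<Longrightarrow> \<phi> \<in> borel_measurable net_borel \<Longrightarrow> (\<And>x. x \<in> points G \<Longrightarrow> \<bar>\<phi> x\<bar> \<le> B) \<Longrightarrow> 0 \<le> B \<Longrightarrow> j \<in> arcs G \<Longrightarrow>
      \<exists>g \<in> borel_measurable borel. (\<forall>y\<in>pdom G j. psum \<phi> j y 0 t = g y) \<and>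
        (t \<in> D \<longrightarrow> (\<integral>y. phi_on \<phi> j y \<partial>N j t) + (\<integral>s. succ_sum \<phi> t j s \<partial>outflow j)
          = (\<integral>y. g y \<partial>line (m0 j)) + (\<integral>s. indicator {0..t} s * psum \<phi> j (lo j) s t \<partial>inflow j))"
  have ex: "\<exists>g \<in> borel_measurable borel. (\<forall>y\<in>pdom G j. psum \<phi> j y 0 t = g y) \<and>
        (t \<in> D \<longrightarrow> (\<integral>y. phi_on \<phi> j y \<partial>N j t) + (\<integral>s. succ_sum \<phi> t j s \<partial>outflow j)
          = (\<integral>y. g y \<partial>line (m0 j)) + (\<integral>s. indicator {0..t} s * psum \<phi> j (lo j) s t \<partial>inflow j))"
    if t: "t \<in> {0..T}" and bf: "bounded_fun \<phi> B" and j: "j \<in> arcs G" for t \<phi> B j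
    by (rule D(3)[OF t bounded_funD(1)[OF bf] _ bounded_funD(2)[OF bf] j]) (rule bounded_funD(3)[OF bf])
  show thesis
  proof (rule that[OF D(1,2)])
    fix t B j and \<phi> :: "'a \<Rightarrow> real"
    assume t: "t \<in> {0..T}" and bf: "bounded_fun \<phi> B" and j: "j \<in> arcs G"
    obtain g where g: "g \<in> borel_measurable borel" "\<forall>y\<in>pdom G j. psum \<phi> j y 0 t = g y"
      using ex[OF t bf j] by auto
    have gm: "g \<in> borel_measurable (m0 j)"
      using measurable_restrict_space1[OF g(1), of "pdom G j"] m0D(1)[OF j] by (simp cong: measurable_cong_sets)
    show "integrable (m0 j) (\<lambda>y. psum \<phi> j y 0 t)"
    proof (rule integrable_bounded_finite[OF m0D(2)[OF j], where B = B])
      have "psum \<phi> j y 0 t = g y" if "y \<in> space (m0 j)" for y using that g(2) m0D(3)[OF j] by simp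
      then show "(\<lambda>y. psum \<phi> j y 0 t) \<in> borel_measurable (m0 j)" using gm by (subst measurable_cong[of _ _ g])
      show "\<bar>psum \<phi> j y 0 t\<bar> \<le> B" if "y \<in> space (m0 j)" for y
        by (rule path_sum_bound[OF j]) (use that m0D(3)[OF j] t bounded_funD(3)[OF bf] T_pos in auto)
    qed
  next
    fix t B and \<phi> :: "'a \<Rightarrow> real"
    assume t: "t \<in> {0..T}" and tD: "t \<in> D" and bf: "bounded_fun \<phi> B"
    define a where "a k s = indicator {0..t} s * psum \<phi> k (lo k) s t" for k s
    define q where "q j k s = indicator {0..T} s * p j k s" for j k s
    \<comment> \<open>What arc \<open>j\<close> hands over to \<open>k\<close>, weighted with the
      continued path sum. Outflows summed over \<open>j\<close> and inflows away from sources summed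
      over \<open>k\<close> are double sums of these same numbers.\<close>
    define b where "b j k = (\<integral>s. q j k s * a k s \<partial>outflow j)" for j k
    define S where "S = {k \<in> arcs G. has_lo k \<and> par G k (lo k) \<in> sources G}"
    have am: "a k \<in> borel_measurable borel" if "k \<in> arcs G" "has_lo k" for k
      unfolding a_def by (rule path_sum_start_measurable[OF t bounded_funD(1)[OF bf] _ bounded_funD(2)[OF bf] that]) (rule bounded_funD(3)[OF bf])
    have ab: "\<bar>a k s\<bar> \<le> B" if k: "k \<in> arcs G" "has_lo k" for k s
    proof (cases "s \<in> {0..t}")
      case True
      have "\<bar>psum \<phi> k (lo k) s t\<bar> \<le> B"
        by (rule path_sum_bound[OF k(1) lo_in[OF k]]) (use True t bounded_funD(3)[OF bf] in auto)
      then show ?thesis using True by (simp add: a_def)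
    qed (use bounded_funD(2)[OF bf] in \<open>simp add: a_def\<close>)
    have arc: "(\<integral>y. \<phi> (par G j y) \<partial>\<nu> t j) + (\<integral>s. succ_sum \<phi> t j s \<partial>outflow j)
        = (\<integral>y. psum \<phi> j y 0 t \<partial>m0 j) + (\<integral>s. a j s \<partial>inflow j)" if j: "j \<in> arcs G" for j
    proof -
      obtain g where g: "g \<in> borel_measurable borel" "\<forall>y\<in>pdom G j. psum \<phi> j y 0 t = g y"
        "(\<integral>y. phi_on \<phi> j y \<partial>N j t) + (\<integral>s. succ_sum \<phi> t j s \<partial>outflow j)
          = (\<integral>y. g y \<partial>line (m0 j)) + (\<integral>s. indicator {0..t} s * psum \<phi> j (lo j) s t \<partial>inflow j)"
        using ex[OF t bf j] tD by auto
      have "(\<integral>y. phi_on \<phi> j y \<partial>N j t) = (\<integral>y. phi_on \<phi> j y \<partial>\<nu> t j)"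
        by (rule N_props(2)[OF j t phi_on_measurable[OF j bounded_funD(1)[OF bf]]])
      also have "\<dots> = (\<integral>y. \<phi> (par G j y) \<partial>\<nu> t j)"
        by (rule Bochner_Integration.integral_cong) (use nuD(3)[OF t j] in \<open>auto simp: phi_on_def\<close>)
      finally have 1: "(\<integral>y. phi_on \<phi> j y \<partial>N j t) = (\<integral>y. \<phi> (par G j y) \<partial>\<nu> t j)" .
      have "(\<integral>y. g y \<partial>line (m0 j)) = (\<integral>y. g y \<partial>m0 j)" by (rule line_props(5)[OF m0D(1,2)[OF j] g(1)])
      also have "\<dots> = (\<integral>y. psum \<phi> j y 0 t \<partial>m0 j)"
        by (rule Bochner_Integration.integral_cong) (use m0D(3)[OF j] g(2) in auto)
      finally show ?thesis using g(3) 1 by (simp add: a_def)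
    qed
    have out: "(\<integral>s. succ_sum \<phi> t j s \<partial>outflow j) = (\<Sum>k\<in>{k\<in>arcs G. k \<in> succs j}. b j k)" if j: "j \<in> arcs G" for j
    proof -
      have "succ_sum \<phi> t j = (\<lambda>s. \<Sum>k\<in>succs j. q j k s * a k s)"
        unfolding q_def a_def
        by (rule succ_sum_props(3)[OF t bounded_funD(1)[OF bf] _ bounded_funD(2)[OF bf] j]) (rule bounded_funD(3)[OF bf])
      then have "(\<integral>s. succ_sum \<phi> t j s \<partial>outflow j) = (\<integral>s. (\<Sum>k\<in>succs j. q j k s * a k s) \<partial>outflow j)" by simp
      also have "\<dots> = (\<Sum>k\<in>succs j. b j k)"
        unfolding b_def
      proof (rule Bochner_Integration.integral_sum)
        fix k assume k: "k \<in> succs j"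
        note ka = succsD(1)[OF k] succsD(2)[OF k]
        show "integrable (outflow j) (\<lambda>s. q j k s * a k s)"
        proof (rule integrable_bounded_finite[OF outflow_props(2)[OF j], where B = "1 * B"])
          have "(\<lambda>s. q j k s * a k s) \<in> borel_measurable borel"
            unfolding q_def by (rule borel_measurable_times[OF p_measurable[OF j ka(1)] am[OF ka]])
          then show "(\<lambda>s. q j k s * a k s) \<in> borel_measurable (outflow j)"
            using outflow_props(1)[OF j] by (simp cong: measurable_cong_sets)
          show "\<bar>q j k s * a k s\<bar> \<le> 1 * B" for s
            unfolding abs_mult
            by (rule mult_mono) (use p_bounds[OF j ka(1), of s] ab[OF ka] in \<open>auto simp: q_def split: split_indicator\<close>)
        qed
      qed
      also have "succs j = {k\<in>arcs G. k \<in> succs j}" using succsD(1) by auto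
      finally show ?thesis .
    qed
    have inn: "(\<integral>s. a k s \<partial>inflow k) = (if k \<in> S then \<integral>s. a k s \<partial>inflow k else 0) + (\<Sum>j\<in>{j\<in>arcs G. k \<in> succs j}. b j k)"
      if k: "k \<in> arcs G" for k
    proof (cases "has_lo k \<and> par G k (lo k) \<notin> sources G")
      case True
      let ?x = "par G k (lo k)"
      have x: "?x \<in> verts G - sources G" "k \<in> Out G ?x" using lo_vertex[OF k] True by auto
      have I: "Inc G ?x = {j\<in>arcs G. k \<in> succs j}"
        using x by (auto simp: succs_def Inc_def Out_def)
      have "(\<integral>s. a k s \<partial>inflow k) = (\<integral>s. a k s \<partial>line (\<tau> k ?x))" using True by (simp add: inflow_def)
      also have "\<dots> = (\<Sum>j\<in>Inc G ?x. \<integral>s. q j k s * a k s \<partial>line (\<tau> j ?x))"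
        unfolding q_def by (rule junction_measure[OF x am[OF k] ab[OF k]]) (use True in auto)
      also have "\<dots> = (\<Sum>j\<in>Inc G ?x. b j k)"
        by (rule sum.cong) (auto simp: b_def outflow_def Inc_def)
      finally show ?thesis using True by (simp add: I S_def)
    next
      case False
      have "k \<notin> succs j" for j
      proof
        assume kj: "k \<in> succs j"
        have "par G j (hi j) \<in> verts G - sources G" using hi_vertex[OF succsD(4)[OF kj] succsD(3)[OF kj]] by simp
        then show False using False succsD(2)[OF kj] succsD(5)[OF kj] by simp
      qed
      moreover have "(\<integral>s. a k s \<partial>inflow k) = 0" if "\<not> has_lo k" using that by (simp add: inflow_def integral_null_measure_eq)
      ultimately show ?thesis using False k by (auto simp: S_def)
    qed
    have swap: "(\<Sum>j\<in>arcs G. \<Sum>k\<in>{k\<in>arcs G. k \<in> succs j}. b j k) = (\<Sum>k\<in>arcs G. \<Sum>j\<in>{j\<in>arcs G. k \<in> succs j}. b j k)"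
      by (rule sum.swap_restrict[OF finite_arcs finite_arcs])
    have "(\<Sum>j\<in>arcs G. \<integral>y. \<phi> (par G j y) \<partial>\<nu> t j) + (\<Sum>j\<in>arcs G. \<integral>s. succ_sum \<phi> t j s \<partial>outflow j)
        = (\<Sum>j\<in>arcs G. \<integral>y. psum \<phi> j y 0 t \<partial>m0 j) + (\<Sum>k\<in>arcs G. \<integral>s. a k s \<partial>inflow k)"
      unfolding sum.distrib[symmetric] by (rule sum.cong[OF refl]) (rule arc)
    moreover have "(\<Sum>j\<in>arcs G. \<integral>s. succ_sum \<phi> t j s \<partial>outflow j) = (\<Sum>k\<in>arcs G. \<Sum>j\<in>{j\<in>arcs G. k \<in> succs j}. b j k)"
      unfolding swap[symmetric] by (rule sum.cong[OF refl]) (rule out)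
    moreover have "(\<Sum>k\<in>arcs G. \<integral>s. a k s \<partial>inflow k) = (\<Sum>k\<in>arcs G. if k \<in> S then \<integral>s. a k s \<partial>inflow k else 0)
        + (\<Sum>k\<in>arcs G. \<Sum>j\<in>{j\<in>arcs G. k \<in> succs j}. b j k)"
      unfolding sum.distrib[symmetric] by (rule sum.cong[OF refl]) (rule inn)
    ultimately have main: "(\<Sum>j\<in>arcs G. \<integral>y. \<phi> (par G j y) \<partial>\<nu> t j)
        = (\<Sum>j\<in>arcs G. \<integral>y. psum \<phi> j y 0 t \<partial>m0 j) + (\<Sum>k\<in>arcs G. if k \<in> S then \<integral>s. a k s \<partial>inflow k else 0)"
      by linarith
    have fs: "finite (sources G)" using finite_verts by (simp add: sources_def)
    have Sv: "S = (\<Union>x\<in>sources G. Out G x)" by (auto simp: S_def Out_def)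
    have "(\<Sum>k\<in>arcs G. if k \<in> S then \<integral>s. a k s \<partial>inflow k else 0) = (\<Sum>k\<in>S. \<integral>s. a k s \<partial>inflow k)"
      by (rule sum.mono_neutral_cong_right[OF finite_arcs]) (auto simp: S_def)
    also have "\<dots> = (\<Sum>x\<in>sources G. \<Sum>k\<in>Out G x. \<integral>s. a k s \<partial>inflow k)"
      unfolding Sv by (rule sum.UNION_disjoint[OF fs]) (use finite_arcs in \<open>auto simp: Out_def\<close>)
    also have "\<dots> = (\<Sum>x\<in>sources G. \<Sum>k\<in>Out G x. LINT s:{0..t}|\<sigma>0 x. psum \<phi> k (lo k) s t)"
    proof (intro sum.cong refl)
      fix x k assume x: "x \<in> sources G" and k: "k \<in> Out G x"
      have ka: "k \<in> arcs G" "has_lo k" "par G k (lo k) = x" using source_start[OF x k] by auto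
      have "(\<integral>s. a k s \<partial>inflow k) = (\<integral>s. a k s \<partial>line (\<sigma>0 x))" using ka x by (simp add: inflow_def)
      also have "\<dots> = (\<integral>s. a k s \<partial>\<sigma>0 x)" by (rule line_props(5)[OF sigmaD[OF x] am[OF ka(1,2)]])
      finally show "(\<integral>s. a k s \<partial>inflow k) = (LINT s:{0..t}|\<sigma>0 x. psum \<phi> k (lo k) s t)"
        by (simp add: a_def set_lebesgue_integral_def)
    qed
    finally have src: "(\<Sum>k\<in>arcs G. if k \<in> S then \<integral>s. a k s \<partial>inflow k else 0)
        = (\<Sum>x\<in>sources G. \<Sum>k\<in>Out G x. LINT s:{0..t}|\<sigma>0 x. psum \<phi> k (lo k) s t)" .
    have "(\<integral>x. \<phi> x \<partial>mt t) = (\<Sum>j\<in>arcs G. \<integral>y. \<phi> (par G j y) \<partial>\<nu> t j)"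
      by (rule glue_line(4)[OF nu_line[OF t] bounded_funD(1)[OF bf] bounded_funD(3)[OF bf]])
    then show "err t \<phi> = 0" using main src by (simp add: err_def rep_def)
  qed
qed

lemma initial_integrable: "t \<in> {0..T} \<Longrightarrow> bounded_fun \<phi> B \<Longrightarrow> j \<in> arcs G \<Longrightarrow> integrable (m0 j) (\<lambda>y. psum \<phi> j y 0 t)"
  by (rule good_times) blast

lemma solution_integrable: "t \<in> {0..T} \<Longrightarrow> bounded_fun \<phi> B \<Longrightarrow> integrable (mt t) \<phi>"
  using net_measuresD[OF mt_net[of t]] bounded_funD[of \<phi> B]
  by (intro integrable_bounded_finite[where B = B]) (auto cong: measurable_cong_sets)

lemma path_sum_linear: "psum (\<lambda>x. a * \<phi> x + b * \<psi> x) j y s t = a * psum \<phi> j y s t + b * psum \<psi> j y s t"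
  unfolding path_sum_def Let_def by (simp add: sum_distrib_left sum.distrib[symmetric] algebra_simps)

lemma bounded_fun_linear:
  assumes "bounded_fun \<phi> B" "bounded_fun \<psi> C"
  shows "bounded_fun (\<lambda>x. a * \<phi> x + b * \<psi> x) (\<bar>a\<bar> * B + \<bar>b\<bar> * C)"
  unfolding bounded_fun_def
proof (intro conjI ballI)
  show "(\<lambda>x. a * \<phi> x + b * \<psi> x) \<in> borel_measurable net_borel"
    using bounded_funD(1)[OF assms(1)] bounded_funD(1)[OF assms(2)] by measurable
  show "0 \<le> \<bar>a\<bar> * B + \<bar>b\<bar> * C" using bounded_funD(2)[OF assms(1)] bounded_funD(2)[OF assms(2)] by simp
  fix x assume x: "x \<in> points G"
  have "\<bar>a * \<phi> x + b * \<psi> x\<bar> \<le> \<bar>a\<bar> * \<bar>\<phi> x\<bar> + \<bar>b\<bar> * \<bar>\<psi> x\<bar>" by (metis abs_mult abs_triangle_ineq)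
  also have "\<dots> \<le> \<bar>a\<bar> * B + \<bar>b\<bar> * C"
    using bounded_funD(3)[OF assms(1) x] bounded_funD(3)[OF assms(2) x] by (intro add_mono mult_left_mono) auto
  finally show "\<bar>a * \<phi> x + b * \<psi> x\<bar> \<le> \<bar>a\<bar> * B + \<bar>b\<bar> * C" .
qed

lemma err_linear:
  assumes t: "t \<in> {0..T}" and f: "bounded_fun \<phi> B" and g: "bounded_fun \<psi> C"
  shows "err t (\<lambda>x. a * \<phi> x + b * \<psi> x) = a * err t \<phi> + b * err t \<psi>"
proof -
  have 1: "(\<integral>x. a * \<phi> x + b * \<psi> x \<partial>mt t) = a * (\<integral>x. \<phi> x \<partial>mt t) + b * (\<integral>x. \<psi> x \<partial>mt t)"
    using solution_integrable[OF t f] solution_integrable[OF t g] by simp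
  have 2: "(\<integral>y. psum (\<lambda>x. a * \<phi> x + b * \<psi> x) j y 0 t \<partial>m0 j) = a * (\<integral>y. psum \<phi> j y 0 t \<partial>m0 j) + b * (\<integral>y. psum \<psi> j y 0 t \<partial>m0 j)"
    if "j \<in> arcs G" for j
    unfolding path_sum_linear using initial_integrable[OF t f that] initial_integrable[OF t g that] by simp
  have 3: "(LINT s:{0..t}|\<sigma>0 x. psum (\<lambda>x. a * \<phi> x + b * \<psi> x) j (lo j) s t)
      = a * (LINT s:{0..t}|\<sigma>0 x. psum \<phi> j (lo j) s t) + b * (LINT s:{0..t}|\<sigma>0 x. psum \<psi> j (lo j) s t)"
    if "x \<in> sources G" "j \<in> Out G x" for x j
    unfolding path_sum_linear using source_integrand(3)[OF f t that] source_integrand(3)[OF g t that] by simp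
  show ?thesis
    unfolding err_def rep_def using 1 2 3 by (simp add: sum.distrib sum_distrib_left algebra_simps)
qed

text \<open>Function and time vary together, so that one dominated convergence covers limits in
  \<open>\<phi>\<close> at a fixed time and limits in time from the right.\<close>

lemma rep_tendsto:
  assumes t: "t \<in> {0..T}" and tn: "\<And>n. r n \<in> {t..T}" "r \<longlonglongrightarrow> t"
    and f: "\<And>n. bounded_fun (\<phi> n) B" and g: "bounded_fun \<psi> B"
    and lim: "\<And>j y s. j \<in> arcs G \<Longrightarrow> y \<in> pdom G j \<Longrightarrow> s \<in> {0..t} \<Longrightarrow> (\<lambda>n. psum (\<phi> n) j y s (r n)) \<longlonglongrightarrow> psum \<psi> j y s t"
  shows "(\<lambda>n. rep (r n) (\<phi> n)) \<longlonglongrightarrow> rep t \<psi>"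
  unfolding rep_def
proof (intro tendsto_add tendsto_sum)
  have rn: "r n \<in> {0..T}" for n using tn(1)[of n] t by auto
  fix j assume j: "j \<in> arcs G"
  show "(\<lambda>n. \<integral>y. psum (\<phi> n) j y 0 (r n) \<partial>m0 j) \<longlonglongrightarrow> (\<integral>y. psum \<psi> j y 0 t \<partial>m0 j)"
  proof (rule integral_dominated_convergence[where w = "\<lambda>_. B"])
    show "integrable (m0 j) (\<lambda>_. B)" by (rule finite_measure.integrable_const[OF m0D(2)[OF j]])
    show "(\<lambda>y. psum \<psi> j y 0 t) \<in> borel_measurable (m0 j)"
      by (rule borel_measurable_integrable[OF initial_integrable[OF t g j]])
    show "(\<lambda>y. psum (\<phi> n) j y 0 (r n)) \<in> borel_measurable (m0 j)" for n
      by (rule borel_measurable_integrable[OF initial_integrable[OF rn f j]])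
    show "AE y in m0 j. (\<lambda>n. psum (\<phi> n) j y 0 (r n)) \<longlonglongrightarrow> psum \<psi> j y 0 t"
      using lim[OF j] t by (intro AE_I2) (auto simp: m0D(3)[OF j])
    show "AE y in m0 j. norm (psum (\<phi> n) j y 0 (r n)) \<le> B" for n
    proof (intro AE_I2)
      fix y assume y: "y \<in> space (m0 j)"
      have "\<bar>psum (\<phi> n) j y 0 (r n)\<bar> \<le> B"
        by (rule path_sum_bound[OF j]) (use y rn m0D(3)[OF j] bounded_funD(3)[OF f] T_pos in auto)
      then show "norm (psum (\<phi> n) j y 0 (r n)) \<le> B" by simp
    qed
  qed
next
  have rn: "r n \<in> {0..T}" for n using tn(1)[of n] t by auto
  fix x j assume x: "x \<in> sources G" and j: "j \<in> Out G x"
  have ja: "j \<in> arcs G" "has_lo j" using source_start[OF x j] by auto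
  show "(\<lambda>n. LINT s:{0..r n}|\<sigma>0 x. psum (\<phi> n) j (lo j) s (r n)) \<longlonglongrightarrow> (LINT s:{0..t}|\<sigma>0 x. psum \<psi> j (lo j) s t)"
    unfolding set_lebesgue_integral_def real_scaleR_def
  proof (rule integral_dominated_convergence[where w = "\<lambda>_. B"])
    show "integrable (\<sigma>0 x) (\<lambda>_. B)" by (rule finite_measure.integrable_const[OF sigmaD(2)[OF x]])
    show "AE s in \<sigma>0 x. norm (indicator {0..r n} s * psum (\<phi> n) j (lo j) s (r n)) \<le> B" for n
      using source_integrand(2)[OF f rn x j] by (intro AE_I2) simp
    show "AE s in \<sigma>0 x. (\<lambda>n. indicator {0..r n} s * psum (\<phi> n) j (lo j) s (r n)) \<longlonglongrightarrow> indicator {0..t} s * psum \<psi> j (lo j) s t"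
    proof (intro AE_I2)
      fix s
      consider "s < 0" | "s \<in> {0..t}" | "t < s" by force
      then show "(\<lambda>n. indicator {0..r n} s * psum (\<phi> n) j (lo j) s (r n)) \<longlonglongrightarrow> indicator {0..t} s * psum \<psi> j (lo j) s t"
      proof cases
        case 2
        have "indicator {0..r n} s = (1 :: real)" for n using 2 tn(1)[of n] by auto
        then show ?thesis using lim[OF ja(1) lo_in[OF ja] 2] 2 by simp
      next
        \<comment> \<open>As \<open>r n\<close> comes down to \<open>t\<close>, an atom of the
          boundary datum at \<open>s > t\<close> is eventually excluded, while one at
          \<open>t\<close> is included throughout.\<close>
        case 3
        have "\<forall>\<^sub>F n in sequentially. r n < s" by (rule order_tendstoD(2)[OF tn(2) 3])
        then have "\<forall>\<^sub>F n in sequentially. indicator {0..r n} s * psum (\<phi> n) j (lo j) s (r n) = 0"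
          by eventually_elim auto
        then show ?thesis using 3 by (simp add: tendsto_eventually)
      qed simp
    qed
  qed (rule source_integrand(1)[OF f rn x j] source_integrand(1)[OF g t x j])+
qed

lemma path_sum_limit:
  assumes "j \<in> arcs G" "y \<in> pdom G j" "s \<in> {0..T}" and t: "t \<in> {s..T}"
    and lim: "\<And>x. x \<in> points G \<Longrightarrow> (\<lambda>n. \<phi> n x) \<longlonglongrightarrow> \<psi> x"
  shows "(\<lambda>n. psum (\<phi> n) j y s t) \<longlonglongrightarrow> psum \<psi> j y s t"
  using assms(1-4)
proof (induction rule: hop_induct)
  case (stays j y s)
  have "X j s y t \<in> pdom G j" by (rule X_in[OF stays(1,2)]) (use stays in \<open>auto simp: stays_def less_imp_le\<close>)
  then show ?case using lim stays(1) path_sum_stays[OF stays(1-5)] by (auto simp: points_def)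
next
  case (exits j y s e)
  show ?case
  proof (cases "e \<le> t")
    case True
    have "(\<lambda>n. \<Sum>k\<in>succs j. p j k e * psum (\<phi> n) k (lo k) e t) \<longlonglongrightarrow> (\<Sum>k\<in>succs j. p j k e * psum \<psi> k (lo k) e t)"
      using exits(5,6) True by (intro tendsto_sum tendsto_mult_left) auto
    then show ?thesis using path_sum_exits(1)[OF exits(1-4), of t] exits(6) True by simp
  next
    case False
    have "X j s y t \<in> pdom G j"
      by (rule X_in[OF exits(1,2)]) (use exits(4,6) False in \<open>auto simp: exits_def less_imp_le\<close>)
    then show ?thesis
      using lim exits(1) path_sum_exits(2)[OF exits(1-4), of t] exits(6) False by (auto simp: points_def)
  qed
qed

lemma err_limit:
  assumes t: "t \<in> {0..T}" and f: "\<And>n. bounded_fun (\<phi> n) B" and g: "bounded_fun \<psi> B"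
    and lim: "\<And>x. x \<in> points G \<Longrightarrow> (\<lambda>n. \<phi> n x) \<longlonglongrightarrow> \<psi> x"
  shows "(\<lambda>n. err t (\<phi> n)) \<longlonglongrightarrow> err t \<psi>"
  unfolding err_def
proof (rule tendsto_diff)
  have "(\<lambda>n. rep ((\<lambda>_. t) n) (\<phi> n)) \<longlonglongrightarrow> rep t \<psi>"
    by (rule rep_tendsto[OF t _ _ f g]) (use t path_sum_limit[OF _ _ _ _ lim] in auto)
  then show "(\<lambda>n. rep t (\<phi> n)) \<longlonglongrightarrow> rep t \<psi>" by simp
  note M = net_measuresD[OF mt_net[OF t]]
  show "(\<lambda>n. \<integral>x. \<phi> n x \<partial>mt t) \<longlonglongrightarrow> (\<integral>x. \<psi> x \<partial>mt t)"
  proof (rule integral_dominated_convergence[where w = "\<lambda>_. B"])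
    show "integrable (mt t) (\<lambda>_. B)" by (rule finite_measure.integrable_const[OF M(1)])
    show "AE x in mt t. (\<lambda>n. \<phi> n x) \<longlonglongrightarrow> \<psi> x" using lim M(2) by (intro AE_I2) simp
    show "AE x in mt t. norm (\<phi> n x) \<le> B" for n using bounded_funD(3)[OF f] M(2) by (intro AE_I2) simp
  qed (rule borel_measurable_integrable[OF solution_integrable[OF t f]] borel_measurable_integrable[OF solution_integrable[OF t g]])+
qed

text \<open>\<open>err_limit\<close> with a constant sequence: its hypothesis of convergence
  concerns points of the network alone.\<close>

lemma err_cong:
  assumes t: "t \<in> {0..T}" and f: "bounded_fun \<phi> B" and g: "bounded_fun \<psi> B"
    and eq: "\<And>x. x \<in> points G \<Longrightarrow> \<phi> x = \<psi> x"
  shows "err t \<phi> = err t \<psi>"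
proof -
  have "(\<lambda>n. err t \<phi>) \<longlonglongrightarrow> err t \<psi>" by (rule err_limit[OF t f g]) (simp add: eq)
  then show ?thesis by (simp add: LIMSEQ_const_iff)
qed

end

section \<open>From good times to all times, and from Lipschitz to Borel functions\<close>

context network_solution
begin

text \<open>If the first arc has been left by \<open>t\<close>, the recursion applies at
  \<open>t\<close> and at all \<open>r n\<close>; otherwise \<open>r n\<close> is eventually before
  the exit, and the position moves continuously within one arc.\<close>

lemma path_sum_right_continuous:
  assumes "j \<in> arcs G" "y \<in> pdom G j" "s \<in> {0..T}" and t: "t \<in> {s..T}"
    and r: "\<And>n. r n \<in> {t..T}" "r \<longlonglongrightarrow> t"
    and cont: "\<And>k. k \<in> arcs G \<Longrightarrow> continuous_on (pdom G k) (\<lambda>z. \<phi> (par G k z))"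
  shows "(\<lambda>n. psum \<phi> j y s (r n)) \<longlonglongrightarrow> psum \<phi> j y s t"
  using assms(1-4)
proof (induction rule: hop_induct)
  case (stays j y s)
  have rs: "r n \<in> {s..T}" for n using r(1)[of n] stays(5) by auto
  have inn: "X j s y q \<in> pdom G j" if "q \<in> {s..T}" for q
    by (rule X_in[OF stays(1,2)]) (use stays that in \<open>auto simp: stays_def less_imp_le\<close>)
  have "(\<lambda>n. \<phi> (par G j (X j s y (r n)))) \<longlonglongrightarrow> \<phi> (par G j (X j s y t))"
  proof (rule continuous_on_tendsto_compose[OF cont[OF stays(1)]])
    show "(\<lambda>n. X j s y (r n)) \<longlonglongrightarrow> X j s y t"
      by (rule continuous_on_tendsto_compose[OF X_cont[OF stays(1), of UNIV] r(2)]) auto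
  qed (use inn rs stays(5) in auto)
  then show ?case using path_sum_stays[OF stays(1-4) rs] path_sum_stays[OF stays(1-5)] by simp
next
  case (exits j y s e)
  show ?case
  proof (cases "e \<le> t")
    case True
    have re: "r n \<in> {e..T}" for n using r(1)[of n] True by auto
    have "(\<lambda>n. \<Sum>k\<in>succs j. p j k e * psum \<phi> k (lo k) e (r n)) \<longlonglongrightarrow> (\<Sum>k\<in>succs j. p j k e * psum \<phi> k (lo k) e t)"
      using exits(5,6) True by (intro tendsto_sum tendsto_mult_left) auto
    then show ?thesis using path_sum_exits(1)[OF exits(1-4) re] path_sum_exits(1)[OF exits(1-4), of t] exits(6) True by simp
  next
    case False
    have ev: "\<forall>\<^sub>F n in sequentially. r n < e" using order_tendstoD(2)[OF r(2), of e] False by simp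
    have inn: "X j s y q \<in> pdom G j" if "s \<le> q" "q < e" for q
      by (rule X_in[OF exits(1,2)]) (use exits(4) that in \<open>auto simp: exits_def less_imp_le\<close>)
    have rs: "s \<le> r n" for n using r(1)[of n] exits(6) by simp
    have "(\<lambda>n. \<phi> (par G j (X j s y (r n)))) \<longlonglongrightarrow> \<phi> (par G j (X j s y t))"
    proof (rule continuous_on_tendsto_compose[OF cont[OF exits(1)]])
      show "(\<lambda>n. X j s y (r n)) \<longlonglongrightarrow> X j s y t"
        by (rule continuous_on_tendsto_compose[OF X_cont[OF exits(1), of UNIV] r(2)]) auto
      show "X j s y t \<in> pdom G j" using inn exits(6) False by simp
      show "\<forall>\<^sub>F n in sequentially. X j s y (r n) \<in> pdom G j" using ev by eventually_elim (rule inn[OF rs])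
    qed
    moreover have "\<forall>\<^sub>F n in sequentially. psum \<phi> j y s (r n) = \<phi> (par G j (X j s y (r n)))"
      using ev by eventually_elim (rule path_sum_exits(2)[OF exits(1-4)], use rs in auto)
    moreover have "psum \<phi> j y s t = \<phi> (par G j (X j s y t))"
      using path_sum_exits(2)[OF exits(1-4), of t] exits(6) False by simp
    ultimately show ?thesis using tendsto_cong by fastforce
  qed
qed

definition arc_lipschitz :: "real \<Rightarrow> ('a \<Rightarrow> real) \<Rightarrow> bool" where
  "arc_lipschitz C \<phi> \<longleftrightarrow> 0 < C \<and>
     (\<forall>j\<in>arcs G. \<forall>a\<in>pdom G j. \<forall>b\<in>pdom G j. \<bar>\<phi> (par G j a) - \<phi> (par G j b)\<bar> \<le> C * \<bar>a - b\<bar>)"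

lemma arc_lipschitz_continuous:
  assumes "arc_lipschitz C \<phi>" "j \<in> arcs G"
  shows "continuous_on (pdom G j) (\<lambda>z. \<phi> (par G j z))"
proof (rule lipschitz_on_continuous_on[OF lipschitz_onI[of _ _ C]])
  show "dist (\<phi> (par G j a)) (\<phi> (par G j b)) \<le> C * dist a b" if "a \<in> pdom G j" "b \<in> pdom G j" for a b
    using assms that by (simp add: arc_lipschitz_def dist_real_def)
  show "0 \<le> C" using assms(1) by (simp add: arc_lipschitz_def)
qed

text \<open>Increments add up along a walk, and the path distance is the infimum of the lengths of
  walks.\<close>

lemma arc_lipschitz_path_dist:
  assumes L: "arc_lipschitz C \<phi>" and xy: "x \<in> points G" "y \<in> points G"
  shows "\<bar>\<phi> x - \<phi> y\<bar> \<le> C * path_dist G x y"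
proof -
  have C: "0 < C" using L by (simp add: arc_lipschitz_def)
  have w: "\<bar>\<phi> x - \<phi> y\<bar> \<le> C * l" if "walk G x l y" for l x y
    using that
  proof induction
    case (walk_step j a b l z)
    have "\<bar>\<phi> (par G j a) - \<phi> (par G j b)\<bar> \<le> C * \<bar>a - b\<bar>" using L walk_step(1-3) by (simp add: arc_lipschitz_def)
    then show ?case using walk_step.IH by (simp add: distrib_left)
  qed simp
  have "\<exists>l. walk G x l y" using net xy by (auto simp: oriented_network_def)
  then have "{l. walk G x l y} \<noteq> {}" by simp
  then have "\<bar>\<phi> x - \<phi> y\<bar> / C \<le> path_dist G x y"
    unfolding path_dist_def
  proof (rule cInf_greatest)
    fix l assume "l \<in> {l. walk G x l y}"
    then show "\<bar>\<phi> x - \<phi> y\<bar> / C \<le> l" using w[of x l y] C by (simp add: divide_le_eq mult.commute)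
  qed
  then show ?thesis using C by (simp add: divide_le_eq mult.commute)
qed

lemma err_arc_lipschitz:
  assumes L: "arc_lipschitz C \<phi>" and bf: "bounded_fun \<phi> B" and t: "t \<in> {0..T}"
  shows "err t \<phi> = 0"
proof (rule good_times)
  fix D
  assume D: "AE t in lborel. t \<in> {0..T} \<longrightarrow> t \<in> D" "T \<in> D"
    "\<And>t \<phi> B. t \<in> {0..T} \<Longrightarrow> t \<in> D \<Longrightarrow> bounded_fun \<phi> B \<Longrightarrow> err t \<phi> = 0"
  show ?thesis
  \<comment> \<open>At \<open>T\<close> there is no limit from the right, but the weak equation
    fixes the solution there and \<open>T\<close> is a good time.\<close>
  proof (cases "t = T")
    case True
    then show ?thesis using D(2,3) t bf by blast
  next
    case False
    then have tT: "t < T" "t \<in> {0..<T}" using t by auto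
    show ?thesis
    \<comment> \<open>\<open>BL_dist_bound\<close> needs a point, for the supremum in the norm;
      without points there are no arcs and both sides are 0.\<close>
    proof (cases "points G = {}")
      case True
      have "arcs G = {}"
      proof (rule ccontr)
        assume "arcs G \<noteq> {}"
        then obtain j where j: "j \<in> arcs G" by blast
        have "\<exists>y. y \<in> pdom G j" by (rule pdom_cases[OF j]) auto
        then show False using True j by (auto simp: points_def)
      qed
      then have "Out G x = {}" for x by (simp add: Out_def)
      then show ?thesis
        using glue_line(4)[OF nu_line[OF t] bounded_funD(1)[OF bf] bounded_funD(3)[OF bf]] \<open>arcs G = {}\<close>
        by (simp add: err_def rep_def)
    next
      case ne: False
      have "\<exists>s. s \<in> {t<..<min T (t + 1 / real (Suc n))} \<and> s \<in> D" for n
      proof (rule ccontr)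
        let ?I = "{t<..<min T (t + 1 / real (Suc n))}"
        assume "\<not> ?thesis"
        then have no: "\<And>s. s \<in> ?I \<Longrightarrow> s \<notin> D" by blast
        have "AE s in lborel. s \<notin> ?I"
          using D(1)
        proof eventually_elim
          case (elim s)
          then show ?case using no[of s] t by force
        qed
        moreover have "?I \<in> sets lborel" by simp
        ultimately have "?I \<in> null_sets lborel" by (simp only: AE_iff_null_sets)
        then have "emeasure lborel ?I = 0" by (rule null_setsD1)
        then show False using tT(1) by (simp add: min_def split: if_splits)
      qed
      then obtain r where r: "\<And>n. r n \<in> {t<..<min T (t + 1 / real (Suc n))}" "\<And>n. r n \<in> D" by metis
      have rn: "r n \<in> {t..T}" "r n \<in> {0..T}" for n using r(1)[of n] t by auto
      have rlim: "r \<longlonglongrightarrow> t"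
      proof (rule tendsto_sandwich)
        show "\<forall>\<^sub>F n in sequentially. t \<le> r n" using rn by (intro always_eventually) auto
        show "\<forall>\<^sub>F n in sequentially. r n \<le> t + 1 / real (Suc n)"
        proof (intro always_eventually allI)
          show "r n \<le> t + 1 / real (Suc n)" for n using r(1)[of n] by simp
        qed
        show "(\<lambda>n. t + 1 / real (Suc n)) \<longlonglongrightarrow> t"
          using tendsto_add[OF tendsto_const LIMSEQ_inverse_real_of_nat, of t] by (simp add: inverse_eq_divide)
      qed simp
      have rr: "filterlim r (at_right t) sequentially"
        unfolding filterlim_at using r(1) rlim by (auto intro!: always_eventually)
      have C: "0 < C" using L by (simp add: arc_lipschitz_def)
      have B1: "\<bar>\<phi> x\<bar> \<le> B + 1" if "x \<in> points G" for x using bounded_funD(3)[OF bf that] by simp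
      have BL: "\<bar>(\<integral>x. \<phi> x \<partial>mt (r n)) - (\<integral>x. \<phi> x \<partial>mt t)\<bar> \<le> (B + 1 + C) * BL_dist G (mt (r n)) (mt t)" for n
        by (rule BL_dist_bound[OF mt_net[OF rn(2)] mt_net[OF t] B1 arc_lipschitz_path_dist[OF L] _ _ ne])
           (use C bounded_funD(2)[OF bf] in auto)
      have "(\<lambda>n. (B + 1 + C) * BL_dist G (mt (r n)) (mt t)) \<longlonglongrightarrow> (B + 1 + C) * 0"
        by (rule tendsto_mult_left[OF filterlim_compose[OF mt_right_continuous[OF tT(2)] rr]])
      then have "(\<lambda>n. (\<integral>x. \<phi> x \<partial>mt (r n)) - (\<integral>x. \<phi> x \<partial>mt t)) \<longlonglongrightarrow> 0"
        by (intro Lim_null_comparison[of "\<lambda>n. (\<integral>x. \<phi> x \<partial>mt (r n)) - (\<integral>x. \<phi> x \<partial>mt t)" "\<lambda>n. (B + 1 + C) * BL_dist G (mt (r n)) (mt t)"])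
           (simp_all add: BL)
      then have 1: "(\<lambda>n. \<integral>x. \<phi> x \<partial>mt (r n)) \<longlonglongrightarrow> (\<integral>x. \<phi> x \<partial>mt t)" by (rule LIM_zero_cancel)
      have 2: "(\<lambda>n. rep (r n) \<phi>) \<longlonglongrightarrow> rep t \<phi>"
      proof (rule rep_tendsto[OF t rn(1) rlim bf bf])
        fix j y s assume "j \<in> arcs G" "y \<in> pdom G j" "s \<in> {0..t}"
        then show "(\<lambda>n. psum \<phi> j y s (r n)) \<longlonglongrightarrow> psum \<phi> j y s t"
          by (intro path_sum_right_continuous rn rlim arc_lipschitz_continuous[OF L]) (use t in auto)
      qed
      have "(\<integral>x. \<phi> x \<partial>mt (r n)) = rep (r n) \<phi>" for n using D(3)[OF rn(2) r(2) bf] by (simp add: err_def)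
      then have "(\<integral>x. \<phi> x \<partial>mt t) = rep t \<phi>" using LIMSEQ_unique[OF 1] 2 by simp
      then show ?thesis by (simp add: err_def)
    qed
  qed
qed

text \<open>The mean value inequality on a bounded part of the arc; along an unbounded arc the
  derivative of the parametrization may grow.\<close>

lemma par_lipschitz:
  assumes j: "j \<in> arcs G"
  shows "\<exists>C>0. \<forall>a\<in>pdom G j \<inter> {- R..R}. \<forall>b\<in>pdom G j \<inter> {- R..R}. dist (par G j a) (par G j b) \<le> C * \<bar>a - b\<bar>"
proof -
  let ?S = "pdom G j \<inter> {- R..R}"
  have "smooth_on_interval (pdom G j) (par G j)" using net j by (simp add: oriented_network_def)
  then obtain g :: "nat \<Rightarrow> real \<Rightarrow> 'a" where g: "\<forall>y\<in>pdom G j. g 0 y = par G j y"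
    "\<forall>n. \<forall>y\<in>pdom G j. (g n has_vector_derivative g (Suc n) y) (at y within pdom G j)"
    unfolding smooth_on_interval_def by auto
  have conv: "convex ?S" and comp: "compact ?S"
    by (rule pdom_cases[OF j]; auto intro!: convex_Int closed_Int_compact)+
  have "continuous_on (pdom G j) (g 1)"
    by (rule continuous_on_vector_derivative) (use g(2) in auto)
  then have "continuous_on ?S (g 1)" by (rule continuous_on_subset) simp
  from compact_imp_bounded[OF compact_continuous_image[OF this comp]]
  obtain C where "0 < C" "\<forall>w\<in>g 1 ` ?S. norm w \<le> C" unfolding bounded_pos by (elim exE conjE)
  then have C: "C > 0" "\<And>z. z \<in> ?S \<Longrightarrow> norm (g 1 z) \<le> C" by simp_all
  have "norm (g 0 a - g 0 b) \<le> C * norm (a - b)" if "a \<in> ?S" "b \<in> ?S" for a b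
  proof (rule differentiable_bound[where f' = "\<lambda>z h. h *\<^sub>R g 1 z", OF conv _ _ that])
    fix z assume z: "z \<in> ?S"
    have "(g 0 has_vector_derivative g 1 z) (at z within pdom G j)" using g(2)[rule_format, of z 0] z by simp
    then have "(g 0 has_vector_derivative g 1 z) (at z within ?S)" by (rule has_vector_derivative_within_subset) simp
    then show "(g 0 has_derivative (\<lambda>h. h *\<^sub>R g 1 z)) (at z within ?S)" by (simp add: has_vector_derivative_def)
    show "onorm (\<lambda>h. h *\<^sub>R g 1 z) \<le> C"
    proof (rule onorm_le)
      fix h :: real
      have "\<bar>h\<bar> * norm (g 1 z) \<le> \<bar>h\<bar> * C" by (rule mult_left_mono[OF C(2)[OF z]]) simp
      then show "norm (h *\<^sub>R g 1 z) \<le> C * norm h" by (simp add: mult.commute)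
    qed
  qed
  then have "dist (par G j a) (par G j b) \<le> C * \<bar>a - b\<bar>" if "a \<in> ?S" "b \<in> ?S" for a b
    using that g(1) by (simp add: dist_norm)
  then show ?thesis using C(1) by (intro exI[of _ C] conjI ballI) simp_all
qed

text \<open>Functions that are Lipschitz in the ambient space are merely locally Lipschitz in the
  parameter of an unbounded arc; these cutoffs repair that. The vertex of an unbounded arc has
  parameter 0, where the cutoff is 1, so all pieces agree at the vertices.\<close>

lemma arc_cutoffs:
  obtains \<psi> :: "nat \<Rightarrow> 'a \<Rightarrow> real" where "\<And>n x. x \<in> points G \<Longrightarrow> 0 \<le> \<psi> n x \<and> \<psi> n x \<le> 1"
    "\<And>x. x \<in> points G \<Longrightarrow> \<forall>\<^sub>F n in sequentially. \<psi> n x = 1"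
    "\<And>n j a b. j \<in> arcs G \<Longrightarrow> a \<in> pdom G j \<Longrightarrow> b \<in> pdom G j \<Longrightarrow> \<bar>\<psi> n (par G j a) - \<psi> n (par G j b)\<bar> \<le> \<bar>a - b\<bar>"
    "\<And>n j. j \<in> arcs G \<Longrightarrow> \<exists>R. \<forall>a\<in>pdom G j. R < \<bar>a\<bar> \<longrightarrow> \<psi> n (par G j a) = 0"
proof -
  define q where "q k z r = (if has_lo k \<and> has_hi k then 1 else max 0 (min 1 (\<bar>r\<bar> + 1 - \<bar>z\<bar>)))" for k and z r :: real
  have "\<exists>F. \<forall>k\<in>arcs G. \<forall>z\<in>pdom G k. \<forall>r. F (par G k z) r = q k z r"
  proof (rule glue_functions[where ?q0.0 = "\<lambda>_ _. 1"])
    show "q k (lo k) r = 1" if k: "k \<in> arcs G" "has_lo k" for k r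
      by (rule pdom_cases[OF k(1)]) (use k(2) in \<open>auto simp: q_def\<close>)
    show "q k (hi k) r = 1" if k: "k \<in> arcs G" "has_hi k" for k r
      by (rule pdom_cases[OF k(1)]) (use k(2) in \<open>auto simp: q_def\<close>)
  qed
  then obtain F where F: "\<And>k z r. k \<in> arcs G \<Longrightarrow> z \<in> pdom G k \<Longrightarrow> F (par G k z) r = q k z r" by auto
  show thesis
  proof (rule that[of "\<lambda>n x. F x (real n)"])
    show "0 \<le> F x (real n) \<and> F x (real n) \<le> 1" if "x \<in> points G" for n x
      using that F by (auto simp: points_def q_def)
    show "\<forall>\<^sub>F n in sequentially. F x (real n) = 1" if "x \<in> points G" for x
    proof -
      from that obtain k z where x: "k \<in> arcs G" "z \<in> pdom G k" "x = par G k z" by (auto simp: points_def)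
      obtain n where n: "\<bar>z\<bar> \<le> real n" using real_arch_simple by blast
      show ?thesis
        unfolding eventually_sequentially
      proof (intro exI[of _ n] allI impI)
        fix i assume "n \<le> i"
        then have "\<bar>z\<bar> \<le> real i" using n by simp
        then show "F x (real i) = 1" using F[OF x(1,2), of "real i"] x(3) by (simp add: q_def)
      qed
    qed
    show "\<bar>F (par G j a) (real n) - F (par G j b) (real n)\<bar> \<le> \<bar>a - b\<bar>" if "j \<in> arcs G" "a \<in> pdom G j" "b \<in> pdom G j" for n j a b
    proof -
      have "\<bar>max 0 (min 1 (c - \<bar>a\<bar>)) - max 0 (min 1 (c - \<bar>b\<bar>))\<bar> \<le> \<bar>a - b\<bar>" for c :: real by linarith
      then show ?thesis unfolding F[OF that(1,2)] F[OF that(1,3)] q_def by simp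
    qed
    show "\<exists>R. \<forall>a\<in>pdom G j. R < \<bar>a\<bar> \<longrightarrow> F (par G j a) (real n) = 0" if j: "j \<in> arcs G" for n j
    proof (rule pdom_cases[OF j])
      fix l assume "l > 0" "pdom G j = {0..l}"
      then show ?thesis by (intro exI[of _ l]) auto
    qed (use F[OF j] in \<open>auto simp: q_def intro!: exI[of _ "real n + 1"]\<close>)
  qed
qed

lemma err_null: "t \<in> {0..T} \<Longrightarrow> err t (\<lambda>_. 0) = 0" "t \<in> {0..T} \<Longrightarrow> err t (indicator {}) = 0"
proof -
  show null: "err t (\<lambda>_. 0) = 0" if "t \<in> {0..T}"
    using err_linear[OF that, of "\<lambda>_. 0" 0 "\<lambda>_. 0" 0 0 0] by (simp add: bounded_fun_def)
  have "(indicator {} :: 'a \<Rightarrow> real) = (\<lambda>_. 0)" by (intro ext) simp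
  then show "err t (indicator {}) = 0" if "t \<in> {0..T}" using null[OF that] by metis
qed

lemma bounded_fun_indicator: "A \<in> sets borel \<Longrightarrow> bounded_fun (indicator A) 1"
  using measurable_restrict_space1[OF borel_measurable_indicator, of A borel "points G"]
  by (auto simp: bounded_fun_def split: split_indicator)

text \<open>The ambient Lipschitz functions \<open>h n\<close> decrease to the indicator of
  \<open>F\<close>. Multiplied by the cutoffs they become Lipschitz along all arcs, and dominated
  convergence passes to the limit.\<close>

lemma err_closed:
  assumes F: "closed F" and t: "t \<in> {0..T}"
  shows "err t (indicator F) = 0"
proof (cases "F = {}")
  case True
  then show ?thesis using err_null(2)[OF t] by simp
next
  case ne: False
  obtain \<psi> :: "nat \<Rightarrow> 'a \<Rightarrow> real" where psi: "\<And>n x. x \<in> points G \<Longrightarrow> 0 \<le> \<psi> n x \<and> \<psi> n x \<le> 1"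
    "\<And>x. x \<in> points G \<Longrightarrow> \<forall>\<^sub>F n in sequentially. \<psi> n x = 1"
    "\<And>n j a b. j \<in> arcs G \<Longrightarrow> a \<in> pdom G j \<Longrightarrow> b \<in> pdom G j \<Longrightarrow> \<bar>\<psi> n (par G j a) - \<psi> n (par G j b)\<bar> \<le> \<bar>a - b\<bar>"
    "\<And>n j. j \<in> arcs G \<Longrightarrow> \<exists>R. \<forall>a\<in>pdom G j. R < \<bar>a\<bar> \<longrightarrow> \<psi> n (par G j a) = 0"
    by (rule arc_cutoffs) (rule that)
  define h where "h n x = max 0 (1 - real n * infdist x F)" for n x
  have h01: "0 \<le> h n x" "h n x \<le> 1" for n x using infdist_nonneg[of x F] by (auto simp: h_def)
  define \<zeta> where "\<zeta> n x = h n x * \<psi> n x" for n x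
  have hl: "\<bar>h n x - h n y\<bar> \<le> real n * dist x y" for n x y
  proof -
    have "\<bar>h n x - h n y\<bar> \<le> \<bar>real n * infdist x F - real n * infdist y F\<bar>" by (auto simp: h_def)
    also have "\<dots> = real n * \<bar>infdist x F - infdist y F\<bar>" by (simp add: abs_mult flip: right_diff_distrib)
    also have "\<dots> \<le> real n * dist x y" by (intro mult_left_mono infdist_triangle_abs) simp
    finally show ?thesis .
  qed
  have lip: "\<exists>C. arc_lipschitz C (\<zeta> n)" for n
  proof -
    have "\<exists>C\<ge>0. \<forall>a\<in>pdom G j. \<forall>b\<in>pdom G j. \<bar>\<zeta> n (par G j a) - \<zeta> n (par G j b)\<bar> \<le> C * \<bar>a - b\<bar>" if j: "j \<in> arcs G" for j
    proof -
      obtain R where R: "\<And>a. a \<in> pdom G j \<Longrightarrow> R < \<bar>a\<bar> \<Longrightarrow> \<psi> n (par G j a) = 0" using psi(4)[OF j] by blast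
      obtain C where C: "C > 0" "\<And>a b. a \<in> pdom G j \<inter> {- R..R} \<Longrightarrow> b \<in> pdom G j \<inter> {- R..R} \<Longrightarrow> dist (par G j a) (par G j b) \<le> C * \<bar>a - b\<bar>"
        using par_lipschitz[OF j, of R] by auto
      have P: "par G j a \<in> points G" if "a \<in> pdom G j" for a using that j by (auto simp: points_def)
      \<comment> \<open>It suffices that one of the two parameters is within \<open>R\<close>: the
        cutoff is Lipschitz everywhere, and if both parameters are beyond \<open>R\<close> then
        \<open>\<zeta> n\<close> vanishes at both points.\<close>
      have half: "\<bar>\<zeta> n (par G j a) - \<zeta> n (par G j b)\<bar> \<le> (real n * C + 1) * \<bar>a - b\<bar>"
        if a: "a \<in> pdom G j" and b: "b \<in> pdom G j" "\<bar>b\<bar> \<le> R" for a b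
      proof -
        let ?x = "par G j a" and ?y = "par G j b"
        have split: "\<zeta> n ?x - \<zeta> n ?y = h n ?x * (\<psi> n ?x - \<psi> n ?y) + (h n ?x - h n ?y) * \<psi> n ?y"
          by (simp add: \<zeta>_def algebra_simps)
        have s1: "\<bar>h n ?x * (\<psi> n ?x - \<psi> n ?y)\<bar> \<le> 1 * \<bar>a - b\<bar>"
          unfolding abs_mult by (rule mult_mono) (use h01 psi(3)[OF j a b(1)] in auto)
        show ?thesis
        proof (cases "\<bar>a\<bar> \<le> R")
          case True
          have "\<bar>h n ?x - h n ?y\<bar> \<le> real n * dist ?x ?y" by (rule hl)
          also have "\<dots> \<le> real n * (C * \<bar>a - b\<bar>)" by (rule mult_left_mono[OF C(2)]) (use a b True in auto)
          finally have "\<bar>h n ?x - h n ?y\<bar> * \<bar>\<psi> n ?y\<bar> \<le> (real n * (C * \<bar>a - b\<bar>)) * 1"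
            by (rule mult_mono) (use psi(1)[OF P[OF b(1)]] C(1) in auto)
          then have "\<bar>(h n ?x - h n ?y) * \<psi> n ?y\<bar> \<le> real n * C * \<bar>a - b\<bar>" by (simp add: abs_mult mult.assoc)
          then show ?thesis
            using s1 unfolding split distrib_right by linarith
        next
          case False
          have "\<psi> n ?x = 0" by (rule R[OF a]) (use False in simp)
          then have "\<bar>\<zeta> n ?x - \<zeta> n ?y\<bar> = \<bar>h n ?y * (\<psi> n ?x - \<psi> n ?y)\<bar>" by (simp add: \<zeta>_def)
          also have "\<dots> \<le> 1 * \<bar>a - b\<bar>"
            unfolding abs_mult by (rule mult_mono) (use h01 psi(3)[OF j a b(1)] in auto)
          also have "\<dots> \<le> (real n * C + 1) * \<bar>a - b\<bar>" by (rule mult_right_mono) (use C(1) in auto)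
          finally show ?thesis .
        qed
      qed
      show ?thesis
      proof (intro exI[of _ "real n * C + 1"] conjI ballI)
        fix a b assume a: "a \<in> pdom G j" and b: "b \<in> pdom G j"
        consider "\<bar>b\<bar> \<le> R" | "\<bar>a\<bar> \<le> R" | "R < \<bar>a\<bar>" "R < \<bar>b\<bar>" by linarith
        then show "\<bar>\<zeta> n (par G j a) - \<zeta> n (par G j b)\<bar> \<le> (real n * C + 1) * \<bar>a - b\<bar>"
        proof cases
          case 1
          then show ?thesis by (rule half[OF a b])
        next
          case 2
          then show ?thesis using half[OF b a] by (simp add: abs_minus_commute)
        next
          case 3
          then show ?thesis using R[OF a] R[OF b] C(1) by (simp add: \<zeta>_def)
        qed
      qed (use C(1) in simp)
    qed
    then have "\<forall>j\<in>arcs G. \<exists>C. 0 \<le> C \<and> (\<forall>a\<in>pdom G j. \<forall>b\<in>pdom G j. \<bar>\<zeta> n (par G j a) - \<zeta> n (par G j b)\<bar> \<le> C * \<bar>a - b\<bar>)"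
      by blast
    from bchoice[OF this] obtain D where D: "\<And>j. j \<in> arcs G \<Longrightarrow> 0 \<le> D j"
      "\<And>j a b. j \<in> arcs G \<Longrightarrow> a \<in> pdom G j \<Longrightarrow> b \<in> pdom G j \<Longrightarrow> \<bar>\<zeta> n (par G j a) - \<zeta> n (par G j b)\<bar> \<le> D j * \<bar>a - b\<bar>"
      by auto
    have "arc_lipschitz (sum D (arcs G) + 1) (\<zeta> n)"
      unfolding arc_lipschitz_def
    proof (intro conjI ballI)
      show "0 < sum D (arcs G) + 1" using sum_nonneg[of "arcs G" D] D(1) by fastforce
      fix j a b assume j: "j \<in> arcs G" and ab: "a \<in> pdom G j" "b \<in> pdom G j"
      have "D j \<le> sum D (arcs G)" by (rule member_le_sum[OF j _ finite_arcs]) (use D(1) in auto)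
      then have "D j * \<bar>a - b\<bar> \<le> (sum D (arcs G) + 1) * \<bar>a - b\<bar>" by (intro mult_right_mono) auto
      then show "\<bar>\<zeta> n (par G j a) - \<zeta> n (par G j b)\<bar> \<le> (sum D (arcs G) + 1) * \<bar>a - b\<bar>" using D(2)[OF j ab] by linarith
    qed
    then show ?thesis ..
  qed
  have bf: "bounded_fun (\<zeta> n) 1" for n
    unfolding bounded_fun_def
  proof (intro conjI ballI)
    obtain C where "arc_lipschitz C (\<zeta> n)" using lip by blast
    then show "\<zeta> n \<in> borel_measurable net_borel"
      by (intro arcwise_continuous_measurable) (rule arc_lipschitz_continuous)
    show "\<bar>\<zeta> n x\<bar> \<le> 1" if "x \<in> points G" for x
      using mult_mono[of "h n x" 1 "\<psi> n x" 1] h01[of n x] psi(1)[OF that, of n] by (simp add: \<zeta>_def abs_mult)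
  qed simp
  have "err t (\<zeta> n) = 0" for n
  proof -
    obtain C where "arc_lipschitz C (\<zeta> n)" using lip by blast
    then show ?thesis by (rule err_arc_lipschitz[OF _ bf t])
  qed
  moreover have "(\<lambda>n. err t (\<zeta> n)) \<longlonglongrightarrow> err t (indicator F)"
  proof (rule err_limit[OF t bf])
    show "bounded_fun (indicator F) 1" by (rule bounded_fun_indicator[OF borel_closed[OF F]])
    fix x assume x: "x \<in> points G"
    have "\<forall>\<^sub>F n in sequentially. h n x = indicator F x"
    proof (cases "x \<in> F")
      case True
      then have "infdist x F = 0" by simp
      then show ?thesis using True by (simp add: h_def)
    next
      case False
      then have d: "infdist x F > 0" by (rule infdist_pos_not_in_closed[OF F ne])
      obtain n where n: "1 < real n * infdist x F" using reals_Archimedean3[OF d] by blast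
      show ?thesis
        unfolding eventually_sequentially
      proof (intro exI[of _ n] allI impI)
        fix i assume "n \<le> i"
        then have "real n * infdist x F \<le> real i * infdist x F" using d by (intro mult_right_mono) auto
        then show "h i x = indicator F x" using n False by (simp add: h_def)
      qed
    qed
    with psi(2)[OF x] have "\<forall>\<^sub>F n in sequentially. \<zeta> n x = indicator F x"
      by eventually_elim (simp add: \<zeta>_def)
    then show "(\<lambda>n. \<zeta> n x) \<longlonglongrightarrow> indicator F x" by (rule tendsto_eventually)
  qed
  ultimately show ?thesis by (simp add: LIMSEQ_const_iff)
qed

text \<open>Closed sets are stable under intersection and generate the Borel sets; linearity handles
  complements and finite disjoint unions, dominated convergence the countable ones.\<close>

lemma err_borel_set:
  assumes A: "A \<in> sets borel" and t: "t \<in> {0..T}"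
  shows "err t (indicator A) = 0"
proof -
  have st: "Int_stable (Collect closed :: 'a set set)" by (auto simp: Int_stable_def)
  have bs: "sets (borel :: 'a measure) = sigma_sets UNIV (Collect closed)" by (simp add: borel_eq_closed)
  show ?thesis
    using st _ A[unfolded bs]
  proof (rule sigma_sets_induct_disjoint)
    fix A :: "'a set" assume "A \<in> Collect closed"
    then show "err t (indicator A) = 0" by (intro err_closed t) simp
  next
    show "err t (indicator {}) = 0" by (rule err_closed[OF closed_empty t])
  next
    fix A :: "'a set" assume "A \<in> sigma_sets UNIV (Collect closed)" and e: "err t (indicator A) = 0"
    then have A: "A \<in> sets borel" by (simp add: bs)
    have "(indicator (UNIV - A) :: 'a \<Rightarrow> real) = (\<lambda>x. 1 * indicator UNIV x + (- 1) * indicator A x)"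
      by (auto split: split_indicator)
    then show "err t (indicator (UNIV - A)) = 0"
      using err_linear[OF t bounded_fun_indicator bounded_fun_indicator[OF A], of UNIV 1 "- 1"] e err_closed[OF closed_UNIV t] by simp
  next
    fix A :: "nat \<Rightarrow> 'a set" assume dj: "disjoint_family A" and "range A \<subseteq> sigma_sets UNIV (Collect closed)"
      and e: "\<And>i. err t (indicator (A i)) = 0"
    then have A: "A i \<in> sets borel" for i by (auto simp: bs)
    have fin: "err t (indicator (\<Union>i<n. A i)) = 0" for n
    proof (induction n)
      case 0
      show ?case using err_null(2)[OF t] by (simp only: lessThan_0 UN_empty)
    next
      case (Suc n)
      have U: "(\<Union>i<n. A i) \<in> sets borel" using A by auto
      have "A n \<inter> A i = {}" if "i < n" for i using dj that by (simp add: disjoint_family_on_def)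
      then have "A n \<inter> (\<Union>i<n. A i) = {}" by blast
      then have "(indicator (\<Union>i<Suc n. A i) :: 'a \<Rightarrow> real) = (\<lambda>x. 1 * indicator (A n) x + 1 * indicator (\<Union>i<n. A i) x)"
        by (intro ext) (auto simp: lessThan_Suc split: split_indicator)
      then show ?case
        using err_linear[OF t bounded_fun_indicator[OF A] bounded_fun_indicator[OF U], of 1 n 1] e Suc by simp
    qed
    have "(\<lambda>n. err t (indicator (\<Union>i<n. A i))) \<longlonglongrightarrow> err t (indicator (\<Union>i. A i))"
    proof (rule err_limit[OF t])
      show "(\<lambda>n. indicator (\<Union>i<n. A i) x :: real) \<longlonglongrightarrow> indicator (\<Union>i. A i) x" for x
        by (rule LIMSEQ_indicator_UN)
    qed (use A in \<open>auto intro!: bounded_fun_indicator\<close>)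
    then show "err t (indicator (\<Union>i. A i)) = 0" using fin by (simp add: LIMSEQ_const_iff)
  qed simp
qed

lemma err_zero:
  assumes bf: "bounded_fun \<phi> B" and t: "t \<in> {0..T}"
  shows "err t \<phi> = 0"
proof -
  \<comment> \<open>On the network this is \<open>\<phi> + B\<close>, nonnegative there; the maximum
    makes it nonnegative also off the network, where \<open>\<phi>\<close> is arbitrary.\<close>
  define u where "u x = max 0 (\<phi> x + B)" for x
  have um: "u \<in> borel_measurable net_borel" unfolding u_def[abs_def] using bounded_funD(1)[OF bf] by measurable
  \<comment> \<open>The bound is part of the induction statement because linearity and limits of
    \<open>err\<close> require it; for nonnegative functions it passes from a sum or an increasing
    limit to the pieces.\<close>
  have "\<forall>C. bounded_fun u C \<longrightarrow> err t u = 0"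
    using um
  proof (rule borel_measurable_induct_real)
    show "0 \<le> u x" for x by (simp add: u_def)
  next
    fix A assume "A \<in> sets net_borel"
    then obtain A' where A': "A' \<in> sets borel" "A = points G \<inter> A'" by (auto simp: sets_restrict_space)
    have "bounded_fun (indicator A) 1" using \<open>A \<in> sets net_borel\<close>
      by (auto simp: bounded_fun_def split: split_indicator)
    then have "err t (indicator A) = err t (indicator A')"
      by (rule err_cong[OF t _ bounded_fun_indicator[OF A'(1)]]) (simp add: A'(2) indicator_def)
    then show "\<forall>C. bounded_fun (indicator A) C \<longrightarrow> err t (indicator A) = 0" using err_borel_set[OF A'(1) t] by simp
  next
    fix u and c :: real
    assume c: "0 \<le> c" and um: "u \<in> borel_measurable net_borel" and u0: "\<And>x. 0 \<le> u x"
      and IH: "\<forall>C. bounded_fun u C \<longrightarrow> err t u = 0"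
    show "\<forall>C. bounded_fun (\<lambda>x. c * u x) C \<longrightarrow> err t (\<lambda>x. c * u x) = 0"
    proof (intro allI impI)
      fix C assume b: "bounded_fun (\<lambda>x. c * u x) C"
      show "err t (\<lambda>x. c * u x) = 0"
      proof (cases "c = 0")
        case True
        then show ?thesis using err_null(1)[OF t] by simp
      next
        case False
        then have c: "0 < c" using c by simp
        have "bounded_fun u (C / c)"
          using b c um by (auto simp: bounded_fun_def abs_mult pos_le_divide_eq mult.commute)
        then show ?thesis using err_linear[OF t, of u "C / c" u "C / c" c 0] IH by simp
      qed
    qed
  next
    fix u w
    assume um: "u \<in> borel_measurable net_borel" "\<And>x. 0 \<le> u x" "\<forall>C. bounded_fun u C \<longrightarrow> err t u = 0"
      and wm: "w \<in> borel_measurable net_borel" "\<And>x. 0 \<le> w x" "\<forall>C. bounded_fun w C \<longrightarrow> err t w = 0"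
    show "\<forall>C. bounded_fun (\<lambda>x. w x + u x) C \<longrightarrow> err t (\<lambda>x. w x + u x) = 0"
    proof (intro allI impI)
      fix C assume b: "bounded_fun (\<lambda>x. w x + u x) C"
      have "\<bar>u x\<bar> \<le> C \<and> \<bar>w x\<bar> \<le> C" if "x \<in> points G" for x
        using bounded_funD(3)[OF b that] um(2)[of x] wm(2)[of x] by auto
      then have "bounded_fun u C" "bounded_fun w C"
        using um(1) wm(1) bounded_funD(2)[OF b] by (auto simp: bounded_fun_def)
      then show "err t (\<lambda>x. w x + u x) = 0" using err_linear[OF t, of w C u C 1 1] um(3) wm(3) by simp
    qed
  next
    fix U :: "nat \<Rightarrow> 'a \<Rightarrow> real"
    assume U: "\<And>i. U i \<in> borel_measurable net_borel" "\<And>i x. 0 \<le> U i x" "\<And>i. \<forall>C. bounded_fun (U i) C \<longrightarrow> err t (U i) = 0"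
      "incseq U" "\<And>x. x \<in> space net_borel \<Longrightarrow> (\<lambda>i. U i x) \<longlonglongrightarrow> u x"
    show "\<forall>C. bounded_fun u C \<longrightarrow> err t u = 0"
    proof (intro allI impI)
      fix C assume b: "bounded_fun u C"
      have "\<bar>U i x\<bar> \<le> C" if x: "x \<in> points G" for i x
      proof -
        have "U i x \<le> u x"
          by (rule incseq_le[of "\<lambda>i. U i x"]) (use U(4) U(5)[of x] x in \<open>auto simp: incseq_def le_fun_def\<close>)
        then show ?thesis using bounded_funD(3)[OF b x] U(2)[of i x] by simp
      qed
      then have Ub: "bounded_fun (U i) C" for i using U(1) bounded_funD(2)[OF b] by (simp add: bounded_fun_def)
      have "(\<lambda>i. err t (U i)) \<longlonglongrightarrow> err t u" by (rule err_limit[OF t Ub b]) (simp add: U(5))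
      moreover have "err t (U i) = 0" for i using U(3)[of i] Ub[of i] by blast
      ultimately show "err t u = 0" by (simp add: LIMSEQ_const_iff)
    qed
  qed
  moreover have ub: "bounded_fun u (2 * B)"
    unfolding bounded_fun_def
  proof (intro conjI ballI)
    show "\<bar>u x\<bar> \<le> 2 * B" if "x \<in> points G" for x using bounded_funD(3)[OF bf that] by (auto simp: u_def)
  qed (use um bounded_funD(2)[OF bf] in auto)
  ultimately have "err t u = 0" by blast
  then have "err t (\<lambda>x. 1 * u x + (- B) * indicator UNIV x) = 0"
    using err_linear[OF t ub bounded_fun_indicator, of UNIV 1 "- B"] err_closed[OF closed_UNIV t] by simp
  moreover have "err t \<phi> = err t (\<lambda>x. 1 * u x + (- B) * indicator UNIV x)"
  proof (rule err_cong[OF t])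
    have B0: "0 \<le> B" by (rule bounded_funD(2)[OF bf])
    show "bounded_fun \<phi> (\<bar>1\<bar> * (2 * B) + \<bar>- B\<bar> * 1)"
      using bf B0 by (force simp: bounded_fun_def)
    show "bounded_fun (\<lambda>x. 1 * u x + (- B) * indicator UNIV x) (\<bar>1\<bar> * (2 * B) + \<bar>- B\<bar> * 1)"
      by (rule bounded_fun_linear[OF ub bounded_fun_indicator]) simp
    show "\<phi> x = 1 * u x + (- B) * indicator UNIV x" if "x \<in> points G" for x
      using bounded_funD(3)[OF bf that] by (auto simp: u_def)
  qed
  ultimately show ?thesis by simp
qed

end

text \<open>Bounded Borel functions determine both sides as measures. Integrability is asserted
  along with the formula because a Bochner integral that does not converge has the value 0 by
  convention. As each source has exactly one outgoing arc, the inner sum over \<open>Out G x\<close>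
  has a single term.\<close>

theorem proposition4p5:
  fixes G :: "('j, 'a::euclidean_space) network"
    and T Vmax L :: real
    and v :: "'a measure \<Rightarrow> 'j \<Rightarrow> real \<Rightarrow> real"
    and p :: "'j \<Rightarrow> 'j \<Rightarrow> real \<Rightarrow> real"
    and m0 :: "'j \<Rightarrow> real measure"
    and \<sigma>0 :: "'a \<Rightarrow> real measure"
    and m :: "('a \<times> real) measure"
    and \<nu> :: "real \<Rightarrow> 'j \<Rightarrow> real measure"
    and t :: real
    and \<phi> :: "'a \<Rightarrow> real"
  assumes "oriented_network G"
    and "T > 0" and "Vmax > 0"
    and "velocity_field G Vmax L v"
    and "distribution_coefficients G T p"
    and "\<And>j. j \<in> arcs G \<Longrightarrow> m0 j \<in> line_measures (pdom G j)"
    and "\<And>x. x \<in> sources G \<Longrightarrow> \<sigma>0 x \<in> line_measures {0..T}"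
    and "measure_valued_solution G T v p m0 \<sigma>0 m \<nu>"
    and "t \<in> {0..T}"
    and "\<phi> \<in> borel_measurable (restrict_space borel (points G))" and "bounded (\<phi> ` points G)"
  shows "(\<forall>j\<in>arcs G. integrable (m0 j) (\<lambda>y. path_sum G T v \<nu> p \<phi> j y 0 t)) \<and>
         (\<forall>x\<in>sources G. \<forall>j\<in>Out G x.
            set_integrable (\<sigma>0 x) {0..t} (\<lambda>s. path_sum G T v \<nu> p \<phi> j (Inf (pdom G j)) s t)) \<and>
         (\<integral>x. \<phi> x \<partial>glue G (\<nu> t)) =
           (\<Sum>j\<in>arcs G. \<integral>y. path_sum G T v \<nu> p \<phi> j y 0 t \<partial>m0 j) +
           (\<Sum>x\<in>sources G. \<Sum>j\<in>Out G x.
              LINT s:{0..t}|\<sigma>0 x. path_sum G T v \<nu> p \<phi> j (Inf (pdom G j)) s t)"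
proof -
  obtain \<tau> :: "'j \<Rightarrow> 'a \<Rightarrow> real measure" where tau:
    "\<forall>x\<in>verts G - sources G. \<forall>j\<in>Inc G x \<union> Out G x. is_trace G T v m0 \<nu> j x (\<tau> j x)"
    "\<forall>x\<in>verts G - sources G. \<forall>j\<in>Out G x. \<forall>f\<in>C1_0 G T.
      (\<integral>t. f x t \<partial>\<tau> j x) = (\<Sum>k\<in>Inc G x. \<integral>t. p k j t * f x t \<partial>\<tau> k x)"
    using assms(8) unfolding measure_valued_solution_def by (elim conjE exE)
  interpret network_solution G T Vmax L v p m0 \<sigma>0 m \<nu> \<tau>
    by unfold_locales (use assms tau in auto)
  obtain B where B: "\<forall>x\<in>points G. \<bar>\<phi> x\<bar> \<le> B" using assms(11) by (auto simp: bounded_iff)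
  have bf: "bounded_fun \<phi> \<bar>B\<bar>" using B assms(10) by (force simp: bounded_fun_def)
  show ?thesis
    using initial_integrable[OF assms(9) bf] source_integrand(3)[OF bf assms(9)] err_zero[OF bf assms(9)]
    by (simp add: err_def rep_def)
qed

end
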